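(* Let $0<\alpha<2/3$. There exists $E_\alpha>0$ such that for any $z\in\overline{\mathbb{C}}_+$ with $|z|\ge E_\alpha$, there is a unique (in law) random variable $R_0(z)$ on $\overline{\mathbb{C}}_+$ which satisfies the distributional equation $$R_0(z)\stackrel{d}{=}-\Big(z+\sum_{k\ge1}\xi_kR_k(z)\Big)^{-1}$$ and $\mathbb{E}|R_0(z)|^{\alpha/2}<\infty$. Moreover, for any $0<\kappa<\alpha/2$ there exist $E_{\alpha,\kappa}\ge E_\alpha$ and $c>0$ such that for any $z\in\mathbb{C}_+$ with $|z|\ge E_{\alpha,\kappa}$, $$\mathbb{E}(\Im R_0(z))^{\alpha/2}\le c\,(\Im z)^\kappa.$$ In particular, if $\Im z=0$ (and $|z|\ge E_\alpha$), $R_0(z)$ is a real random variable.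
   Context: $\mathbb{C}_+=\{z\in\mathbb{C}:\Im z>0\}$ and $\overline{\mathbb{C}}_+=\{z:\Im z\ge0\}$. In the distributional equation, $\{\xi_k\}_{k\ge1}$ is a Poisson point process on $\mathbb{R}_+$ with intensity measure $\frac\alpha2x^{\frac\alpha2-1}dx$, independent of $(R_k(z))_{k\ge1}$, which is a sequence of independent copies of $R_0(z)$; $\stackrel{d}{=}$ denotes equality in distribution.
   Formalization: The Poisson intensity is taken as (α/2)x^{-α/2-1}dx instead of the printed (α/2)x^{α/2-1}dx; with the printed one the points tend to infinity, the series diverges almost surely unless R_0=0, and no solution exists for any z. *)

theory Defs
  imports "HOL-Probability.Probability"
begin

definition ppp_intensity :: "real \<Rightarrow> real measure" where
  "ppp_intensity \<alpha> = density lborel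
     (\<lambda>x. ennreal (indicator {0<..} x * (\<alpha> / 2) * x powr (- (\<alpha> / 2) - 1)))"

text \<open>The random sequence xi (an enumeration, with multiplicity, of the atoms of a point process)
  is a Poisson point process with intensity measure nu: for every Borel set A of finite
  nu-measure, the number of points in A is a.s. finite and Poisson(nu A) distributed, and the
  counts of finitely many pairwise disjoint such sets are independent.\<close>
definition poisson_point_process ::
  "'a measure \<Rightarrow> real measure \<Rightarrow> ('a \<Rightarrow> nat \<Rightarrow> real) \<Rightarrow> bool" where
  "poisson_point_process M \<nu> \<xi> \<longleftrightarrow>
     prob_space M \<and>
     (\<forall>k. (\<lambda>\<omega>. \<xi> \<omega> k) \<in> borel_measurable M) \<and>
     (\<forall>A. A \<in> sets borel \<and> emeasure \<nu> A < \<infinity> \<longrightarrow>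
        (AE \<omega> in M. finite {k. \<xi> \<omega> k \<in> A}) \<and>
        (\<forall>n::nat. {\<omega> \<in> space M. card {k. \<xi> \<omega> k \<in> A} = n} \<in> sets M \<and>
           measure M {\<omega> \<in> space M. card {k. \<xi> \<omega> k \<in> A} = n}
             = enn2real (emeasure \<nu> A) ^ n / fact n * exp (- enn2real (emeasure \<nu> A)))) \<and>
     (\<forall>(I::nat set) A. finite I \<and> (\<forall>i\<in>I. A i \<in> sets borel \<and> emeasure \<nu> (A i) < \<infinity>)
        \<and> disjoint_family_on A I \<longrightarrow>
        prob_space.indep_vars M (\<lambda>_. count_space UNIV)
          (\<lambda>i \<omega>. card {k. \<xi> \<omega> k \<in> A i}) I)"

text \<open>mu (a probability law on C) solves the recursive distributional equation
  R_0 =d -(z + sum_k xi_k R_k)^{-1}: whenever xi is a PPP with the above intensity, the R_k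
  are i.i.d. with law mu and (R_k)_k is independent of (xi_k)_k, the series converges a.s.
  (unconditionally) and the law of -(z + sum)^{-1} is mu.  The sample space type is fixed to
  nat => real (rich enough to carry such objects).\<close>
definition solves_RDE :: "real \<Rightarrow> complex \<Rightarrow> complex measure \<Rightarrow> bool" where
  "solves_RDE \<alpha> z \<mu> \<longleftrightarrow>
     (\<forall>(M :: (nat \<Rightarrow> real) measure) \<xi> R.
        poisson_point_process M (ppp_intensity \<alpha>) \<xi> \<and>
        (\<forall>k. (\<lambda>\<omega>. R \<omega> k) \<in> borel_measurable M) \<and>
        (\<forall>k. distr M borel (\<lambda>\<omega>. R \<omega> k) = \<mu>) \<and>
        prob_space.indep_vars M (\<lambda>_. borel) (\<lambda>k \<omega>. R \<omega> k) UNIV \<and>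
        prob_space.indep_var M (Pi\<^sub>M UNIV (\<lambda>_. borel)) \<xi> (Pi\<^sub>M UNIV (\<lambda>_. borel)) R
      \<longrightarrow>
        (AE \<omega> in M. (\<lambda>k. complex_of_real (\<xi> \<omega> k) * R \<omega> k) summable_on UNIV) \<and>
        distr M borel
          (\<lambda>\<omega>. - inverse (z + (\<Sum>\<^sub>\<infinity>k. complex_of_real (\<xi> \<omega> k) * R \<omega> k))) = \<mu>)"

definition fixed_law :: "real \<Rightarrow> complex \<Rightarrow> complex measure \<Rightarrow> bool" where
  "fixed_law \<alpha> z \<mu> \<longleftrightarrow>
     prob_space \<mu> \<and> sets \<mu> = sets borel \<and>
     (AE x in \<mu>. 0 \<le> Im x) \<and>
     (\<integral>\<^sup>+ x. ennreal (cmod x powr (\<alpha> / 2)) \<partial>\<mu>) < \<infinity> \<and>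
     solves_RDE \<alpha> z \<mu>"

end

theory Submission
  imports Defs
begin

text \<open>Put \<open>a = \<alpha> / 2 < 1 / 3\<close> and let \<open>S\<close> be the sum of the weighted marks.  The Mecke formula for the
  Poisson process reduces inverse moments of \<open>z + S\<close> to a one-variable integral over a single weight;
  as \<open>x\<close> runs over the weights, \<open>\<bar>w + x r\<bar> powr (- p)\<close> is integrable for \<open>p + a < 1\<close> uniformly in \<open>w\<close>, so all
  inverse moments of order \<open>p < 1 - a\<close> are bounded by \<open>\<bar>z\<bar> powr (- p)\<close>.  For coupled inputs \<open>f\<close>, \<open>g\<close> the distance
  \<open>E \<bar>f - g\<bar> powr (a + \<eta>) * (\<bar>f\<bar> powr (- \<eta>) + \<bar>g\<bar> powr (- \<eta>))\<close> is then contracted by the map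
  \<open>R \<mapsto> - 1 / (z + S)\<close> once \<open>\<bar>z\<bar>\<close> is large.

  Iterating a coupling of two solutions gives uniqueness.  For existence the map is iterated on a
  tree of independent weight families, where the iterates converge almost surely.  Replacing
  \<open>\<bar>f - g\<bar>\<close> by \<open>Im f\<close> in the same estimate bounds the weighted moment of the imaginary part by a
  multiple of \<open>(Im z) powr (a + \<eta>)\<close>; removing the weight costs \<open>(Im z) powr (- \<eta>)\<close>, and for real \<open>z\<close>
  the moment vanishes.

  The definition of a solution quantifies over all models of the Poisson process and the marks.
  Discretising the weights shows that the characteristic function of \<open>S\<close> depends only on the counts
  in disjoint cells, so every model may be replaced by the explicit one.\<close>

section \<open>Poisson sums over independent cells\<close>

text \<open>The obstacle is that the reciprocal is singular and that for real z the imaginary part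
  gives no lower bound for z + S. The only regularity comes from the weights themselves: a single
  weight has a density, and integrating over it smooths the singularity. This is why every estimate
  isolates one point of the process. It also explains the range of \<alpha>: one weight yields
  inverse moments of order p only for p + a < 1, while the difference of two reciprocals costs order
  2 * a, hence 3 * a < 1. The weighted distance is not treated as a metric on laws. It serves to
  produce couplings, or iterates on a common sample space, at geometrically small distance; from
  there the argument passes to moments of order a, and then to characteristic functions for
  uniqueness or to summable increments for existence. A law solving the equation in all models can
  be tested on one model only if some model exists on the prescribed sample space, so such a model
  has to be built. Conversely, a fixed point of the explicit map solves the equation only if the law
  of S is the same in all models.\<close>

lemma nn_integral_PiM_reindex:
  fixes \<rho> :: "'e measure" and f :: "'i \<Rightarrow> 'i"
  assumes "prob_space \<rho>" "inj f" and [measurable]: "H \<in> borel_measurable (PiM UNIV (\<lambda>_. \<rho>))"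
  shows "(\<integral>\<^sup>+Z. H (\<lambda>i. Z (f i)) \<partial>PiM UNIV (\<lambda>_. \<rho>)) = (\<integral>\<^sup>+Z. H Z \<partial>PiM UNIV (\<lambda>_. \<rho>))"
proof -
  have *: "distr (PiM UNIV (\<lambda>_. \<rho>)) (PiM UNIV (\<lambda>_. \<rho>)) (\<lambda>\<omega> n. \<omega> (f n)) = PiM UNIV (\<lambda>_. \<rho>)"
    using distr_PiM_reindex[of UNIV "\<lambda>_. \<rho>" f UNIV] assms by (simp add: restrict_def)
  have [measurable]: "(\<lambda>\<omega> n. \<omega> (f n)) \<in> PiM UNIV (\<lambda>_. \<rho>) \<rightarrow>\<^sub>M PiM UNIV (\<lambda>_. \<rho>)"
    by (rule measurable_PiM_single') (auto simp: space_PiM)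
  show ?thesis by (subst (2) *[symmetric]) (simp add: nn_integral_distr)
qed

text \<open>Resampling one coordinate of an i.i.d. family. The others may be renamed by
  \<open>g\<close>, which has to be injective only away from \<open>k\<close>; in the Mecke formula
  this closes the gap left behind by an extracted point.\<close>

lemma nn_integral_PiM_insert:
  fixes \<rho> :: "'e measure" and g :: "'i \<Rightarrow> 'i"
  assumes \<rho>: "prob_space \<rho>" and g: "inj_on g (- {k})"
    and H [measurable]: "H \<in> borel_measurable (PiM UNIV (\<lambda>_. \<rho>))"
  shows "(\<integral>\<^sup>+z. \<integral>\<^sup>+Z. H (\<lambda>i. if i = k then z else Z (g i)) \<partial>PiM UNIV (\<lambda>_. \<rho>) \<partial>\<rho>)
       = (\<integral>\<^sup>+Z. H Z \<partial>PiM UNIV (\<lambda>_. \<rho>))"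
proof -
  let ?I = "- {k}"
  interpret R: prob_space \<rho> by fact
  interpret P: prob_space "PiM ?I (\<lambda>_. \<rho>)" by (intro prob_space_PiM assms)
  have *: "distr (PiM UNIV (\<lambda>_. \<rho>)) (PiM ?I (\<lambda>_. \<rho>)) (\<lambda>\<omega>. \<lambda>n\<in>?I. \<omega> (g n)) = PiM ?I (\<lambda>_. \<rho>)"
    using distr_PiM_reindex[of UNIV "\<lambda>_. \<rho>" g ?I] assms by simp
  have **: "distr (\<rho> \<Otimes>\<^sub>M PiM ?I (\<lambda>_. \<rho>)) (PiM UNIV (\<lambda>_. \<rho>)) (\<lambda>(x, X). X(k := x)) = PiM UNIV (\<lambda>_. \<rho>)"
    using distr_pair_PiM_eq_PiM[of ?I "\<lambda>_. \<rho>" k] assms insert_Diff[of k UNIV] by (simp add: Compl_eq_Diff_UNIV)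
  have [measurable]: "(\<lambda>\<omega>. \<lambda>n\<in>?I. \<omega> (g n)) \<in> PiM UNIV (\<lambda>_. \<rho>) \<rightarrow>\<^sub>M PiM ?I (\<lambda>_. \<rho>)"
    by (intro measurable_restrict measurable_component_singleton) auto
  have m[measurable]: "(\<lambda>(x, X). X(k := x)) \<in> \<rho> \<Otimes>\<^sub>M PiM ?I (\<lambda>_. \<rho>) \<rightarrow>\<^sub>M PiM UNIV (\<lambda>_. \<rho>)"
    unfolding case_prod_beta'
    by (rule measurable_fun_upd[where J="?I"])
      (auto intro: measurable_snd measurable_fst)
  have "(\<integral>\<^sup>+Z. H Z \<partial>PiM UNIV (\<lambda>_. \<rho>)) = (\<integral>\<^sup>+z. H ((\<lambda>(x, X). X(k := x)) z) \<partial>(\<rho> \<Otimes>\<^sub>M PiM ?I (\<lambda>_. \<rho>)))"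
    by (subst **[symmetric], subst nn_integral_distr) auto
  also have "\<dots> = (\<integral>\<^sup>+x. \<integral>\<^sup>+X. H (X(k := x)) \<partial>PiM ?I (\<lambda>_. \<rho>) \<partial>\<rho>)"
    by (subst P.nn_integral_fst[symmetric]) (auto simp: case_prod_beta' intro!: measurable_compose[OF m H])
  also have "\<dots> = (\<integral>\<^sup>+x. \<integral>\<^sup>+Z. H ((\<lambda>n\<in>?I. Z (g n))(k := x)) \<partial>PiM UNIV (\<lambda>_. \<rho>) \<partial>\<rho>)"
  proof (intro nn_integral_cong)
    fix x assume x: "x \<in> space \<rho>"
    have [measurable]: "(\<lambda>X. H (X(k := x))) \<in> borel_measurable (PiM ?I (\<lambda>_. \<rho>))"
      using measurable_compose[OF measurable_compose[OF measurable_Pair1'[OF x] m] H] by simp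
    show "(\<integral>\<^sup>+X. H (X(k := x)) \<partial>PiM ?I (\<lambda>_. \<rho>)) = (\<integral>\<^sup>+Z. H ((\<lambda>n\<in>?I. Z (g n))(k := x)) \<partial>PiM UNIV (\<lambda>_. \<rho>))"
      by (subst *[symmetric], subst nn_integral_distr) auto
  qed
  also have "(\<lambda>x Z. (\<lambda>n\<in>?I. Z (g n))(k := x)) = (\<lambda>x Z i. if i = k then x else Z (g i))"
    by (auto simp: fun_eq_iff)
  finally show ?thesis by (simp add: fun_upd_def if_distrib cong: if_cong)
qed

lemma suminf_ennreal_bij:
  fixes g :: "nat \<Rightarrow> ennreal"
  assumes "bij \<sigma>"
  shows "(\<Sum>p. g (\<sigma> p)) = (\<Sum>p. g p)"
  using nn_integral_bij_count_space[of \<sigma> UNIV UNIV g] assms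
  by (simp add: nn_integral_count_space_nat)

lemma suminf_prod_decode:
  fixes g :: "nat \<Rightarrow> nat \<Rightarrow> ennreal"
  shows "(\<Sum>p. g (fst (prod_decode p)) (snd (prod_decode p))) = (\<Sum>j. \<Sum>i. g j i)"
  using suminf_ennreal_2dimen[of "\<lambda>x. \<Sum>i. g x i" "\<lambda>(x, y). g x y"]
  by (simp add: comp_def case_prod_beta')

abbreviation pois1 :: "nat measure" where "pois1 \<equiv> measure_pmf (poisson_pmf 1)"

text \<open>The factor n cancels against the factorial in the Poisson weights. This size-bias
  identity is the one property of the counts on which \<open>Mecke_cells\<close> rests.\<close>

lemma nn_integral_poisson_shift:
  "(\<integral>\<^sup>+n. of_nat n * g n \<partial>pois1) = (\<integral>\<^sup>+n. g (Suc n) \<partial>pois1)"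
proof -
  have "(\<integral>\<^sup>+n. of_nat n * g n \<partial>pois1) = (\<Sum>n. ennreal (pmf (poisson_pmf 1) n) * (of_nat n * g n))"
    by (simp add: nn_integral_measure_pmf nn_integral_count_space_nat)
  also have "\<dots> = (\<Sum>n. ennreal (pmf (poisson_pmf 1) (Suc n)) * (of_nat (Suc n) * g (Suc n)))"
    by (subst suminf_offset[where i=1]) auto
  also have "\<dots> = (\<Sum>n. ennreal (pmf (poisson_pmf 1) n) * g (Suc n))"
  proof (intro arg_cong[where f=suminf] ext)
    fix n
    have "ennreal (pmf (poisson_pmf 1) (Suc n)) * of_nat (Suc n) = ennreal (pmf (poisson_pmf 1) n)"
      by (subst ennreal_of_nat_eq_real_of_nat, subst ennreal_mult[symmetric]) (auto simp: fact_Suc simp del: of_nat_Suc)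
    then show "ennreal (pmf (poisson_pmf 1) (Suc n)) * (of_nat (Suc n) * g (Suc n)) = ennreal (pmf (poisson_pmf 1) n) * g (Suc n)"
      by (simp add: mult.assoc[symmetric])
  qed
  finally show ?thesis by (simp add: nn_integral_measure_pmf nn_integral_count_space_nat)
qed

text \<open>A natural number codes a pair of a cell j and a slot i; the slot is occupied when i < N
  j. A single i.i.d. sequence thus supplies the points of all cells.\<close>

definition pt_cell :: "nat \<Rightarrow> nat" where "pt_cell p = fst (prod_decode p)"
definition pt_slot :: "nat \<Rightarrow> nat" where "pt_slot p = snd (prod_decode p)"

text \<open>The index \<open>l\<close> lets several sums over the same points be carried along
  together: later the four signed parts of a complex sum, or the counts in several sets.\<close>

definition pt_functional :: "(nat \<Rightarrow> nat \<Rightarrow> 'e \<Rightarrow> ennreal) \<Rightarrow> (nat \<Rightarrow> nat) \<Rightarrow> (nat \<Rightarrow> 'e) \<Rightarrow> nat \<Rightarrow> ennreal" where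
  "pt_functional \<phi> N Z l = (\<Sum>p. if pt_slot p < N (pt_cell p) then \<phi> l (pt_cell p) (Z p) else 0)"

lemma suminf_ennreal_split1:
  fixes g :: "nat \<Rightarrow> ennreal" shows "(\<Sum>p. g p) = g k + (\<Sum>p. if p = k then 0 else g p)"
proof -
  have "(\<Sum>p. g p) = (\<Sum>p. (if p = k then g k else 0) + (if p = k then 0 else g p))"
    by (intro arg_cong[where f=suminf] ext) auto
  also have "\<dots> = (\<Sum>p. if p = k then g k else 0) + (\<Sum>p. if p = k then 0 else g p)"
    by (rule suminf_add[symmetric]) auto
  also have "(\<Sum>p. if p = k then g k else 0) = g k"
    by (subst suminf_finite[of "{k}"]) auto
  finally show ?thesis .
qed

lemma suminf_ennreal_reindex_zero:
  fixes g h :: "nat \<Rightarrow> ennreal"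
  assumes "inj_on \<tau> A" "\<tau> ` A = UNIV" "\<And>p. p \<notin> A \<Longrightarrow> h p = 0" "\<And>p. p \<in> A \<Longrightarrow> h p = g (\<tau> p)"
  shows "(\<Sum>p. h p) = (\<Sum>p. g p)"
proof -
  have "(\<Sum>p. h p) = (\<integral>\<^sup>+p. h p \<partial>count_space UNIV)" by (simp add: nn_integral_count_space_nat)
  also have "\<dots> = (\<integral>\<^sup>+p. h p \<partial>count_space A)"
    using assms(3) by (intro nn_integral_count_space_eq) auto
  also have "\<dots> = (\<integral>\<^sup>+p. g (\<tau> p) \<partial>count_space A)"
    by (intro nn_integral_cong) (auto simp: assms)
  also have "\<dots> = (\<integral>\<^sup>+p. g p \<partial>count_space UNIV)"
    by (rule nn_integral_bij_count_space) (use assms in \<open>auto simp: bij_betw_def\<close>)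
  finally show ?thesis by (simp add: nn_integral_count_space_nat)
qed

text \<open>The points of a cell are exchangeable, so each summand may be evaluated at slot 0 of its
  cell, which gives it the multiplicity N j. The Poisson shift trades this factor for one additional
  point, and resampling slot 0 exhibits that point as independent of all others.\<close>

lemma Mecke_cells:
  fixes \<rho> :: "'e measure" and \<phi> :: "nat \<Rightarrow> nat \<Rightarrow> 'e \<Rightarrow> ennreal" and F :: "nat \<Rightarrow> 'e \<Rightarrow> (nat \<Rightarrow> ennreal) \<Rightarrow> ennreal"
  assumes \<rho>: "prob_space \<rho>"
    and \<phi> [measurable]: "\<And>l j. \<phi> l j \<in> borel_measurable \<rho>"
    and F: "\<And>j. (\<lambda>(z, t). F j z t) \<in> borel_measurable (\<rho> \<Otimes>\<^sub>M PiM UNIV (\<lambda>_. borel))"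
  defines "NN \<equiv> PiM (UNIV :: nat set) (\<lambda>_. pois1)" and "ZZ \<equiv> PiM (UNIV :: nat set) (\<lambda>_. \<rho>)"
  shows "(\<integral>\<^sup>+N. \<integral>\<^sup>+Z. (\<Sum>p. if pt_slot p < N (pt_cell p) then F (pt_cell p) (Z p) (pt_functional \<phi> N Z) else 0) \<partial>ZZ \<partial>NN)
       = (\<Sum>j. \<integral>\<^sup>+N. \<integral>\<^sup>+z. \<integral>\<^sup>+Z. F j z (\<lambda>l. \<phi> l j z + pt_functional \<phi> N Z l) \<partial>ZZ \<partial>\<rho> \<partial>NN)"
proof -
  interpret R: prob_space \<rho> by fact
  interpret Z: prob_space ZZ unfolding ZZ_def by (intro prob_space_PiM assms)
  interpret N: prob_space NN unfolding NN_def by (intro prob_space_PiM prob_space_measure_pmf)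
  have [measurable]: "(\<lambda>N. N j) \<in> NN \<rightarrow>\<^sub>M count_space UNIV" for j
    unfolding NN_def by (subst measurable_cong_sets[OF refl, of _ pois1]) (auto intro: measurable_component_singleton)
  have [measurable]: "(\<lambda>Z. Z j) \<in> ZZ \<rightarrow>\<^sub>M \<rho>" for j
    using measurable_component_singleton[of j UNIV "\<lambda>_. \<rho>"] by (simp add: ZZ_def)
  have T_meas: "(\<lambda>(N, Z). pt_functional \<phi> N Z) \<in> NN \<Otimes>\<^sub>M ZZ \<rightarrow>\<^sub>M PiM UNIV (\<lambda>_. borel)"
    unfolding pt_functional_def by (rule measurable_PiM_single') (auto simp: case_prod_beta')
  have F_meas[measurable (raw)]: "(\<lambda>x. F j (f x) (g x)) \<in> borel_measurable Q"
    if "f \<in> Q \<rightarrow>\<^sub>M \<rho>" "g \<in> Q \<rightarrow>\<^sub>M PiM UNIV (\<lambda>_. borel)" for f g j and Q :: "'q measure"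
    using measurable_compose[OF measurable_Pair[OF that] F[of j]] by simp
  have T_meas2[measurable (raw)]: "(\<lambda>x. pt_functional \<phi> (f x) (g x)) \<in> Q \<rightarrow>\<^sub>M PiM UNIV (\<lambda>_. borel)"
    if "f \<in> Q \<rightarrow>\<^sub>M NN" "g \<in> Q \<rightarrow>\<^sub>M ZZ" for f g and Q :: "'q measure"
    using measurable_compose[OF measurable_Pair[OF that] T_meas] by simp
  have T_meas3[measurable (raw)]: "(\<lambda>x. pt_functional \<phi> (f x) (g x) l) \<in> borel_measurable Q"
    if "f \<in> Q \<rightarrow>\<^sub>M NN" "g \<in> Q \<rightarrow>\<^sub>M ZZ" for f g l and Q :: "'q measure"
    using measurable_compose[OF T_meas2[OF that] measurable_component_singleton[of l UNIV]] by simp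
  have "(\<integral>\<^sup>+N. \<integral>\<^sup>+Z. (\<Sum>p. if pt_slot p < N (pt_cell p) then F (pt_cell p) (Z p) (pt_functional \<phi> N Z) else 0) \<partial>ZZ \<partial>NN)
      = (\<integral>\<^sup>+N. (\<Sum>p. if pt_slot p < N (pt_cell p) then (\<integral>\<^sup>+Z. F (pt_cell p) (Z (prod_encode (pt_cell p, 0))) (pt_functional \<phi> N Z) \<partial>ZZ) else 0) \<partial>NN)"
  proof (rule nn_integral_cong)
    fix N assume [measurable]: "N \<in> space NN"
    have "(\<integral>\<^sup>+Z. (\<Sum>p. if pt_slot p < N (pt_cell p) then F (pt_cell p) (Z p) (pt_functional \<phi> N Z) else 0) \<partial>ZZ)
      = (\<Sum>p. \<integral>\<^sup>+Z. (if pt_slot p < N (pt_cell p) then F (pt_cell p) (Z p) (pt_functional \<phi> N Z) else 0) \<partial>ZZ)"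
      by (rule nn_integral_suminf) measurable
    also have "\<dots> = (\<Sum>p. if pt_slot p < N (pt_cell p) then (\<integral>\<^sup>+Z. F (pt_cell p) (Z (prod_encode (pt_cell p, 0))) (pt_functional \<phi> N Z) \<partial>ZZ) else 0)"
    proof (intro arg_cong[where f=suminf] ext)
      fix p
      show "(\<integral>\<^sup>+Z. (if pt_slot p < N (pt_cell p) then F (pt_cell p) (Z p) (pt_functional \<phi> N Z) else 0) \<partial>ZZ)
        = (if pt_slot p < N (pt_cell p) then (\<integral>\<^sup>+Z. F (pt_cell p) (Z (prod_encode (pt_cell p, 0))) (pt_functional \<phi> N Z) \<partial>ZZ) else 0)"
      proof (cases "pt_slot p < N (pt_cell p)")
        case act: True
        let ?q = "prod_encode (pt_cell p, 0)"
        \<comment> \<open>If \<open>p\<close> is occupied, so is slot 0 of its cell. Swapping the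
          two permutes occupied points within one cell and leaves every functional
          unchanged.\<close>
        let ?s = "Transposition.transpose p ?q"
        have cs: "pt_cell (?s x) = pt_cell x" "pt_slot (?s x) < N (pt_cell x) \<longleftrightarrow> pt_slot x < N (pt_cell x)" for x
          using act by (auto simp: Transposition.transpose_def pt_cell_def pt_slot_def)
        have inv: "pt_functional \<phi> N (\<lambda>x. Z (?s x)) = pt_functional \<phi> N Z" for Z
        proof
          fix l
          show "pt_functional \<phi> N (\<lambda>x. Z (?s x)) l = pt_functional \<phi> N Z l"
            unfolding pt_functional_def
            by (subst (2) suminf_ennreal_bij[of ?s, symmetric]) (auto simp: cs cong: if_cong)
        qed
        have "(\<integral>\<^sup>+Z. F (pt_cell p) (Z p) (pt_functional \<phi> N Z) \<partial>ZZ)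
            = (\<integral>\<^sup>+Z. F (pt_cell p) (Z (?s p)) (pt_functional \<phi> N (\<lambda>x. Z (?s x))) \<partial>ZZ)"
          unfolding ZZ_def
          by (rule nn_integral_PiM_reindex[of \<rho> ?s "\<lambda>Z. F (pt_cell p) (Z p) (pt_functional \<phi> N Z)", symmetric])
             (auto intro: \<rho> bij_is_inj simp: ZZ_def[symmetric])
        then show ?thesis using act by (simp add: inv)
      qed auto
    qed
    finally show "(\<integral>\<^sup>+Z. (\<Sum>p. if pt_slot p < N (pt_cell p) then F (pt_cell p) (Z p) (pt_functional \<phi> N Z) else 0) \<partial>ZZ) = \<dots>" .
  qed
  \<comment> \<open>After the symmetrisation a summand depends on the cell alone, so cell j
    contributes it once for each of its N j occupied slots.\<close>
  also have "\<dots> = (\<integral>\<^sup>+N. (\<Sum>j. of_nat (N j) * (\<integral>\<^sup>+Z. F j (Z (prod_encode (j, 0))) (pt_functional \<phi> N Z) \<partial>ZZ)) \<partial>NN)"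
  proof (rule nn_integral_cong)
    fix N
    have "(\<Sum>p. if pt_slot p < N (pt_cell p) then (\<integral>\<^sup>+Z. F (pt_cell p) (Z (prod_encode (pt_cell p, 0))) (pt_functional \<phi> N Z) \<partial>ZZ) else 0)
      = (\<Sum>j. \<Sum>i. if i < N j then (\<integral>\<^sup>+Z. F j (Z (prod_encode (j, 0))) (pt_functional \<phi> N Z) \<partial>ZZ) else 0)"
      unfolding pt_slot_def pt_cell_def by (rule suminf_prod_decode)
    also have "\<dots> = (\<Sum>j. of_nat (N j) * (\<integral>\<^sup>+Z. F j (Z (prod_encode (j, 0))) (pt_functional \<phi> N Z) \<partial>ZZ))"
      by (intro arg_cong[where f=suminf] ext, subst suminf_finite[of "{..<N _}"]) auto
    finally show "(\<Sum>p. if pt_slot p < N (pt_cell p) then (\<integral>\<^sup>+Z. F (pt_cell p) (Z (prod_encode (pt_cell p, 0))) (pt_functional \<phi> N Z) \<partial>ZZ) else 0) = \<dots>" .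
  qed
  also have "\<dots> = (\<Sum>j. \<integral>\<^sup>+N. of_nat (N j) * (\<integral>\<^sup>+Z. F j (Z (prod_encode (j, 0))) (pt_functional \<phi> N Z) \<partial>ZZ) \<partial>NN)"
    by (rule nn_integral_suminf) measurable
  also have "\<dots> = (\<Sum>j. \<integral>\<^sup>+N. \<integral>\<^sup>+z. \<integral>\<^sup>+Z. F j z (\<lambda>l. \<phi> l j z + pt_functional \<phi> N Z l) \<partial>ZZ \<partial>\<rho> \<partial>NN)"
  proof (intro arg_cong[where f=suminf] ext)
    fix j
    let ?q = "prod_encode (j, 0)"
    define G where "G N = (\<integral>\<^sup>+Z. F j (Z ?q) (pt_functional \<phi> N Z) \<partial>ZZ)" for N
    have G[measurable]: "G \<in> borel_measurable NN" unfolding G_def by measurable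
    have upd[measurable]: "(\<lambda>(n, N). (\<lambda>i. if i = j then n else N i)) \<in> count_space UNIV \<Otimes>\<^sub>M NN \<rightarrow>\<^sub>M NN"
    proof (subst (2) NN_def, rule measurable_PiM_single')
      fix i show "(\<lambda>\<omega>. (case \<omega> of (n, N) \<Rightarrow> \<lambda>i. if i = j then n else N i) i) \<in> count_space UNIV \<Otimes>\<^sub>M NN \<rightarrow>\<^sub>M pois1"
        by (cases "i = j") (auto simp: case_prod_beta' cong: measurable_cong_sets)
    qed auto
    have Gu: "(\<lambda>N. G (\<lambda>i. if i = j then n else N i)) \<in> borel_measurable NN" for n
      using measurable_compose[OF measurable_compose[OF measurable_Pair1'[of n "count_space UNIV" NN] upd] G] by simp
    have Gu2: "(\<lambda>(n, N). G (\<lambda>i. if i = j then n else N i)) \<in> borel_measurable (count_space UNIV \<Otimes>\<^sub>M NN)"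
      using measurable_compose[OF upd G] by (simp add: case_prod_beta')
    have ins: "(\<integral>\<^sup>+n. \<integral>\<^sup>+N. H (\<lambda>i. if i = j then n else N i) \<partial>NN \<partial>pois1) = (\<integral>\<^sup>+N. H N \<partial>NN)"
      if "H \<in> borel_measurable NN" for H :: "(nat \<Rightarrow> nat) \<Rightarrow> ennreal"
      using nn_integral_PiM_insert[of pois1 "\<lambda>x. x" j H] that prob_space_measure_pmf unfolding NN_def by auto
    \<comment> \<open>The count of cell j is drawn separately from the others, which isolates the
      factor on which the Poisson shift acts; afterwards it is merged back.\<close>
    have "(\<integral>\<^sup>+N. of_nat (N j) * G N \<partial>NN) = (\<integral>\<^sup>+n. \<integral>\<^sup>+N. of_nat n * G (\<lambda>i. if i = j then n else N i) \<partial>NN \<partial>pois1)"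
      by (subst ins[symmetric]) auto
    also have "\<dots> = (\<integral>\<^sup>+n. of_nat n * (\<integral>\<^sup>+N. G (\<lambda>i. if i = j then n else N i) \<partial>NN) \<partial>pois1)"
      by (intro nn_integral_cong nn_integral_cmult Gu)
    also have "\<dots> = (\<integral>\<^sup>+n. \<integral>\<^sup>+N. G (\<lambda>i. if i = j then Suc n else N i) \<partial>NN \<partial>pois1)"
      by (rule nn_integral_poisson_shift)
    also have "\<dots> = (\<integral>\<^sup>+N. G (\<lambda>i. if i = j then Suc (N j) else N i) \<partial>NN)"
    proof -
      have "(\<lambda>N i. if i = j then Suc (N j) else N i) \<in> NN \<rightarrow>\<^sub>M NN"
      proof -
        have "(\<lambda>N. (Suc (N j), N)) \<in> NN \<rightarrow>\<^sub>M count_space UNIV \<Otimes>\<^sub>M NN"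
        proof (rule measurable_Pair)
          show "(\<lambda>N. Suc (N j)) \<in> NN \<rightarrow>\<^sub>M count_space UNIV"
            by (rule measurable_compose[of "\<lambda>N. N j" _ "count_space UNIV" Suc]) simp_all
        qed simp
        from measurable_compose[OF this upd] show ?thesis by simp
      qed
      from measurable_compose[OF this G]
      show ?thesis by (subst ins[symmetric]) (auto cong: if_cong)
    qed
    also have "\<dots> = (\<integral>\<^sup>+N. \<integral>\<^sup>+z. \<integral>\<^sup>+Z. F j z (\<lambda>l. \<phi> l j z + pt_functional \<phi> N Z l) \<partial>ZZ \<partial>\<rho> \<partial>NN)"
    proof (rule nn_integral_cong)
      fix N assume N[measurable]: "N \<in> space NN"
      let ?N = "\<lambda>i. if i = j then Suc (N j) else N i"
      have [measurable]: "?N \<in> space NN" by (auto simp: NN_def space_PiM)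
      \<comment> \<open>Slot 0 of cell j becomes the new point and the other slots of that cell move
        down by one. Truncated subtraction sends slots 0 and 1 to the same place, so
        \<open>\<tau>\<close> is injective only off \<open>?q\<close>.\<close>
      define \<tau> where "\<tau> p = (if pt_cell p = j then prod_encode (j, pt_slot p - 1) else p)" for p
      have dec: "p = prod_encode (pt_cell p, pt_slot p)" for p by (simp add: pt_cell_def pt_slot_def)
      have enc: "pt_cell (prod_encode (x, y)) = x" "pt_slot (prod_encode (x, y)) = y" for x y
        by (auto simp: pt_cell_def pt_slot_def)
      have pq: "p = ?q \<longleftrightarrow> pt_cell p = j \<and> pt_slot p = 0" for p
        using dec[of p] by (auto simp: enc)
      have inj: "inj_on \<tau> (- {?q})"
      proof (rule inj_onI)
        fix x y assume xy: "x \<in> - {?q}" "y \<in> - {?q}" "\<tau> x = \<tau> y"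
        have "pt_cell (\<tau> x) = pt_cell x" "pt_cell (\<tau> y) = pt_cell y" by (auto simp: \<tau>_def enc)
        then have "pt_cell x = pt_cell y" using xy by simp
        moreover have "pt_slot x = pt_slot y"
          using xy calculation unfolding \<tau>_def by (auto simp: pq split: if_splits)
        ultimately show "x = y" using dec by metis
      qed
      have surj: "\<tau> ` (- {?q}) = UNIV"
      proof -
        have "p \<in> \<tau> ` (- {?q})" for p
        proof (cases "pt_cell p = j")
          case True
          have "\<tau> (prod_encode (j, Suc (pt_slot p))) = p" using True dec[of p] by (simp add: \<tau>_def enc)
          then show ?thesis by (intro image_eqI[of _ _ "prod_encode (j, Suc (pt_slot p))"]) (auto simp: pq enc)
        next
          case False
          then show ?thesis by (intro image_eqI[of _ _ p]) (auto simp: pq \<tau>_def)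
        qed
        then show ?thesis by auto
      qed
      have T: "pt_functional \<phi> ?N (\<lambda>i. if i = ?q then z else Z (\<tau> i)) l = \<phi> l j z + pt_functional \<phi> N Z l" for z Z l
      proof -
        have "pt_functional \<phi> ?N (\<lambda>i. if i = ?q then z else Z (\<tau> i)) l =
          \<phi> l j z + (\<Sum>p. if p = ?q then 0 else if pt_slot p < ?N (pt_cell p) then \<phi> l (pt_cell p) (Z (\<tau> p)) else 0)"
          unfolding pt_functional_def
          by (subst suminf_ennreal_split1[of _ ?q]) (auto simp: enc intro!: arg_cong[where f=suminf] arg_cong2[where f="(+)"])
        also have "(\<Sum>p. if p = ?q then 0 else if pt_slot p < ?N (pt_cell p) then \<phi> l (pt_cell p) (Z (\<tau> p)) else 0)
          = pt_functional \<phi> N Z l"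
          unfolding pt_functional_def
        proof (rule suminf_ennreal_reindex_zero[OF inj surj])
          fix p assume "p \<in> - {?q}"
          then have "p \<noteq> ?q" by simp
          then show "(if p = ?q then 0 else if pt_slot p < ?N (pt_cell p) then \<phi> l (pt_cell p) (Z (\<tau> p)) else 0)
            = (if pt_slot (\<tau> p) < N (pt_cell (\<tau> p)) then \<phi> l (pt_cell (\<tau> p)) (Z (\<tau> p)) else 0)"
            by (auto simp: pq \<tau>_def enc)
        qed auto
        finally show ?thesis .
      qed
      have "G ?N = (\<integral>\<^sup>+z. \<integral>\<^sup>+Z. F j z (pt_functional \<phi> ?N (\<lambda>i. if i = ?q then z else Z (\<tau> i))) \<partial>ZZ \<partial>\<rho>)"
        unfolding G_def
        using nn_integral_PiM_insert[of \<rho> \<tau> ?q "\<lambda>Z. F j (Z ?q) (pt_functional \<phi> ?N Z)"] \<rho> inj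
        by (simp add: ZZ_def[symmetric])
      also have "\<dots> = (\<integral>\<^sup>+z. \<integral>\<^sup>+Z. F j z (\<lambda>l. \<phi> l j z + pt_functional \<phi> N Z l) \<partial>ZZ \<partial>\<rho>)"
        by (intro nn_integral_cong arg_cong[where f="F j _"] ext T)
      finally show "G ?N = \<dots>" .
    qed
    finally show "(\<integral>\<^sup>+N. of_nat (N j) * (\<integral>\<^sup>+Z. F j (Z ?q) (pt_functional \<phi> N Z) \<partial>ZZ) \<partial>NN) = \<dots>"
      by (simp add: G_def)
  qed
  finally show ?thesis .
qed

section \<open>The intensity measure\<close>

lemma nn_integral_PiM_prod:
  fixes \<rho> :: "'e measure" and F :: "'i \<Rightarrow> 'e \<Rightarrow> ennreal"
  assumes \<rho>: "prob_space \<rho>" and "finite J" and F [measurable]: "\<And>j. F j \<in> borel_measurable \<rho>"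
  shows "(\<integral>\<^sup>+Z. (\<Prod>j\<in>J. F j (Z j)) \<partial>PiM UNIV (\<lambda>_. \<rho>)) = (\<Prod>j\<in>J. \<integral>\<^sup>+z. F j z \<partial>\<rho>)"
  using \<open>finite J\<close>
proof (induction J)
  case empty
  interpret P: prob_space "PiM UNIV (\<lambda>_. \<rho>)" by (intro prob_space_PiM \<rho>)
  show ?case by (simp add: P.emeasure_space_1)
next
  case (insert k J)
  have "(\<integral>\<^sup>+Z. (\<Prod>j\<in>insert k J. F j (Z j)) \<partial>PiM UNIV (\<lambda>_. \<rho>))
      = (\<integral>\<^sup>+z. \<integral>\<^sup>+Z. F k z * (\<Prod>j\<in>J. F j (Z j)) \<partial>PiM UNIV (\<lambda>_. \<rho>) \<partial>\<rho>)"
    using insert(1,2)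
    by (subst nn_integral_PiM_insert[OF \<rho>, of "\<lambda>x. x" k, symmetric])
       (auto intro!: nn_integral_cong arg_cong2[where f="(*)"] prod.cong)
  also have "\<dots> = (\<integral>\<^sup>+z. F k z * (\<Prod>j\<in>J. \<integral>\<^sup>+z. F j z \<partial>\<rho>) \<partial>\<rho>)"
    by (subst nn_integral_cmult) (auto simp: insert)
  also have "\<dots> = (\<Prod>j\<in>insert k J. \<integral>\<^sup>+z. F j z \<partial>\<rho>)"
    using insert by (simp add: nn_integral_multc)
  finally show ?case .
qed

text \<open>\<open>Mecke_cells\<close> knows one i.i.d. family of points, whereas uniform positions
  and marks are sampled as two sequences. This identity merges them into one family of
  pairs.\<close>

lemma distr_PiM_pair:
  fixes A :: "'a measure" and B :: "'b measure"
  assumes A: "prob_space A" and B: "prob_space B"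
  shows "distr (PiM (UNIV :: 'i set) (\<lambda>_. A) \<Otimes>\<^sub>M PiM UNIV (\<lambda>_. B)) (PiM UNIV (\<lambda>_. A \<Otimes>\<^sub>M B)) (\<lambda>(U, Y) p. (U p, Y p))
       = PiM UNIV (\<lambda>_. A \<Otimes>\<^sub>M B)" (is "?L = ?R")
proof (rule measure_eqI_PiM_infinite[symmetric, OF refl])
  interpret A: prob_space A by fact
  interpret B: prob_space B by fact
  interpret AB: pair_prob_space A B ..
  interpret PA: prob_space "PiM (UNIV :: 'i set) (\<lambda>_. A)" by (intro prob_space_PiM A)
  interpret PB: prob_space "PiM (UNIV :: 'i set) (\<lambda>_. B)" by (intro prob_space_PiM B)
  interpret PAB: pair_prob_space "PiM (UNIV :: 'i set) (\<lambda>_. A)" "PiM (UNIV :: 'i set) (\<lambda>_. B)" ..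
  interpret R: product_prob_space "\<lambda>_. A \<Otimes>\<^sub>M B" "UNIV :: 'i set" by unfold_locales
  have AB: "prob_space (A \<Otimes>\<^sub>M B)" by unfold_locales
  show "finite_measure ?R" by unfold_locales
  have [measurable]: "(\<lambda>(U, Y) p. (U p, Y p)) \<in> PiM (UNIV :: 'i set) (\<lambda>_. A) \<Otimes>\<^sub>M PiM UNIV (\<lambda>_. B) \<rightarrow>\<^sub>M ?R"
    by (rule measurable_PiM_single') (auto simp: case_prod_beta' space_PiM space_pair_measure PiE_iff)
  fix E and J :: "'i set" assume J: "finite J" "J \<subseteq> UNIV" and E: "\<And>i. i \<in> J \<Longrightarrow> E i \<in> sets (A \<Otimes>\<^sub>M B)"
  \<comment> \<open>The value \<open>{}\<close> off \<open>J\<close> makes every member measurable,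
    as \<open>nn_integral_PiM_prod\<close> asks for all indices.\<close>
  define E' where "E' i = (if i \<in> J then E i else {})" for i
  have E'[measurable]: "E' i \<in> sets (A \<Otimes>\<^sub>M B)" for i using E by (auto simp: E'_def)
  have emb: "prod_emb UNIV (\<lambda>_. A \<Otimes>\<^sub>M B) J (Pi\<^sub>E J E) \<in> sets ?R"
    using J E by (intro sets_PiM_I) auto
  have ind: "indicator (prod_emb UNIV (\<lambda>_. A \<Otimes>\<^sub>M B) J (Pi\<^sub>E J E)) Z = (\<Prod>j\<in>J. indicator (E' j) (Z j) :: ennreal)"
    if "Z \<in> space ?R" for Z
    using that J(1) E sets.sets_into_space
    by (auto simp: prod_emb_def space_PiM PiE_iff E'_def split: split_indicator)
  have "emeasure ?L (prod_emb UNIV (\<lambda>_. A \<Otimes>\<^sub>M B) J (Pi\<^sub>E J E)) = (\<integral>\<^sup>+Z. (\<Prod>j\<in>J. indicator (E' j) (Z j)) \<partial>?L)"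
  proof -
    have "emeasure ?L (prod_emb UNIV (\<lambda>_. A \<Otimes>\<^sub>M B) J (Pi\<^sub>E J E)) = (\<integral>\<^sup>+Z. indicator (prod_emb UNIV (\<lambda>_. A \<Otimes>\<^sub>M B) J (Pi\<^sub>E J E)) Z \<partial>?L)"
      using emb by (intro nn_integral_indicator[symmetric]) simp
    also have "\<dots> = (\<integral>\<^sup>+Z. (\<Prod>j\<in>J. indicator (E' j) (Z j)) \<partial>?L)"
      by (intro nn_integral_cong ind) simp
    finally show ?thesis .
  qed
  also have "\<dots> = (\<integral>\<^sup>+U. \<integral>\<^sup>+Y. (\<Prod>j\<in>J. indicator (E' j) (U j, Y j)) \<partial>PiM UNIV (\<lambda>_. B) \<partial>PiM (UNIV :: 'i set) (\<lambda>_. A))"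
    by (subst nn_integral_distr) (auto simp: case_prod_beta' PB.nn_integral_fst[symmetric])
  also have "\<dots> = (\<integral>\<^sup>+U. (\<Prod>j\<in>J. \<integral>\<^sup>+y. indicator (E' j) (U j, y) \<partial>B) \<partial>PiM (UNIV :: 'i set) (\<lambda>_. A))"
  proof (intro nn_integral_cong)
    fix U :: "'i \<Rightarrow> 'a" assume "U \<in> space (PiM UNIV (\<lambda>_. A))"
    then have [measurable]: "U j \<in> space A" for j by (auto simp: space_PiM)
    show "(\<integral>\<^sup>+Y. (\<Prod>j\<in>J. indicator (E' j) (U j, Y j)) \<partial>PiM UNIV (\<lambda>_. B)) = (\<Prod>j\<in>J. \<integral>\<^sup>+y. indicator (E' j) (U j, y) \<partial>B)"
      by (rule nn_integral_PiM_prod[OF B J(1)]) measurable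
  qed
  also have "\<dots> = (\<Prod>j\<in>J. \<integral>\<^sup>+u. \<integral>\<^sup>+y. indicator (E' j) (u, y) \<partial>B \<partial>A)"
    by (rule nn_integral_PiM_prod[OF A J(1)]) measurable
  also have "\<dots> = (\<Prod>j\<in>J. emeasure (A \<Otimes>\<^sub>M B) (E' j))"
    by (simp add: B.nn_integral_fst)
  also have "\<dots> = emeasure ?R (prod_emb UNIV (\<lambda>_. A \<Otimes>\<^sub>M B) J (Pi\<^sub>E J E))"
    using J E by (subst R.emeasure_PiM_emb) (auto simp: E'_def)
  finally show "emeasure ?R (prod_emb UNIV (\<lambda>_. A \<Otimes>\<^sub>M B) J (Pi\<^sub>E J E)) = emeasure ?L (prod_emb UNIV (\<lambda>_. A \<Otimes>\<^sub>M B) J (Pi\<^sub>E J E))" by simp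
qed auto

text \<open>Here a stands for \<alpha> / 2. The measure \<open>nu\<close> below has density a * x
  powr (- a - 1) on the positive half line and hence tail x powr (- a), as for the jumps of an
  a-stable subordinator. The condition 3 * a < 1 is what inverse moments of order 2 * a
  require.\<close>

locale stable_index =
  fixes a :: real
  assumes a_pos: "0 < a" and a_less: "3 * a < 1"
begin

definition nu :: "real measure" where "nu = ppp_intensity (2 * a)"

lemma sets_nu [measurable_cong, simp]: "sets nu = sets borel" and space_nu [simp]: "space nu = UNIV"
  by (auto simp: nu_def ppp_intensity_def)

lemma nn_integral_nu:
  assumes [measurable]: "h \<in> borel_measurable borel"
  shows "(\<integral>\<^sup>+x. h x \<partial>nu) = (\<integral>\<^sup>+x. h x * ennreal (a * x powr (- a - 1)) * indicator {0<..} x \<partial>lborel)"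
  unfolding nu_def ppp_intensity_def
  by (subst nn_integral_density) (auto intro!: nn_integral_cong split: split_indicator simp: mult_ac)

interpretation sigma_nu: sigma_finite_measure nu
  unfolding nu_def ppp_intensity_def
  by (subst sigma_finite_measure.sigma_finite_iff_density_finite[OF sigma_finite_lborel]) auto

lemma sigma_finite_nu: "sigma_finite_measure nu" ..

lemma AE_nu_pos: "AE x in nu. 0 < x"
  unfolding nu_def ppp_intensity_def by (subst AE_density) (auto split: split_indicator)

definition unif :: "real measure" where "unif = uniform_measure lborel {0<..<1}"

lemma sets_unif [measurable_cong, simp]: "sets unif = sets borel" and space_unif [simp]: "space unif = UNIV"
  by (auto simp: unif_def)

lemma prob_space_unif: "prob_space unif"
  unfolding unif_def by (rule prob_space_uniform_measure) auto

definition wt :: "nat \<Rightarrow> real \<Rightarrow> real" where "wt j u = (real j + u) powr (- 1 / a)"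

lemma wt_measurable [measurable]: "wt j \<in> borel_measurable borel"
  unfolding wt_def by measurable

text \<open>Up to sign, the density of \<open>nu\<close> is the derivative of x powr (- a), so the
  map taking x to x powr (- a) carries \<open>nu\<close> to Lebesgue measure on the half
  line.\<close>

lemma nn_integral_powr_substitution:
  assumes h[measurable]: "h \<in> borel_measurable borel"
  shows "(\<integral>\<^sup>+x. h x \<partial>nu) = (\<integral>\<^sup>+g. h (g powr (- 1 / a)) * indicator {0<..} g \<partial>lborel)"
proof -
  \<comment> \<open>The substitution rule is for compact intervals. The sets \<open>?A n\<close>
    exhaust the half line and \<open>?B n\<close> are their images under the decreasing map;
    monotone convergence does the rest.\<close>
  let ?A = "\<lambda>n::nat. {1 / (real n + 2) .. real n + 2}"
  let ?B = "\<lambda>n::nat. {(real n + 2) powr (- a) .. (1 / (real n + 2)) powr (- a)}"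
  have step: "(\<integral>\<^sup>+g. h (g powr (- 1 / a)) * indicator (?B n) g \<partial>lborel)
      = (\<integral>\<^sup>+x. h x * ennreal (a * x powr (- a - 1)) * indicator (?A n) x \<partial>lborel)" for n
  proof -
    \<comment> \<open>The rule also wants a nonnegative derivative, so the substitution is y = - (x
      powr (- a)).\<close>
    let ?f = "\<lambda>y. h ((- y) powr (- 1 / a))"
    have "(\<integral>\<^sup>+g. h (g powr (- 1 / a)) * indicator (?B n) g \<partial>lborel)
       = (\<integral>\<^sup>+y. ?f y * indicator (?B n) (- y) \<partial>lborel)"
      by (subst nn_integral_real_affine[of _ "-1" 0]) auto
    also have "\<dots> = (\<integral>\<^sup>+y. ?f y * indicator {(\<lambda>x. - (x powr (-a))) (1 / (real n + 2)) .. (\<lambda>x. - (x powr (-a))) (real n + 2)} y \<partial>lborel)"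
      by (auto intro!: nn_integral_cong split: split_indicator)
    also have "\<dots> = (\<integral>\<^sup>+x. ?f (- (x powr (- a))) * ennreal (a * x powr (- a - 1)) * indicator (?A n) x \<partial>lborel)"
    proof (rule nn_integral_substitution_aux)
      fix x assume "x \<in> ?A n"
      then have x: "0 < x" by (auto intro: less_le_trans[of 0 "1 / (real n + 2)"])
      show "((\<lambda>x. - (x powr - a)) has_real_derivative a * x powr (- a - 1)) (at x)"
        using x by (auto intro!: derivative_eq_intros)
      show "0 \<le> a * x powr (- a - 1)" using a_pos by auto
    next
      show "continuous_on (?A n) (\<lambda>x. a * x powr (- a - 1))"
        by (intro continuous_intros) (auto simp: divide_simps)
      show "1 / (real n + 2) < real n + 2" by (auto simp: field_simps intro!: add_pos_nonneg)
    qed auto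
    also have "\<dots> = (\<integral>\<^sup>+x. h x * ennreal (a * x powr (- a - 1)) * indicator (?A n) x \<partial>lborel)"
    proof (intro nn_integral_cong)
      fix x :: real
      show "?f (- (x powr (- a))) * ennreal (a * x powr (- a - 1)) * indicator (?A n) x = h x * ennreal (a * x powr (- a - 1)) * indicator (?A n) x"
      proof (cases "x \<in> ?A n")
        case True
        then have x: "0 < x" by (auto intro: less_le_trans[of 0 "1 / (real n + 2)"])
        then have "(x powr (- a)) powr (- 1 / a) = x" using a_pos by (simp add: powr_powr)
        then show ?thesis by simp
      qed auto
    qed
    finally show ?thesis .
  qed
  have UA: "(SUP n. indicator (?A n) x) = (indicator {0<..} x :: ennreal)" for x :: real
  proof (cases "0 < x")
    case True
    obtain n where n: "max x (1/x) \<le> real n" using real_arch_simple by blast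
    have "x \<le> real n + 2" "1 / x \<le> real n + 2" using n by auto
    then have "x \<in> ?A n" using True by (auto simp: field_simps)
    then have "(SUP n. indicator (?A n) x) \<ge> (1::ennreal)" by (intro SUP_upper2[of n]) auto
    moreover have "(SUP n. indicator (?A n) x) \<le> (1::ennreal)" by (intro SUP_least) (auto split: split_indicator)
    ultimately show ?thesis using True by (auto intro: antisym)
  next
    case False
    then have "x \<notin> ?A n" for n by (auto intro: less_le_trans[of 0 "1 / (real n + 2)"])
    then show ?thesis using False by simp
  qed
  have UB: "(SUP n. indicator (?B n) x) = (indicator {0<..} x :: ennreal)" for x :: real
  proof (cases "0 < x")
    case True
    obtain n where n: "max (x powr (-1/a)) (x powr (1/a)) \<le> real n" using real_arch_simple by blast
    have "(real n + 2) powr (- a) \<le> x"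
    proof -
      have "(real n + 2) powr (- a) \<le> (x powr (-1/a)) powr (-a)"
        using n True a_pos by (intro powr_mono2') auto
      then show ?thesis using True a_pos by (simp add: powr_powr)
    qed
    moreover have "x \<le> (1 / (real n + 2)) powr (- a)"
    proof -
      have "(x powr (1/a)) powr a \<le> (real n + 2) powr a"
        using n True a_pos by (intro powr_mono2) auto
      then show ?thesis using True a_pos by (simp add: powr_powr powr_divide powr_minus_divide)
    qed
    ultimately have "x \<in> ?B n" by auto
    then have "(SUP n. indicator (?B n) x) \<ge> (1::ennreal)" by (intro SUP_upper2[of n]) auto
    moreover have "(SUP n. indicator (?B n) x) \<le> (1::ennreal)" by (intro SUP_least) (auto split: split_indicator)
    ultimately show ?thesis using True by (auto intro: antisym)
  next
    case False
    moreover have "0 < (real n + 2) powr (- a)" for n by auto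
    ultimately have "x \<notin> ?B n" for n by (meson atLeastAtMost_iff less_le_trans greaterThan_iff)
    then show ?thesis using False by simp
  qed
  have incA: "incseq (\<lambda>n. ?A n)"
    by (intro incseq_SucI) (auto simp: divide_simps)
  have incB: "incseq (\<lambda>n. ?B n)"
    using a_pos by (intro incseq_SucI) (auto intro!: powr_mono2' simp: divide_simps intro: order_trans[OF powr_mono2'] order_trans[OF _ powr_mono2'])
  have inc_ind: "incseq (\<lambda>n x. (c::real \<Rightarrow> ennreal) x * indicator (S n) x)" if "incseq S" for c S
    using that by (auto simp: incseq_def indicator_def le_fun_def intro!: mult_left_mono)
  have "(\<integral>\<^sup>+x. h x \<partial>nu) = (\<integral>\<^sup>+x. (SUP n. h x * ennreal (a * x powr (- a - 1)) * indicator (?A n) x) \<partial>lborel)"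
    by (subst nn_integral_nu) (auto simp: UA SUP_mult_left_ennreal[symmetric])
  also have "\<dots> = (SUP n. \<integral>\<^sup>+x. h x * ennreal (a * x powr (- a - 1)) * indicator (?A n) x \<partial>lborel)"
    by (rule nn_integral_monotone_convergence_SUP)
       (auto intro: inc_ind[OF incA, of "\<lambda>x. h x * ennreal (a * x powr (- a - 1))"])
  also have "\<dots> = (SUP n. \<integral>\<^sup>+g. h (g powr (- 1 / a)) * indicator (?B n) g \<partial>lborel)"
    by (simp only: step)
  also have "\<dots> = (\<integral>\<^sup>+g. (SUP n. h (g powr (- 1 / a)) * indicator (?B n) g) \<partial>lborel)"
    by (rule nn_integral_monotone_convergence_SUP[symmetric])
       (auto intro: inc_ind[OF incB, of "\<lambda>g. h (g powr (- 1 / a))", simplified])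
  also have "\<dots> = (\<integral>\<^sup>+g. h (g powr (- 1 / a)) * indicator {0<..} g \<partial>lborel)"
    by (auto simp: UB SUP_mult_left_ennreal[symmetric])
  finally show ?thesis .
qed

text \<open>Cutting the half line at the integers, which form a null set, turns the transported
  Lebesgue integral into a sum over cells. This is the form in which \<open>Mecke_cells\<close>
  delivers its right-hand side.\<close>

lemma nn_integral_nu_cells:
  assumes h[measurable]: "h \<in> borel_measurable borel"
  shows "(\<integral>\<^sup>+x. h x \<partial>nu) = (\<Sum>j. \<integral>\<^sup>+u. h (wt j u) \<partial>unif)"
proof -
  have "(\<integral>\<^sup>+u. h (wt j u) \<partial>unif) = (\<integral>\<^sup>+g. h (g powr (- 1 / a)) * indicator {real j<..<real j + 1} g \<partial>lborel)" for j
  proof -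
    have "(\<integral>\<^sup>+u. h (wt j u) \<partial>unif) = (\<integral>\<^sup>+u. h (wt j u) * indicator {0<..<1} u \<partial>lborel)"
      unfolding unif_def by (subst nn_integral_uniform_measure) (auto simp: divide_ennreal_def)
    also have "\<dots> = (\<integral>\<^sup>+g. h (g powr (- 1 / a)) * indicator {real j<..<real j + 1} g \<partial>lborel)"
      by (subst (2) nn_integral_real_affine[of _ 1 "real j"])
         (auto simp: wt_def intro!: nn_integral_cong split: split_indicator)
    finally show ?thesis .
  qed
  then have "(\<Sum>j. \<integral>\<^sup>+u. h (wt j u) \<partial>unif) = (\<integral>\<^sup>+g. (\<Sum>j. h (g powr (- 1 / a)) * indicator {real j<..<real j + 1} g) \<partial>lborel)"
    by (simp only:) (rule nn_integral_suminf[symmetric], measurable)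
  also have "\<dots> = (\<integral>\<^sup>+g. h (g powr (- 1 / a)) * indicator {0<..} g \<partial>lborel)"
  proof (rule nn_integral_cong_AE)
    have "AE g in lborel. g \<notin> (real ` (UNIV :: nat set))"
      by (intro AE_not_in countable_imp_null_set_lborel) auto
    then show "AE g in lborel. (\<Sum>j. h (g powr (- 1 / a)) * indicator {real j<..<real j + 1} g) = h (g powr (- 1 / a)) * indicator {0<..} g"
    proof eventually_elim
      case (elim g)
      show ?case
      proof (cases "0 < g")
        case True
        define k where "k = nat \<lfloor>g\<rfloor>"
        have k: "real k < g" "g < real k + 1"
        proof -
          have k': "real k \<le> g" "g < real k + 1" using True unfolding k_def by linarith+
          have "real k \<noteq> g" using elim by blast
          then show "real k < g" "g < real k + 1" using k' by linarith+
        qed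
        have z: "h (g powr (- 1 / a)) * indicator {real j<..<real j + 1} g = 0" if "j \<noteq> k" for j
          using that k by (auto split: split_indicator)
        have "(\<Sum>j. h (g powr (- 1 / a)) * indicator {real j<..<real j + 1} g) = (\<Sum>j\<in>{k}. h (g powr (- 1 / a)) * indicator {real j<..<real j + 1} g)"
          by (rule suminf_finite) (simp, rule z, blast)
        then show ?thesis using k True by simp
      next
        case False
        then have "g \<notin> {real j<..<real j + 1}" for j by auto
        then show ?thesis using False by simp
      qed
    qed
  qed
  also have "\<dots> = (\<integral>\<^sup>+x. h x \<partial>nu)" by (rule nn_integral_powr_substitution[symmetric]) fact
  finally show ?thesis by simp
qed

section \<open>Marked Poisson weights and the Mecke formula\<close>


definition wmap :: "(nat \<Rightarrow> nat) \<Rightarrow> (nat \<Rightarrow> real) \<Rightarrow> nat \<Rightarrow> real" where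
  "wmap N U p = (if pt_slot p < N (pt_cell p) then wt (pt_cell p) (U p) else 0)"

definition cell_counts :: "(nat \<Rightarrow> nat) measure" where "cell_counts = PiM UNIV (\<lambda>_. pois1)"

text \<open>Each interval \<open>[j, j + 1)\<close> receives a Poisson(1) number of uniform points, which gives a
  rate-one Poisson process on the half line; the map \<open>u \<mapsto> u powr (- 1 / a)\<close> carries it to intensity
  \<open>nu\<close>.  Slots without a point hold \<open>0\<close>, hence the guard \<open>0 < w p\<close> in the sums below.\<close>
definition weights :: "(nat \<Rightarrow> real) measure" where
  "weights = distr (cell_counts \<Otimes>\<^sub>M PiM UNIV (\<lambda>_. unif)) (PiM UNIV (\<lambda>_. borel)) (\<lambda>(N, U). wmap N U)"

text \<open>Marks are attached to all slots, occupied or not, so that weights and marks are plainly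
  independent; the guard on the weight discards the marks of empty slots.\<close>

definition marked :: "'v measure \<Rightarrow> ((nat \<Rightarrow> real) \<times> (nat \<Rightarrow> 'v)) measure" where
  "marked \<rho> = weights \<Otimes>\<^sub>M PiM UNIV (\<lambda>_. \<rho>)"

definition wT :: "(nat \<Rightarrow> real \<Rightarrow> 'v \<Rightarrow> ennreal) \<Rightarrow> (nat \<Rightarrow> real) \<Rightarrow> (nat \<Rightarrow> 'v) \<Rightarrow> nat \<Rightarrow> ennreal" where
  "wT \<phi> w Y l = (\<Sum>p. if 0 < w p then \<phi> l (w p) (Y p) else 0)"

lemma measurable_cell_counts: "(\<lambda>N. N j) \<in> cell_counts \<rightarrow>\<^sub>M count_space UNIV"
  unfolding cell_counts_def by (subst measurable_cong_sets[OF refl, of _ pois1]) (auto intro: measurable_component_singleton)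

lemma prob_space_cell_counts: "prob_space cell_counts"
  unfolding cell_counts_def by (intro prob_space_PiM prob_space_measure_pmf)

lemma measurable_unif_seq: "(\<lambda>U. U j) \<in> PiM UNIV (\<lambda>_. unif) \<rightarrow>\<^sub>M borel"
  by (subst measurable_cong_sets[OF refl, of _ unif]) (auto intro: measurable_component_singleton)

lemma measurable_wmap [measurable (raw)]:
  assumes [measurable]: "f \<in> M \<rightarrow>\<^sub>M cell_counts" "g \<in> M \<rightarrow>\<^sub>M PiM UNIV (\<lambda>_. unif)"
  shows "(\<lambda>x. wmap (f x) (g x)) \<in> M \<rightarrow>\<^sub>M PiM UNIV (\<lambda>_. borel)"
proof (rule measurable_PiM_single')
  fix p
  have 1: "(\<lambda>x. g x p) \<in> borel_measurable M"
    by (rule measurable_compose[OF assms(2) measurable_unif_seq])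
  have 2: "(\<lambda>x. f x (pt_cell p)) \<in> M \<rightarrow>\<^sub>M count_space UNIV"
    by (rule measurable_compose[OF assms(1) measurable_cell_counts])
  show "(\<lambda>x. wmap (f x) (g x) p) \<in> borel_measurable M"
    unfolding wmap_def using 1 2 by measurable
qed auto

lemma sets_weights [measurable_cong, simp]: "sets weights = sets (PiM UNIV (\<lambda>_. borel))"
  and space_weights [simp]: "space weights = UNIV"
  by (auto simp: weights_def space_PiM)

lemma prob_space_weights: "prob_space weights"
proof -
  interpret A: prob_space cell_counts by (rule prob_space_cell_counts)
  interpret B: prob_space "PiM UNIV (\<lambda>_::nat. unif)" by (intro prob_space_PiM prob_space_unif)
  interpret AB: pair_prob_space cell_counts "PiM UNIV (\<lambda>_::nat. unif)" ..
  show ?thesis unfolding weights_def by (rule AB.prob_space_distr) measurable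
qed

lemma prob_space_marked: assumes "prob_space \<rho>" shows "prob_space (marked \<rho>)"
proof -
  interpret A: prob_space weights by (rule prob_space_weights)
  interpret B: prob_space "PiM UNIV (\<lambda>_::nat. \<rho>)" by (intro prob_space_PiM assms)
  interpret AB: pair_prob_space weights "PiM UNIV (\<lambda>_::nat. \<rho>)" ..
  show ?thesis unfolding marked_def by unfold_locales
qed

lemma sets_marked [measurable_cong]: "sets (marked \<rho>) = sets (PiM UNIV (\<lambda>_. borel) \<Otimes>\<^sub>M PiM UNIV (\<lambda>_. \<rho>))"
  unfolding marked_def by (intro sets_pair_measure_cong) auto

text \<open>Regroups the randomness into the counts on one side and, on the other, an i.i.d. family
  of pairs of position and mark, as required by \<open>Mecke_cells\<close>.\<close>

lemma nn_integral_marked_cells: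
  fixes \<rho> :: "'v measure"
  assumes \<rho>: "prob_space \<rho>" and H[measurable]: "H \<in> borel_measurable (marked \<rho>)"
  shows "(\<integral>\<^sup>+\<omega>. H \<omega> \<partial>marked \<rho>) =
    (\<integral>\<^sup>+N. \<integral>\<^sup>+Z. H (wmap N (\<lambda>p. fst (Z p)), \<lambda>p. snd (Z p)) \<partial>PiM UNIV (\<lambda>_. unif \<Otimes>\<^sub>M \<rho>) \<partial>cell_counts)"
proof -
  let ?U = "PiM UNIV (\<lambda>_::nat. unif)" and ?Y = "PiM UNIV (\<lambda>_::nat. \<rho>)" and ?N = "cell_counts"
  interpret N: prob_space ?N by (rule prob_space_cell_counts)
  interpret U: prob_space ?U by (intro prob_space_PiM prob_space_unif)
  interpret Y: prob_space ?Y by (intro prob_space_PiM \<rho>)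
  interpret NU: pair_prob_space ?N ?U ..
  interpret UY: pair_prob_space ?U ?Y ..
  interpret W: prob_space weights by (rule prob_space_weights)
  have H'[measurable]: "H \<in> borel_measurable (PiM UNIV (\<lambda>_. borel) \<Otimes>\<^sub>M ?Y)"
    using H by (simp add: sets_marked cong: measurable_cong_sets)
  have "(\<integral>\<^sup>+\<omega>. H \<omega> \<partial>marked \<rho>) = (\<integral>\<^sup>+w. \<integral>\<^sup>+Y. H (w, Y) \<partial>?Y \<partial>weights)"
    unfolding marked_def by (rule Y.nn_integral_fst[symmetric]) measurable
  also have "\<dots> = (\<integral>\<^sup>+x. (\<integral>\<^sup>+Y. H (case x of (N, U) \<Rightarrow> wmap N U, Y) \<partial>?Y) \<partial>(?N \<Otimes>\<^sub>M ?U))"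
    unfolding weights_def by (subst nn_integral_distr) auto
  also have "\<dots> = (\<integral>\<^sup>+N. \<integral>\<^sup>+U. (\<integral>\<^sup>+Y. H (wmap N U, Y) \<partial>?Y) \<partial>?U \<partial>?N)"
    by (subst U.nn_integral_fst[symmetric]) auto
  also have "\<dots> = (\<integral>\<^sup>+N. \<integral>\<^sup>+Z. H (wmap N (\<lambda>p. fst (Z p)), \<lambda>p. snd (Z p)) \<partial>PiM UNIV (\<lambda>_. unif \<Otimes>\<^sub>M \<rho>) \<partial>?N)"
  proof (intro nn_integral_cong)
    fix N assume [measurable]: "N \<in> space ?N"
    have [measurable]: "(\<lambda>Z p. fst (Z p)) \<in> PiM UNIV (\<lambda>_. unif \<Otimes>\<^sub>M \<rho>) \<rightarrow>\<^sub>M ?U"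
      "(\<lambda>Z p. snd (Z p)) \<in> PiM UNIV (\<lambda>_. unif \<Otimes>\<^sub>M \<rho>) \<rightarrow>\<^sub>M ?Y"
      by (rule measurable_PiM_single'; auto simp: space_PiM space_pair_measure PiE_iff mem_Times_iff)+
    have [measurable]: "(\<lambda>(U, Y) p. (U p, Y p)) \<in> ?U \<Otimes>\<^sub>M ?Y \<rightarrow>\<^sub>M PiM UNIV (\<lambda>_. unif \<Otimes>\<^sub>M \<rho>)"
      by (rule measurable_PiM_single') (auto simp: case_prod_beta' space_PiM space_pair_measure PiE_iff)
    have "(\<integral>\<^sup>+Z. H (wmap N (\<lambda>p. fst (Z p)), \<lambda>p. snd (Z p)) \<partial>PiM UNIV (\<lambda>_. unif \<Otimes>\<^sub>M \<rho>))
      = (\<integral>\<^sup>+x. H (wmap N (fst x), snd x) \<partial>(?U \<Otimes>\<^sub>M ?Y))"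
      by (subst distr_PiM_pair[OF prob_space_unif \<rho>, symmetric], subst nn_integral_distr) (auto simp: case_prod_beta')
    also have "\<dots> = (\<integral>\<^sup>+U. \<integral>\<^sup>+Y. H (wmap N U, Y) \<partial>?Y \<partial>?U)"
      by (subst Y.nn_integral_fst[symmetric]) auto
    finally show "(\<integral>\<^sup>+U. \<integral>\<^sup>+Y. H (wmap N U, Y) \<partial>?Y \<partial>?U) = (\<integral>\<^sup>+Z. H (wmap N (\<lambda>p. fst (Z p)), \<lambda>p. snd (Z p)) \<partial>PiM UNIV (\<lambda>_. unif \<Otimes>\<^sub>M \<rho>))"
      by simp
  qed
  finally show ?thesis .
qed

lemma measurable_wT:
  fixes \<rho> :: "'v measure"
  assumes \<phi>: "\<And>l. (\<lambda>(x, y). \<phi> l x y) \<in> borel_measurable (borel \<Otimes>\<^sub>M \<rho>)"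
  shows "(\<lambda>(w, Y). wT \<phi> w Y) \<in> marked \<rho> \<rightarrow>\<^sub>M PiM UNIV (\<lambda>_. borel)"
proof -
  have [measurable (raw)]: "(\<lambda>x. \<phi> l (f x) (g x)) \<in> borel_measurable Q"
    if "f \<in> Q \<rightarrow>\<^sub>M borel" "g \<in> Q \<rightarrow>\<^sub>M \<rho>" for f g l and Q :: "'q measure"
    using measurable_compose[OF measurable_Pair[OF that] \<phi>[of l]] by simp
  show ?thesis
    unfolding wT_def by (rule measurable_PiM_single') (auto simp: case_prod_beta')
qed

text \<open>A point of \<open>Mecke_cells\<close> is here a pair (u, y). Integrating u within cell j
  and summing over j reassembles the integral against \<open>nu\<close>, and the extra point (x, y)
  enters each functional through the single summand \<phi> l x y.\<close>

theorem Mecke: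
  fixes \<rho> :: "'v measure"
  assumes \<rho>: "prob_space \<rho>"
    and \<phi>: "\<And>l. (\<lambda>(x, y). \<phi> l x y) \<in> borel_measurable (borel \<Otimes>\<^sub>M \<rho>)"
    and F: "(\<lambda>((x, y), t). F x y t) \<in> borel_measurable ((borel \<Otimes>\<^sub>M \<rho>) \<Otimes>\<^sub>M PiM UNIV (\<lambda>_. borel))"
  shows "(\<integral>\<^sup>+(w, Y). (\<Sum>p. if 0 < w p then F (w p) (Y p) (wT \<phi> w Y) else 0) \<partial>marked \<rho>)
    = (\<integral>\<^sup>+x. \<integral>\<^sup>+y. \<integral>\<^sup>+(w, Y). F x y (\<lambda>l. \<phi> l x y + wT \<phi> w Y l) \<partial>marked \<rho> \<partial>\<rho> \<partial>nu)"
proof -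
  let ?U = "PiM UNIV (\<lambda>_::nat. unif)" and ?Z = "PiM UNIV (\<lambda>_::nat. unif \<Otimes>\<^sub>M \<rho>)" and ?N = "cell_counts"
  interpret R: prob_space \<rho> by fact
  interpret u: prob_space unif by (rule prob_space_unif)
  interpret uR: pair_prob_space unif \<rho> ..
  have uR: "prob_space (unif \<Otimes>\<^sub>M \<rho>)" by unfold_locales
  interpret N: prob_space ?N by (rule prob_space_cell_counts)
  interpret Z: prob_space ?Z by (intro prob_space_PiM uR)
  interpret K: prob_space "marked \<rho>" by (rule prob_space_marked[OF \<rho>])
  have F_meas[measurable (raw)]: "(\<lambda>x. F (e x) (f x) (g x)) \<in> borel_measurable Q"
    if "e \<in> Q \<rightarrow>\<^sub>M borel" "f \<in> Q \<rightarrow>\<^sub>M \<rho>" "g \<in> Q \<rightarrow>\<^sub>M PiM UNIV (\<lambda>_. borel)" for e f g and Q :: "'q measure"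
    using measurable_compose[OF measurable_Pair[OF measurable_Pair[OF that(1,2)] that(3)] F] by simp
  have \<phi>_meas[measurable (raw)]: "(\<lambda>x. \<phi> l (f x) (g x)) \<in> borel_measurable Q"
    if "f \<in> Q \<rightarrow>\<^sub>M borel" "g \<in> Q \<rightarrow>\<^sub>M \<rho>" for f g l and Q :: "'q measure"
    using measurable_compose[OF measurable_Pair[OF that] \<phi>[of l]] by simp
  have T_meas[measurable]: "(\<lambda>\<omega>. wT \<phi> (fst \<omega>) (snd \<omega>)) \<in> marked \<rho> \<rightarrow>\<^sub>M PiM UNIV (\<lambda>_. borel)"
    using measurable_wT[of \<phi> \<rho>] \<phi> by (simp add: case_prod_beta')
  have T_meas2[measurable]: "(\<lambda>\<omega>. wT \<phi> (fst \<omega>) (snd \<omega>) l) \<in> borel_measurable (marked \<rho>)" for l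
    using measurable_compose[OF T_meas measurable_component_singleton[of l UNIV]] by simp
  \<comment> \<open>The weight is 0 exactly when real j + u = 0, by the convention for
    \<open>powr\<close> at base 0. Repeating the guard of \<open>wT\<close> keeps the two
    functionals equal pointwise, exceptional values included.\<close>
  define \<phi>' where "\<phi>' l j z = (if 0 < wt j (fst z) then \<phi> l (wt j (fst z)) (snd z) else 0)" for l j z
  define F' where "F' j z t = (if 0 < wt j (fst z) then F (wt j (fst z)) (snd z) t else 0)" for j z t
  have \<phi>'[measurable]: "\<phi>' l j \<in> borel_measurable (unif \<Otimes>\<^sub>M \<rho>)" for l j
    unfolding \<phi>'_def by measurable
  have F'[measurable]: "(\<lambda>(z, t). F' j z t) \<in> borel_measurable ((unif \<Otimes>\<^sub>M \<rho>) \<Otimes>\<^sub>M PiM UNIV (\<lambda>_. borel))" for j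
    unfolding F'_def by measurable
  have T: "wT \<phi> (wmap N (\<lambda>p. fst (Z p))) (\<lambda>p. snd (Z p)) = pt_functional \<phi>' N Z" for N Z
    unfolding wT_def pt_functional_def wmap_def \<phi>'_def by (intro ext arg_cong[where f=suminf]) auto
  define G where "G x y = (\<integral>\<^sup>+\<omega>. F x y (\<lambda>l. \<phi> l x y + wT \<phi> (fst \<omega>) (snd \<omega>) l) \<partial>marked \<rho>)" for x y
  have T': "(\<lambda>x l. \<phi> l (f x) (g x) + wT \<phi> (fst (h x)) (snd (h x)) l) \<in> Q \<rightarrow>\<^sub>M PiM UNIV (\<lambda>_. borel)"
    if [measurable]: "f \<in> Q \<rightarrow>\<^sub>M borel" "g \<in> Q \<rightarrow>\<^sub>M \<rho>" "h \<in> Q \<rightarrow>\<^sub>M marked \<rho>" for f g h and Q :: "'q measure"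
    by (rule measurable_PiM_single') (auto intro!: borel_measurable_add measurable_compose[OF that(3) T_meas2])
  have G_meas: "(\<lambda>(x, y). G x y) \<in> borel_measurable (borel \<Otimes>\<^sub>M \<rho>)"
    unfolding G_def case_prod_beta' by (intro K.borel_measurable_nn_integral, unfold case_prod_beta', intro F_meas T') measurable
  have G_meas'[measurable (raw)]: "(\<lambda>x. G (f x) (g x)) \<in> borel_measurable Q"
    if "f \<in> Q \<rightarrow>\<^sub>M borel" "g \<in> Q \<rightarrow>\<^sub>M \<rho>" for f g and Q :: "'q measure"
    using measurable_compose[OF measurable_Pair[OF that] G_meas] by simp
  have PT_meas: "(\<lambda>x. pt_functional \<phi>' (f x) (g x) l) \<in> borel_measurable Q"
    if [measurable]: "f \<in> Q \<rightarrow>\<^sub>M ?N" "g \<in> Q \<rightarrow>\<^sub>M ?Z" for f g l and Q :: "'q measure"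
  proof -
    have [measurable]: "(\<lambda>x. f x j) \<in> Q \<rightarrow>\<^sub>M count_space UNIV" "(\<lambda>x. g x j) \<in> Q \<rightarrow>\<^sub>M unif \<Otimes>\<^sub>M \<rho>" for j
      using measurable_compose[OF that(1) measurable_cell_counts[of j]] measurable_compose[OF that(2) measurable_component_singleton[of j UNIV "\<lambda>_. unif \<Otimes>\<^sub>M \<rho>"]] by simp_all
    show ?thesis unfolding pt_functional_def by measurable
  qed
  have F'_meas: "(\<lambda>x. F' j (f x) (g x)) \<in> borel_measurable Q"
    if "f \<in> Q \<rightarrow>\<^sub>M unif \<Otimes>\<^sub>M \<rho>" "g \<in> Q \<rightarrow>\<^sub>M PiM UNIV (\<lambda>_. borel)" for f g j and Q :: "'q measure"
    using measurable_compose[OF measurable_Pair[OF that] F'[of j]] by simp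
  have "(\<integral>\<^sup>+\<omega>. (\<Sum>p. if 0 < fst \<omega> p then F (fst \<omega> p) (snd \<omega> p) (wT \<phi> (fst \<omega>) (snd \<omega>)) else 0) \<partial>marked \<rho>)
      = (\<integral>\<^sup>+N. \<integral>\<^sup>+Z. (\<Sum>p. if pt_slot p < N (pt_cell p) then F' (pt_cell p) (Z p) (pt_functional \<phi>' N Z) else 0) \<partial>?Z \<partial>?N)"
    by (subst nn_integral_marked_cells[OF \<rho>])
       (measurable, auto simp: T wmap_def F'_def intro!: nn_integral_cong arg_cong[where f=suminf])
  also have "\<dots> = (\<Sum>j. \<integral>\<^sup>+N. \<integral>\<^sup>+z. \<integral>\<^sup>+Z. F' j z (\<lambda>l. \<phi>' l j z + pt_functional \<phi>' N Z l) \<partial>?Z \<partial>(unif \<Otimes>\<^sub>M \<rho>) \<partial>?N)"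
    unfolding cell_counts_def by (rule Mecke_cells[OF uR]) measurable
  also have "\<dots> = (\<Sum>j. \<integral>\<^sup>+u. (if 0 < wt j u then (\<integral>\<^sup>+y. G (wt j u) y \<partial>\<rho>) else 0) \<partial>unif)"
  proof (intro arg_cong[where f=suminf] ext)
    fix j
    interpret NuR: pair_sigma_finite ?N "unif \<Otimes>\<^sub>M \<rho>" ..
    have "(\<integral>\<^sup>+N. \<integral>\<^sup>+z. \<integral>\<^sup>+Z. F' j z (\<lambda>l. \<phi>' l j z + pt_functional \<phi>' N Z l) \<partial>?Z \<partial>(unif \<Otimes>\<^sub>M \<rho>) \<partial>?N)
      = (\<integral>\<^sup>+z. \<integral>\<^sup>+N. \<integral>\<^sup>+Z. F' j z (\<lambda>l. \<phi>' l j z + pt_functional \<phi>' N Z l) \<partial>?Z \<partial>?N \<partial>(unif \<Otimes>\<^sub>M \<rho>))"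
      by (rule NuR.Fubini'[symmetric])
         (simp add: case_prod_beta', intro Z.borel_measurable_nn_integral, unfold case_prod_beta', intro F'_meas measurable_PiM_single',
            auto intro!: borel_measurable_add PT_meas measurable_compose[OF _ \<phi>'])
    also have "\<dots> = (\<integral>\<^sup>+z. (if 0 < wt j (fst z) then G (wt j (fst z)) (snd z) else 0) \<partial>(unif \<Otimes>\<^sub>M \<rho>))"
    proof (intro nn_integral_cong)
      fix z assume z: "z \<in> space (unif \<Otimes>\<^sub>M \<rho>)"
      then have [measurable]: "snd z \<in> space \<rho>" by (auto simp: space_pair_measure)
      have "G (wt j (fst z)) (snd z) = (\<integral>\<^sup>+N. \<integral>\<^sup>+Z. F (wt j (fst z)) (snd z) (\<lambda>l. \<phi> l (wt j (fst z)) (snd z) + pt_functional \<phi>' N Z l) \<partial>?Z \<partial>?N)"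
        unfolding G_def T[symmetric]
        by (subst nn_integral_marked_cells[OF \<rho>]) (measurable, rule T', auto)
      then show "(\<integral>\<^sup>+N. \<integral>\<^sup>+Z. F' j z (\<lambda>l. \<phi>' l j z + pt_functional \<phi>' N Z l) \<partial>?Z \<partial>?N) = (if 0 < wt j (fst z) then G (wt j (fst z)) (snd z) else 0)"
        by (auto simp: F'_def \<phi>'_def)
    qed
    also have "\<dots> = (\<integral>\<^sup>+u. \<integral>\<^sup>+y. (if 0 < wt j u then G (wt j u) y else 0) \<partial>\<rho> \<partial>unif)"
      by (subst R.nn_integral_fst[symmetric]) (auto cong: if_cong)
    also have "\<dots> = (\<integral>\<^sup>+u. (if 0 < wt j u then (\<integral>\<^sup>+y. G (wt j u) y \<partial>\<rho>) else 0) \<partial>unif)"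
      by (auto intro!: nn_integral_cong)
    finally show "(\<integral>\<^sup>+N. \<integral>\<^sup>+z. \<integral>\<^sup>+Z. F' j z (\<lambda>l. \<phi>' l j z + pt_functional \<phi>' N Z l) \<partial>?Z \<partial>(unif \<Otimes>\<^sub>M \<rho>) \<partial>?N) = \<dots>" .
  qed
  also have "\<dots> = (\<integral>\<^sup>+x. (if 0 < x then (\<integral>\<^sup>+y. G x y \<partial>\<rho>) else 0) \<partial>nu)"
    by (rule nn_integral_nu_cells[symmetric]) measurable
  also have "\<dots> = (\<integral>\<^sup>+x. (\<integral>\<^sup>+y. G x y \<partial>\<rho>) \<partial>nu)"
    by (rule nn_integral_cong_AE) (use AE_nu_pos in eventually_elim, simp)
  finally show ?thesis by (simp add: G_def case_prod_beta')
qed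

end

section \<open>Integrals against the intensity\<close>

text \<open>The value at \<open>0\<close> is \<open>\<infinity>\<close>, so finiteness of a mean of \<open>inv_powr p\<close> excludes an atom at \<open>0\<close>.\<close>
definition inv_powr :: "real \<Rightarrow> complex \<Rightarrow> ennreal" where
  "inv_powr p w = inverse (ennreal (cmod w powr p))"

lemma inv_powr_measurable [measurable]: "inv_powr p \<in> borel_measurable borel"
  unfolding inv_powr_def by measurable

lemma inv_powr_nz: "w \<noteq> 0 \<Longrightarrow> inv_powr p w = ennreal (cmod w powr (- p))"
  unfolding inv_powr_def by (subst inverse_ennreal) (auto simp: powr_minus)

lemma inv_powr_0 [simp]: "inv_powr p 0 = \<top>"
  by (simp add: inv_powr_def)

lemma inv_powr_pos [simp]: "0 < inv_powr p w" "inv_powr p w \<noteq> 0"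
  by (auto simp: inv_powr_def ennreal_zero_less_mult_iff zero_less_iff_neq_zero)

lemma inv_powr_antimono: "0 \<le> p \<Longrightarrow> cmod z \<le> cmod w \<Longrightarrow> inv_powr p w \<le> inv_powr p z"
  by (cases "z = 0"; cases "w = 0") (auto simp: inv_powr_nz intro!: ennreal_leI powr_mono2')

section \<open>Elementary power integrals\<close>

lemma nn_integral_has_integral_on:
  fixes f :: "real \<Rightarrow> real"
  assumes [measurable]: "f \<in> borel_measurable borel" "S \<in> sets borel" and "\<And>x. 0 \<le> f x" and I: "(f has_integral I) S"
  shows "(\<integral>\<^sup>+x. ennreal (f x) * indicator S x \<partial>lborel) = ennreal I"
proof -
  have "(\<integral>\<^sup>+x. ennreal (if x \<in> S then f x else 0) \<partial>lborel) = ennreal I"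
    by (rule nn_integral_has_integral_lborel) (use assms in \<open>auto simp: has_integral_restrict_UNIV\<close>)
  also have "(\<lambda>x. ennreal (if x \<in> S then f x else 0)) = (\<lambda>x. ennreal (f x) * indicator S x)"
    by (auto simp: fun_eq_iff)
  finally show ?thesis .
qed

lemma nn_integral_lincomb2:
  assumes [measurable]: "f \<in> borel_measurable M" "g \<in> borel_measurable M"
  shows "(\<integral>\<^sup>+x. c * f x + d * g x \<partial>M) = c * (\<integral>\<^sup>+x. f x \<partial>M) + d * (\<integral>\<^sup>+x. g x \<partial>M)"
  by (simp add: nn_integral_add nn_integral_cmult)

lemma nn_integral_lincomb3:
  assumes [measurable]: "f \<in> borel_measurable M" "g \<in> borel_measurable M" "h \<in> borel_measurable M"
  shows "(\<integral>\<^sup>+x. c * f x + (d * g x + e * h x) \<partial>M) = c * (\<integral>\<^sup>+x. f x \<partial>M) + (d * (\<integral>\<^sup>+x. g x \<partial>M) + e * (\<integral>\<^sup>+x. h x \<partial>M))"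
  by (simp add: nn_integral_add nn_integral_cmult)

lemma nn_integral_powr_0:
  assumes "0 < b" "0 \<le> M"
  shows "(\<integral>\<^sup>+y. ennreal (y powr (b - 1)) * indicator {0<..M} y \<partial>lborel) = ennreal (M powr b / b)"
proof -
  have "((\<lambda>y. y powr (b - 1)) has_integral (M powr (b - 1 + 1) / (b - 1 + 1))) {0..M}"
    using assms by (intro has_integral_powr_from_0) auto
  then have "(\<integral>\<^sup>+y. ennreal (y powr (b - 1)) * indicator {0..M} y \<partial>lborel) = ennreal (M powr b / b)"
    by (subst nn_integral_has_integral_on) auto
  then show ?thesis
    by (subst (asm) nn_integral_cong[of _ _ "\<lambda>y. ennreal (y powr (b - 1)) * indicator {0<..M} y"])
       (auto split: split_indicator simp: not_less)
qed

lemma nn_integral_powr_inf: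
  assumes "0 < b" "0 < M"
  shows "(\<integral>\<^sup>+y. ennreal (y powr (- b - 1)) * indicator {M..} y \<partial>lborel) = ennreal (M powr (- b) / b)"
proof -
  have "((\<lambda>y. y powr (- b - 1)) has_integral (- (M powr (- b - 1 + 1)) / (- b - 1 + 1))) {M..}"
    using assms by (intro has_integral_powr_to_inf) auto
  then show ?thesis
    by (subst nn_integral_has_integral_on) auto
qed

lemma nn_integral_powr_centered:
  assumes c: "c < 1" and M: "0 \<le> M"
  shows "(\<integral>\<^sup>+y. ennreal (\<bar>y - t\<bar> powr (- c)) * indicator {y. \<bar>y - t\<bar> \<le> M} y \<partial>lborel) \<le> ennreal (2 * M powr (1 - c) / (1 - c))"
proof -
  let ?f = "\<lambda>y. ennreal (y powr ((1 - c) - 1)) * indicator {0<..M} y"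
  have "(\<integral>\<^sup>+y. ennreal (\<bar>y - t\<bar> powr (- c)) * indicator {y. \<bar>y - t\<bar> \<le> M} y \<partial>lborel)
      = (\<integral>\<^sup>+y. ennreal (\<bar>y\<bar> powr (- c)) * indicator {y. \<bar>y\<bar> \<le> M} y \<partial>lborel)"
    by (subst nn_integral_real_affine[of _ 1 t]) (auto simp: indicator_def cong: if_cong)
  also have "\<dots> \<le> (\<integral>\<^sup>+y. ?f y + ?f (- y) \<partial>lborel)"
    by (intro nn_integral_mono) (auto split: split_indicator simp: abs_if)
  also have "\<dots> = (\<integral>\<^sup>+y. ?f y \<partial>lborel) + (\<integral>\<^sup>+y. ?f (- y) \<partial>lborel)"
    by (rule nn_integral_add) auto
  also have "(\<integral>\<^sup>+y. ?f (- y) \<partial>lborel) = (\<integral>\<^sup>+y. ?f y \<partial>lborel)"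
    by (subst (2) nn_integral_real_affine[of _ "-1" 0]) auto
  also have "(\<integral>\<^sup>+y. ?f y \<partial>lborel) = ennreal (M powr (1 - c) / (1 - c))"
    by (rule nn_integral_powr_0) (use assms in auto)
  also have "ennreal (M powr (1 - c) / (1 - c)) + ennreal (M powr (1 - c) / (1 - c)) = ennreal (2 * M powr (1 - c) / (1 - c))"
    using c by (subst ennreal_plus[symmetric]) auto
  finally show ?thesis .
qed

text \<open>After division by r the points w / r + x run along a horizontal line, so the modulus is
  at least the horizontal distance. A complex singularity becomes a real one at - Re (w / r), with a
  bound uniform in w.\<close>

lemma cmod_add_of_real_mult_ge:
  assumes "r \<noteq> 0"
  shows "cmod r * \<bar>x - (- Re (w / r))\<bar> \<le> cmod (w + of_real x * r)"
proof -
  have "w + of_real x * r = r * (w / r + of_real x)" using assms by (simp add: field_simps)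
  then have "cmod (w + of_real x * r) = cmod r * cmod (w / r + of_real x)" by (simp add: norm_mult)
  moreover have "\<bar>Re (w / r + of_real x)\<bar> \<le> cmod (w / r + of_real x)" by (rule abs_Re_le_cmod)
  ultimately show ?thesis by (simp add: add.commute mult_left_mono)
qed

context stable_index
begin

text \<open>The integral is split at x = 1 / r, where the two entries of the minimum agree. The
  linear part converges at 0 because a < 1, the power \<eta> converges at infinity because \<eta> <
  a, and scaling produces r powr a in both.\<close>

lemma powr_nu_bound:
  assumes \<eta>: "0 < \<eta>" "\<eta> < a" and r: "0 \<le> r"
  shows "(\<integral>\<^sup>+x. ennreal (min (x * r) ((x * r) powr \<eta>)) \<partial>nu) \<le> ennreal ((a / (1 - a) + a / (a - \<eta>)) * r powr a)"
proof (cases "r = 0")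
  case False
  then have r: "0 < r" using r by simp
  have "(\<integral>\<^sup>+x. ennreal (min (x * r) ((x * r) powr \<eta>)) \<partial>nu)
     = (\<integral>\<^sup>+x. ennreal (min (x * r) ((x * r) powr \<eta>)) * ennreal (a * x powr (- a - 1)) * indicator {0<..} x \<partial>lborel)"
    by (rule nn_integral_nu) measurable
  also have "\<dots> \<le> (\<integral>\<^sup>+x. ennreal (r * a) * (ennreal (x powr ((1 - a) - 1)) * indicator {0<..1/r} x)
       + ennreal (r powr \<eta> * a) * (ennreal (x powr (- (a - \<eta>) - 1)) * indicator {1/r..} x) \<partial>lborel)"
  proof (intro nn_integral_mono)
    fix x :: real
    show "ennreal (min (x * r) ((x * r) powr \<eta>)) * ennreal (a * x powr (- a - 1)) * indicator {0<..} x
      \<le> ennreal (r * a) * (ennreal (x powr ((1 - a) - 1)) * indicator {0<..1/r} x)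
       + ennreal (r powr \<eta> * a) * (ennreal (x powr (- (a - \<eta>) - 1)) * indicator {1/r..} x)"
    proof (cases "0 < x")
      case True
      have e1: "x * x powr (- a - 1) = x powr (- a)" using True by (simp add: powr_mult_base)
      have e2: "x powr \<eta> * x powr (- a - 1) = x powr (\<eta> - a - 1)" by (simp add: powr_add[symmetric] algebra_simps)
      consider "x \<le> 1 / r" | "1 / r \<le> x" by linarith
      then show ?thesis
      proof cases
        case 1
        have "ennreal (min (x * r) ((x * r) powr \<eta>)) * ennreal (a * x powr (- a - 1)) \<le> ennreal (x * r) * ennreal (a * x powr (- a - 1))"
          by (intro mult_right_mono ennreal_leI) auto
        also have "\<dots> = ennreal (r * a) * ennreal (x powr ((1 - a) - 1))"
          using True r a_pos by (simp add: ennreal_mult[symmetric] e1 mult_ac)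
        finally show ?thesis using True 1 by (simp add: add_increasing2)
      next
        case 2
        have "ennreal (min (x * r) ((x * r) powr \<eta>)) * ennreal (a * x powr (- a - 1)) \<le> ennreal ((x * r) powr \<eta>) * ennreal (a * x powr (- a - 1))"
          by (intro mult_right_mono ennreal_leI) auto
        also have "\<dots> = ennreal (r powr \<eta> * a) * ennreal (x powr (- (a - \<eta>) - 1))"
          using True r a_pos by (simp add: ennreal_mult[symmetric] e2 powr_mult mult_ac)
        finally show ?thesis using True 2 by (simp add: add_increasing)
      qed
    qed simp
  qed
  also have "\<dots> = ennreal (r * a) * ennreal ((1/r) powr (1 - a) / (1 - a)) + ennreal (r powr \<eta> * a) * ennreal ((1/r) powr (- (a - \<eta>)) / (a - \<eta>))"
  proof -
    have A: "(\<integral>\<^sup>+x. ennreal (x powr ((1 - a) - 1)) * indicator {0<..1/r} x \<partial>lborel) = ennreal ((1/r) powr (1 - a) / (1 - a))"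
      using r a_pos a_less by (intro nn_integral_powr_0) auto
    have B: "(\<integral>\<^sup>+x. ennreal (x powr (- (a - \<eta>) - 1)) * indicator {1/r..} x \<partial>lborel) = ennreal ((1/r) powr (- (a - \<eta>)) / (a - \<eta>))"
      using r \<eta> by (intro nn_integral_powr_inf) auto
    show ?thesis
      unfolding A[symmetric] B[symmetric] by (rule nn_integral_lincomb2; measurable)
  qed
  also have "\<dots> = ennreal ((a / (1 - a) + a / (a - \<eta>)) * r powr a)"
  proof -
    have "r * (1/r) powr (1 - a) = r powr a" using r by (simp add: powr_divide powr_diff)
    moreover have "r powr \<eta> * (1/r) powr (- (a - \<eta>)) = r powr a" using r by (simp add: powr_divide powr_minus_divide powr_diff)
    ultimately have "r * a * ((1/r) powr (1 - a) / (1 - a)) + r powr \<eta> * a * ((1/r) powr (- (a - \<eta>)) / (a - \<eta>)) = (a / (1 - a) + a / (a - \<eta>)) * r powr a"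
      by (simp add: algebra_simps add_divide_distrib)
    then show ?thesis using r \<eta> a_pos a_less
      by (simp add: ennreal_mult[symmetric] ennreal_plus[symmetric] del: ennreal_plus)
  qed
  finally show ?thesis .
qed simp

text \<open>The factor x tames the density of \<open>nu\<close> to x powr (- a), which leaves
  singularities of order a at 0 and of order p at b. The restriction to modulus at most L confines x
  to distance at most M = L / R from b, and a + p < 1 makes everything integrable with a bound free
  of w.\<close>

lemma inv_powr_near_nu_bound:
  assumes p: "0 < p" "p + a < 1" and L: "0 \<le> L"
  shows "(\<integral>\<^sup>+x. ennreal (x * cmod r) * (inv_powr p (w + of_real x * r) * indicator {v. cmod v \<le> L} (w + of_real x * r)) \<partial>nu)
    \<le> ennreal (3 * a / (1 - a - p) * L powr (1 - a - p) * cmod r powr a)"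
proof (cases "r = 0")
  case False
  define R where "R = cmod r"
  define b where "b = - Re (w / r)"
  define M where "M = L / R"
  have R: "0 < R" using False by (simp add: R_def)
  have M: "0 \<le> M" using L R by (simp add: M_def)
  have "(\<integral>\<^sup>+x. ennreal (x * R) * (inv_powr p (w + of_real x * r) * indicator {v. cmod v \<le> L} (w + of_real x * r)) \<partial>nu)
    = (\<integral>\<^sup>+x. ennreal (x * R) * (inv_powr p (w + of_real x * r) * indicator {v. cmod v \<le> L} (w + of_real x * r)) * ennreal (a * x powr (- a - 1)) * indicator {0<..} x \<partial>lborel)"
    by (rule nn_integral_nu) measurable
  also have "\<dots> \<le> (\<integral>\<^sup>+x. ennreal (a * R powr (1 - p)) *
      (ennreal (\<bar>x - b\<bar> powr (- (a + p))) * indicator {x. \<bar>x - b\<bar> \<le> M} x + ennreal (x powr ((1 - (a + p)) - 1)) * indicator {0<..M} x) \<partial>lborel)"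
  proof (rule nn_integral_mono_AE)
    have "AE x in lborel. x \<noteq> b" by (rule AE_lborel_singleton)
    then show "AE x in lborel. ennreal (x * R) * (inv_powr p (w + of_real x * r) * indicator {v. cmod v \<le> L} (w + of_real x * r)) * ennreal (a * x powr (- a - 1)) * indicator {0<..} x
      \<le> ennreal (a * R powr (1 - p)) *
      (ennreal (\<bar>x - b\<bar> powr (- (a + p))) * indicator {x. \<bar>x - b\<bar> \<le> M} x + ennreal (x powr ((1 - (a + p)) - 1)) * indicator {0<..M} x)"
    proof eventually_elim
      case (elim x)
      let ?v = "w + of_real x * r"
      have ge: "R * \<bar>x - b\<bar> \<le> cmod ?v" unfolding R_def b_def by (rule cmod_add_of_real_mult_ge) fact
      show ?case
      proof (cases "0 < x \<and> cmod ?v \<le> L")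
        case True
        have xb: "0 < \<bar>x - b\<bar>" using elim by simp
        have xM: "\<bar>x - b\<bar> \<le> M" using ge True R by (simp add: M_def field_simps)
        have "0 < R * \<bar>x - b\<bar>" using xb R by simp
        then have v: "0 < cmod ?v" using ge by linarith
        then have v': "?v \<noteq> 0" by force
        have "cmod ?v powr (- p) \<le> (R * \<bar>x - b\<bar>) powr (- p)"
          using ge xb R p by (intro powr_mono2') auto
        also have "\<dots> = R powr (- p) * \<bar>x - b\<bar> powr (- p)" using R by (simp add: powr_mult)
        finally have 1: "cmod ?v powr (- p) \<le> R powr (- p) * \<bar>x - b\<bar> powr (- p)" .
        \<comment> \<open>Whichever of 0 and b is closer to x carries both exponents. If that is 0,
          then x is smaller than its distance to b and hence at most M.\<close>
        have 2: "x powr (- a) * \<bar>x - b\<bar> powr (- p) \<le> \<bar>x - b\<bar> powr (- (a + p)) + (if x \<le> M then x powr (- (a + p)) else 0)"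
        proof (cases "\<bar>x - b\<bar> \<le> x")
          case le: True
          have "x powr (- a) \<le> \<bar>x - b\<bar> powr (- a)" using le xb a_pos by (intro powr_mono2') auto
          then have "x powr (- a) * \<bar>x - b\<bar> powr (- p) \<le> \<bar>x - b\<bar> powr (- a) * \<bar>x - b\<bar> powr (- p)" by (intro mult_right_mono) auto
          also have "\<dots> = \<bar>x - b\<bar> powr (- (a + p))" by (simp add: powr_add[symmetric])
          finally show ?thesis by (simp add: add_increasing2)
        next
          case ge: False
          have "\<bar>x - b\<bar> powr (- p) \<le> x powr (- p)" using ge True p by (intro powr_mono2') auto
          then have "x powr (- a) * \<bar>x - b\<bar> powr (- p) \<le> x powr (- a) * x powr (- p)" by (intro mult_left_mono) auto
          also have "\<dots> = x powr (- (a + p))" by (simp add: powr_add[symmetric])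
          finally have "x powr (- a) * \<bar>x - b\<bar> powr (- p) \<le> x powr (- (a + p))" .
          moreover have "x \<le> M" using ge xM by linarith
          ultimately show ?thesis by (simp add: add_increasing)
        qed
        have "(x * R) * cmod ?v powr (- p) * (a * x powr (- a - 1)) \<le> (x * R) * (R powr (- p) * \<bar>x - b\<bar> powr (- p)) * (a * x powr (- a - 1))"
          using True R a_pos 1 by (intro mult_right_mono mult_left_mono) auto
        also have "\<dots> = a * R powr (1 - p) * (x powr (- a) * \<bar>x - b\<bar> powr (- p))"
        proof -
          have "x * x powr (- a - 1) = x powr (- a)" using True by (simp add: powr_mult_base)
          moreover have "R * R powr (- p) = R powr (1 - p)" using R by (simp add: powr_mult_base)
          moreover have "(x * R) * (R powr (- p) * \<bar>x - b\<bar> powr (- p)) * (a * x powr (- a - 1)) = a * (R * R powr (- p)) * ((x * x powr (- a - 1)) * \<bar>x - b\<bar> powr (- p))"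
            by (simp only: mult_ac)
          ultimately show ?thesis by (simp only:)
        qed
        also have "\<dots> \<le> a * R powr (1 - p) * (\<bar>x - b\<bar> powr (- (a + p)) + (if x \<le> M then x powr (- (a + p)) else 0))"
          using a_pos 2 by (intro mult_left_mono) auto
        finally have 3: "(x * R) * cmod ?v powr (- p) * (a * x powr (- a - 1)) \<le> a * R powr (1 - p) * (\<bar>x - b\<bar> powr (- (a + p)) + (if x \<le> M then x powr (- (a + p)) else 0))" .
        have "ennreal (x * R) * (inv_powr p ?v * indicator {v. cmod v \<le> L} ?v) * ennreal (a * x powr (- a - 1)) * indicator {0<..} x
          = ennreal ((x * R) * cmod ?v powr (- p) * (a * x powr (- a - 1)))"
          using True v' R a_pos by (simp add: inv_powr_nz ennreal_mult)
        also have "\<dots> \<le> ennreal (a * R powr (1 - p) * (\<bar>x - b\<bar> powr (- (a + p)) + (if x \<le> M then x powr (- (a + p)) else 0)))"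
          using 3 by (rule ennreal_leI)
        also have "\<dots> = ennreal (a * R powr (1 - p)) *
          (ennreal (\<bar>x - b\<bar> powr (- (a + p))) * indicator {x. \<bar>x - b\<bar> \<le> M} x + ennreal (x powr ((1 - (a + p)) - 1)) * indicator {0<..M} x)"
          using xM True a_pos by (auto simp: ennreal_mult split: split_indicator)
        finally show ?thesis .
      qed (auto split: split_indicator)
    qed
  qed
  \<comment> \<open>Two sides of b and one side of 0 account for the factor 3 in the
    statement.\<close>
  also have "\<dots> \<le> ennreal (a * R powr (1 - p)) * (ennreal (2 * M powr (1 - (a + p)) / (1 - (a + p))) + ennreal (M powr (1 - (a + p)) / (1 - (a + p))))"
  proof -
    have A: "(\<integral>\<^sup>+x. ennreal (\<bar>x - b\<bar> powr (- (a + p))) * indicator {x. \<bar>x - b\<bar> \<le> M} x \<partial>lborel) \<le> ennreal (2 * M powr (1 - (a + p)) / (1 - (a + p)))"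
      using p M by (intro nn_integral_powr_centered) auto
    have B: "(\<integral>\<^sup>+x. ennreal (x powr ((1 - (a + p)) - 1)) * indicator {0<..M} x \<partial>lborel) = ennreal (M powr (1 - (a + p)) / (1 - (a + p)))"
      using p M by (intro nn_integral_powr_0) auto
    have "(\<integral>\<^sup>+x. ennreal (a * R powr (1 - p)) *
        (ennreal (\<bar>x - b\<bar> powr (- (a + p))) * indicator {x. \<bar>x - b\<bar> \<le> M} x + ennreal (x powr ((1 - (a + p)) - 1)) * indicator {0<..M} x) \<partial>lborel)
      = ennreal (a * R powr (1 - p)) * ((\<integral>\<^sup>+x. ennreal (\<bar>x - b\<bar> powr (- (a + p))) * indicator {x. \<bar>x - b\<bar> \<le> M} x \<partial>lborel)
        + (\<integral>\<^sup>+x. ennreal (x powr ((1 - (a + p)) - 1)) * indicator {0<..M} x \<partial>lborel))"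
      unfolding distrib_left by (rule nn_integral_lincomb2; measurable)
    then show ?thesis unfolding B by (simp only:) (intro mult_left_mono add_mono A order_refl, simp)
  qed
  also have "\<dots> = ennreal (3 * a / (1 - a - p) * L powr (1 - a - p) * R powr a)"
  proof -
    have "R powr (1 - p) * M powr (1 - (a + p)) = L powr (1 - a - p) * R powr a"
    proof -
      have "M powr (1 - (a + p)) = L powr (1 - a - p) / R powr (1 - a - p)" using L R by (simp add: M_def powr_divide diff_diff_add)
      moreover have "R powr (1 - p) = R powr a * R powr (1 - a - p)" by (simp add: powr_add[symmetric])
      ultimately show ?thesis using R by simp
    qed
    then have *: "(R powr (1 - p) * M powr (1 - (a + p))) * (3 * a / (1 - a - p)) = 3 * a / (1 - a - p) * L powr (1 - a - p) * R powr a"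
      by simp
    have "a * R powr (1 - p) * (2 * M powr (1 - (a + p)) / (1 - (a + p)) + M powr (1 - (a + p)) / (1 - (a + p))) = (R powr (1 - p) * M powr (1 - (a + p))) * (3 * a / (1 - a - p))"
      by (simp add: add_divide_distrib[symmetric] diff_diff_eq mult_ac)
    also note *
    finally show ?thesis using p a_pos by (simp add: ennreal_mult[symmetric] ennreal_plus[symmetric] del: ennreal_plus)
  qed
  finally show ?thesis unfolding R_def .
qed simp

text \<open>Together with the density of \<open>nu\<close> the integrand is x powr (\<eta> - 1)
  times the inverse power q = 2 * a + \<eta>. It is integrable at 0 since \<eta> > 0, decays like x
  powr (- 2 * a - 1) at infinity, and has an integrable singularity since q < 1. The right-hand side
  is what homogeneity in w and r dictates.\<close>

lemma inv_powr_weighted_nu_bound: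
  assumes \<eta>: "0 < \<eta>" "2 * a + \<eta> < 1"
  obtains C where "0 < C" "\<And>w r. (\<integral>\<^sup>+x. ennreal (x powr (a + \<eta>)) * inv_powr (2 * a + \<eta>) (w + of_real x * r) \<partial>nu) \<le> ennreal C * (inv_powr (2 * a) w * inv_powr \<eta> r)"
proof -
  define q where "q = 2 * a + \<eta>"
  define C1 where "C1 = a / \<eta> * 2 powr (2 * a)"
  define C2 where "C2 = a * 2 powr (1 - \<eta>) * 2 * 3 powr (1 - q) / (1 - q)"
  define C3 where "C3 = 2 powr \<eta> / 2"
  have C: "0 < C1" "0 < C2" "0 < C3" using a_pos \<eta> by (auto simp: C1_def C2_def C3_def q_def)
  have q: "0 < q" "q < 1" using \<eta> a_pos by (auto simp: q_def)
  have main: "(\<integral>\<^sup>+x. ennreal (x powr (a + \<eta>)) * inv_powr q (w + of_real x * r) \<partial>nu) \<le> ennreal (C1 + C2 + C3) * (inv_powr (2 * a) w * inv_powr \<eta> r)" for w r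
  proof (cases "w = 0 \<or> r = 0")
    case True
    then have "inv_powr (2 * a) w * inv_powr \<eta> r = \<top>" by (auto simp: ennreal_mult_top ennreal_top_mult)
    then show ?thesis using C by (simp add: ennreal_mult_top)
  next
    case False
    define R where "R = cmod r"
    define V where "V = cmod w"
    \<comment> \<open>The scale at which \<open>w\<close> and \<open>x * r\<close> have the same
      modulus. Below m / 2 the first dominates, above 2 * m the second; in between lies the possible
      singularity, at most 3 * m away from x.\<close>
    define m where "m = V / R"
    define b where "b = - Re (w / r)"
    define W where "W = V powr (- 2 * a) * R powr (- \<eta>)"
    have R: "0 < R" and V: "0 < V" using False by (auto simp: R_def V_def)
    have m: "0 < m" using R V by (simp add: m_def)
    have bm: "\<bar>b\<bar> \<le> m"
      unfolding b_def m_def V_def R_def by (simp add: norm_divide[symmetric] abs_Re_le_cmod del: Re_divide)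
    define K1 where "K1 = a * (V / 2) powr (- q)"
    define K2 where "K2 = a * (m / 2) powr (\<eta> - 1) * R powr (- q)"
    define K3 where "K3 = a * (R / 2) powr (- q)"
    have K: "0 \<le> K1" "0 \<le> K2" "0 \<le> K3" using a_pos by (auto simp: K1_def K2_def K3_def)
    let ?f1 = "\<lambda>x. ennreal (x powr (\<eta> - 1)) * indicator {0<..m/2} x"
    let ?f2 = "\<lambda>x. ennreal (\<bar>x - b\<bar> powr (- q)) * indicator {x. \<bar>x - b\<bar> \<le> 3 * m} x"
    let ?f3 = "\<lambda>x. ennreal (x powr (- (2 * a) - 1)) * indicator {2 * m..} x"
    have "(\<integral>\<^sup>+x. ennreal (x powr (a + \<eta>)) * inv_powr q (w + of_real x * r) \<partial>nu)
      = (\<integral>\<^sup>+x. ennreal (x powr (a + \<eta>)) * inv_powr q (w + of_real x * r) * ennreal (a * x powr (- a - 1)) * indicator {0<..} x \<partial>lborel)"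
      by (rule nn_integral_nu) measurable
    also have "\<dots> \<le> (\<integral>\<^sup>+x. ennreal K1 * ?f1 x + (ennreal K2 * ?f2 x + ennreal K3 * ?f3 x) \<partial>lborel)"
    proof (rule nn_integral_mono_AE)
      have "AE x in lborel. x \<noteq> b" by (rule AE_lborel_singleton)
      then show "AE x in lborel. ennreal (x powr (a + \<eta>)) * inv_powr q (w + of_real x * r) * ennreal (a * x powr (- a - 1)) * indicator {0<..} x
        \<le> ennreal K1 * ?f1 x + (ennreal K2 * ?f2 x + ennreal K3 * ?f3 x)"
      proof eventually_elim
        case (elim x)
        let ?v = "w + of_real x * r"
        have ge: "R * \<bar>x - b\<bar> \<le> cmod ?v" unfolding R_def b_def by (rule cmod_add_of_real_mult_ge) (use False in auto)
        show ?case
        proof (cases "0 < x")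
          case x: True
          have xb: "0 < \<bar>x - b\<bar>" using elim by simp
          then have "0 < R * \<bar>x - b\<bar>" using R by simp
          then have v: "0 < cmod ?v" using ge by linarith
          then have v': "?v \<noteq> 0" by force
          have cxr: "cmod (of_real x * r) = x * R" using x by (simp add: norm_mult R_def)
          have e: "x powr (a + \<eta>) * x powr (- a - 1) = x powr (\<eta> - 1)" by (simp add: powr_add[symmetric] algebra_simps)
          have L: "ennreal (x powr (a + \<eta>)) * inv_powr q ?v * ennreal (a * x powr (- a - 1)) * indicator {0<..} x
            = ennreal (a * x powr (\<eta> - 1) * cmod ?v powr (- q))"
            using x v' a_pos by (simp add: inv_powr_nz ennreal_mult[symmetric] e[symmetric] mult_ac)
          consider "x \<le> m / 2" | "2 * m \<le> x" | "m / 2 \<le> x" "x \<le> 2 * m" by linarith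
          then show ?thesis
          proof cases
            case 1
            have "x * R \<le> V / 2" using 1 R by (simp add: m_def field_simps)
            moreover have "V - x * R \<le> cmod ?v" unfolding V_def cxr[symmetric] by (rule norm_diff_ineq)
            ultimately have "V / 2 \<le> cmod ?v" by linarith
            then have "cmod ?v powr (- q) \<le> (V / 2) powr (- q)" using V q by (intro powr_mono2') auto
            then have "a * x powr (\<eta> - 1) * cmod ?v powr (- q) \<le> K1 * x powr (\<eta> - 1)"
              using a_pos by (auto simp: K1_def mult_ac intro!: mult_left_mono)
            then have "ennreal (a * x powr (\<eta> - 1) * cmod ?v powr (- q)) \<le> ennreal K1 * ?f1 x"
              using 1 x K by (simp add: ennreal_mult[symmetric] ennreal_leI)
            then show ?thesis unfolding L by (rule order_trans) simp
          next
            case 2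
            have "2 * V \<le> x * R" using 2 R by (simp add: m_def field_simps)
            moreover have "x * R - V \<le> cmod ?v" unfolding V_def cxr[symmetric] by (metis add.commute norm_diff_ineq)
            ultimately have "x * (R / 2) \<le> cmod ?v" by simp
            then have "cmod ?v powr (- q) \<le> (x * (R / 2)) powr (- q)" using x R q by (intro powr_mono2') auto
            also have "\<dots> = x powr (- q) * (R / 2) powr (- q)" using x R by (simp only: powr_mult)
            finally have "a * x powr (\<eta> - 1) * cmod ?v powr (- q) \<le> a * x powr (\<eta> - 1) * (x powr (- q) * (R / 2) powr (- q))"
              using a_pos by (intro mult_left_mono) auto
            also have "\<dots> = K3 * (x powr (\<eta> - 1) * x powr (- q))" by (simp only: K3_def mult_ac)
            also have "x powr (\<eta> - 1) * x powr (- q) = x powr (- (2 * a) - 1)"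
            proof -
              have "\<eta> - 1 + - q = - (2 * a) - 1" by (simp add: q_def)
              then show ?thesis by (simp only: powr_add[symmetric])
            qed
            finally have "a * x powr (\<eta> - 1) * cmod ?v powr (- q) \<le> K3 * x powr (- (2 * a) - 1)" .
            then have "ennreal (a * x powr (\<eta> - 1) * cmod ?v powr (- q)) \<le> ennreal K3 * ?f3 x"
              using 2 K by (simp add: ennreal_mult[symmetric] ennreal_leI)
            then show ?thesis unfolding L by (rule order_trans) simp
          next
            case 3
            have xbm: "\<bar>x - b\<bar> \<le> 3 * m" using 3 bm x by linarith
            have "cmod ?v powr (- q) \<le> (R * \<bar>x - b\<bar>) powr (- q)" using ge xb R q by (intro powr_mono2') auto
            also have "\<dots> = R powr (- q) * \<bar>x - b\<bar> powr (- q)" using R by (simp add: powr_mult)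
            finally have 1: "cmod ?v powr (- q) \<le> R powr (- q) * \<bar>x - b\<bar> powr (- q)" .
            have "x powr (\<eta> - 1) \<le> (m / 2) powr (\<eta> - 1)" using 3 m \<eta> a_pos by (intro powr_mono2') auto
            then have "a * x powr (\<eta> - 1) * cmod ?v powr (- q) \<le> a * (m / 2) powr (\<eta> - 1) * (R powr (- q) * \<bar>x - b\<bar> powr (- q))"
              using a_pos 1 by (intro mult_mono) auto
            also have "\<dots> = K2 * \<bar>x - b\<bar> powr (- q)" by (simp add: K2_def)
            finally have "ennreal (a * x powr (\<eta> - 1) * cmod ?v powr (- q)) \<le> ennreal K2 * ?f2 x"
              using xbm K by (simp add: ennreal_mult[symmetric] ennreal_leI)
            then show ?thesis unfolding L by (rule order_trans) (simp add: add_increasing)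
          qed
        qed simp
      qed
    qed
    also have "\<dots> \<le> ennreal K1 * ennreal ((m/2) powr \<eta> / \<eta>) + (ennreal K2 * ennreal (2 * (3 * m) powr (1 - q) / (1 - q)) + ennreal K3 * ennreal ((2 * m) powr (- (2 * a)) / (2 * a)))"
    proof -
      have A: "(\<integral>\<^sup>+x. ?f1 x \<partial>lborel) = ennreal ((m/2) powr \<eta> / \<eta>)"
        using m \<eta> by (intro nn_integral_powr_0) auto
      have B: "(\<integral>\<^sup>+x. ?f2 x \<partial>lborel) \<le> ennreal (2 * (3 * m) powr (1 - q) / (1 - q))"
        using m q by (intro nn_integral_powr_centered) auto
      have C: "(\<integral>\<^sup>+x. ?f3 x \<partial>lborel) = ennreal ((2 * m) powr (- (2 * a)) / (2 * a))"
        using m a_pos by (intro nn_integral_powr_inf) auto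
      have "(\<integral>\<^sup>+x. ennreal K1 * ?f1 x + (ennreal K2 * ?f2 x + ennreal K3 * ?f3 x) \<partial>lborel)
        = ennreal K1 * (\<integral>\<^sup>+x. ?f1 x \<partial>lborel) + (ennreal K2 * (\<integral>\<^sup>+x. ?f2 x \<partial>lborel) + ennreal K3 * (\<integral>\<^sup>+x. ?f3 x \<partial>lborel))"
        by (rule nn_integral_lincomb3; measurable)
      then show ?thesis unfolding A C by (simp only:) (intro add_mono mult_left_mono order_refl B, simp)
    qed
    also have "\<dots> = ennreal (K1 * ((m/2) powr \<eta> / \<eta>) + (K2 * (2 * (3 * m) powr (1 - q) / (1 - q)) + K3 * ((2 * m) powr (- (2 * a)) / (2 * a))))"
      using K \<eta> q a_pos by (simp add: ennreal_mult[symmetric] ennreal_plus[symmetric] del: ennreal_plus)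
    also have "K1 * ((m/2) powr \<eta> / \<eta>) + (K2 * (2 * (3 * m) powr (1 - q) / (1 - q)) + K3 * ((2 * m) powr (- (2 * a)) / (2 * a))) = (C1 + C2 + C3) * W"
    proof -
      have "(V / 2) powr (- q) * (m / 2) powr \<eta> = 2 powr (2 * a) * W"
        using R V by (simp add: W_def m_def q_def powr_def ln_div ln_mult mult_exp_exp algebra_simps)
      then have 1: "K1 * ((m/2) powr \<eta> / \<eta>) = C1 * W"
        unfolding K1_def C1_def by (simp add: mult_ac)
      have "(m / 2) powr (\<eta> - 1) * R powr (- q) * (3 * m) powr (1 - q) = 2 powr (1 - \<eta>) * 3 powr (1 - q) * W"
        using R V by (simp add: W_def m_def q_def powr_def ln_div ln_mult mult_exp_exp algebra_simps)
      then have 2: "K2 * (2 * (3 * m) powr (1 - q) / (1 - q)) = C2 * W"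
        unfolding K2_def C2_def by (simp add: mult_ac)
      have "(R / 2) powr (- q) * (2 * m) powr (- (2 * a)) = 2 powr \<eta> * W"
        using R V by (simp add: W_def m_def q_def powr_def ln_div ln_mult mult_exp_exp algebra_simps)
      then have 3: "K3 * ((2 * m) powr (- (2 * a)) / (2 * a)) = C3 * W"
        unfolding K3_def C3_def using a_pos by (simp add: mult_ac)
      show ?thesis unfolding 1 2 3 by (simp add: algebra_simps)
    qed
    also have "ennreal ((C1 + C2 + C3) * W) = ennreal (C1 + C2 + C3) * (inv_powr (2 * a) w * inv_powr \<eta> r)"
      using False C by (simp add: inv_powr_nz ennreal_mult W_def V_def R_def del: ennreal_plus)
    finally show ?thesis .
  qed
  show ?thesis by (rule that[of "C1 + C2 + C3"]) (use C main in \<open>auto simp: q_def\<close>)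
qed

end

section \<open>Weighted Poisson sums\<close>

lemma powr_add_le:
  fixes x y s :: real
  assumes "0 \<le> x" "0 \<le> y" "0 < s" "s \<le> 1"
  shows "(x + y) powr s \<le> x powr s + y powr s"
proof (cases "x + y = 0")
  case False
  then have xy: "0 < x + y" using assms by auto
  have *: "u \<le> u powr s" if "0 \<le> u" "u \<le> 1" for u :: real
    using powr_mono'[of s 1 u] that assms by (cases "u = 0") auto
  have "1 = x / (x + y) + y / (x + y)" using xy by (simp add: add_divide_distrib[symmetric])
  also have "\<dots> \<le> (x / (x + y)) powr s + (y / (x + y)) powr s"
    using assms xy by (intro add_mono *) auto
  also have "\<dots> = (x powr s + y powr s) / (x + y) powr s"
    using assms xy by (simp add: powr_divide add_divide_distrib)
  finally show ?thesis using xy by (simp add: field_simps)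
qed (use assms in auto)

lemma sum_powr_le:
  fixes t :: "nat \<Rightarrow> real"
  assumes "\<And>p. 0 \<le> t p" "0 < s" "s \<le> 1"
  shows "(\<Sum>p<n. t p) powr s \<le> (\<Sum>p<n. t p powr s)"
proof (induction n)
  case (Suc n)
  have "(\<Sum>p<Suc n. t p) powr s \<le> (\<Sum>p<n. t p) powr s + t n powr s"
    using assms by (simp add: powr_add_le sum_nonneg)
  then show ?case using Suc by simp
qed (use assms in auto)

text \<open>For \<eta> < a the expected sum of the powers t powr \<eta> diverges because of the many
  small points, so plain subadditivity is too weak. Above level 1 the power function has slope at
  most 1, so small terms enter linearly; subadditivity is applied to the large ones only. The
  maximum with 1 in the induction keeps the running sum above that level.\<close>

lemma sum_powr_le_min:
  fixes t :: "nat \<Rightarrow> real"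
  assumes t: "\<And>p. 0 \<le> t p" and \<eta>: "0 < \<eta>" "\<eta> < 1"
  shows "(\<Sum>p<n. t p) powr \<eta> \<le> 1 + (\<Sum>p<n. min (t p) (t p powr \<eta>))"
proof -
  have "(max 1 (\<Sum>p<n. t p)) powr \<eta> \<le> 1 + (\<Sum>p<n. min (t p) (t p powr \<eta>))"
  proof (induction n)
    case (Suc n)
    let ?M = "max 1 (\<Sum>p<n. t p)"
    have "(max 1 (\<Sum>p<Suc n. t p)) powr \<eta> \<le> (?M + t n) powr \<eta>"
      using t[of n] \<eta> by (intro powr_mono2) auto
    also have "\<dots> \<le> ?M powr \<eta> + min (t n) (t n powr \<eta>)"
    proof (cases "t n \<le> 1")
      case True
      then have m: "min (t n) (t n powr \<eta>) = t n"
        using powr_mono'[of \<eta> 1 "t n"] t[of n] \<eta> by (cases "t n = 0") auto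
      have "?M + t n = ?M * (1 + t n / ?M)" by (simp add: field_simps)
      then have "(?M + t n) powr \<eta> = ?M powr \<eta> * (1 + t n / ?M) powr \<eta>"
        by (simp only: powr_mult)
      also have "\<dots> \<le> ?M powr \<eta> * (1 + t n / ?M) powr 1"
        using t[of n] \<eta> by (intro mult_left_mono powr_mono) auto
      also have "\<dots> = ?M powr \<eta> + ?M powr (\<eta> - 1) * t n"
        using t[of n] by (simp add: powr_diff field_simps)
      also have "?M powr (\<eta> - 1) * t n \<le> 1 * t n"
      proof (intro mult_right_mono t)
        have "?M powr (\<eta> - 1) \<le> 1 powr (\<eta> - 1)" using \<eta> by (intro powr_mono2') auto
        then show "?M powr (\<eta> - 1) \<le> 1" by simp
      qed
      finally show ?thesis using m by simp
    next
      case False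
      have "t n powr \<eta> \<le> t n powr 1" using False \<eta> by (intro powr_mono) auto
      then have m: "min (t n) (t n powr \<eta>) = t n powr \<eta>" using t[of n] by simp
      show ?thesis unfolding m using t[of n] \<eta> by (intro powr_add_le) auto
    qed
    finally show ?case using Suc by simp
  qed (use \<eta> in auto)
  moreover have "(\<Sum>p<n. t p) powr \<eta> \<le> (max 1 (\<Sum>p<n. t p)) powr \<eta>"
    using t \<eta> by (intro powr_mono2) (auto intro: sum_nonneg)
  ultimately show ?thesis by linarith
qed

text \<open>Passage to the limit in bounds for finite sums. If the sum of \<open>t\<close> diverges,
  \<open>enn2real\<close> returns 0 and the left-hand side vanishes.\<close>

lemma ennreal_powr_suminf_le:
  fixes t g :: "nat \<Rightarrow> real"
  assumes t: "\<And>p. 0 \<le> t p" and g: "\<And>p. 0 \<le> g p" and s: "0 < s" and c: "0 \<le> c"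
    and le: "\<And>n. (\<Sum>p<n. t p) powr s \<le> c + (\<Sum>p<n. g p)"
  shows "ennreal (enn2real (\<Sum>p. ennreal (t p)) powr s) \<le> ennreal c + (\<Sum>p. ennreal (g p))"
proof (cases "(\<Sum>p. ennreal (t p)) = \<top> \<or> (\<Sum>p. ennreal (g p)) = \<top>")
  case False
  have st: "summable t" using t False by (intro summable_suminf_not_top) auto
  have sg: "summable g" using g False by (intro summable_suminf_not_top) auto
  have "(\<lambda>n. (\<Sum>p<n. t p) powr s) \<longlonglongrightarrow> (suminf t) powr s"
    using s t by (intro tendsto_powr' tendsto_const summable_LIMSEQ st) (auto intro!: always_eventually sum_nonneg)
  moreover have "(\<lambda>n. c + (\<Sum>p<n. g p)) \<longlonglongrightarrow> c + suminf g"
    by (intro tendsto_add tendsto_const summable_LIMSEQ sg)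
  ultimately have "(suminf t) powr s \<le> c + suminf g"
    by (rule LIMSEQ_le) (use le in auto)
  moreover have "(\<Sum>p. ennreal (t p)) = ennreal (suminf t)" "(\<Sum>p. ennreal (g p)) = ennreal (suminf g)"
    using st sg t g by (auto intro!: suminf_ennreal2)
  moreover have "0 \<le> suminf t" "0 \<le> suminf g" using st sg t g by (auto intro: suminf_nonneg)
  ultimately show ?thesis using c by (simp add: ennreal_plus[symmetric] ennreal_leI del: ennreal_plus)
qed auto

text \<open>The terms of a convergent series tend to 0, so eventually t p < 1, and there the minimum
  is t p itself.\<close>

lemma suminf_min_powr_finite:
  fixes t :: "nat \<Rightarrow> real"
  assumes t: "\<And>p. 0 \<le> t p" and \<eta>: "0 < \<eta>" "\<eta> < 1"
    and fin: "(\<Sum>p. ennreal (min (t p) (t p powr \<eta>))) \<noteq> \<top>"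
  shows "(\<Sum>p. ennreal (t p)) \<noteq> \<top>"
proof -
  have s: "summable (\<lambda>p. min (t p) (t p powr \<eta>))"
    using t fin by (intro summable_suminf_not_top) auto
  have "(\<lambda>p. min (t p) (t p powr \<eta>)) \<longlonglongrightarrow> 0" by (rule summable_LIMSEQ_zero[OF s])
  then have "eventually (\<lambda>p. min (t p) (t p powr \<eta>) < 1) sequentially" by (rule order_tendstoD) simp
  then have "eventually (\<lambda>p. norm (t p) \<le> min (t p) (t p powr \<eta>)) sequentially"
  proof eventually_elim
    case (elim p)
    have "t p < 1"
    proof (rule ccontr)
      assume "\<not> t p < 1"
      then have "1 \<le> t p" "1 \<le> t p powr \<eta>" using \<eta> by (auto intro: ge_one_powr_ge_zero)
      then show False using elim by simp
    qed
    then have "t p \<le> t p powr \<eta>" using powr_mono'[of \<eta> 1 "t p"] t[of p] \<eta> by (cases "t p = 0") auto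
    then show ?case using t[of p] by simp
  qed
  then have "summable t" by (rule summable_comparison_test_ev[OF _ s])
  then show ?thesis using t by (simp add: suminf_ennreal2)
qed

lemma ennreal_neq_top_mono: "a \<le> b \<Longrightarrow> b \<noteq> \<top> \<Longrightarrow> (a :: ennreal) \<noteq> \<top>"
  by (auto simp: top_unique)

lemma sums_enn2real_diff:
  fixes r :: "nat \<Rightarrow> real"
  assumes "(\<Sum>p. ennreal \<bar>r p\<bar>) \<noteq> \<top>"
  shows "r sums (enn2real (\<Sum>p. ennreal (r p)) - enn2real (\<Sum>p. ennreal (- r p)))"
proof -
  have s: "summable (\<lambda>p. \<bar>r p\<bar>)" using assms by (intro summable_suminf_not_top) auto
  have "summable (\<lambda>p. max 0 (r p))" "summable (\<lambda>p. max 0 (- r p))"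
    by (rule summable_comparison_test'[OF s, of 0]; auto)+
  moreover have "(\<Sum>p. ennreal (r p)) = (\<Sum>p. ennreal (max 0 (r p)))" "(\<Sum>p. ennreal (- r p)) = (\<Sum>p. ennreal (max 0 (- r p)))"
    by (intro arg_cong[where f=suminf] ext; simp add: max_def ennreal_neg)+
  ultimately have "(\<lambda>p. max 0 (r p)) sums enn2real (\<Sum>p. ennreal (r p))" "(\<lambda>p. max 0 (- r p)) sums enn2real (\<Sum>p. ennreal (- r p))"
    by (simp_all only: suminf_ennreal2 max.cobounded1 enn2real_ennreal suminf_nonneg summable_sums)
  from sums_diff[OF this] show ?thesis by (rule sums_cong[THEN iffD1, rotated]) auto
qed

definition real_sum :: "('v \<Rightarrow> real) \<Rightarrow> (nat \<Rightarrow> real) \<times> (nat \<Rightarrow> 'v) \<Rightarrow> ennreal" where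
  "real_sum h \<omega> = (\<Sum>p. if 0 < fst \<omega> p then ennreal (fst \<omega> p * h (snd \<omega> p)) else 0)"

text \<open>Summing positive and negative parts separately makes this total and measurable; it is the sum
  of the series as soon as that converges absolutely.\<close>
definition complex_sum :: "('v \<Rightarrow> complex) \<Rightarrow> (nat \<Rightarrow> real) \<times> (nat \<Rightarrow> 'v) \<Rightarrow> complex" where
  "complex_sum f \<omega> = Complex (enn2real (real_sum (\<lambda>y. Re (f y)) \<omega>) - enn2real (real_sum (\<lambda>y. - Re (f y)) \<omega>))
                     (enn2real (real_sum (\<lambda>y. Im (f y)) \<omega>) - enn2real (real_sum (\<lambda>y. - Im (f y)) \<omega>))"

abbreviation wterm :: "('v \<Rightarrow> complex) \<Rightarrow> (nat \<Rightarrow> real) \<times> (nat \<Rightarrow> 'v) \<Rightarrow> nat \<Rightarrow> complex" where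
  "wterm f \<omega> p \<equiv> (if 0 < fst \<omega> p then of_real (fst \<omega> p) * f (snd \<omega> p) else 0)"

lemma real_sum_mono: "(\<And>y. h y \<le> h' y) \<Longrightarrow> real_sum h \<omega> \<le> real_sum h' \<omega>"
  unfolding real_sum_def by (intro suminf_le) (auto intro!: ennreal_leI mult_left_mono)

lemma real_sum_finite_le: "real_sum h' \<omega> \<noteq> \<top> \<Longrightarrow> (\<And>y. h y \<le> h' y) \<Longrightarrow> real_sum h \<omega> \<noteq> \<top>"
  using real_sum_mono[of h h' \<omega>] by (auto simp: top_unique)

lemma real_sum_eq: "real_sum h \<omega> = (\<Sum>p. ennreal (if 0 < fst \<omega> p then fst \<omega> p * h (snd \<omega> p) else 0))"
  unfolding real_sum_def by (intro arg_cong[where f=suminf] ext) auto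

lemma
  assumes "real_sum (\<lambda>y. cmod (f y)) \<omega> \<noteq> \<top>"
  shows complex_sum_sums: "wterm f \<omega> sums complex_sum f \<omega>" and wterm_norm_summable: "summable (\<lambda>p. norm (wterm f \<omega> p))"
proof -
  have eq: "norm (wterm f \<omega> p) = (if 0 < fst \<omega> p then fst \<omega> p * cmod (f (snd \<omega> p)) else 0)" for p
    by (auto simp: norm_mult)
  have s: "(\<Sum>p. ennreal (norm (wterm f \<omega> p))) \<noteq> \<top>"
    using assms unfolding real_sum_eq by (subst eq)
  then show "summable (\<lambda>p. norm (wterm f \<omega> p))" by (intro summable_suminf_not_top) auto
  have "(\<Sum>p. ennreal \<bar>Re (wterm f \<omega> p)\<bar>) \<noteq> \<top>"
    by (rule ennreal_neq_top_mono[OF _ s], rule suminf_le, rule ennreal_leI, rule abs_Re_le_cmod) (rule summableI)+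
  moreover have "(\<Sum>p. ennreal \<bar>Im (wterm f \<omega> p)\<bar>) \<noteq> \<top>"
    by (rule ennreal_neq_top_mono[OF _ s], rule suminf_le, rule ennreal_leI, rule abs_Im_le_cmod) (rule summableI)+
  ultimately have "(\<Sum>p. ennreal \<bar>Re (wterm f \<omega> p)\<bar>) \<noteq> \<top>" "(\<Sum>p. ennreal \<bar>Im (wterm f \<omega> p)\<bar>) \<noteq> \<top>" .
  from this[THEN sums_enn2real_diff]
  have "(\<lambda>p. Re (wterm f \<omega> p)) sums Re (complex_sum f \<omega>)" "(\<lambda>p. Im (wterm f \<omega> p)) sums Im (complex_sum f \<omega>)"
    by (auto simp: complex_sum_def real_sum_eq if_distrib[of Re] if_distrib[of Im] if_distrib[of uminus] cong: if_cong)
  then show "wterm f \<omega> sums complex_sum f \<omega>" by (simp add: sums_complex_iff)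
qed

lemma cmod_complex_sum_diff_le:
  assumes f: "real_sum (\<lambda>y. cmod (f y)) \<omega> \<noteq> \<top>" and g: "real_sum (\<lambda>y. cmod (g y)) \<omega> \<noteq> \<top>"
    and d: "real_sum (\<lambda>y. cmod (f y - g y)) \<omega> \<noteq> \<top>"
  shows "cmod (complex_sum f \<omega> - complex_sum g \<omega>) \<le> enn2real (real_sum (\<lambda>y. cmod (f y - g y)) \<omega>)"
proof -
  have "(\<lambda>p. wterm f \<omega> p - wterm g \<omega> p) sums (complex_sum f \<omega> - complex_sum g \<omega>)"
    by (intro sums_diff complex_sum_sums f g)
  moreover have "wterm f \<omega> p - wterm g \<omega> p = wterm (\<lambda>y. f y - g y) \<omega> p" for p by (auto simp: algebra_simps)
  ultimately have s: "wterm (\<lambda>y. f y - g y) \<omega> sums (complex_sum f \<omega> - complex_sum g \<omega>)" by simp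
  have n: "summable (\<lambda>p. norm (wterm (\<lambda>y. f y - g y) \<omega> p))" by (rule wterm_norm_summable[OF d])
  have "cmod (complex_sum f \<omega> - complex_sum g \<omega>) \<le> (\<Sum>p. norm (wterm (\<lambda>y. f y - g y) \<omega> p))"
    using summable_norm[OF n] s by (simp add: sums_iff)
  also have "\<dots> = enn2real (\<Sum>p. ennreal (norm (wterm (\<lambda>y. f y - g y) \<omega> p)))"
    using n by (simp add: suminf_ennreal2 suminf_nonneg)
  also have "(\<Sum>p. ennreal (norm (wterm (\<lambda>y. f y - g y) \<omega> p))) = real_sum (\<lambda>y. cmod (f y - g y)) \<omega>"
    unfolding real_sum_def by (intro arg_cong[where f=suminf] ext) (auto simp: norm_mult)
  finally show ?thesis .
qed

context stable_index
begin

lemma measurable_marked_fst: "(\<lambda>\<omega>. fst \<omega> p) \<in> borel_measurable (marked \<rho>)"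
  by (rule measurable_compose[of fst _ "PiM UNIV (\<lambda>_. borel)"]) auto

lemma measurable_marked_snd: "(\<lambda>\<omega>. snd \<omega> p) \<in> marked \<rho> \<rightarrow>\<^sub>M \<rho>"
  by (rule measurable_compose[of snd _ "PiM UNIV (\<lambda>_. \<rho>)"]) auto

lemma real_sum_measurable [measurable]:
  assumes [measurable]: "h \<in> borel_measurable \<rho>"
  shows "real_sum h \<in> borel_measurable (marked \<rho>)"
proof -
  note measurable_marked_fst[measurable] measurable_marked_snd[measurable]
  show ?thesis unfolding real_sum_def by measurable
qed

lemma complex_sum_measurable [measurable]:
  assumes [measurable]: "f \<in> borel_measurable \<rho>"
  shows "complex_sum f \<in> borel_measurable (marked \<rho>)"
  unfolding complex_sum_def by (subst borel_measurable_complex_iff) auto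

text \<open>The case of \<open>Mecke\<close> in which F ignores the configuration.\<close>

lemma Campbell:
  assumes \<rho>: "prob_space \<rho>" and F: "(\<lambda>(x, y). F x y) \<in> borel_measurable (borel \<Otimes>\<^sub>M \<rho>)"
  shows "(\<integral>\<^sup>+\<omega>. (\<Sum>p. if 0 < fst \<omega> p then F (fst \<omega> p) (snd \<omega> p) else 0) \<partial>marked \<rho>) = (\<integral>\<^sup>+y. \<integral>\<^sup>+x. F x y \<partial>nu \<partial>\<rho>)"
proof -
  interpret R: prob_space \<rho> by fact
  interpret N: sigma_finite_measure nu by (rule sigma_finite_nu)
  interpret K: prob_space "marked \<rho>" by (rule prob_space_marked[OF \<rho>])
  interpret NR: pair_sigma_finite nu \<rho> ..
  have [measurable]: "(\<lambda>\<omega>. F (fst \<omega>) (snd \<omega>)) \<in> borel_measurable (borel \<Otimes>\<^sub>M \<rho>)"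
    using F by (simp add: case_prod_beta')
  have F': "(\<lambda>(x, y). F x y) \<in> borel_measurable (nu \<Otimes>\<^sub>M \<rho>)"
    using F by (simp cong: measurable_cong_sets)
  have "(\<integral>\<^sup>+\<omega>. (\<Sum>p. if 0 < fst \<omega> p then F (fst \<omega> p) (snd \<omega> p) else 0) \<partial>marked \<rho>)
    = (\<integral>\<^sup>+x. \<integral>\<^sup>+y. \<integral>\<^sup>+\<omega>. F x y \<partial>marked \<rho> \<partial>\<rho> \<partial>nu)"
    using Mecke[OF \<rho>, of "\<lambda>_ _ _. 0" "\<lambda>x y t. F x y"] by (simp add: case_prod_beta')
  also have "\<dots> = (\<integral>\<^sup>+x. \<integral>\<^sup>+y. F x y \<partial>\<rho> \<partial>nu)" by (simp add: K.emeasure_space_1)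
  also have "\<dots> = (\<integral>\<^sup>+y. \<integral>\<^sup>+x. F x y \<partial>nu \<partial>\<rho>)" by (rule NR.Fubini'[OF F', symmetric])
  finally show ?thesis .
qed

text \<open>The moment of order \<alpha> / 2 from the theorem. It is the natural size of a mark,
  since rescaling the weights by h multiplies \<open>nu\<close> by h powr a.\<close>

definition amom :: "'v measure \<Rightarrow> ('v \<Rightarrow> real) \<Rightarrow> ennreal" where
  "amom \<rho> h = (\<integral>\<^sup>+y. ennreal (h y powr a) \<partial>\<rho>)"

lemma real_sum_min_moment:
  assumes \<rho>: "prob_space \<rho>" and h[measurable]: "h \<in> borel_measurable \<rho>" and h0: "\<And>y. 0 \<le> h y" and \<eta>: "0 < \<eta>" "\<eta> < a"
  shows "(\<integral>\<^sup>+\<omega>. (\<Sum>p. if 0 < fst \<omega> p then ennreal (min (fst \<omega> p * h (snd \<omega> p)) ((fst \<omega> p * h (snd \<omega> p)) powr \<eta>)) else 0) \<partial>marked \<rho>)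
    \<le> ennreal (a / (1 - a) + a / (a - \<eta>)) * amom \<rho> h"
proof -
  have "(\<integral>\<^sup>+\<omega>. (\<Sum>p. if 0 < fst \<omega> p then ennreal (min (fst \<omega> p * h (snd \<omega> p)) ((fst \<omega> p * h (snd \<omega> p)) powr \<eta>)) else 0) \<partial>marked \<rho>)
    = (\<integral>\<^sup>+y. \<integral>\<^sup>+x. ennreal (min (x * h y) ((x * h y) powr \<eta>)) \<partial>nu \<partial>\<rho>)"
    by (rule Campbell[OF \<rho>]) measurable
  also have "\<dots> \<le> (\<integral>\<^sup>+y. ennreal ((a / (1 - a) + a / (a - \<eta>)) * h y powr a) \<partial>\<rho>)"
    by (intro nn_integral_mono powr_nu_bound \<eta> h0)
  also have "\<dots> = ennreal (a / (1 - a) + a / (a - \<eta>)) * amom \<rho> h"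
    using \<eta> a_pos a_less unfolding amom_def by (subst nn_integral_cmult[symmetric]) (auto simp: ennreal_mult)
  finally show ?thesis .
qed

text \<open>The sum itself has infinite mean as soon as large weights matter, so finiteness is
  obtained from the truncated terms of \<open>powr_nu_bound\<close>; a / 2 stands for any exponent
  between 0 and a.\<close>

lemma AE_real_sum_finite:
  assumes \<rho>: "prob_space \<rho>" and h[measurable]: "h \<in> borel_measurable \<rho>" and h0: "\<And>y. 0 \<le> h y" and A: "amom \<rho> h \<noteq> \<top>"
  shows "AE \<omega> in marked \<rho>. real_sum h \<omega> \<noteq> \<top>"
proof -
  note measurable_marked_fst[measurable] measurable_marked_snd[measurable]
  let ?G = "\<lambda>\<omega>. (\<Sum>p. if 0 < fst \<omega> p then ennreal (min (fst \<omega> p * h (snd \<omega> p)) ((fst \<omega> p * h (snd \<omega> p)) powr (a/2))) else 0)"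
  have "(\<integral>\<^sup>+\<omega>. ?G \<omega> \<partial>marked \<rho>) \<le> ennreal (a / (1 - a) + a / (a - a/2)) * amom \<rho> h"
    using a_pos by (intro real_sum_min_moment \<rho> h h0) auto
  also have "\<dots> < \<top>" using A by (simp add: ennreal_mult_less_top less_top)
  finally have "AE \<omega> in marked \<rho>. ?G \<omega> \<noteq> \<infinity>" by (intro nn_integral_PInf_AE) auto
  then show ?thesis
  proof eventually_elim
    case (elim \<omega>)
    define t where "t p = (if 0 < fst \<omega> p then fst \<omega> p * h (snd \<omega> p) else 0)" for p
    have 1: "real_sum h \<omega> = (\<Sum>p. ennreal (t p))" unfolding real_sum_eq t_def ..
    have 2: "?G \<omega> = (\<Sum>p. ennreal (min (t p) (t p powr (a/2))))"
      unfolding t_def by (intro arg_cong[where f=suminf] ext) auto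
    have t: "0 \<le> t p" for p using h0 by (auto simp: t_def)
    have "(\<Sum>p. ennreal (min (t p) (t p powr (a/2)))) \<noteq> \<top>"
      using elim unfolding 2 infinity_ennreal_def .
    then show ?case unfolding 1 by (intro suminf_min_powr_finite[of t "a/2"] t) (use a_pos a_less in auto)
  qed
qed

text \<open>Positive moments of S of order below a become negative moments of the output - 1 / (z +
  S).\<close>

lemma real_sum_powr_moment:
  assumes \<rho>: "prob_space \<rho>" and h[measurable]: "h \<in> borel_measurable \<rho>" and h0: "\<And>y. 0 \<le> h y" and \<eta>: "0 < \<eta>" "\<eta> < a"
  shows "(\<integral>\<^sup>+\<omega>. ennreal (enn2real (real_sum h \<omega>) powr \<eta>) \<partial>marked \<rho>) \<le> 1 + ennreal (a / (1 - a) + a / (a - \<eta>)) * amom \<rho> h"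
proof -
  interpret K: prob_space "marked \<rho>" by (rule prob_space_marked[OF \<rho>])
  note measurable_marked_fst[measurable] measurable_marked_snd[measurable]
  let ?G = "\<lambda>\<omega>. (\<Sum>p. if 0 < fst \<omega> p then ennreal (min (fst \<omega> p * h (snd \<omega> p)) ((fst \<omega> p * h (snd \<omega> p)) powr \<eta>)) else 0)"
  have "(\<integral>\<^sup>+\<omega>. ennreal (enn2real (real_sum h \<omega>) powr \<eta>) \<partial>marked \<rho>) \<le> (\<integral>\<^sup>+\<omega>. ennreal 1 + ?G \<omega> \<partial>marked \<rho>)"
  proof (intro nn_integral_mono)
    fix \<omega> :: "(nat \<Rightarrow> real) \<times> (nat \<Rightarrow> 'a)"
    define t where "t p = (if 0 < fst \<omega> p then fst \<omega> p * h (snd \<omega> p) else 0)" for p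
    have 1: "real_sum h \<omega> = (\<Sum>p. ennreal (t p))" unfolding real_sum_eq t_def ..
    have 2: "?G \<omega> = (\<Sum>p. ennreal (min (t p) (t p powr \<eta>)))"
      unfolding t_def by (intro arg_cong[where f=suminf] ext) auto
    have t: "0 \<le> t p" for p using h0 by (auto simp: t_def)
    show "ennreal (enn2real (real_sum h \<omega>) powr \<eta>) \<le> ennreal 1 + ?G \<omega>"
      unfolding 1 2 using t \<eta> a_less a_pos by (intro ennreal_powr_suminf_le sum_powr_le_min) auto
  qed
  also have "\<dots> = 1 + (\<integral>\<^sup>+\<omega>. ?G \<omega> \<partial>marked \<rho>)"
    by (subst nn_integral_add) (auto simp: K.emeasure_space_1)
  also have "\<dots> \<le> 1 + ennreal (a / (1 - a) + a / (a - \<eta>)) * amom \<rho> h"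
    by (intro add_left_mono real_sum_min_moment \<rho> h h0 \<eta>)
  finally show ?thesis .
qed

text \<open>Adding a point (x, y) adds x * f y to the sum. The integral over x is placed innermost
  so that the one-variable bounds, uniform in the remaining sum, can be inserted.\<close>

theorem Mecke_complex_sum:
  assumes \<rho>: "prob_space \<rho>" and f[measurable]: "f \<in> borel_measurable \<rho>" and A: "amom \<rho> (\<lambda>y. cmod (f y)) \<noteq> \<top>"
    and F: "(\<lambda>((x, y), c). F x y c) \<in> borel_measurable ((borel \<Otimes>\<^sub>M \<rho>) \<Otimes>\<^sub>M borel)"
  shows "(\<integral>\<^sup>+\<omega>. (\<Sum>p. if 0 < fst \<omega> p then F (fst \<omega> p) (snd \<omega> p) (complex_sum f \<omega>) else 0) \<partial>marked \<rho>)
    = (\<integral>\<^sup>+y. \<integral>\<^sup>+\<omega>. \<integral>\<^sup>+x. F x y (complex_sum f \<omega> + of_real x * f y) \<partial>nu \<partial>marked \<rho> \<partial>\<rho>)"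
proof -
  interpret R: prob_space \<rho> by fact
  interpret N: sigma_finite_measure nu by (rule sigma_finite_nu)
  interpret K: prob_space "marked \<rho>" by (rule prob_space_marked[OF \<rho>])
  interpret NR: pair_sigma_finite nu \<rho> ..
  interpret NK: pair_sigma_finite nu "marked \<rho>" ..
  \<comment> \<open>A complex sum is a function of four nonnegative sums, since
    \<open>ennreal\<close> cuts off negative terms; these are the functionals handed to
    \<open>Mecke\<close>.\<close>
  define sel :: "nat \<Rightarrow> complex \<Rightarrow> real" where "sel l c = (if l = 0 then Re c else if l = 1 then - Re c else if l = 2 then Im c else - Im c)" for l c
  define \<phi> where "\<phi> l x y = ennreal (x * sel l (f y))" for l :: nat and x y
  define toC :: "(nat \<Rightarrow> ennreal) \<Rightarrow> complex" where "toC t = Complex (enn2real (t 0) - enn2real (t 1)) (enn2real (t 2) - enn2real (t 3))" for t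
  have [measurable]: "sel l \<in> borel_measurable borel" for l unfolding sel_def by measurable
  have [measurable]: "toC \<in> borel_measurable (PiM UNIV (\<lambda>_. borel))"
    unfolding toC_def by (subst borel_measurable_complex_iff) auto
  have F_meas[measurable (raw)]: "(\<lambda>x. F (e x) (k x) (g x)) \<in> borel_measurable Q"
    if "e \<in> Q \<rightarrow>\<^sub>M borel" "k \<in> Q \<rightarrow>\<^sub>M \<rho>" "g \<in> Q \<rightarrow>\<^sub>M borel" for e k g and Q :: "'q measure"
    using measurable_compose[OF measurable_Pair[OF measurable_Pair[OF that(1,2)] that(3)] F] by simp
  have SCT: "complex_sum f \<omega> = toC (wT \<phi> (fst \<omega>) (snd \<omega>))" for \<omega>
    by (simp add: complex_sum_def toC_def wT_def \<phi>_def sel_def real_sum_def cong: if_cong)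
  have "(\<integral>\<^sup>+\<omega>. (\<Sum>p. if 0 < fst \<omega> p then F (fst \<omega> p) (snd \<omega> p) (complex_sum f \<omega>) else 0) \<partial>marked \<rho>)
    = (\<integral>\<^sup>+x. \<integral>\<^sup>+y. \<integral>\<^sup>+\<omega>. F x y (toC (\<lambda>l. \<phi> l x y + wT \<phi> (fst \<omega>) (snd \<omega>) l)) \<partial>marked \<rho> \<partial>\<rho> \<partial>nu)"
    unfolding SCT using Mecke[OF \<rho>, of \<phi> "\<lambda>x y t. F x y (toC t)"] by (simp add: case_prod_beta' \<phi>_def)
  also have "\<dots> = (\<integral>\<^sup>+x. \<integral>\<^sup>+y. \<integral>\<^sup>+\<omega>. F x y (complex_sum f \<omega> + of_real x * f y) \<partial>marked \<rho> \<partial>\<rho> \<partial>nu)"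
  proof (rule nn_integral_cong, rule nn_integral_cong, rule nn_integral_cong_AE)
    fix x y
    have "AE \<omega> in marked \<rho>. real_sum (\<lambda>y. cmod (f y)) \<omega> \<noteq> \<top>"
      by (rule AE_real_sum_finite[OF \<rho> _ _ A]) auto
    then show "AE \<omega> in marked \<rho>. F x y (toC (\<lambda>l. \<phi> l x y + wT \<phi> (fst \<omega>) (snd \<omega>) l)) = F x y (complex_sum f \<omega> + of_real x * f y)"
    proof eventually_elim
      case (elim \<omega>)
      \<comment> \<open>\<open>enn2real\<close> is additive only for finite arguments, so the new
        point can be split off only where all four sums converge.\<close>
      have fin: "wT \<phi> (fst \<omega>) (snd \<omega>) l \<noteq> \<top>" for l
      proof -
        have "real_sum (\<lambda>y. sel l (f y)) \<omega> \<noteq> \<top>"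
        proof (rule real_sum_finite_le[OF elim])
          fix y show "sel l (f y) \<le> cmod (f y)"
            using abs_Re_le_cmod[of "f y"] abs_Im_le_cmod[of "f y"] by (auto simp: sel_def)
        qed
        then show ?thesis by (simp add: wT_def \<phi>_def real_sum_def cong: if_cong)
      qed
      have "toC (\<lambda>l. \<phi> l x y + wT \<phi> (fst \<omega>) (snd \<omega>) l) = toC (wT \<phi> (fst \<omega>) (snd \<omega>)) + of_real x * f y"
      proof -
        have m: "enn2real (ennreal u) = max 0 u" for u by (cases "0 \<le> u") (auto simp: ennreal_neg)
        have e: "enn2real (\<phi> l x y + wT \<phi> (fst \<omega>) (snd \<omega>) l) = max 0 (x * sel l (f y)) + enn2real (wT \<phi> (fst \<omega>) (snd \<omega>) l)" for l
          using fin[of l] by (simp add: enn2real_plus \<phi>_def less_top m)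
        show ?thesis unfolding toC_def e by (simp add: complex_eq_iff sel_def max_def)
      qed
      then show ?case by (simp add: SCT)
    qed
  qed
  also have "\<dots> = (\<integral>\<^sup>+y. \<integral>\<^sup>+x. \<integral>\<^sup>+\<omega>. F x y (complex_sum f \<omega> + of_real x * f y) \<partial>marked \<rho> \<partial>nu \<partial>\<rho>)"
    by (rule NR.Fubini'[symmetric]) measurable
  also have "\<dots> = (\<integral>\<^sup>+y. \<integral>\<^sup>+\<omega>. \<integral>\<^sup>+x. F x y (complex_sum f \<omega> + of_real x * f y) \<partial>nu \<partial>marked \<rho> \<partial>\<rho>)"
  proof (intro nn_integral_cong)
    fix y assume [measurable]: "y \<in> space \<rho>"
    show "(\<integral>\<^sup>+x. \<integral>\<^sup>+\<omega>. F x y (complex_sum f \<omega> + of_real x * f y) \<partial>marked \<rho> \<partial>nu) = (\<integral>\<^sup>+\<omega>. \<integral>\<^sup>+x. F x y (complex_sum f \<omega> + of_real x * f y) \<partial>nu \<partial>marked \<rho>)"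
      by (rule NK.Fubini'[symmetric]) measurable
  qed
  finally show ?thesis .
qed

section \<open>Moment bounds and the contraction\<close>


text \<open>The marks are abstract and \<open>f\<close> reads a complex number from each. Two
  functions on the same marks thus give two outputs driven by the same weights, which is how
  couplings and successive iterates are compared.\<close>

definition rde_map :: "complex \<Rightarrow> ('v \<Rightarrow> complex) \<Rightarrow> (nat \<Rightarrow> real) \<times> (nat \<Rightarrow> 'v) \<Rightarrow> complex" where
  "rde_map z f \<omega> = - inverse (z + complex_sum f \<omega>)"

lemma rde_map_measurable [measurable]:
  assumes [measurable]: "f \<in> borel_measurable \<rho>" shows "rde_map z f \<in> borel_measurable (marked \<rho>)"
  unfolding rde_map_def by measurable

lemma cmod_complex_sum_le:
  assumes "real_sum (\<lambda>y. cmod (f y)) \<omega> \<noteq> \<top>"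
  shows "cmod (complex_sum f \<omega>) \<le> enn2real (real_sum (\<lambda>y. cmod (f y)) \<omega>)"
proof -
  have "complex_sum (\<lambda>_. 0) \<omega> = 0" by (simp add: complex_sum_def real_sum_def complex_eq_iff cong: if_cong)
  then show ?thesis
    using cmod_complex_sum_diff_le[of f \<omega> "\<lambda>_. 0"] assms by (simp add: real_sum_def cong: if_cong)
qed

text \<open>Where z + S exceeds half of z in modulus the bound is trivial. Elsewhere S has modulus
  at least half that of z, so 2 / Z times the sum of the moduli of its terms is at least 1.
  Inserting this factor creates the sum over points on which the Mecke formula acts, and
  \<open>inv_powr_near_nu_bound\<close> applies with L = Z / 2.\<close>

lemma inverse_moment:
  assumes \<rho>: "prob_space \<rho>" and f[measurable]: "f \<in> borel_measurable \<rho>" and A: "amom \<rho> (\<lambda>y. cmod (f y)) \<noteq> \<top>"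
    and p: "0 < p" "p + a < 1" and z: "z \<noteq> 0"
  shows "(\<integral>\<^sup>+\<omega>. inv_powr p (z + complex_sum f \<omega>) \<partial>marked \<rho>) \<le>
    ennreal ((2 powr p + 6 * a / (1 - a - p)) * cmod z powr (- p)) * (1 + ennreal (cmod z powr (- a)) * amom \<rho> (\<lambda>y. cmod (f y)))"
proof -
  interpret R: prob_space \<rho> by fact
  interpret K: prob_space "marked \<rho>" by (rule prob_space_marked[OF \<rho>])
  note measurable_marked_fst[measurable] measurable_marked_snd[measurable]
  define Z where "Z = cmod z"
  have Z: "0 < Z" using z by (simp add: Z_def)
  define F where "F x y c = ennreal (x * cmod (f y)) * (inv_powr p (z + c) * indicator {v. cmod v \<le> Z / 2} (z + c))" for x y c
  have Fm[measurable]: "(\<lambda>((x, y), c). F x y c) \<in> borel_measurable ((borel \<Otimes>\<^sub>M \<rho>) \<Otimes>\<^sub>M borel)"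
    unfolding F_def case_prod_beta' case_prod_beta by measurable
  have F_meas[measurable (raw)]: "(\<lambda>x. F (e x) (k x) (g x)) \<in> borel_measurable Q"
    if "e \<in> Q \<rightarrow>\<^sub>M borel" "k \<in> Q \<rightarrow>\<^sub>M \<rho>" "g \<in> Q \<rightarrow>\<^sub>M borel" for e k g and Q :: "'q measure"
    using measurable_compose[OF measurable_Pair[OF measurable_Pair[OF that(1,2)] that(3)] Fm] by simp
  let ?S = "\<lambda>\<omega>. (\<Sum>p. if 0 < fst \<omega> p then F (fst \<omega> p) (snd \<omega> p) (complex_sum f \<omega>) else 0)"
  have "(\<integral>\<^sup>+\<omega>. inv_powr p (z + complex_sum f \<omega>) \<partial>marked \<rho>) \<le> (\<integral>\<^sup>+\<omega>. ennreal ((Z / 2) powr (- p)) + ennreal (2 / Z) * ?S \<omega> \<partial>marked \<rho>)"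
  proof (rule nn_integral_mono_AE)
    have "AE \<omega> in marked \<rho>. real_sum (\<lambda>y. cmod (f y)) \<omega> \<noteq> \<top>"
      by (rule AE_real_sum_finite[OF \<rho> _ _ A]) auto
    then show "AE \<omega> in marked \<rho>. inv_powr p (z + complex_sum f \<omega>) \<le> ennreal ((Z / 2) powr (- p)) + ennreal (2 / Z) * ?S \<omega>"
    proof eventually_elim
      case (elim \<omega>)
      show ?case
      proof (cases "cmod (z + complex_sum f \<omega>) \<le> Z / 2")
        case True
        define T where "T = enn2real (real_sum (\<lambda>y. cmod (f y)) \<omega>)"
        have T: "real_sum (\<lambda>y. cmod (f y)) \<omega> = ennreal T" using elim by (simp add: T_def less_top)
        have "Z \<le> cmod (z + complex_sum f \<omega>) + cmod (complex_sum f \<omega>)" unfolding Z_def by (metis norm_triangle_ineq4 add_diff_cancel_right')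
        then have "Z / 2 \<le> T" using True cmod_complex_sum_le[OF elim] unfolding T_def by linarith
        then have "1 \<le> 2 / Z * T" using Z by (simp add: field_simps)
        then have "1 \<le> ennreal (2 / Z * T)" by (simp add: ennreal_leI flip: ennreal_1)
        also have "\<dots> = ennreal (2 / Z) * real_sum (\<lambda>y. cmod (f y)) \<omega>"
          unfolding T by (rule ennreal_mult) (use Z in \<open>auto simp: T_def\<close>)
        finally have 1: "1 \<le> ennreal (2 / Z) * real_sum (\<lambda>y. cmod (f y)) \<omega>" .
        have S: "?S \<omega> = real_sum (\<lambda>y. cmod (f y)) \<omega> * inv_powr p (z + complex_sum f \<omega>)"
          unfolding real_sum_def ennreal_suminf_multc[symmetric] using True
          by (intro arg_cong[where f=suminf] ext) (simp add: F_def)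
        have "inv_powr p (z + complex_sum f \<omega>) = 1 * inv_powr p (z + complex_sum f \<omega>)" by simp
        also have "\<dots> \<le> (ennreal (2 / Z) * real_sum (\<lambda>y. cmod (f y)) \<omega>) * inv_powr p (z + complex_sum f \<omega>)"
          by (intro mult_right_mono 1) simp
        also have "\<dots> = ennreal (2 / Z) * ?S \<omega>" unfolding S by (simp add: mult_ac)
        finally show ?thesis by (simp add: add_increasing)
      next
        case False
        then have "Z / 2 \<le> cmod (z + complex_sum f \<omega>)" by simp
        then have "inv_powr p (z + complex_sum f \<omega>) \<le> inv_powr p (of_real (Z / 2))"
          using Z p by (intro inv_powr_antimono) (auto simp: norm_divide)
        also have "\<dots> = ennreal ((Z / 2) powr (- p))" using Z by (subst inv_powr_nz) (auto simp: norm_divide)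
        finally show ?thesis by (simp add: add_increasing2)
      qed
    qed
  qed
  also have "\<dots> = ennreal ((Z / 2) powr (- p)) + ennreal (2 / Z) * (\<integral>\<^sup>+\<omega>. ?S \<omega> \<partial>marked \<rho>)"
    by (subst nn_integral_add) (auto simp: K.emeasure_space_1 nn_integral_cmult)
  also have "\<dots> \<le> ennreal ((Z / 2) powr (- p)) + ennreal (2 / Z) * (ennreal (3 * a / (1 - a - p) * (Z / 2) powr (1 - a - p)) * amom \<rho> (\<lambda>y. cmod (f y)))"
  proof (intro add_left_mono mult_left_mono)
  have "(\<integral>\<^sup>+\<omega>. ?S \<omega> \<partial>marked \<rho>) = (\<integral>\<^sup>+y. \<integral>\<^sup>+\<omega>. \<integral>\<^sup>+x. F x y (complex_sum f \<omega> + of_real x * f y) \<partial>nu \<partial>marked \<rho> \<partial>\<rho>)"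
    by (rule Mecke_complex_sum[OF \<rho> f A Fm])
  also have "\<dots> \<le> (\<integral>\<^sup>+y. \<integral>\<^sup>+\<omega>. ennreal (3 * a / (1 - a - p) * (Z / 2) powr (1 - a - p) * cmod (f y) powr a) \<partial>marked \<rho> \<partial>\<rho>)"
    unfolding F_def add.assoc[symmetric] using Z by (intro nn_integral_mono inv_powr_near_nu_bound p) auto
  also have "\<dots> = ennreal (3 * a / (1 - a - p) * (Z / 2) powr (1 - a - p)) * amom \<rho> (\<lambda>y. cmod (f y))"
  proof -
    define c where "c = 3 * a / (1 - a - p) * (Z / 2) powr (1 - a - p)"
    have "0 \<le> c" using p a_pos by (simp add: c_def)
    then have "(\<integral>\<^sup>+y. \<integral>\<^sup>+\<omega>. ennreal (c * cmod (f y) powr a) \<partial>marked \<rho> \<partial>\<rho>) = ennreal c * amom \<rho> (\<lambda>y. cmod (f y))"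
      unfolding amom_def by (subst nn_integral_cmult[symmetric]) (auto simp: K.emeasure_space_1 ennreal_mult)
    then show ?thesis unfolding c_def .
  qed
    finally show "(\<integral>\<^sup>+\<omega>. ?S \<omega> \<partial>marked \<rho>) \<le> ennreal (3 * a / (1 - a - p) * (Z / 2) powr (1 - a - p)) * amom \<rho> (\<lambda>y. cmod (f y))" .
  qed simp
  also have "\<dots>
    \<le> ennreal (2 powr p * Z powr (- p)) + ennreal (6 * a / (1 - a - p) * Z powr (- p) * Z powr (- a)) * amom \<rho> (\<lambda>y. cmod (f y))"
  proof (rule add_mono)
    show "ennreal ((Z / 2) powr (- p)) \<le> ennreal (2 powr p * Z powr (- p))"
      using Z by (simp add: powr_divide powr_minus field_simps)
    have e: "2 / Z * (3 * a / (1 - a - p) * (Z / 2) powr (1 - a - p)) \<le> 6 * a / (1 - a - p) * Z powr (- p) * Z powr (- a)"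
    proof -
      have "2 / Z * (Z / 2) powr (1 - a - p) = (Z / 2) powr (- (a + p))"
      proof -
        have "1 - a - p = 1 + - (a + p)" by simp
        then have "(Z / 2) powr (1 - a - p) = (Z / 2) powr 1 * (Z / 2) powr (- (a + p))" by (simp only: powr_add)
        then show ?thesis using Z by (simp add: field_simps)
      qed
      also have "\<dots> = 2 powr (a + p) * Z powr (- (a + p))"
      proof -
        have "(Z / 2) powr (- m) = 2 powr m * Z powr (- m)" for m
          using Z by (simp add: powr_def ln_div mult_exp_exp algebra_simps)
        then show ?thesis .
      qed
      also have "\<dots> = 2 powr (a + p) * (Z powr (- p) * Z powr (- a))"
      proof -
        have "- (a + p) = - p + - a" by simp
        then show ?thesis by (simp only: powr_add)
      qed
      \<comment> \<open>Since a + p < 1, the power of 2 is at most 2; this turns 3 * a into the 6 *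
        a of the statement.\<close>
      also have "\<dots> \<le> 2 powr 1 * (Z powr (- p) * Z powr (- a))"
        using p by (intro mult_right_mono powr_mono) auto
      finally have "3 * a / (1 - a - p) * (2 / Z * (Z / 2) powr (1 - a - p)) \<le> 3 * a / (1 - a - p) * (2 * (Z powr (- p) * Z powr (- a)))"
        using p a_pos by (intro mult_left_mono) auto
      then show ?thesis by (simp add: mult_ac)
    qed
    have "ennreal (2 / Z) * (ennreal (3 * a / (1 - a - p) * (Z / 2) powr (1 - a - p)) * amom \<rho> (\<lambda>y. cmod (f y)))
      = ennreal (2 / Z * (3 * a / (1 - a - p) * (Z / 2) powr (1 - a - p))) * amom \<rho> (\<lambda>y. cmod (f y))"
      using Z p a_pos by (subst ennreal_mult) (auto simp: mult.assoc)
    also have "\<dots> \<le> ennreal (6 * a / (1 - a - p) * Z powr (- p) * Z powr (- a)) * amom \<rho> (\<lambda>y. cmod (f y))"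
      by (intro mult_right_mono ennreal_leI e) simp
    finally show "ennreal (2 / Z) * (ennreal (3 * a / (1 - a - p) * (Z / 2) powr (1 - a - p)) * amom \<rho> (\<lambda>y. cmod (f y))) \<le> \<dots>" .
  qed
  also have "\<dots> \<le> ennreal ((2 powr p + 6 * a / (1 - a - p)) * Z powr (- p)) * (1 + ennreal (Z powr (- a)) * amom \<rho> (\<lambda>y. cmod (f y)))"
  proof -
    define G where "G = 6 * a / (1 - a - p)"
    have G: "0 \<le> G" using p a_pos by (simp add: G_def)
    have 1: "ennreal (2 powr p * Z powr (- p)) \<le> ennreal ((2 powr p + G) * Z powr (- p))"
      using G by (intro ennreal_leI mult_right_mono) auto
    have "G * Z powr (- p) * Z powr (- a) \<le> (2 powr p + G) * Z powr (- p) * Z powr (- a)"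
      by (intro mult_right_mono) auto
    then have "ennreal (G * Z powr (- p) * Z powr (- a)) \<le> ennreal ((2 powr p + G) * Z powr (- p)) * ennreal (Z powr (- a))"
      using G by (simp add: ennreal_mult[symmetric] ennreal_leI)
    from mult_right_mono[OF this zero_le, of "amom \<rho> (\<lambda>y. cmod (f y))"]
    have "ennreal (G * Z powr (- p) * Z powr (- a)) * amom \<rho> (\<lambda>y. cmod (f y)) \<le> ennreal ((2 powr p + G) * Z powr (- p)) * ennreal (Z powr (- a)) * amom \<rho> (\<lambda>y. cmod (f y))" .
    from add_mono[OF 1 this] show ?thesis unfolding G_def[symmetric] distrib_left mult_1_right mult.assoc .
  qed
  finally show ?thesis unfolding Z_def .
qed

text \<open>With \<open>h = \<bar>f - g\<bar>\<close>, the weight \<open>\<bar>f\<bar> powr (- \<eta>)\<close> absorbs the singularity of the inverse: the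
  difference of \<open>1/u\<close> and \<open>1/v\<close>, weighted by \<open>\<bar>u\<bar> powr \<eta>\<close>, is controlled by inverse moments of order
  \<open>2 * a + \<eta>\<close>, which are finite as long as \<open>3 * a + \<eta> < 1\<close>.\<close>
definition weighted_moment :: "real \<Rightarrow> 'v measure \<Rightarrow> ('v \<Rightarrow> real) \<Rightarrow> ('v \<Rightarrow> complex) \<Rightarrow> ennreal" where
  "weighted_moment \<eta> \<rho> h f = (\<integral>\<^sup>+y. ennreal (h y powr (a + \<eta>)) * inv_powr \<eta> (f y) \<partial>\<rho>)"

text \<open>One constant, independent of w, r and z, is fixed so that the threshold for z can be
  expressed through it.\<close>

definition weight_const :: "real \<Rightarrow> real" where
  "weight_const \<eta> = (SOME C. 0 < C \<and> (\<forall>w r. (\<integral>\<^sup>+x. ennreal (x powr (a + \<eta>)) * inv_powr (2 * a + \<eta>) (w + of_real x * r) \<partial>nu) \<le> ennreal C * (inv_powr (2 * a) w * inv_powr \<eta> r)))"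

lemma weight_const:
  assumes "0 < \<eta>" "2 * a + \<eta> < 1"
  shows "0 < weight_const \<eta>" "(\<integral>\<^sup>+x. ennreal (x powr (a + \<eta>)) * inv_powr (2 * a + \<eta>) (w + of_real x * r) \<partial>nu) \<le> ennreal (weight_const \<eta>) * (inv_powr (2 * a) w * inv_powr \<eta> r)"
proof -
  have "\<exists>C. 0 < C \<and> (\<forall>w r. (\<integral>\<^sup>+x. ennreal (x powr (a + \<eta>)) * inv_powr (2 * a + \<eta>) (w + of_real x * r) \<partial>nu) \<le> ennreal C * (inv_powr (2 * a) w * inv_powr \<eta> r))"
    using inv_powr_weighted_nu_bound[OF assms] by metis
  from someI_ex[OF this] show "0 < weight_const \<eta>" "(\<integral>\<^sup>+x. ennreal (x powr (a + \<eta>)) * inv_powr (2 * a + \<eta>) (w + of_real x * r) \<partial>nu) \<le> ennreal (weight_const \<eta>) * (inv_powr (2 * a) w * inv_powr \<eta> r)"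
    unfolding weight_const_def by blast+
qed

text \<open>As a + \<eta> is at most 1, the power of the sum is at most the sum of the powers. The
  Mecke formula removes the point in question from S, and integrating over its weight splits off
  exactly the weight of \<open>weighted_moment\<close> together with an inverse moment of order 2 *
  a of the independent rest.\<close>

lemma weighted_bound:
  assumes \<rho>: "prob_space \<rho>" and f[measurable]: "f \<in> borel_measurable \<rho>" and A: "amom \<rho> (\<lambda>y. cmod (f y)) \<noteq> \<top>"
    and h[measurable]: "h \<in> borel_measurable \<rho>" and h0: "\<And>y. 0 \<le> h y"
    and \<eta>: "0 < \<eta>" "2 * a + \<eta> < 1"
  shows "(\<integral>\<^sup>+\<omega>. ennreal (enn2real (real_sum h \<omega>) powr (a + \<eta>)) * inv_powr (2 * a + \<eta>) (z + complex_sum f \<omega>) \<partial>marked \<rho>)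
    \<le> ennreal (weight_const \<eta>) * (\<integral>\<^sup>+\<omega>. inv_powr (2 * a) (z + complex_sum f \<omega>) \<partial>marked \<rho>) * weighted_moment \<eta> \<rho> h f"
proof -
  interpret R: prob_space \<rho> by fact
  note measurable_marked_fst[measurable] measurable_marked_snd[measurable]
  define F where "F x y c = ennreal (h y powr (a + \<eta>)) * (ennreal (x powr (a + \<eta>)) * inv_powr (2 * a + \<eta>) (z + c))" for x y c
  have Fm[measurable]: "(\<lambda>((x, y), c). F x y c) \<in> borel_measurable ((borel \<Otimes>\<^sub>M \<rho>) \<Otimes>\<^sub>M borel)"
    unfolding F_def case_prod_beta' case_prod_beta by measurable
  have "(\<integral>\<^sup>+\<omega>. ennreal (enn2real (real_sum h \<omega>) powr (a + \<eta>)) * inv_powr (2 * a + \<eta>) (z + complex_sum f \<omega>) \<partial>marked \<rho>)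
     \<le> (\<integral>\<^sup>+\<omega>. (\<Sum>p. if 0 < fst \<omega> p then F (fst \<omega> p) (snd \<omega> p) (complex_sum f \<omega>) else 0) \<partial>marked \<rho>)"
  proof (intro nn_integral_mono)
    fix \<omega> :: "(nat \<Rightarrow> real) \<times> (nat \<Rightarrow> 'a)"
    define t where "t p = (if 0 < fst \<omega> p then fst \<omega> p * h (snd \<omega> p) else 0)" for p
    have t: "0 \<le> t p" for p using h0 by (auto simp: t_def)
    have "ennreal (enn2real (real_sum h \<omega>) powr (a + \<eta>)) \<le> ennreal 0 + (\<Sum>p. ennreal (t p powr (a + \<eta>)))"
      unfolding real_sum_eq t_def[symmetric] using \<eta> a_pos t
      by (intro ennreal_powr_suminf_le) (auto intro!: sum_powr_le)
    then have "ennreal (enn2real (real_sum h \<omega>) powr (a + \<eta>)) * inv_powr (2 * a + \<eta>) (z + complex_sum f \<omega>) \<le> (\<Sum>p. ennreal (t p powr (a + \<eta>))) * inv_powr (2 * a + \<eta>) (z + complex_sum f \<omega>)"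
      by (intro mult_right_mono) auto
    also have "\<dots> = (\<Sum>p. if 0 < fst \<omega> p then F (fst \<omega> p) (snd \<omega> p) (complex_sum f \<omega>) else 0)"
      unfolding ennreal_suminf_multc[symmetric] using h0
      by (intro arg_cong[where f=suminf] ext) (auto simp: F_def t_def powr_mult ennreal_mult mult_ac)
    finally show "ennreal (enn2real (real_sum h \<omega>) powr (a + \<eta>)) * inv_powr (2 * a + \<eta>) (z + complex_sum f \<omega>) \<le> \<dots>" .
  qed
  also have "\<dots> = (\<integral>\<^sup>+y. \<integral>\<^sup>+\<omega>. \<integral>\<^sup>+x. F x y (complex_sum f \<omega> + of_real x * f y) \<partial>nu \<partial>marked \<rho> \<partial>\<rho>)"
    by (rule Mecke_complex_sum[OF \<rho> f A Fm])
  also have "\<dots> \<le> (\<integral>\<^sup>+y. \<integral>\<^sup>+\<omega>. ennreal (h y powr (a + \<eta>)) * (ennreal (weight_const \<eta>) * (inv_powr (2 * a) (z + complex_sum f \<omega>) * inv_powr \<eta> (f y))) \<partial>marked \<rho> \<partial>\<rho>)"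
  proof (intro nn_integral_mono)
    fix y \<omega>
    have "(\<integral>\<^sup>+x. F x y (complex_sum f \<omega> + of_real x * f y) \<partial>nu) = ennreal (h y powr (a + \<eta>)) * (\<integral>\<^sup>+x. ennreal (x powr (a + \<eta>)) * inv_powr (2 * a + \<eta>) ((z + complex_sum f \<omega>) + of_real x * f y) \<partial>nu)"
      unfolding F_def add.assoc by (rule nn_integral_cmult) measurable
    also have "\<dots> \<le> ennreal (h y powr (a + \<eta>)) * (ennreal (weight_const \<eta>) * (inv_powr (2 * a) (z + complex_sum f \<omega>) * inv_powr \<eta> (f y)))"
      by (intro mult_left_mono weight_const \<eta>) simp
    finally show "(\<integral>\<^sup>+x. F x y (complex_sum f \<omega> + of_real x * f y) \<partial>nu) \<le> \<dots>" .
  qed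
  also have "\<dots> = (\<integral>\<^sup>+y. (ennreal (weight_const \<eta>) * (\<integral>\<^sup>+\<omega>. inv_powr (2 * a) (z + complex_sum f \<omega>) \<partial>marked \<rho>)) * (ennreal (h y powr (a + \<eta>)) * inv_powr \<eta> (f y)) \<partial>\<rho>)"
  proof (intro nn_integral_cong)
    fix y
    have "(\<integral>\<^sup>+\<omega>. ennreal (h y powr (a + \<eta>)) * (ennreal (weight_const \<eta>) * (inv_powr (2 * a) (z + complex_sum f \<omega>) * inv_powr \<eta> (f y))) \<partial>marked \<rho>)
      = (\<integral>\<^sup>+\<omega>. (ennreal (h y powr (a + \<eta>)) * ennreal (weight_const \<eta>) * inv_powr \<eta> (f y)) * inv_powr (2 * a) (z + complex_sum f \<omega>) \<partial>marked \<rho>)"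
      by (simp only: mult_ac)
    also have "\<dots> = (ennreal (h y powr (a + \<eta>)) * ennreal (weight_const \<eta>) * inv_powr \<eta> (f y)) * (\<integral>\<^sup>+\<omega>. inv_powr (2 * a) (z + complex_sum f \<omega>) \<partial>marked \<rho>)"
      by (rule nn_integral_cmult) measurable
    finally show "(\<integral>\<^sup>+\<omega>. ennreal (h y powr (a + \<eta>)) * (ennreal (weight_const \<eta>) * (inv_powr (2 * a) (z + complex_sum f \<omega>) * inv_powr \<eta> (f y))) \<partial>marked \<rho>) =
      (ennreal (weight_const \<eta>) * (\<integral>\<^sup>+\<omega>. inv_powr (2 * a) (z + complex_sum f \<omega>) \<partial>marked \<rho>)) * (ennreal (h y powr (a + \<eta>)) * inv_powr \<eta> (f y))"
      by (simp only: mult_ac)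
  qed
  also have "\<dots> = ennreal (weight_const \<eta>) * (\<integral>\<^sup>+\<omega>. inv_powr (2 * a) (z + complex_sum f \<omega>) \<partial>marked \<rho>) * weighted_moment \<eta> \<rho> h f"
    unfolding weighted_moment_def by (rule nn_integral_cmult) measurable
  finally show ?thesis .
qed

text \<open>Split at h = t * cmod f: below, h is small relative to f; above, the weight is at least
  (h / t) powr (- \<eta>) times a bounded power and is traded for powers of h. The parameter t stays
  free, to be sent to 0 after the distance, to decay geometrically along the iterates, or to be set
  to Im z.\<close>

lemma amom_le_weighted_moment:
  assumes [measurable]: "f \<in> borel_measurable \<rho>" "h \<in> borel_measurable \<rho>" and h0: "\<And>y. 0 \<le> h y" and \<eta>: "0 < \<eta>" and t: "0 < t"
  shows "amom \<rho> h \<le> ennreal (t powr a) * amom \<rho> (\<lambda>y. cmod (f y)) + ennreal (t powr (- \<eta>)) * weighted_moment \<eta> \<rho> h f"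
proof -
  have "amom \<rho> h \<le> (\<integral>\<^sup>+y. ennreal (t powr a) * ennreal (cmod (f y) powr a) + ennreal (t powr (- \<eta>)) * (ennreal (h y powr (a + \<eta>)) * inv_powr \<eta> (f y)) \<partial>\<rho>)"
    unfolding amom_def
  proof (intro nn_integral_mono)
    fix y
    show "ennreal (h y powr a) \<le> ennreal (t powr a) * ennreal (cmod (f y) powr a) + ennreal (t powr (- \<eta>)) * (ennreal (h y powr (a + \<eta>)) * inv_powr \<eta> (f y))"
    proof (cases "h y \<le> t * cmod (f y)")
      case True
      have "h y powr a \<le> (t * cmod (f y)) powr a" using True h0 a_pos by (intro powr_mono2) auto
      then have "ennreal (h y powr a) \<le> ennreal (t powr a) * ennreal (cmod (f y) powr a)"
        using t by (simp add: powr_mult ennreal_mult[symmetric] ennreal_leI)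
      then show ?thesis by (rule order_trans) simp
    next
      case False
      have hp: "0 < h y" using False t by (smt (verit) mult_nonneg_nonneg norm_ge_zero)
      show ?thesis
      proof (cases "f y = 0")
        case True
        then show ?thesis using hp t by (simp add: ennreal_mult_top)
      next
        case fy: False
        have "h y powr (- \<eta>) \<le> (t * cmod (f y)) powr (- \<eta>)" using False fy t \<eta> by (intro powr_mono2') auto
        then have "h y powr (a + \<eta>) * h y powr (- \<eta>) \<le> h y powr (a + \<eta>) * (t * cmod (f y)) powr (- \<eta>)" by (intro mult_left_mono) auto
        moreover have "h y powr (a + \<eta>) * h y powr (- \<eta>) = h y powr a" by (simp add: powr_add[symmetric])
        ultimately have "h y powr a \<le> t powr (- \<eta>) * (h y powr (a + \<eta>) * cmod (f y) powr (- \<eta>))"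
          using t by (simp add: powr_mult mult_ac)
        then have "ennreal (h y powr a) \<le> ennreal (t powr (- \<eta>)) * (ennreal (h y powr (a + \<eta>)) * inv_powr \<eta> (f y))"
          using fy by (simp add: inv_powr_nz ennreal_mult[symmetric] ennreal_leI)
        then show ?thesis by (rule order_trans) simp
      qed
    qed
  qed
  also have "\<dots> = ennreal (t powr a) * amom \<rho> (\<lambda>y. cmod (f y)) + ennreal (t powr (- \<eta>)) * weighted_moment \<eta> \<rho> h f"
    unfolding amom_def weighted_moment_def by (rule nn_integral_lincomb2; measurable)
  finally show ?thesis .
qed

lemma amom_rde_map_le: "amom (marked \<rho>) (\<lambda>\<omega>. cmod (rde_map z f \<omega>)) \<le> (\<integral>\<^sup>+\<omega>. inv_powr a (z + complex_sum f \<omega>) \<partial>marked \<rho>)"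
  unfolding amom_def
proof (intro nn_integral_mono)
  fix \<omega> show "ennreal (cmod (rde_map z f \<omega>) powr a) \<le> inv_powr a (z + complex_sum f \<omega>)"
    by (cases "z + complex_sum f \<omega> = 0") (auto simp: rde_map_def inv_powr_nz norm_inverse powr_minus inverse_powr)
qed

lemma AE_denominator_nonzero:
  assumes \<rho>: "prob_space \<rho>" and f[measurable]: "f \<in> borel_measurable \<rho>" and A: "amom \<rho> (\<lambda>y. cmod (f y)) \<noteq> \<top>" and z: "z \<noteq> 0"
  shows "AE \<omega> in marked \<rho>. z + complex_sum f \<omega> \<noteq> 0"
proof -
  have "(\<integral>\<^sup>+\<omega>. inv_powr a (z + complex_sum f \<omega>) \<partial>marked \<rho>) \<le>
    ennreal ((2 powr a + 6 * a / (1 - a - a)) * cmod z powr (- a)) * (1 + ennreal (cmod z powr (- a)) * amom \<rho> (\<lambda>y. cmod (f y)))"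
    using a_pos a_less by (intro inverse_moment assms) auto
  also have "\<dots> < \<top>" using A by (simp add: ennreal_mult_less_top less_top)
  finally have "AE \<omega> in marked \<rho>. inv_powr a (z + complex_sum f \<omega>) \<noteq> \<infinity>" by (intro nn_integral_PInf_AE) auto
  then show ?thesis by eventually_elim auto
qed

text \<open>The inverse of the output is z + S, so negative moments of the output are positive
  moments of S, finite for orders below a.\<close>

lemma negative_moment_rde_map:
  assumes \<rho>: "prob_space \<rho>" and f[measurable]: "f \<in> borel_measurable \<rho>" and A: "amom \<rho> (\<lambda>y. cmod (f y)) \<noteq> \<top>" and z: "z \<noteq> 0"
    and \<eta>: "0 < \<eta>" "\<eta> < a"
  shows "(\<integral>\<^sup>+\<omega>. inv_powr \<eta> (rde_map z f \<omega>) \<partial>marked \<rho>) \<noteq> \<top>"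
proof -
  interpret K: prob_space "marked \<rho>" by (rule prob_space_marked[OF \<rho>])
  have "(\<integral>\<^sup>+\<omega>. inv_powr \<eta> (rde_map z f \<omega>) \<partial>marked \<rho>) \<le> (\<integral>\<^sup>+\<omega>. ennreal (cmod z powr \<eta>) + ennreal (enn2real (real_sum (\<lambda>y. cmod (f y)) \<omega>) powr \<eta>) \<partial>marked \<rho>)"
  proof (rule nn_integral_mono_AE)
    have "AE \<omega> in marked \<rho>. real_sum (\<lambda>y. cmod (f y)) \<omega> \<noteq> \<top>"
      by (rule AE_real_sum_finite[OF \<rho> _ _ A]) auto
    with AE_denominator_nonzero[OF \<rho> f A z]
    show "AE \<omega> in marked \<rho>. inv_powr \<eta> (rde_map z f \<omega>) \<le> ennreal (cmod z powr \<eta>) + ennreal (enn2real (real_sum (\<lambda>y. cmod (f y)) \<omega>) powr \<eta>)"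
    proof eventually_elim
      case (elim \<omega>)
      let ?T = "enn2real (real_sum (\<lambda>y. cmod (f y)) \<omega>)"
      have "inv_powr \<eta> (rde_map z f \<omega>) = ennreal (cmod (z + complex_sum f \<omega>) powr \<eta>)"
        using elim(1) by (subst inv_powr_nz) (auto simp: rde_map_def norm_inverse inverse_powr powr_minus)
      also have "cmod (z + complex_sum f \<omega>) powr \<eta> \<le> (cmod z + ?T) powr \<eta>"
        using \<eta> cmod_complex_sum_le[OF elim(2)] norm_triangle_ineq[of z "complex_sum f \<omega>"] by (intro powr_mono2) auto
      also have "\<dots> \<le> cmod z powr \<eta> + ?T powr \<eta>"
        using \<eta> a_less a_pos by (intro powr_add_le) auto
      finally show ?case by (simp add: ennreal_leI flip: ennreal_plus)
    qed
  qed
  also have "\<dots> = ennreal (cmod z powr \<eta>) + (\<integral>\<^sup>+\<omega>. ennreal (enn2real (real_sum (\<lambda>y. cmod (f y)) \<omega>) powr \<eta>) \<partial>marked \<rho>)"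
    by (subst nn_integral_add) (auto simp: K.emeasure_space_1)
  also have "\<dots> \<le> ennreal (cmod z powr \<eta>) + (1 + ennreal (a / (1 - a) + a / (a - \<eta>)) * amom \<rho> (\<lambda>y. cmod (f y)))"
    by (intro add_left_mono real_sum_powr_moment \<rho> \<eta>) auto
  also have "\<dots> < \<top>" using A by (simp add: ennreal_mult_less_top less_top)
  finally show ?thesis by simp
qed

lemma amom_diff_finite:
  assumes [measurable]: "f \<in> borel_measurable \<rho>" "g \<in> borel_measurable \<rho>" and A: "amom \<rho> (\<lambda>y. cmod (f y)) \<noteq> \<top>" "amom \<rho> (\<lambda>y. cmod (g y)) \<noteq> \<top>"
  shows "amom \<rho> (\<lambda>y. cmod (f y - g y)) \<noteq> \<top>"
proof -
  have "amom \<rho> (\<lambda>y. cmod (f y - g y)) \<le> (\<integral>\<^sup>+y. ennreal (cmod (f y) powr a) + ennreal (cmod (g y) powr a) \<partial>\<rho>)"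
    unfolding amom_def
  proof (intro nn_integral_mono)
    fix y
    have "cmod (f y - g y) powr a \<le> (cmod (f y) + cmod (g y)) powr a"
      using a_pos by (intro powr_mono2 norm_triangle_ineq4) auto
    also have "\<dots> \<le> cmod (f y) powr a + cmod (g y) powr a" using a_pos a_less by (intro powr_add_le) auto
    finally show "ennreal (cmod (f y - g y) powr a) \<le> ennreal (cmod (f y) powr a) + ennreal (cmod (g y) powr a)"
      by (simp add: ennreal_leI flip: ennreal_plus)
  qed
  also have "\<dots> = amom \<rho> (\<lambda>y. cmod (f y)) + amom \<rho> (\<lambda>y. cmod (g y))"
    unfolding amom_def by (rule nn_integral_add) measurable
  finally show ?thesis using A by (auto simp: top_unique)
qed

text \<open>Symmetrised because the difference of the outputs, weighted by either one, is controlled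
  by inverse powers of both denominators, and each denominator reproduces the weight of its own
  input.\<close>

definition weighted_dist :: "real \<Rightarrow> 'v measure \<Rightarrow> ('v \<Rightarrow> complex) \<Rightarrow> ('v \<Rightarrow> complex) \<Rightarrow> ennreal" where
  "weighted_dist \<eta> \<rho> f g = weighted_moment \<eta> \<rho> (\<lambda>y. cmod (f y - g y)) f + weighted_moment \<eta> \<rho> (\<lambda>y. cmod (f y - g y)) g"

text \<open>The difference of reciprocals is (u - v) / (u * v). The weight lowers the exponent of
  the modulus of u from a + \<eta> to a, and the total order 2 * a + \<eta> can then be assigned to
  the smaller of the two moduli.\<close>

lemma contraction_pointwise:
  fixes u v :: complex and H :: real
  assumes uv: "u \<noteq> 0" "v \<noteq> 0" and H: "cmod (u - v) \<le> H" and \<eta>: "0 < \<eta>"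
  shows "ennreal (cmod (- inverse u - - inverse v) powr (a + \<eta>)) * inv_powr \<eta> (- inverse u) \<le> ennreal (H powr (a + \<eta>)) * (inv_powr (2 * a + \<eta>) u + inv_powr (2 * a + \<eta>) v)"
proof -
  let ?U = "cmod u" and ?V = "cmod v"
  have UV: "0 < ?U" "0 < ?V" using uv by auto
  have "- inverse u - - inverse v = (u - v) / (u * v)" using uv by (simp add: field_simps)
  then have "cmod (- inverse u - - inverse v) powr (a + \<eta>) = (cmod (u - v) / (?U * ?V)) powr (a + \<eta>)" by (simp add: norm_divide norm_mult)
  also have "\<dots> \<le> (H / (?U * ?V)) powr (a + \<eta>)" using H UV a_pos \<eta> by (intro powr_mono2 divide_right_mono) auto
  also have "\<dots> = H powr (a + \<eta>) * (?U powr (- (a + \<eta>)) * ?V powr (- (a + \<eta>)))"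
    by (simp only: powr_divide powr_mult powr_minus divide_inverse inverse_mult_distrib inverse_powr norm_ge_zero)
  finally have "cmod (- inverse u - - inverse v) powr (a + \<eta>) * ?U powr \<eta> \<le> H powr (a + \<eta>) * (?U powr (- (a + \<eta>)) * ?V powr (- (a + \<eta>))) * ?U powr \<eta>"
    by (intro mult_right_mono) auto
  also have "\<dots> = H powr (a + \<eta>) * (?U powr (- a) * ?V powr (- (a + \<eta>)))"
    by (simp add: powr_add[symmetric] mult_ac)
  also have "\<dots> \<le> H powr (a + \<eta>) * (?U powr (- (2 * a + \<eta>)) + ?V powr (- (2 * a + \<eta>)))"
  proof (intro mult_left_mono)
    show "?U powr (- a) * ?V powr (- (a + \<eta>)) \<le> ?U powr (- (2 * a + \<eta>)) + ?V powr (- (2 * a + \<eta>))"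
    proof (cases "?U \<le> ?V")
      case True
      have "?V powr (- (a + \<eta>)) \<le> ?U powr (- (a + \<eta>))" using True UV a_pos \<eta> by (intro powr_mono2') auto
      then have "?U powr (- a) * ?V powr (- (a + \<eta>)) \<le> ?U powr (- a) * ?U powr (- (a + \<eta>))" by (intro mult_left_mono) auto
      also have "\<dots> = ?U powr (- (2 * a + \<eta>))" by (simp add: powr_add[symmetric])
      finally show ?thesis by (simp add: add_increasing2)
    next
      case False
      have "?U powr (- a) \<le> ?V powr (- a)" using False UV a_pos \<eta> by (intro powr_mono2') auto
      then have "?U powr (- a) * ?V powr (- (a + \<eta>)) \<le> ?V powr (- a) * ?V powr (- (a + \<eta>))" by (intro mult_right_mono) auto
      also have "\<dots> = ?V powr (- (2 * a + \<eta>))" by (simp add: powr_add[symmetric])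
      finally show ?thesis by (simp add: add_increasing)
    qed
  qed auto
  finally have "cmod (- inverse u - - inverse v) powr (a + \<eta>) * ?U powr \<eta> \<le> H powr (a + \<eta>) * (?U powr (- (2 * a + \<eta>)) + ?V powr (- (2 * a + \<eta>)))" .
  moreover have "inv_powr \<eta> (- inverse u) = ennreal (?U powr \<eta>)" using uv by (subst inv_powr_nz) (auto simp: norm_inverse inverse_powr powr_minus)
  ultimately show ?thesis using uv by (simp add: inv_powr_nz ennreal_mult[symmetric] ennreal_leI flip: ennreal_plus)
qed

text \<open>Each of the two weighted moments of the output is bounded by the sum of the integrals
  for f and g, whence the factor 2. Smallness is carried by B, which decays in the modulus of
  z.\<close>

theorem contraction:
  assumes \<rho>: "prob_space \<rho>" and f[measurable]: "f \<in> borel_measurable \<rho>" and Af: "amom \<rho> (\<lambda>y. cmod (f y)) \<noteq> \<top>"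
    and g[measurable]: "g \<in> borel_measurable \<rho>" and Ag: "amom \<rho> (\<lambda>y. cmod (g y)) \<noteq> \<top>"
    and \<eta>: "0 < \<eta>" "2 * a + \<eta> < 1" and z: "z \<noteq> 0"
    and Bf: "(\<integral>\<^sup>+\<omega>. inv_powr (2 * a) (z + complex_sum f \<omega>) \<partial>marked \<rho>) \<le> B" and Bg: "(\<integral>\<^sup>+\<omega>. inv_powr (2 * a) (z + complex_sum g \<omega>) \<partial>marked \<rho>) \<le> B"
  shows "weighted_dist \<eta> (marked \<rho>) (rde_map z f) (rde_map z g) \<le> 2 * ennreal (weight_const \<eta>) * B * weighted_dist \<eta> \<rho> f g"
proof -
  define h where "h y = cmod (f y - g y)" for y
  have h[measurable]: "h \<in> borel_measurable \<rho>" unfolding h_def by measurable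
  have h0: "0 \<le> h y" for y by (simp add: h_def)
  let ?Q = "\<lambda>k. \<integral>\<^sup>+\<omega>. ennreal (enn2real (real_sum h \<omega>) powr (a + \<eta>)) * inv_powr (2 * a + \<eta>) (z + complex_sum k \<omega>) \<partial>marked \<rho>"
  have Q: "?Q k \<le> ennreal (weight_const \<eta>) * B * weighted_moment \<eta> \<rho> h k"
    if [measurable]: "k \<in> borel_measurable \<rho>" and "amom \<rho> (\<lambda>y. cmod (k y)) \<noteq> \<top>" "(\<integral>\<^sup>+\<omega>. inv_powr (2 * a) (z + complex_sum k \<omega>) \<partial>marked \<rho>) \<le> B" for k
    by (rule order_trans[OF weighted_bound[OF \<rho> that(1,2) h h0 \<eta>]]) (intro mult_right_mono mult_left_mono that, auto)
  have fin: "AE \<omega> in marked \<rho>. z + complex_sum f \<omega> \<noteq> 0 \<and> z + complex_sum g \<omega> \<noteq> 0 \<and> cmod ((z + complex_sum f \<omega>) - (z + complex_sum g \<omega>)) \<le> enn2real (real_sum h \<omega>)"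
  proof -
    have "AE \<omega> in marked \<rho>. real_sum (\<lambda>y. cmod (f y)) \<omega> \<noteq> \<top>"
      by (rule AE_real_sum_finite[OF \<rho> _ _ Af]) auto
    moreover have "AE \<omega> in marked \<rho>. real_sum (\<lambda>y. cmod (g y)) \<omega> \<noteq> \<top>"
      by (rule AE_real_sum_finite[OF \<rho> _ _ Ag]) auto
    moreover have "AE \<omega> in marked \<rho>. real_sum (\<lambda>y. cmod (f y - g y)) \<omega> \<noteq> \<top>"
      by (rule AE_real_sum_finite[OF \<rho> _ _ amom_diff_finite[OF f g Af Ag]]) auto
    moreover note AE_denominator_nonzero[OF \<rho> f Af z] AE_denominator_nonzero[OF \<rho> g Ag z]
    ultimately show ?thesis by eventually_elim (use cmod_complex_sum_diff_le[of f _ g] in \<open>auto simp: h_def[abs_def]\<close>)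
  qed
  have one: "weighted_moment \<eta> (marked \<rho>) (\<lambda>\<omega>. cmod (rde_map z f \<omega> - rde_map z g \<omega>)) (rde_map z f) \<le> ?Q f + ?Q g"
  proof -
    have "weighted_moment \<eta> (marked \<rho>) (\<lambda>\<omega>. cmod (rde_map z f \<omega> - rde_map z g \<omega>)) (rde_map z f) \<le> (\<integral>\<^sup>+\<omega>. ennreal (enn2real (real_sum h \<omega>) powr (a + \<eta>)) * (inv_powr (2 * a + \<eta>) (z + complex_sum f \<omega>) + inv_powr (2 * a + \<eta>) (z + complex_sum g \<omega>)) \<partial>marked \<rho>)"
      unfolding weighted_moment_def
      by (rule nn_integral_mono_AE, use fin in eventually_elim) (unfold rde_map_def, rule contraction_pointwise, use \<eta> in auto)
    also have "\<dots> = ?Q f + ?Q g" unfolding distrib_left by (rule nn_integral_add) measurable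
    finally show ?thesis .
  qed
  have two: "weighted_moment \<eta> (marked \<rho>) (\<lambda>\<omega>. cmod (rde_map z f \<omega> - rde_map z g \<omega>)) (rde_map z g) \<le> ?Q f + ?Q g"
  proof -
    have "weighted_moment \<eta> (marked \<rho>) (\<lambda>\<omega>. cmod (rde_map z f \<omega> - rde_map z g \<omega>)) (rde_map z g) \<le> (\<integral>\<^sup>+\<omega>. ennreal (enn2real (real_sum h \<omega>) powr (a + \<eta>)) * (inv_powr (2 * a + \<eta>) (z + complex_sum g \<omega>) + inv_powr (2 * a + \<eta>) (z + complex_sum f \<omega>)) \<partial>marked \<rho>)"
      unfolding weighted_moment_def
    proof (rule nn_integral_mono_AE, use fin in eventually_elim)
      case (elim \<omega>)
      show ?case unfolding rde_map_def
        by (subst norm_minus_commute, rule contraction_pointwise) (use \<eta> elim in \<open>auto simp: norm_minus_commute\<close>)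
    qed
    also have "\<dots> = ?Q g + ?Q f" unfolding distrib_left by (rule nn_integral_add) measurable
    finally show ?thesis by (simp add: add.commute)
  qed
  have "weighted_dist \<eta> (marked \<rho>) (rde_map z f) (rde_map z g) \<le> (?Q f + ?Q g) + (?Q f + ?Q g)"
    unfolding weighted_dist_def by (intro add_mono one two)
  also have "\<dots> \<le> (ennreal (weight_const \<eta>) * B * weighted_moment \<eta> \<rho> h f + ennreal (weight_const \<eta>) * B * weighted_moment \<eta> \<rho> h g) + (ennreal (weight_const \<eta>) * B * weighted_moment \<eta> \<rho> h f + ennreal (weight_const \<eta>) * B * weighted_moment \<eta> \<rho> h g)"
    by (intro add_mono Q f g Af Ag Bf Bg)
  also have "\<dots> = 2 * ennreal (weight_const \<eta>) * B * weighted_dist \<eta> \<rho> f g"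
    unfolding weighted_dist_def h_def by (simp add: distrib_left distrib_right mult_2 mult.assoc ac_simps)
  finally show ?thesis .
qed

section \<open>Counts in the Poisson process of the weights\<close>


definition active :: "(nat \<Rightarrow> real) \<Rightarrow> real set \<Rightarrow> nat set" where
  "active w A = {p. 0 < w p \<and> w p \<in> A}"

text \<open>Extended-valued, so that infinitely many points differ from none; \<open>card\<close> is
  0 in both cases. It is also a functional of the type accepted by the Mecke formula.\<close>

definition count_sum :: "(nat \<Rightarrow> real set) \<Rightarrow> (nat \<Rightarrow> real) \<Rightarrow> nat \<Rightarrow> ennreal" where
  "count_sum A w l = (\<Sum>p. if 0 < w p then indicator (A l) (w p) else 0)"

lemma count_sum_eq: "count_sum A w l = (if finite (active w (A l)) then of_nat (card (active w (A l))) else \<top>)"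
proof -
  have "count_sum A w l = (\<Sum>p. indicator (active w (A l)) p)"
    unfolding count_sum_def by (intro arg_cong[where f=suminf] ext) (auto simp: active_def split: split_indicator)
  also have "\<dots> = emeasure (count_space UNIV) (active w (A l))"
    by (simp add: nn_integral_count_space_nat[symmetric])
  finally show ?thesis by (auto simp: emeasure_count_space)
qed

lemma measurable_weights_component: "(\<lambda>w. w p) \<in> borel_measurable weights"
  by (subst measurable_cong_sets[OF sets_weights refl]) (rule measurable_component_singleton, simp)

lemma count_sum_measurable [measurable]:
  assumes [measurable]: "A l \<in> sets borel"
  shows "(\<lambda>w. count_sum A w l) \<in> borel_measurable weights"
proof -
  note measurable_weights_component[measurable]
  show ?thesis unfolding count_sum_def by measurable
qed

lemma Mecke_weights:
  fixes \<phi> :: "nat \<Rightarrow> real \<Rightarrow> ennreal" and F :: "real \<Rightarrow> (nat \<Rightarrow> ennreal) \<Rightarrow> ennreal"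
  assumes \<phi>[measurable]: "\<And>l. \<phi> l \<in> borel_measurable borel"
    and F: "(\<lambda>(x, t). F x t) \<in> borel_measurable (borel \<Otimes>\<^sub>M PiM UNIV (\<lambda>_. borel))"
  shows "(\<integral>\<^sup>+w. (\<Sum>p. if 0 < w p then F (w p) (\<lambda>l. \<Sum>p. if 0 < w p then \<phi> l (w p) else 0) else 0) \<partial>weights)
    = (\<integral>\<^sup>+x. \<integral>\<^sup>+w. F x (\<lambda>l. \<phi> l x + (\<Sum>p. if 0 < w p then \<phi> l (w p) else 0)) \<partial>weights \<partial>nu)"
proof -
  interpret u: prob_space unif by (rule prob_space_unif)
  have u1: "emeasure unif UNIV = 1" using u.emeasure_space_1 by simp
  interpret U: prob_space "PiM UNIV (\<lambda>_::nat. unif)" by (intro prob_space_PiM prob_space_unif)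
  interpret W: prob_space weights by (rule prob_space_weights)
  note measurable_weights_component[measurable]
  have F_meas[measurable (raw)]: "(\<lambda>x. F (f x) (g x)) \<in> borel_measurable Q"
    if "f \<in> Q \<rightarrow>\<^sub>M borel" "g \<in> Q \<rightarrow>\<^sub>M PiM UNIV (\<lambda>_. borel)" for f g and Q :: "'q measure"
    using measurable_compose[OF measurable_Pair[OF that] F] by simp
  have T[measurable]: "(\<lambda>w l. \<Sum>p. if 0 < w p then \<phi> l (w p) else 0) \<in> weights \<rightarrow>\<^sub>M PiM UNIV (\<lambda>_. borel)"
    by (rule measurable_PiM_single') auto
  have T'[measurable]: "(\<lambda>w l. \<phi> l x + (\<Sum>p. if 0 < w p then \<phi> l (w p) else 0)) \<in> weights \<rightarrow>\<^sub>M PiM UNIV (\<lambda>_. borel)" for x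
    by (rule measurable_PiM_single') auto
  \<comment> \<open>The mark law \<open>unif\<close> is a dummy; any probability law would integrate
    out in the same way.\<close>
  have e: "(\<integral>\<^sup>+\<omega>. H (fst \<omega>) \<partial>marked unif) = (\<integral>\<^sup>+w. H w \<partial>weights)" if [measurable]: "H \<in> borel_measurable weights" for H
    unfolding marked_def by (subst U.nn_integral_fst[symmetric]) (auto simp: U.emeasure_space_1)
  have "(\<integral>\<^sup>+w. (\<Sum>p. if 0 < w p then F (w p) (\<lambda>l. \<Sum>p. if 0 < w p then \<phi> l (w p) else 0) else 0) \<partial>weights)
    = (\<integral>\<^sup>+(w, Y). (\<Sum>p. if 0 < w p then F (w p) (wT (\<lambda>l x y. \<phi> l x) w Y) else 0) \<partial>marked unif)"
    unfolding wT_def case_prod_beta' by (rule e[symmetric]) measurable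
  also have "\<dots> = (\<integral>\<^sup>+x. \<integral>\<^sup>+y. \<integral>\<^sup>+(w, Y). F x (\<lambda>l. \<phi> l x + wT (\<lambda>l x y. \<phi> l x) w Y l) \<partial>marked unif \<partial>unif \<partial>nu)"
    by (rule Mecke[OF prob_space_unif]) (unfold case_prod_beta' case_prod_beta, measurable)
  also have "\<dots> = (\<integral>\<^sup>+x. \<integral>\<^sup>+y. \<integral>\<^sup>+w. F x (\<lambda>l. \<phi> l x + (\<Sum>p. if 0 < w p then \<phi> l (w p) else 0)) \<partial>weights \<partial>unif \<partial>nu)"
    unfolding wT_def case_prod_beta' by (intro nn_integral_cong e) measurable
  finally show ?thesis by (simp add: u1)
qed

text \<open>This recursion, iterated over \<open>n\<close> and \<open>J\<close>, forces the joint law of the counts to be a product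
  of Poisson laws.\<close>
lemma counts_recursion:
  assumes A[measurable]: "\<And>l. A l \<in> sets borel" and J: "finite J" "i \<notin> J" and disj: "\<And>j. j \<in> J \<Longrightarrow> A j \<inter> A i = {}"
  shows "of_nat (Suc n) * emeasure weights {w. count_sum A w i = of_nat (Suc n) \<and> (\<forall>j\<in>J. count_sum A w j = of_nat (m j))}
    = emeasure nu (A i) * emeasure weights {w. count_sum A w i = of_nat n \<and> (\<forall>j\<in>J. count_sum A w j = of_nat (m j))}"
proof -
  interpret W: prob_space weights by (rule prob_space_weights)
  have E[measurable]: "{w. count_sum A w i = of_nat n \<and> (\<forall>j\<in>J. count_sum A w j = of_nat (m j))} \<in> sets weights" for n
  proof -
    have "{w \<in> space weights. count_sum A w i = of_nat n \<and> (\<forall>j\<in>J. count_sum A w j = of_nat (m j))} \<in> sets weights"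
      using J by measurable
    then show ?thesis by simp
  qed
  define P where "P n t \<longleftrightarrow> t i = of_nat n \<and> (\<forall>j\<in>J. t j = of_nat (m j))" for n and t :: "nat \<Rightarrow> ennreal"
  \<comment> \<open>Summing over the points of A i multiplies the event by its count Suc n. On the
    other side the added point accounts for one of them, so the rest has n, and by disjointness the
    counts for J are unaffected.\<close>
  define F where "F x t = indicator (A i) x * (if P (Suc n) t then 1 else 0 :: ennreal)" for x t
  have Pm[measurable]: "Measurable.pred (PiM UNIV (\<lambda>_. borel)) (P n)" for n
    unfolding P_def using J by measurable
  have count_sum: "count_sum A w = (\<lambda>l. \<Sum>p. if 0 < w p then indicator (A l) (w p) else 0)" for w
    by (auto simp: count_sum_def)
  have "(\<integral>\<^sup>+w. (\<Sum>p. if 0 < w p then F (w p) (count_sum A w) else 0) \<partial>weights)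
    = (\<integral>\<^sup>+x. \<integral>\<^sup>+w. F x (\<lambda>l. indicator (A l) x + count_sum A w l) \<partial>weights \<partial>nu)"
    unfolding count_sum by (rule Mecke_weights) (auto simp: F_def)
  also have "(\<integral>\<^sup>+w. (\<Sum>p. if 0 < w p then F (w p) (count_sum A w) else 0) \<partial>weights)
    = (\<integral>\<^sup>+w. of_nat (Suc n) * indicator {w. P (Suc n) (count_sum A w)} w \<partial>weights)"
  proof (intro nn_integral_cong)
    fix w
    have "(\<Sum>p. if 0 < w p then F (w p) (count_sum A w) else 0) = (\<Sum>p. (if 0 < w p then indicator (A i) (w p) else 0) * (if P (Suc n) (count_sum A w) then 1 else 0 :: ennreal))"
      by (intro arg_cong[where f=suminf] ext) (auto simp: F_def)
    also have "\<dots> = count_sum A w i * (if P (Suc n) (count_sum A w) then 1 else 0)"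
      unfolding count_sum_def by (rule ennreal_suminf_multc)
    also have "\<dots> = of_nat (Suc n) * indicator {w. P (Suc n) (count_sum A w)} w" by (auto simp: P_def)
    finally show "(\<Sum>p. if 0 < w p then F (w p) (count_sum A w) else 0) = \<dots>" .
  qed
  also have "\<dots> = of_nat (Suc n) * emeasure weights {w. P (Suc n) (count_sum A w)}"
    using E[of "Suc n"] unfolding P_def by (intro nn_integral_cmult_indicator)
  also have "(\<integral>\<^sup>+x. \<integral>\<^sup>+w. F x (\<lambda>l. indicator (A l) x + count_sum A w l) \<partial>weights \<partial>nu)
    = (\<integral>\<^sup>+x. \<integral>\<^sup>+w. indicator (A i) x * indicator {w. P n (count_sum A w)} w \<partial>weights \<partial>nu)"
  proof (intro nn_integral_cong)
    fix x w
    show "F x (\<lambda>l. indicator (A l) x + count_sum A w l) = indicator (A i) x * indicator {w. P n (count_sum A w)} w"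
    proof (cases "x \<in> A i")
      case True
      have "(indicator (A j) x :: ennreal) = 0" if "j \<in> J" for j using disj[OF that] True by (auto simp: indicator_def)
      moreover have "1 + count_sum A w i = of_nat (Suc n) \<longleftrightarrow> count_sum A w i = of_nat n"
        by (simp add: ennreal_add_left_cancel)
      ultimately have "P (Suc n) (\<lambda>l. indicator (A l) x + count_sum A w l) \<longleftrightarrow> P n (count_sum A w)"
        using True unfolding P_def by auto
      then show ?thesis using True by (simp add: F_def)
    qed (simp add: F_def)
  qed
  also have "\<dots> = (\<integral>\<^sup>+x. indicator (A i) x * emeasure weights {w. P n (count_sum A w)} \<partial>nu)"
    using E[of n] unfolding P_def by (intro nn_integral_cong nn_integral_cmult_indicator)
  also have "\<dots> = emeasure nu (A i) * emeasure weights {w. P n (count_sum A w)}"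
    by (subst nn_integral_multc) auto
  finally show ?thesis by (simp add: P_def)
qed

lemma emeasure_nu_UNIV: "emeasure nu UNIV = \<top>"
proof -
  interpret u: prob_space unif by (rule prob_space_unif)
  have "emeasure nu UNIV = (\<integral>\<^sup>+x. 1 \<partial>nu)" by simp
  also have "\<dots> = (\<Sum>j::nat. \<integral>\<^sup>+u. 1 \<partial>unif)" by (subst nn_integral_nu_cells) auto
  also have "\<dots> = (\<Sum>j::nat. 1)" by (simp add: u.emeasure_space_1 del: space_unif)
  also have "\<dots> = \<top>" by (subst nn_integral_count_space_nat[symmetric]) (simp add: emeasure_count_space)
  finally show ?thesis .
qed

text \<open>If the total count were n with positive probability, the recursion with
  \<open>nu\<close> of infinite mass would force infinite probability for n + 1.\<close>

lemma AE_infinite_active: "AE w in weights. infinite (active w UNIV)"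
proof -
  interpret W: prob_space weights by (rule prob_space_weights)
  let ?A = "\<lambda>_::nat. UNIV :: real set"
  have z: "emeasure weights {w. count_sum ?A w 0 = of_nat n} = 0" for n
  proof (rule ccontr)
    assume ne: "emeasure weights {w. count_sum ?A w 0 = of_nat n} \<noteq> 0"
    have "of_nat (Suc n) * emeasure weights {w. count_sum ?A w 0 = of_nat (Suc n)} = \<top> * emeasure weights {w. count_sum ?A w 0 = of_nat n}"
      using counts_recursion[of ?A "{}" 0 n] by (simp add: emeasure_nu_UNIV)
    also have "\<dots> = \<top>" using ne by (simp add: ennreal_top_mult)
    finally have "of_nat (Suc n) * emeasure weights {w. count_sum ?A w 0 = of_nat (Suc n)} = \<top>" .
    then show False
      using W.emeasure_finite by (simp add: ennreal_mult_eq_top_iff)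
  qed
  have "AE w in weights. count_sum ?A w 0 \<noteq> of_nat n" for n
  proof -
    have "{w \<in> space weights. count_sum ?A w 0 = of_nat n} \<in> sets weights" by measurable
    then have "{w. count_sum ?A w 0 = of_nat n} \<in> null_sets weights" using z[of n] by (auto simp: null_sets_def)
    from AE_not_in[OF this] show ?thesis by simp
  qed
  then have "AE w in weights. \<forall>n. count_sum ?A w 0 \<noteq> of_nat n" by (simp add: AE_all_countable)
  then show ?thesis by eventually_elim (auto simp: count_sum_eq split: if_splits)
qed

lemma AE_count_sum_finite:
  assumes A[measurable]: "A l \<in> sets borel" and fin: "emeasure nu (A l) \<noteq> \<top>"
  shows "AE w in weights. count_sum A w l \<noteq> \<top>"
proof -
  interpret W: prob_space weights by (rule prob_space_weights)
  have "(\<integral>\<^sup>+w. count_sum A w l \<partial>weights) = (\<integral>\<^sup>+x. \<integral>\<^sup>+w. indicator (A l) x \<partial>weights \<partial>nu)"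
    unfolding count_sum_def using Mecke_weights[of "\<lambda>_ _. 0" "\<lambda>x t. indicator (A l) x"] by simp
  also have "\<dots> = emeasure nu (A l)" by (simp add: W.emeasure_space_1 del: space_weights)
  finally have "AE w in weights. count_sum A w l \<noteq> \<infinity>" using fin by (intro nn_integral_PInf_AE) auto
  then show ?thesis by simp
qed

definition poi :: "real \<Rightarrow> nat \<Rightarrow> real" where "poi r n = r ^ n / fact n * exp (- r)"

text \<open>Solving the recursion in n gives the terms of an exponential series times the
  probability of count 0. Summing over n returns the event for J alone and so identifies that
  probability as exp (- r) times the one for J; induction on J gives the product.\<close>

lemma counts_joint:
  assumes A[measurable]: "\<And>l. A l \<in> sets borel" and J: "finite J" and disj: "disjoint_family_on A J"
    and fin: "\<And>j. j \<in> J \<Longrightarrow> emeasure nu (A j) \<noteq> \<top>"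
  shows "measure weights {w. \<forall>j\<in>J. count_sum A w j = of_nat (m j)} = (\<Prod>j\<in>J. poi (enn2real (emeasure nu (A j))) (m j))"
  using J disj fin
proof (induction J)
  case empty
  interpret W: prob_space weights by (rule prob_space_weights)
  show ?case using W.prob_space by simp
next
  case (insert i J)
  interpret W: prob_space weights by (rule prob_space_weights)
  define r where "r = enn2real (emeasure nu (A i))"
  have r: "emeasure nu (A i) = ennreal r" "0 \<le> r" using insert.prems by (auto simp: r_def less_top)
  define E where "E n = {w. count_sum A w i = of_nat n \<and> (\<forall>j\<in>J. count_sum A w j = of_nat (m j))}" for n :: nat
  define E' where "E' = {w. \<forall>j\<in>J. count_sum A w j = of_nat (m j)}"
  have Em[measurable]: "E n \<in> sets weights" for n
  proof -
    have "{w \<in> space weights. count_sum A w i = of_nat n \<and> (\<forall>j\<in>J. count_sum A w j = of_nat (m j))} \<in> sets weights"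
      using insert by measurable
    then show ?thesis by (simp add: E_def)
  qed
  have Em'[measurable]: "E' \<in> sets weights"
  proof -
    have "{w \<in> space weights. (\<forall>j\<in>J. count_sum A w j = of_nat (m j))} \<in> sets weights"
      using insert by measurable
    then show ?thesis by (simp add: E'_def)
  qed
  have dj: "A j \<inter> A i = {}" if "j \<in> J" for j
    using insert.prems(1) that insert.hyps by (auto simp: disjoint_family_on_def)
  have rec: "real (Suc n) * measure weights (E (Suc n)) = r * measure weights (E n)" for n
  proof -
    have "of_nat (Suc n) * emeasure weights (E (Suc n)) = ennreal r * emeasure weights (E n)"
      unfolding E_def r(1)[symmetric] by (rule counts_recursion) (use insert.hyps dj in auto)
    then have "ennreal (real (Suc n) * measure weights (E (Suc n))) = ennreal (r * measure weights (E n))"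
      using r(2) by (simp add: W.emeasure_eq_measure ennreal_mult ennreal_of_nat_eq_real_of_nat del: of_nat_Suc)
    then show ?thesis using r(2) by (subst (asm) ennreal_inj) (auto simp del: of_nat_Suc)
  qed
  have q: "measure weights (E n) = r ^ n / fact n * measure weights (E 0)" for n
  proof (induction n)
    case (Suc n)
    have "measure weights (E (Suc n)) = r / real (Suc n) * measure weights (E n)"
      using rec[of n] by (simp add: field_simps del: of_nat_Suc)
    then show ?case unfolding Suc by (simp add: fact_Suc del: of_nat_Suc)
  qed simp
  have "(\<lambda>n. measure weights (E n)) sums measure weights (\<Union>n. E n)"
  proof (rule W.finite_measure_UNION)
    show "disjoint_family E" by (auto simp: disjoint_family_on_def E_def)
  qed (use Em in blast)
  moreover have "measure weights (\<Union>n. E n) = measure weights E'"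
  proof (rule W.finite_measure_eq_AE)
    have "AE w in weights. count_sum A w i \<noteq> \<top>" using insert.prems by (intro AE_count_sum_finite) auto
    then show "AE x in weights. (x \<in> (\<Union>n. E n)) = (x \<in> E')"
      by eventually_elim (auto simp: E_def E'_def count_sum_eq split: if_splits)
  qed (use Em Em' in \<open>auto simp del: sets_weights\<close>)
  moreover have "(\<lambda>n. measure weights (E n)) sums (exp r * measure weights (E 0))"
  proof -
    have "(\<lambda>n. measure weights (E n)) = (\<lambda>n. r ^ n / fact n * measure weights (E 0))" by (intro ext q)
    then show ?thesis
      using sums_mult2[OF exp_converges[of r], of "measure weights (E 0)"] by (simp only:) (simp add: divide_inverse mult_ac)
  qed
  ultimately have "measure weights E' = exp r * measure weights (E 0)" by (metis sums_unique2)
  then have "measure weights (E 0) = exp (- r) * measure weights E'" by (simp add: exp_minus field_simps)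
  then have "measure weights (E (m i)) = poi r (m i) * measure weights E'" by (subst q) (simp add: poi_def)
  moreover have "measure weights E' = (\<Prod>j\<in>J. poi (enn2real (emeasure nu (A j))) (m j))"
    unfolding E'_def using insert.prems by (intro insert.IH) (auto simp: disjoint_family_on_def)
  moreover have "{w. \<forall>j\<in>insert i J. count_sum A w j = of_nat (m j)} = E (m i)" by (auto simp: E_def)
  ultimately show ?case using insert.hyps by (simp add: r_def)
qed

end

section \<open>Enumeration by a single sequence\<close>

definition seqcount :: "real set \<Rightarrow> (nat \<Rightarrow> real) \<Rightarrow> nat" where
  "seqcount A x = card {k. x k \<in> A}"

lemma suminf_indicator_eq:
  "(\<Sum>k. indicator A (x k)) = (if finite {k. x k \<in> A} then of_nat (seqcount A x) else (\<top> :: ennreal))"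
proof -
  have "(\<Sum>k. indicator A (x k)) = (\<Sum>k. indicator {k. x k \<in> A} k :: ennreal)"
    by (intro arg_cong[where f=suminf] ext) (auto split: split_indicator)
  also have "\<dots> = emeasure (count_space UNIV) {k. x k \<in> A}"
    by (simp add: nn_integral_count_space_nat[symmetric])
  finally show ?thesis by (auto simp: emeasure_count_space seqcount_def)
qed

text \<open>The count is read off from a measurable extended-valued sum; the case distinction
  reproduces the value 0 of \<open>card\<close> on infinite sets.\<close>

lemma seqcount_measurable [measurable]:
  assumes [measurable]: "A \<in> sets borel"
  shows "seqcount A \<in> PiM UNIV (\<lambda>_. borel) \<rightarrow>\<^sub>M count_space UNIV"
proof -
  let ?T = "\<lambda>x. \<Sum>k. indicator A (x k) :: ennreal"
  have "seqcount A = (\<lambda>x. if ?T x = \<top> then 0 else nat \<lfloor>enn2real (?T x)\<rfloor>)"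
    by (auto simp: suminf_indicator_eq fun_eq_iff seqcount_def)
  then show ?thesis by simp
qed

lemma finite_seq_measurable [measurable]:
  assumes [measurable]: "A \<in> sets borel"
  shows "Measurable.pred (PiM UNIV (\<lambda>_. borel)) (\<lambda>x :: nat \<Rightarrow> real. finite {k. x k \<in> A})"
proof -
  have "finite {k. x k \<in> A} \<longleftrightarrow> (\<Sum>k. indicator A (x k)) \<noteq> (\<top> :: ennreal)" for x :: "nat \<Rightarrow> real"
    unfolding suminf_indicator_eq by simp
  then show ?thesis by (simp only:) measurable
qed

context stable_index
begin

text \<open>The explicit recursion, rather than \<open>enumerate\<close>, is what makes measurability in \<open>w\<close> evident.\<close>
primrec en_least :: "(nat \<Rightarrow> real) \<Rightarrow> nat \<Rightarrow> nat" where
  "en_least w 0 = (LEAST n. 0 < w n)"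
| "en_least w (Suc k) = (LEAST n. 0 < w n \<and> en_least w k < n)"

text \<open>The fallback on the null event of finitely many points makes \<open>en w\<close>
  injective for every w, so that reindexing i.i.d. marks along it works without exceptions.\<close>

definition en :: "(nat \<Rightarrow> real) \<Rightarrow> nat \<Rightarrow> nat" where
  "en w k = (if infinite (active w UNIV) then en_least w k else k)"

definition xi :: "(nat \<Rightarrow> real) \<Rightarrow> nat \<Rightarrow> real" where "xi w k = w (en w k)"

lemma en_eq_enumerate: "infinite (active w UNIV) \<Longrightarrow> en w k = enumerate (active w UNIV) k"
proof -
  assume inf: "infinite (active w UNIV)"
  have "en_least w k = enumerate (active w UNIV) k"
  proof -
    have mem: "p \<in> active w UNIV \<longleftrightarrow> 0 < w p" for p by (simp add: active_def)
    show ?thesis by (induction k) (simp_all add: enumerate_0 enumerate_Suc''[OF inf] mem)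
  qed
  then show ?thesis using inf by (simp add: en_def)
qed

lemma inj_en: "inj (en w)"
proof (cases "infinite (active w UNIV)")
  case True
  then have "en w = enumerate (active w UNIV)" by (auto simp: en_eq_enumerate)
  then show ?thesis using True by (simp add: inj_enumerate)
qed (auto simp: en_def inj_on_def)

lemma range_en:
  assumes "infinite (active w UNIV)" shows "range (en w) = active w UNIV"
proof -
  have "en w = enumerate (active w UNIV)" using assms by (simp add: en_eq_enumerate fun_eq_iff)
  then show ?thesis using assms by (simp add: range_enumerate)
qed

lemma measurable_en [measurable]: "(\<lambda>w. en w k) \<in> weights \<rightarrow>\<^sub>M count_space UNIV"
proof -
  note measurable_weights_component[measurable]
  have 1: "(\<lambda>w. en_least w k) \<in> weights \<rightarrow>\<^sub>M count_space UNIV"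
    by (induction k) (simp_all, measurable)
  have "infinite (active w UNIV) \<longleftrightarrow> (\<forall>m. \<exists>n. m \<le> n \<and> 0 < w n)" for w
    by (simp add: infinite_nat_iff_unbounded_le active_def)
  then show ?thesis unfolding en_def using 1 by simp
qed

lemma measurable_xi [measurable]: "xi \<in> weights \<rightarrow>\<^sub>M PiM UNIV (\<lambda>_. borel)"
proof (rule measurable_PiM_single')
  fix k show "(\<lambda>w. xi w k) \<in> borel_measurable weights"
    unfolding xi_def by (rule measurable_compose_countable[OF measurable_weights_component]) measurable
qed auto

definition Xi :: "(nat \<Rightarrow> real) measure" where "Xi = distr weights (PiM UNIV (\<lambda>_. borel)) xi"

lemma sets_Xi [simp, measurable_cong]: "sets Xi = sets (PiM UNIV (\<lambda>_. borel))" and space_Xi [simp]: "space Xi = UNIV"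
  by (auto simp: Xi_def space_PiM)

lemma prob_space_Xi: "prob_space Xi"
  unfolding Xi_def by (rule prob_space.prob_space_distr[OF prob_space_weights]) measurable

lemma seqcount_xi:
  assumes inf: "infinite (active w UNIV)"
  shows "finite {k. xi w k \<in> A} \<longleftrightarrow> finite (active w A)" "seqcount A (xi w) = card (active w A)"
proof -
  have "en w ` {k. xi w k \<in> A} = active w A"
  proof (intro subset_antisym subsetI)
    fix p assume "p \<in> active w A"
    then have "p \<in> range (en w)" using range_en[OF inf] by (auto simp: active_def)
    then obtain k where "p = en w k" by auto
    with \<open>p \<in> active w A\<close> show "p \<in> en w ` {k. xi w k \<in> A}" by (auto simp: xi_def active_def)
  next
    fix p assume "p \<in> en w ` {k. xi w k \<in> A}"
    then obtain k where k: "p = en w k" "w p \<in> A" by (auto simp: xi_def)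
    have "p \<in> active w UNIV" unfolding k(1) range_en[OF inf, symmetric] by simp
    with k show "p \<in> active w A" by (auto simp: active_def)
  qed
  then have b: "bij_betw (en w) {k. xi w k \<in> A} (active w A)"
    using inj_en by (auto simp: bij_betw_def intro: inj_on_subset)
  show "finite {k. xi w k \<in> A} \<longleftrightarrow> finite (active w A)" by (rule bij_betw_finite[OF b])
  show "seqcount A (xi w) = card (active w A)" unfolding seqcount_def by (rule bij_betw_same_card[OF b])
qed

lemma Xi_finite:
  assumes A[measurable]: "A \<in> sets borel" and fin: "emeasure nu A \<noteq> \<top>"
  shows "AE x in Xi. finite {k. x k \<in> A}"
proof -
  have "AE w in weights. count_sum (\<lambda>_. A) w 0 \<noteq> \<top>" using fin by (intro AE_count_sum_finite) auto
  with AE_infinite_active have "AE w in weights. finite {k. xi w k \<in> A}"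
    by eventually_elim (auto simp: count_sum_eq seqcount_xi split: if_splits)
  then show ?thesis unfolding Xi_def by (subst AE_distr_iff) auto
qed

lemma Xi_joint:
  fixes J :: "nat set"
  assumes A: "\<And>j. j \<in> J \<Longrightarrow> A j \<in> sets borel" and J: "finite J" and disj: "disjoint_family_on A J"
    and fin: "\<And>j. j \<in> J \<Longrightarrow> emeasure nu (A j) \<noteq> \<top>"
  shows "measure Xi {x. \<forall>j\<in>J. seqcount (A j) x = m j} = (\<Prod>j\<in>J. poi (enn2real (emeasure nu (A j))) (m j))"
proof -
  interpret W: prob_space weights by (rule prob_space_weights)
  define A' where "A' j = (if j \<in> J then A j else {})" for j
  have A'[measurable]: "A' j \<in> sets borel" for j using A by (auto simp: A'_def)
  have m: "{x. \<forall>j\<in>J. seqcount (A' j) x = m j} \<in> sets (PiM UNIV (\<lambda>_. borel))"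
  proof -
    have "{x \<in> space (PiM UNIV (\<lambda>_. borel)). \<forall>j\<in>J. seqcount (A' j) x = m j} \<in> sets (PiM UNIV (\<lambda>_. borel))"
      using J by measurable
    then show ?thesis by (simp add: space_PiM)
  qed
  have m2: "{w. \<forall>j\<in>J. count_sum A' w j = of_nat (m j)} \<in> sets weights"
  proof -
    have "{w \<in> space weights. \<forall>j\<in>J. count_sum A' w j = of_nat (m j)} \<in> sets weights"
      using J by measurable
    then show ?thesis by simp
  qed
  have "measure Xi {x. \<forall>j\<in>J. seqcount (A j) x = m j} = measure Xi {x. \<forall>j\<in>J. seqcount (A' j) x = m j}"
    by (intro arg_cong[where f="measure Xi"]) (auto simp: A'_def)
  also have "\<dots> = measure weights (xi -` {x. \<forall>j\<in>J. seqcount (A' j) x = m j} \<inter> space weights)"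
    unfolding Xi_def using m by (intro measure_distr) auto
  also have "\<dots> = measure weights {w. \<forall>j\<in>J. count_sum A' w j = of_nat (m j)}"
  proof (rule W.finite_measure_eq_AE)
    have "AE w in weights. \<forall>j\<in>J. count_sum A' w j \<noteq> \<top>"
      using J fin A by (intro AE_finite_allI AE_count_sum_finite) (auto simp: A'_def)
    with AE_infinite_active
    show "AE w in weights. (w \<in> xi -` {x. \<forall>j\<in>J. seqcount (A' j) x = m j} \<inter> space weights) = (w \<in> {w. \<forall>j\<in>J. count_sum A' w j = of_nat (m j)})"
      by eventually_elim (auto simp: seqcount_xi count_sum_eq split: if_splits)
  qed (use m m2 measurable_sets[OF measurable_xi m] in auto)
  also have "\<dots> = (\<Prod>j\<in>J. poi (enn2real (emeasure nu (A' j))) (m j))"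
    using J disj fin A by (intro counts_joint) (auto simp: A'_def disjoint_family_on_def)
  also have "\<dots> = (\<Prod>j\<in>J. poi (enn2real (emeasure nu (A j))) (m j))"
    by (intro prod.cong) (auto simp: A'_def)
  finally show ?thesis .
qed

text \<open>Singletons generate all sets of natural numbers; adding \<open>{}\<close> and
  \<open>UNIV\<close> makes the generator closed under intersection. Coordinates with value
  \<open>UNIV\<close> drop out of the event, which is why the product formula is asked for every
  subfamily J.\<close>

lemma indep_vars_countI:
  fixes X :: "'i \<Rightarrow> 'a \<Rightarrow> nat"
  assumes M: "prob_space M" and I: "finite I" and rv: "\<And>i. i \<in> I \<Longrightarrow> X i \<in> M \<rightarrow>\<^sub>M count_space UNIV"
    and joint: "\<And>J m. J \<subseteq> I \<Longrightarrow> measure M {\<omega>\<in>space M. \<forall>j\<in>J. X j \<omega> = m j} = (\<Prod>j\<in>J. measure M {\<omega>\<in>space M. X j \<omega> = m j})"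
  shows "prob_space.indep_vars M (\<lambda>_. count_space UNIV) X I"
proof (cases "I = {}")
  case True
  interpret prob_space M by fact
  show ?thesis unfolding True indep_vars_def indep_sets_def by auto
next
  case False
  interpret prob_space M by fact
  let ?E = "insert {} (insert UNIV (range (\<lambda>n. {n::nat})))"
  have sig: "sigma_sets UNIV ?E = (UNIV :: nat set set)"
  proof -
    have "B \<in> sigma_sets UNIV ?E" for B :: "nat set"
    proof -
      have "(\<Union>n\<in>B. {n}) \<in> sigma_sets UNIV ?E"
        by (rule sigma_sets_UNION) auto
      then show ?thesis by simp
    qed
    then show ?thesis by auto
  qed
  show ?thesis
  proof (subst indep_vars_finite[OF False I, where E="\<lambda>_. ?E"])
    show "\<forall>A\<in>I \<rightarrow> ?E. prob (\<Inter>j\<in>I. X j -` A j \<inter> space M) = (\<Prod>j\<in>I. prob (X j -` A j \<inter> space M))"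
    proof
      fix A assume A: "A \<in> I \<rightarrow> ?E"
      show "prob (\<Inter>j\<in>I. X j -` A j \<inter> space M) = (\<Prod>j\<in>I. prob (X j -` A j \<inter> space M))"
      proof (cases "\<exists>j\<in>I. A j = {}")
        case True
        then obtain j where j: "j \<in> I" "A j = {}" by auto
        then have "(\<Inter>j\<in>I. X j -` A j \<inter> space M) = {}" by auto
        moreover have "(\<Prod>j\<in>I. prob (X j -` A j \<inter> space M)) = 0"
          by (rule prod_zero[OF I], rule bexI[OF _ j(1)]) (simp add: j(2))
        ultimately show ?thesis by simp
      next
        case ne: False
        define J where "J = {j\<in>I. A j \<noteq> UNIV}"
        have JI: "J \<subseteq> I" by (auto simp: J_def)
        have "\<exists>n. A j = {n}" if "j \<in> J" for j using that A ne by (auto simp: J_def Pi_iff)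
        then obtain m where m: "\<And>j. j \<in> J \<Longrightarrow> A j = {m j}" by metis
        have "(\<Inter>j\<in>I. X j -` A j \<inter> space M) = {\<omega>\<in>space M. \<forall>j\<in>J. X j \<omega> = m j}"
        proof (intro set_eqI iffI)
          fix \<omega> assume *: "\<omega> \<in> (\<Inter>j\<in>I. X j -` A j \<inter> space M)"
          then have "\<omega> \<in> space M" using False by auto
          moreover have "X j \<omega> = m j" if "j \<in> J" for j
          proof -
            have "X j \<omega> \<in> A j" using INT_D[OF *, of j] that JI by auto
            then show ?thesis using m[OF that] by simp
          qed
          ultimately show "\<omega> \<in> {\<omega>\<in>space M. \<forall>j\<in>J. X j \<omega> = m j}" by auto
        next
          fix \<omega> assume *: "\<omega> \<in> {\<omega>\<in>space M. \<forall>j\<in>J. X j \<omega> = m j}"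
          have "X j \<omega> \<in> A j" if "j \<in> I" for j
          proof (cases "j \<in> J")
            case True then show ?thesis using m[OF True] * by simp
          qed (use that in \<open>auto simp: J_def\<close>)
          then show "\<omega> \<in> (\<Inter>j\<in>I. X j -` A j \<inter> space M)" using * by auto
        qed
        then have "prob (\<Inter>j\<in>I. X j -` A j \<inter> space M) = (\<Prod>j\<in>J. prob {\<omega>\<in>space M. X j \<omega> = m j})"
          using joint[OF JI] by simp
        also have "\<dots> = (\<Prod>j\<in>J. prob (X j -` A j \<inter> space M))"
          using m by (intro prod.cong refl arg_cong[where f=prob]) auto
        also have "\<dots> = (\<Prod>j\<in>I. prob (X j -` A j \<inter> space M))"
          using I JI by (intro prod.mono_neutral_left) (auto simp: J_def prob_space)
        finally show ?thesis .
      qed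
    qed
  qed (use rv in \<open>auto simp: sig Int_stable_def\<close>)
qed

text \<open>Every clause of the definition concerns counts of the sequence and therefore depends on
  its law only; \<open>Xi_finite\<close> and \<open>Xi_joint\<close> provide them for
  \<open>Xi\<close>.\<close>

lemma poisson_point_process_of_law:
  assumes M: "prob_space M" and \<xi>: "\<xi> \<in> M \<rightarrow>\<^sub>M PiM UNIV (\<lambda>_. borel)" and law: "distr M (PiM UNIV (\<lambda>_. borel)) \<xi> = Xi"
  shows "poisson_point_process M nu \<xi>"
proof -
  interpret prob_space M by fact
  have comp: "(\<lambda>\<omega>. \<xi> \<omega> k) \<in> borel_measurable M" for k
    using measurable_compose[OF \<xi> measurable_component_singleton[of k UNIV]] by simp
  have cnt: "(\<lambda>\<omega>. seqcount A (\<xi> \<omega>)) \<in> M \<rightarrow>\<^sub>M count_space UNIV" if "A \<in> sets borel" for A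
    using measurable_compose[OF \<xi> seqcount_measurable[OF that]] .
  have joint: "measure M {\<omega>\<in>space M. \<forall>j\<in>J. seqcount (A j) (\<xi> \<omega>) = m j} = (\<Prod>j\<in>J. poi (enn2real (emeasure nu (A j))) (m j))"
    if A: "\<And>j. j \<in> J \<Longrightarrow> A j \<in> sets borel" and J: "finite J" and disj: "disjoint_family_on A J"
      and fin: "\<And>j. j \<in> J \<Longrightarrow> emeasure nu (A j) \<noteq> \<top>" for A and J :: "nat set" and m
  proof -
    have meas: "{x. \<forall>j\<in>J. seqcount (A j) x = m j} \<in> sets (PiM UNIV (\<lambda>_. borel))"
    proof -
      have "(\<Inter>j\<in>J. seqcount (A j) -` {m j} \<inter> space (PiM UNIV (\<lambda>_. borel))) \<in> sets (PiM UNIV (\<lambda>_. borel))" if "J \<noteq> {}"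
        using J that A by (intro sets.finite_INT measurable_sets[OF seqcount_measurable]) auto
      moreover have "{x. \<forall>j\<in>J. seqcount (A j) x = m j} = (if J = {} then UNIV else (\<Inter>j\<in>J. seqcount (A j) -` {m j} \<inter> space (PiM UNIV (\<lambda>_. borel))))"
        by (auto simp: space_PiM)
      ultimately show ?thesis using sets.top[of "PiM UNIV (\<lambda>_. borel)"] by (auto simp: space_PiM)
    qed
    have "measure M {\<omega>\<in>space M. \<forall>j\<in>J. seqcount (A j) (\<xi> \<omega>) = m j} = measure M (\<xi> -` {x. \<forall>j\<in>J. seqcount (A j) x = m j} \<inter> space M)"
      by (intro arg_cong[where f="measure M"]) auto
    also have "\<dots> = measure Xi {x. \<forall>j\<in>J. seqcount (A j) x = m j}"
      unfolding law[symmetric] by (rule measure_distr[symmetric]) (use \<xi> meas in auto)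
    also have "\<dots> = (\<Prod>j\<in>J. poi (enn2real (emeasure nu (A j))) (m j))"
      by (rule Xi_joint[OF A J disj fin])
    finally show ?thesis .
  qed
  have single: "measure M {\<omega>\<in>space M. seqcount A (\<xi> \<omega>) = n} = poi (enn2real (emeasure nu A)) n"
    if "A \<in> sets borel" "emeasure nu A \<noteq> \<top>" for A n
    using joint[of "{0}" "\<lambda>_. A" "\<lambda>_. n"] that by (simp add: disjoint_family_on_def)
  have fin: "AE \<omega> in M. finite {k. \<xi> \<omega> k \<in> A}" if [measurable]: "A \<in> sets borel" and "emeasure nu A \<noteq> \<top>" for A
    using Xi_finite[OF that] unfolding law[symmetric] by (subst (asm) AE_distr_iff[OF \<xi>]) (use finite_seq_measurable[OF that(1)] in \<open>auto simp: pred_def space_PiM\<close>)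
  show ?thesis unfolding poisson_point_process_def
  proof (intro conjI allI impI M comp)
    fix A assume "A \<in> sets borel \<and> emeasure nu A < \<infinity>"
    then have A: "A \<in> sets borel" "emeasure nu A \<noteq> \<top>" by auto
    show "AE \<omega> in M. finite {k. \<xi> \<omega> k \<in> A}" by (rule fin[OF A])
    fix n
    have "{\<omega> \<in> space M. seqcount A (\<xi> \<omega>) = n} \<in> sets M"
      using measurable_sets[OF cnt[OF A(1)], of "{n}"] by (simp add: vimage_def Int_def conj_commute)
    then show "{\<omega> \<in> space M. card {k. \<xi> \<omega> k \<in> A} = n} \<in> sets M" by (simp add: seqcount_def)
    show "measure M {\<omega> \<in> space M. card {k. \<xi> \<omega> k \<in> A} = n} = enn2real (emeasure nu A) ^ n / fact n * exp (- enn2real (emeasure nu A))"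
      using single[OF A, of n] by (simp add: seqcount_def poi_def)
  next
    fix I :: "nat set" and A
    assume *: "finite I \<and> (\<forall>i\<in>I. A i \<in> sets borel \<and> emeasure nu (A i) < \<infinity>) \<and> disjoint_family_on A I"
    have "prob_space.indep_vars M (\<lambda>_. count_space UNIV) (\<lambda>i \<omega>. seqcount (A i) (\<xi> \<omega>)) I"
    proof (rule indep_vars_countI[OF M])
      fix J m assume J: "J \<subseteq> I"
      then have "finite J" "disjoint_family_on A J" using * by (auto intro: finite_subset disjoint_family_on_mono)
      moreover have "A j \<in> sets borel" "emeasure nu (A j) \<noteq> \<top>" if "j \<in> J" for j using J that * by (auto simp: less_top)
      ultimately show "measure M {\<omega>\<in>space M. \<forall>j\<in>J. seqcount (A j) (\<xi> \<omega>) = m j} = (\<Prod>j\<in>J. measure M {\<omega>\<in>space M. seqcount (A j) (\<xi> \<omega>) = m j})"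
        by (simp add: joint single)
    qed (use * cnt in auto)
    then show "indep_vars (\<lambda>_. count_space UNIV) (\<lambda>i \<omega>. card {k. \<xi> \<omega> k \<in> A i}) I" by (simp add: seqcount_def)
  qed
qed

end

section \<open>From arbitrary models to the canonical one\<close>

text \<open>The premises of \<open>solves_RDE\<close> as a predicate of their own, with the type of
  the sample space left open.\<close>

definition rde_model :: "real measure \<Rightarrow> 'a measure \<Rightarrow> ('a \<Rightarrow> nat \<Rightarrow> real) \<Rightarrow> ('a \<Rightarrow> nat \<Rightarrow> complex) \<Rightarrow> complex measure \<Rightarrow> bool" where
  "rde_model \<nu> M \<xi> R \<mu> \<longleftrightarrow>
     poisson_point_process M \<nu> \<xi> \<and>
     (\<forall>k. (\<lambda>\<omega>. R \<omega> k) \<in> borel_measurable M) \<and>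
     (\<forall>k. distr M borel (\<lambda>\<omega>. R \<omega> k) = \<mu>) \<and>
     prob_space.indep_vars M (\<lambda>_. borel) (\<lambda>k \<omega>. R \<omega> k) UNIV \<and>
     prob_space.indep_var M (Pi\<^sub>M UNIV (\<lambda>_. borel)) \<xi> (Pi\<^sub>M UNIV (\<lambda>_. borel)) R"

lemma solves_RDE_iff:
  "solves_RDE \<alpha> z \<mu> \<longleftrightarrow> (\<forall>(M :: (nat \<Rightarrow> real) measure) \<xi> R. rde_model (ppp_intensity \<alpha>) M \<xi> R \<mu> \<longrightarrow>
     (AE \<omega> in M. (\<lambda>k. complex_of_real (\<xi> \<omega> k) * R \<omega> k) summable_on UNIV) \<and>
     distr M borel (\<lambda>\<omega>. - inverse (z + (\<Sum>\<^sub>\<infinity>k. complex_of_real (\<xi> \<omega> k) * R \<omega> k))) = \<mu>)"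
  unfolding solves_RDE_def rde_model_def by blast

text \<open>Unconditional and absolute summability agree in the plane, and the right-hand side is
  visibly measurable in parameters.\<close>

lemma complex_summable_on_nat_iff:
  fixes f :: "nat \<Rightarrow> complex"
  shows "f summable_on UNIV \<longleftrightarrow> (\<Sum>k. ennreal (norm (f k))) \<noteq> \<top>"
proof -
  have "f summable_on UNIV \<longleftrightarrow> summable (\<lambda>k. norm (f k))"
    by (simp add: summable_on_iff_abs_summable_on_complex summable_on_UNIV_nonneg_real_iff)
  also have "\<dots> \<longleftrightarrow> (\<Sum>k. ennreal (norm (f k))) \<noteq> \<top>"
    by (auto simp: suminf_ennreal2 intro: summable_suminf_not_top)
  finally show ?thesis .
qed

lemma complex_infsum_nat_eq:
  fixes f :: "nat \<Rightarrow> complex"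
  shows "(\<Sum>\<^sub>\<infinity>k. f k) = (if (\<Sum>k. ennreal (norm (f k))) \<noteq> \<top> then (\<Sum>k. f k) else 0)"
proof (cases "(\<Sum>k. ennreal (norm (f k))) = \<top>")
  case True
  then have "\<not> f summable_on UNIV" by (simp add: complex_summable_on_nat_iff)
  then show ?thesis using True by (simp add: infsum_not_exists)
next
  case False
  then have s: "summable (\<lambda>k. norm (f k))" by (intro summable_suminf_not_top) auto
  have "(f has_sum (\<Sum>k. f k)) UNIV"
    by (rule norm_summable_imp_has_sum[OF s]) (rule summable_sums[OF summable_norm_cancel[OF s]])
  then show ?thesis using False by (simp add: infsumI)
qed

lemma measurable_complex_infsum:
  fixes X :: "nat \<Rightarrow> 'a \<Rightarrow> complex"
  assumes [measurable]: "\<And>k. X k \<in> borel_measurable M"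
  shows "(\<lambda>\<omega>. \<Sum>\<^sub>\<infinity>k. X k \<omega>) \<in> borel_measurable M"
  unfolding complex_infsum_nat_eq by measurable

lemma distr_PiM_map:
  assumes \<rho>: "prob_space \<rho>" and f[measurable]: "f \<in> \<rho> \<rightarrow>\<^sub>M N"
  shows "distr (PiM (UNIV :: 'i set) (\<lambda>_. \<rho>)) (PiM UNIV (\<lambda>_. N)) (\<lambda>Y p. f (Y p)) = PiM UNIV (\<lambda>_. distr \<rho> N f)"
proof (rule measure_eqI_PiM_infinite)
  interpret R: prob_space \<rho> by fact
  have \<mu>: "prob_space (distr \<rho> N f)" by (rule R.prob_space_distr) measurable
  interpret P: prob_space "PiM (UNIV :: 'i set) (\<lambda>_. \<rho>)" by (intro prob_space_PiM \<rho>)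
  interpret Q: product_prob_space "\<lambda>_. distr \<rho> N f" "UNIV :: 'i set" by (intro product_prob_spaceI \<mu>)
  have m[measurable]: "(\<lambda>Y p. f (Y p)) \<in> PiM (UNIV :: 'i set) (\<lambda>_. \<rho>) \<rightarrow>\<^sub>M PiM UNIV (\<lambda>_. N)"
    by (rule measurable_PiM_single') (auto simp: space_PiM PiE_iff measurable_space[OF f])
  show "sets (distr (PiM (UNIV :: 'i set) (\<lambda>_. \<rho>)) (PiM UNIV (\<lambda>_. N)) (\<lambda>Y p. f (Y p))) = sets (PiM UNIV (\<lambda>_. distr \<rho> N f))"
    by (simp cong: sets_PiM_cong)
  show "sets (PiM (UNIV :: 'i set) (\<lambda>_. distr \<rho> N f)) = sets (PiM UNIV (\<lambda>_. distr \<rho> N f))" ..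
  show "finite_measure (distr (PiM (UNIV :: 'i set) (\<lambda>_. \<rho>)) (PiM UNIV (\<lambda>_. N)) (\<lambda>Y p. f (Y p)))"
    using P.prob_space_distr[OF m] by (simp add: prob_space_def)
  fix A and J :: "'i set" assume J: "finite J" "J \<subseteq> UNIV" and A: "\<And>i. i \<in> J \<Longrightarrow> A i \<in> sets (distr \<rho> N f)"
  define A' where "A' i = (if i \<in> J then A i else {})" for i
  have A'[measurable]: "A' i \<in> sets N" for i using A by (auto simp: A'_def)
  have e: "prod_emb UNIV (\<lambda>_. distr \<rho> N f) J (Pi\<^sub>E J A) = prod_emb UNIV (\<lambda>_. N) J (Pi\<^sub>E J A')"
    by (auto simp: prod_emb_def A'_def PiE_iff)
  have emb: "prod_emb UNIV (\<lambda>_. N) J (Pi\<^sub>E J A') \<in> sets (PiM UNIV (\<lambda>_. N))"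
    using J by (intro sets_PiM_I) auto
  have "emeasure (distr (PiM (UNIV :: 'i set) (\<lambda>_. \<rho>)) (PiM UNIV (\<lambda>_. N)) (\<lambda>Y p. f (Y p))) (prod_emb UNIV (\<lambda>_. N) J (Pi\<^sub>E J A'))
    = emeasure (PiM UNIV (\<lambda>_. \<rho>)) ((\<lambda>Y p. f (Y p)) -` prod_emb UNIV (\<lambda>_. N) J (Pi\<^sub>E J A') \<inter> space (PiM UNIV (\<lambda>_. \<rho>)))"
    by (rule emeasure_distr[OF m emb])
  also have "\<dots> = (\<integral>\<^sup>+Y. indicator ((\<lambda>Y p. f (Y p)) -` prod_emb UNIV (\<lambda>_. N) J (Pi\<^sub>E J A') \<inter> space (PiM UNIV (\<lambda>_. \<rho>))) Y \<partial>PiM UNIV (\<lambda>_. \<rho>))"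
    by (rule nn_integral_indicator[symmetric]) (rule measurable_sets[OF m emb])
  also have "\<dots> = (\<integral>\<^sup>+Y. (\<Prod>j\<in>J. indicator (A' j) (f (Y j))) \<partial>PiM UNIV (\<lambda>_. \<rho>))"
  proof (rule nn_integral_cong)
    fix Y :: "'i \<Rightarrow> 'a" assume Y: "Y \<in> space (PiM UNIV (\<lambda>_. \<rho>))"
    have "(\<Prod>j\<in>J. indicator (A' j) (f (Y j)) :: ennreal) = (if \<forall>j\<in>J. f (Y j) \<in> A' j then 1 else 0)"
      using J(1) by (induction J rule: finite_induct) (auto simp: indicator_def)
    moreover have "(\<lambda>p. f (Y p)) \<in> prod_emb UNIV (\<lambda>_. N) J (Pi\<^sub>E J A') \<longleftrightarrow> (\<forall>j\<in>J. f (Y j) \<in> A' j)"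
      using Y measurable_space[OF f] by (auto simp: prod_emb_def space_PiM PiE_iff extensional_def)
    ultimately show "indicator ((\<lambda>Y p. f (Y p)) -` prod_emb UNIV (\<lambda>_. N) J (Pi\<^sub>E J A') \<inter> space (PiM UNIV (\<lambda>_. \<rho>))) Y = (\<Prod>j\<in>J. indicator (A' j) (f (Y j)) :: ennreal)"
      using Y by (simp add: indicator_def)
  qed
  also have "\<dots> = (\<Prod>j\<in>J. \<integral>\<^sup>+y. indicator (A' j) (f y) \<partial>\<rho>)"
    by (rule nn_integral_PiM_prod[OF \<rho> J(1)]) measurable
  also have "\<dots> = (\<Prod>j\<in>J. emeasure (distr \<rho> N f) (A' j))"
  proof (intro prod.cong refl)
    fix j
    have "(\<integral>\<^sup>+y. indicator (A' j) (f y) \<partial>\<rho>) = (\<integral>\<^sup>+x. indicator (A' j) x \<partial>distr \<rho> N f)"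
      by (rule nn_integral_distr[symmetric]) measurable
    then show "(\<integral>\<^sup>+y. indicator (A' j) (f y) \<partial>\<rho>) = emeasure (distr \<rho> N f) (A' j)" by simp
  qed
  also have "\<dots> = emeasure (PiM UNIV (\<lambda>_. distr \<rho> N f)) (prod_emb UNIV (\<lambda>_. distr \<rho> N f) J (Pi\<^sub>E J A))"
    using J A by (subst Q.emeasure_PiM_emb) (auto simp: A'_def intro!: prod.cong)
  finally show "emeasure (distr (PiM (UNIV :: 'i set) (\<lambda>_. \<rho>)) (PiM UNIV (\<lambda>_. N)) (\<lambda>Y p. f (Y p))) (prod_emb UNIV (\<lambda>_. distr \<rho> N f) J (Pi\<^sub>E J A))
    = emeasure (PiM UNIV (\<lambda>_. distr \<rho> N f)) (prod_emb UNIV (\<lambda>_. distr \<rho> N f) J (Pi\<^sub>E J A))" unfolding e .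
qed

context stable_index
begin

text \<open>Only the law of f under \<rho> influences the law of the output. Hence the marginals of
  a coupling, or the law of a function on trees, can be treated as laws on the plane.\<close>

lemma distr_rde_map_map:
  assumes \<rho>: "prob_space \<rho>" and f[measurable]: "f \<in> borel_measurable \<rho>"
  shows "distr (marked \<rho>) borel (rde_map z f) = distr (marked (distr \<rho> borel f)) borel (rde_map z (\<lambda>x. x))"
proof -
  let ?\<mu> = "distr \<rho> borel f"
  interpret R: prob_space \<rho> by fact
  have \<mu>: "prob_space ?\<mu>" by (rule R.prob_space_distr) measurable
  interpret P: prob_space "PiM UNIV (\<lambda>_::nat. \<rho>)" by (intro prob_space_PiM \<rho>)
  interpret Q: prob_space "PiM UNIV (\<lambda>_::nat. ?\<mu>)" by (intro prob_space_PiM \<mu>)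
  interpret W: prob_space weights by (rule prob_space_weights)
  have m: "(\<lambda>Y p. f (Y p)) \<in> PiM (UNIV :: nat set) (\<lambda>_. \<rho>) \<rightarrow>\<^sub>M PiM UNIV (\<lambda>_. borel)"
    by (rule measurable_PiM_single') auto
  have s: "sets (PiM (UNIV :: nat set) (\<lambda>_. ?\<mu>)) = sets (PiM UNIV (\<lambda>_. borel))" by (intro sets_PiM_cong) auto
  have d: "distr (PiM UNIV (\<lambda>_::nat. \<rho>)) (PiM UNIV (\<lambda>_. borel)) (\<lambda>Y p. f (Y p)) = PiM UNIV (\<lambda>_. ?\<mu>)"
    by (rule distr_PiM_map[OF \<rho>]) measurable
  have "marked ?\<mu> = distr weights weights (\<lambda>w. w) \<Otimes>\<^sub>M distr (PiM UNIV (\<lambda>_::nat. \<rho>)) (PiM UNIV (\<lambda>_. borel)) (\<lambda>Y p. f (Y p))"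
    unfolding marked_def d by simp
  also have "\<dots> = distr (marked \<rho>) (weights \<Otimes>\<^sub>M PiM UNIV (\<lambda>_. borel)) (\<lambda>(w, Y). (w, \<lambda>p. f (Y p)))"
    unfolding marked_def by (rule pair_measure_distr) (use m d Q.sigma_finite_measure_axioms in auto)
  finally have eq: "marked ?\<mu> = distr (marked \<rho>) (weights \<Otimes>\<^sub>M PiM UNIV (\<lambda>_. borel)) (\<lambda>(w, Y). (w, \<lambda>p. f (Y p)))" .
  have mm: "(\<lambda>(w, Y). (w, \<lambda>p. f (Y p))) \<in> marked \<rho> \<rightarrow>\<^sub>M weights \<Otimes>\<^sub>M PiM UNIV (\<lambda>_. borel)"
    unfolding marked_def using m by measurable
  have mR: "rde_map z (\<lambda>x. x) \<in> borel_measurable (weights \<Otimes>\<^sub>M PiM UNIV (\<lambda>_. borel))"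
  proof -
    have "rde_map z (\<lambda>x. x) \<in> borel_measurable (marked borel)" by measurable
    then show ?thesis by (simp add: marked_def)
  qed
  have "distr (marked ?\<mu>) borel (rde_map z (\<lambda>x. x)) = distr (marked \<rho>) borel (rde_map z (\<lambda>x. x) \<circ> (\<lambda>(w, Y). (w, \<lambda>p. f (Y p))))"
    unfolding eq by (rule distr_distr[OF mR mm])
  also have "rde_map z (\<lambda>x. x) \<circ> (\<lambda>(w, Y). (w, \<lambda>p. f (Y p))) = rde_map z f"
    by (auto simp: fun_eq_iff rde_map_def complex_sum_def real_sum_def cong: if_cong)
  finally show ?thesis ..
qed

section \<open>Relabelling weights and marks by the occupied slots\<close>

definition xi_marks :: "(nat \<Rightarrow> real) \<times> (nat \<Rightarrow> 'v) \<Rightarrow> (nat \<Rightarrow> real) \<times> (nat \<Rightarrow> 'v)" where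
  "xi_marks \<omega> = (xi (fst \<omega>), \<lambda>k. snd \<omega> (en (fst \<omega>) k))"

lemma measurable_xi_marks: "xi_marks \<in> marked \<rho> \<rightarrow>\<^sub>M Xi \<Otimes>\<^sub>M PiM UNIV (\<lambda>_. \<rho>)"
proof -
  have 1: "(\<lambda>\<omega>. xi (fst \<omega>)) \<in> marked \<rho> \<rightarrow>\<^sub>M Xi"
    by (subst measurable_cong_sets[OF refl sets_Xi]) (simp add: marked_def)
  have 2: "(\<lambda>\<omega> k. snd \<omega> (en (fst \<omega>) k)) \<in> marked \<rho> \<rightarrow>\<^sub>M PiM UNIV (\<lambda>_. \<rho>)"
  proof (rule measurable_PiM_single')
    fix k
    have "(\<lambda>\<omega>. en (fst \<omega>) k) \<in> marked \<rho> \<rightarrow>\<^sub>M count_space UNIV" by (simp add: marked_def)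
    then show "(\<lambda>\<omega>. snd \<omega> (en (fst \<omega>) k)) \<in> marked \<rho> \<rightarrow>\<^sub>M \<rho>"
      by (rule measurable_compose_countable[OF measurable_marked_snd])
  qed (auto simp: marked_def space_pair_measure space_PiM PiE_iff)
  show ?thesis unfolding xi_marks_def using 1 2 by measurable
qed

text \<open>For frozen weights the enumeration is an injective reindexing of an i.i.d. sequence, so
  the relabelled marks keep their law whatever the weights are. This gives their independence of the
  enumerated weights.\<close>

lemma distr_xi_marks:
  assumes \<rho>: "prob_space \<rho>"
  shows "distr (marked \<rho>) (Xi \<Otimes>\<^sub>M PiM UNIV (\<lambda>_. \<rho>)) xi_marks = Xi \<Otimes>\<^sub>M PiM UNIV (\<lambda>_. \<rho>)"
proof (rule measure_eqI)
  interpret P: prob_space "PiM UNIV (\<lambda>_::nat. \<rho>)" by (intro prob_space_PiM \<rho>)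
  let ?N = "Xi \<Otimes>\<^sub>M PiM UNIV (\<lambda>_. \<rho>)"
  note measurable_xi_marks[measurable]
  fix A assume "A \<in> sets (distr (marked \<rho>) ?N xi_marks)"
  then have A[measurable]: "A \<in> sets ?N" by simp
  have m: "(\<lambda>\<omega>. indicator A (xi_marks \<omega>) :: ennreal) \<in> borel_measurable (weights \<Otimes>\<^sub>M PiM UNIV (\<lambda>_. \<rho>))"
    unfolding marked_def[symmetric] by measurable
  have "emeasure (distr (marked \<rho>) ?N xi_marks) A = (\<integral>\<^sup>+n. indicator A n \<partial>distr (marked \<rho>) ?N xi_marks)"
    by (rule nn_integral_indicator[symmetric]) (simp only: sets_distr A)
  also have "\<dots> = (\<integral>\<^sup>+\<omega>. indicator A (xi_marks \<omega>) \<partial>marked \<rho>)" by (rule nn_integral_distr) measurable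
  also have "\<dots> = (\<integral>\<^sup>+w. \<integral>\<^sup>+Y. indicator A (xi w, \<lambda>k. Y (en w k)) \<partial>PiM UNIV (\<lambda>_. \<rho>) \<partial>weights)"
    unfolding marked_def by (subst P.nn_integral_fst[OF m, symmetric]) (simp add: xi_marks_def)
  also have "\<dots> = (\<integral>\<^sup>+w. \<integral>\<^sup>+Y. indicator A (xi w, Y) \<partial>PiM UNIV (\<lambda>_. \<rho>) \<partial>weights)"
  proof (rule nn_integral_cong)
    fix w
    have "xi w \<in> space Xi" by simp
    then show "(\<integral>\<^sup>+Y. indicator A (xi w, \<lambda>k. Y (en w k)) \<partial>PiM UNIV (\<lambda>_. \<rho>)) = (\<integral>\<^sup>+Y. indicator A (xi w, Y) \<partial>PiM UNIV (\<lambda>_. \<rho>))"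
      by (intro nn_integral_PiM_reindex[OF \<rho> inj_en, of "\<lambda>Y. indicator A (xi w, Y)"]) measurable
  qed
  also have "\<dots> = (\<integral>\<^sup>+x. \<integral>\<^sup>+Y. indicator A (x, Y) \<partial>PiM UNIV (\<lambda>_. \<rho>) \<partial>Xi)"
  proof -
    have "(\<lambda>x. \<integral>\<^sup>+Y. indicator A (x, Y) \<partial>PiM UNIV (\<lambda>_. \<rho>)) \<in> borel_measurable Xi" by measurable
    then show ?thesis unfolding Xi_def by (subst nn_integral_distr) auto
  qed
  also have "\<dots> = (\<integral>\<^sup>+n. indicator A n \<partial>?N)" by (rule P.nn_integral_fst) measurable
  also have "\<dots> = emeasure ?N A" by (rule nn_integral_indicator[OF A])
  finally show "emeasure (distr (marked \<rho>) ?N xi_marks) A = emeasure ?N A" .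
qed simp

text \<open>Enumerating the occupied slots omits vanishing terms and renumbers the others; absolute
  convergence makes the sum insensitive to this.\<close>

lemma xi_marks_sum:
  assumes inf: "infinite (active (fst \<omega>) UNIV)" and fin: "real_sum cmod \<omega> \<noteq> \<top>"
  shows "((\<lambda>k. complex_of_real (fst (xi_marks \<omega>) k) * snd (xi_marks \<omega>) k) has_sum complex_sum (\<lambda>x. x) \<omega>) UNIV"
proof -
  have "((wterm (\<lambda>x. x) \<omega>) has_sum complex_sum (\<lambda>x. x) \<omega>) UNIV"
    by (rule norm_summable_imp_has_sum; rule wterm_norm_summable complex_sum_sums; use fin in simp)
  also have "?this \<longleftrightarrow> ((\<lambda>p. complex_of_real (fst \<omega> p) * snd \<omega> p) has_sum complex_sum (\<lambda>x. x) \<omega>) (range (en (fst \<omega>)))"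
    unfolding range_en[OF inf] by (rule has_sum_cong_neutral) (auto simp: active_def)
  also have "\<dots> \<longleftrightarrow> ((\<lambda>k. complex_of_real (fst (xi_marks \<omega>) k) * snd (xi_marks \<omega>) k) has_sum complex_sum (\<lambda>x. x) \<omega>) UNIV"
    by (subst has_sum_reindex[OF inj_en]) (simp add: xi_marks_def xi_def comp_def)
  finally show ?thesis .
qed

text \<open>In \<open>solves_RDE\<close> the sample space is \<open>nat \<Rightarrow> real\<close>, so weights and complex marks are interleaved
  in one real sequence.\<close>
definition enc :: "(nat \<Rightarrow> real) \<times> (nat \<Rightarrow> complex) \<Rightarrow> nat \<Rightarrow> real" where
  "enc n i = (if i mod 3 = 0 then fst n (i div 3) else if i mod 3 = 1 then Re (snd n (i div 3)) else Im (snd n (i div 3)))"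
definition dec1 :: "(nat \<Rightarrow> real) \<Rightarrow> nat \<Rightarrow> real" where "dec1 y k = y (3 * k)"
definition dec2 :: "(nat \<Rightarrow> real) \<Rightarrow> nat \<Rightarrow> complex" where "dec2 y k = Complex (y (3 * k + 1)) (y (3 * k + 2))"

lemma dec_enc: "dec1 (enc n) = fst n" "dec2 (enc n) = snd n"
proof -
  have m: "3 * k mod 3 = 0" "3 * k div 3 = k" "(3 * k + 1) mod 3 = 1" "(3 * k + 1) div 3 = k"
    "(3 * k + 2) mod 3 = 2" "(3 * k + 2) div 3 = k" for k :: nat
    by presburger+
  show "dec1 (enc n) = fst n" by (intro ext) (simp only: dec1_def enc_def m if_True simp_thms)
  show "dec2 (enc n) = snd n" by (intro ext) (simp only: dec2_def enc_def m, simp)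
qed

section \<open>A model on the prescribed sample space\<close>

definition canonical_model :: "complex measure \<Rightarrow> (nat \<Rightarrow> real) measure" where
  "canonical_model \<mu> = distr (Xi \<Otimes>\<^sub>M PiM UNIV (\<lambda>_. \<mu>)) (PiM UNIV (\<lambda>_. borel)) enc"

context
  fixes \<mu> :: "complex measure"
  assumes \<mu>: "prob_space \<mu>" and s\<mu>: "sets \<mu> = sets borel"
begin

interpretation P: prob_space "PiM UNIV (\<lambda>_::nat. \<mu>)" by (intro prob_space_PiM \<mu>)
interpretation X: prob_space Xi by (rule prob_space_Xi)
interpretation XP: pair_prob_space Xi "PiM UNIV (\<lambda>_::nat. \<mu>)" ..

lemma sets_PiM_mu: "sets (PiM (UNIV :: nat set) (\<lambda>_. \<mu>)) = sets (PiM UNIV (\<lambda>_. borel))"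
  by (intro sets_PiM_cong s\<mu> refl)

lemma sets_pair_mu: "sets (Xi \<Otimes>\<^sub>M PiM (UNIV :: nat set) (\<lambda>_. \<mu>)) = sets (PiM UNIV (\<lambda>_. borel) \<Otimes>\<^sub>M PiM UNIV (\<lambda>_. borel))"
  by (intro sets_pair_measure_cong sets_Xi sets_PiM_mu)

lemma measurable_enc: "enc \<in> Xi \<Otimes>\<^sub>M PiM UNIV (\<lambda>_. \<mu>) \<rightarrow>\<^sub>M PiM UNIV (\<lambda>_. borel)"
proof (subst measurable_cong_sets[OF sets_pair_mu refl], rule measurable_PiM_single')
  fix i
  show "(\<lambda>n. enc n i) \<in> borel_measurable (PiM UNIV (\<lambda>_. borel) \<Otimes>\<^sub>M PiM UNIV (\<lambda>_. borel))"
    unfolding enc_def by measurable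
qed auto

lemma measurable_dec1: "dec1 \<in> PiM UNIV (\<lambda>_. borel) \<rightarrow>\<^sub>M PiM UNIV (\<lambda>_. borel)"
  unfolding dec1_def[abs_def] by (rule measurable_PiM_single') auto

lemma measurable_dec2: "dec2 \<in> PiM UNIV (\<lambda>_. borel) \<rightarrow>\<^sub>M PiM UNIV (\<lambda>_. borel)"
  unfolding dec2_def[abs_def] by (rule measurable_PiM_single') (auto simp: borel_measurable_complex_iff)

lemma prob_space_canonical_model: "prob_space (canonical_model \<mu>)"
  unfolding canonical_model_def by (rule XP.prob_space_distr[OF measurable_enc])

lemma distr_dec1: "distr (canonical_model \<mu>) (PiM UNIV (\<lambda>_. borel)) dec1 = Xi"
proof -
  have "distr (canonical_model \<mu>) (PiM UNIV (\<lambda>_. borel)) dec1 = distr (Xi \<Otimes>\<^sub>M PiM UNIV (\<lambda>_. \<mu>)) (PiM UNIV (\<lambda>_. borel)) (dec1 \<circ> enc)"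
    unfolding canonical_model_def by (rule distr_distr[OF measurable_dec1 measurable_enc])
  also have "\<dots> = distr (Xi \<Otimes>\<^sub>M PiM UNIV (\<lambda>_::nat. \<mu>)) Xi fst"
    by (rule distr_cong) (auto simp: dec_enc)
  also have "\<dots> = Xi" by (rule P.distr_pair_fst)
  finally show ?thesis .
qed

lemma distr_dec2: "distr (canonical_model \<mu>) (PiM UNIV (\<lambda>_. borel)) dec2 = PiM UNIV (\<lambda>_. \<mu>)"
proof -
  have "distr (canonical_model \<mu>) (PiM UNIV (\<lambda>_. borel)) dec2 = distr (Xi \<Otimes>\<^sub>M PiM UNIV (\<lambda>_. \<mu>)) (PiM UNIV (\<lambda>_. borel)) (dec2 \<circ> enc)"
    unfolding canonical_model_def by (rule distr_distr[OF measurable_dec2 measurable_enc])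
  also have "\<dots> = distr (Xi \<Otimes>\<^sub>M PiM UNIV (\<lambda>_. \<mu>)) (PiM UNIV (\<lambda>_. \<mu>)) snd"
    by (rule distr_cong) (auto simp: dec_enc sets_PiM_mu)
  also have "\<dots> = PiM UNIV (\<lambda>_. \<mu>)"
  proof (rule measure_eqI)
    fix A :: "(nat \<Rightarrow> complex) set" assume "A \<in> sets (distr (Xi \<Otimes>\<^sub>M PiM UNIV (\<lambda>_. \<mu>)) (PiM UNIV (\<lambda>_. \<mu>)) snd)"
    then have A: "A \<in> sets (PiM UNIV (\<lambda>_. \<mu>))" by simp
    have *: "snd -` A \<inter> space (Xi \<Otimes>\<^sub>M PiM UNIV (\<lambda>_. \<mu>)) = space Xi \<times> A"
      using sets.sets_into_space[OF A] by (auto simp: space_pair_measure)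
    show "emeasure (distr (Xi \<Otimes>\<^sub>M PiM UNIV (\<lambda>_. \<mu>)) (PiM UNIV (\<lambda>_. \<mu>)) snd) A = emeasure (PiM UNIV (\<lambda>_. \<mu>)) A"
    proof -
      have "emeasure (Xi \<Otimes>\<^sub>M PiM UNIV (\<lambda>_. \<mu>)) (space Xi \<times> A) = emeasure Xi (space Xi) * emeasure (PiM UNIV (\<lambda>_. \<mu>)) A"
        by (rule P.emeasure_pair_measure_Times[of "space Xi" Xi A, OF sets.top A])
      then show ?thesis using A X.emeasure_space_1 * by (subst emeasure_distr) simp_all
    qed
  qed simp
  finally show ?thesis .
qed

lemma distr_dec: "distr (canonical_model \<mu>) (PiM UNIV (\<lambda>_. borel) \<Otimes>\<^sub>M PiM UNIV (\<lambda>_. borel)) (\<lambda>y. (dec1 y, dec2 y)) = Xi \<Otimes>\<^sub>M PiM UNIV (\<lambda>_. \<mu>)"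
proof -
  have "(\<lambda>y. (dec1 y, dec2 y)) \<in> PiM UNIV (\<lambda>_. borel) \<rightarrow>\<^sub>M PiM UNIV (\<lambda>_. borel) \<Otimes>\<^sub>M PiM UNIV (\<lambda>_. borel)"
    by (intro measurable_Pair measurable_dec1 measurable_dec2)
  then have "distr (canonical_model \<mu>) (PiM UNIV (\<lambda>_. borel) \<Otimes>\<^sub>M PiM UNIV (\<lambda>_. borel)) (\<lambda>y. (dec1 y, dec2 y))
    = distr (Xi \<Otimes>\<^sub>M PiM UNIV (\<lambda>_. \<mu>)) (PiM UNIV (\<lambda>_. borel) \<Otimes>\<^sub>M PiM UNIV (\<lambda>_. borel)) ((\<lambda>y. (dec1 y, dec2 y)) \<circ> enc)"
    unfolding canonical_model_def by (rule distr_distr[OF _ measurable_enc])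
  also have "\<dots> = distr (Xi \<Otimes>\<^sub>M PiM UNIV (\<lambda>_. \<mu>)) (Xi \<Otimes>\<^sub>M PiM UNIV (\<lambda>_. \<mu>)) (\<lambda>n. n)"
    by (rule distr_cong) (simp_all only: dec_enc sets_pair_mu comp_def prod.collapse)
  finally show ?thesis by simp
qed

text \<open>Without such an instance the quantification over models in \<open>solves_RDE\<close>
  might be vacuous and every law a solution; uniqueness depends on it.\<close>

lemma canonical_model_model: "rde_model nu (canonical_model \<mu>) dec1 dec2 \<mu>"
proof -
  interpret C: prob_space "canonical_model \<mu>" by (rule prob_space_canonical_model)
  have d1: "dec1 \<in> canonical_model \<mu> \<rightarrow>\<^sub>M PiM UNIV (\<lambda>_. borel)" and d2: "dec2 \<in> canonical_model \<mu> \<rightarrow>\<^sub>M PiM UNIV (\<lambda>_. borel)"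
    using measurable_dec1 measurable_dec2 by (simp_all add: canonical_model_def)
  have comp: "(\<lambda>\<omega>. dec2 \<omega> k) \<in> borel_measurable (canonical_model \<mu>)" for k
    using measurable_compose[OF d2 measurable_component_singleton[of k UNIV]] by simp
  have law: "distr (canonical_model \<mu>) borel (\<lambda>\<omega>. dec2 \<omega> k) = \<mu>" for k
  proof -
    have "distr (canonical_model \<mu>) borel (\<lambda>\<omega>. dec2 \<omega> k) = distr (PiM UNIV (\<lambda>_. \<mu>)) borel (\<lambda>r. r k)"
      unfolding distr_dec2[symmetric] by (subst distr_distr[OF measurable_component_singleton d2]) (auto simp: comp_def)
    also have "\<dots> = distr (PiM UNIV (\<lambda>_. \<mu>)) \<mu> (\<lambda>r. r k)" by (rule distr_cong) (auto simp: s\<mu>)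
    also have "\<dots> = \<mu>" by (rule distr_PiM_component) (auto intro: \<mu>)
    finally show ?thesis .
  qed
  show ?thesis unfolding rde_model_def
  proof (intro conjI allI comp law)
    show "poisson_point_process (canonical_model \<mu>) nu dec1"
      by (rule poisson_point_process_of_law[OF prob_space_canonical_model d1 distr_dec1])
    show "C.indep_vars (\<lambda>_. borel) (\<lambda>k \<omega>. dec2 \<omega> k) UNIV"
      using distr_dec2 by (subst C.indep_vars_iff_distr_eq_PiM') (auto simp: comp law restrict_UNIV)
    show "C.indep_var (Pi\<^sub>M UNIV (\<lambda>_. borel)) dec1 (Pi\<^sub>M UNIV (\<lambda>_. borel)) dec2"
    proof (subst C.indep_var_distribution_eq, intro conjI d2)
      \<comment> \<open>\<open>indep_var\<close> takes two variables with values in one type, so the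
        independence clause speaks of the weights embedded in the complex numbers.
        \<open>ofr\<close> is this embedding.\<close>
      define ofr :: "(nat \<Rightarrow> real) \<Rightarrow> nat \<Rightarrow> complex" where "ofr x k = complex_of_real (x k)" for x k
      have ofr[measurable]: "ofr \<in> PiM UNIV (\<lambda>_. borel) \<rightarrow>\<^sub>M PiM UNIV (\<lambda>_. borel)"
        unfolding ofr_def[abs_def] by (rule measurable_PiM_single') auto
      have o: "(\<lambda>\<omega> k. complex_of_real (dec1 \<omega> k)) = ofr \<circ> dec1" by (simp add: ofr_def fun_eq_iff)
      show "(\<lambda>\<omega> k. complex_of_real (dec1 \<omega> k)) \<in> canonical_model \<mu> \<rightarrow>\<^sub>M PiM UNIV (\<lambda>_. borel)"
        unfolding o by (rule measurable_comp[OF d1 ofr])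
      have 1: "distr (canonical_model \<mu>) (PiM UNIV (\<lambda>_. borel)) (\<lambda>\<omega> k. complex_of_real (dec1 \<omega> k)) = distr Xi (PiM UNIV (\<lambda>_. borel)) ofr"
        unfolding o distr_dec1[symmetric] by (rule distr_distr[OF ofr d1, symmetric])
      have 2: "distr (PiM UNIV (\<lambda>_::nat. \<mu>)) (PiM UNIV (\<lambda>_. borel)) (\<lambda>r. r) = PiM UNIV (\<lambda>_. \<mu>)"
        by (rule trans[OF distr_cong[OF refl sets_PiM_mu[symmetric] refl] distr_id])
      let ?B = "PiM UNIV (\<lambda>_. borel) \<Otimes>\<^sub>M PiM UNIV (\<lambda>_. borel)"
      have 3: "(\<lambda>y. (dec1 y, dec2 y)) \<in> canonical_model \<mu> \<rightarrow>\<^sub>M ?B" by (intro measurable_Pair d1 d2)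
      have "distr Xi (PiM UNIV (\<lambda>_. borel)) ofr \<Otimes>\<^sub>M PiM UNIV (\<lambda>_. \<mu>)
        = distr (Xi \<Otimes>\<^sub>M PiM UNIV (\<lambda>_::nat. \<mu>)) (PiM UNIV (\<lambda>_. borel) \<Otimes>\<^sub>M PiM UNIV (\<lambda>_. borel)) (\<lambda>(x, r). (ofr x, r))"
        using pair_measure_distr[of ofr Xi "PiM UNIV (\<lambda>_. borel)" "\<lambda>r. r" "PiM UNIV (\<lambda>_::nat. \<mu>)" "PiM UNIV (\<lambda>_. borel)"]
        unfolding 2 using P.sigma_finite_measure_axioms measurable_ident_sets[OF sets_PiM_mu] by simp
      also have "\<dots> = distr (canonical_model \<mu>) (PiM UNIV (\<lambda>_. borel) \<Otimes>\<^sub>M PiM UNIV (\<lambda>_. borel)) ((\<lambda>(x, r). (ofr x, r)) \<circ> (\<lambda>y. (dec1 y, dec2 y)))"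
        unfolding distr_dec[symmetric] by (rule distr_distr[OF _ 3]) measurable
      finally show "distr (canonical_model \<mu>) (PiM UNIV (\<lambda>_. borel)) (\<lambda>\<omega> k. complex_of_real (dec1 \<omega> k)) \<Otimes>\<^sub>M distr (canonical_model \<mu>) (PiM UNIV (\<lambda>_. borel)) dec2
        = distr (canonical_model \<mu>) (PiM UNIV (\<lambda>_. borel) \<Otimes>\<^sub>M PiM UNIV (\<lambda>_. borel)) (\<lambda>\<omega>. (\<lambda>k. complex_of_real (dec1 \<omega> k), dec2 \<omega>))"
        unfolding 1 distr_dec2 by (simp add: comp_def ofr_def[abs_def])
    qed
  qed
qed

text \<open>Carries the series of the canonical model, an \<open>infsum\<close> over enumerated
  points, to \<open>complex_sum\<close> over slots, for which the moment estimates are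
  available.\<close>

lemma canonical_model_law:
  assumes A: "amom \<mu> cmod \<noteq> \<top>"
  shows "distr (canonical_model \<mu>) borel (\<lambda>\<omega>. - inverse (z + (\<Sum>\<^sub>\<infinity>k. complex_of_real (dec1 \<omega> k) * dec2 \<omega> k))) = distr (marked \<mu>) borel (rde_map z (\<lambda>x. x))"
    and "AE \<omega> in canonical_model \<mu>. (\<lambda>k. complex_of_real (dec1 \<omega> k) * dec2 \<omega> k) summable_on UNIV"
proof -
  have id: "(\<lambda>x. x) \<in> borel_measurable \<mu>" by (simp add: s\<mu> cong: measurable_cong_sets)
  let ?N = "Xi \<Otimes>\<^sub>M PiM UNIV (\<lambda>_. \<mu>)"
  define G :: "(nat \<Rightarrow> real) \<times> (nat \<Rightarrow> complex) \<Rightarrow> complex" where "G n = - inverse (z + (\<Sum>\<^sub>\<infinity>k. complex_of_real (fst n k) * snd n k))" for n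
  have t: "(\<lambda>n. complex_of_real (fst n k) * snd n k) \<in> borel_measurable ?N" for k
    by (subst measurable_cong_sets[OF sets_pair_mu refl]) measurable
  have G: "G \<in> borel_measurable ?N" unfolding G_def using measurable_complex_infsum[OF t] by measurable
  have dec: "(\<lambda>y. (dec1 y, dec2 y)) \<in> PiM UNIV (\<lambda>_. borel) \<rightarrow>\<^sub>M ?N"
    by (subst measurable_cong_sets[OF refl sets_pair_mu]) (intro measurable_Pair measurable_dec1 measurable_dec2)
  have "AE \<omega> in marked \<mu>. infinite (active (fst \<omega>) UNIV)"
  proof -
    have "AE \<omega> in weights \<Otimes>\<^sub>M PiM UNIV (\<lambda>_::nat. \<mu>). infinite (active (fst \<omega>) UNIV)"
    proof (rule pair_sigma_finite.AE_pair_measure)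
      interpret W: prob_space weights by (rule prob_space_weights)
      show "pair_sigma_finite weights (PiM UNIV (\<lambda>_::nat. \<mu>))" ..
      have "infinite (active w UNIV) \<longleftrightarrow> (\<forall>m. \<exists>n. m \<le> n \<and> 0 < w n)" for w
        by (simp add: infinite_nat_iff_unbounded_le active_def)
      then have "Measurable.pred (weights \<Otimes>\<^sub>M PiM UNIV (\<lambda>_::nat. \<mu>)) (\<lambda>\<omega>. infinite (active (fst \<omega>) UNIV))"
        using measurable_marked_fst[of _ \<mu>, unfolded marked_def] by (simp only:) measurable
      then show "{\<omega> \<in> space (weights \<Otimes>\<^sub>M PiM UNIV (\<lambda>_::nat. \<mu>)). infinite (active (fst \<omega>) UNIV)} \<in> sets (weights \<Otimes>\<^sub>M PiM UNIV (\<lambda>_. \<mu>))"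
        by (simp only: pred_def)
    qed (use AE_infinite_active in simp)
    then show ?thesis unfolding marked_def .
  qed
  moreover have "AE \<omega> in marked \<mu>. real_sum cmod \<omega> \<noteq> \<top>"
    using id A by (intro AE_real_sum_finite[OF \<mu>]) auto
  ultimately have hs: "AE \<omega> in marked \<mu>. ((\<lambda>k. complex_of_real (fst (xi_marks \<omega>) k) * snd (xi_marks \<omega>) k) has_sum complex_sum (\<lambda>x. x) \<omega>) UNIV"
    by eventually_elim (rule xi_marks_sum)
  have "distr (canonical_model \<mu>) borel (\<lambda>\<omega>. - inverse (z + (\<Sum>\<^sub>\<infinity>k. complex_of_real (dec1 \<omega> k) * dec2 \<omega> k))) = distr (canonical_model \<mu>) borel (G \<circ> (\<lambda>y. (dec1 y, dec2 y)))"
    by (simp add: G_def comp_def)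
  also have "\<dots> = distr ?N borel G"
  proof -
    have "G \<circ> (\<lambda>y. (dec1 y, dec2 y)) \<in> borel_measurable (PiM UNIV (\<lambda>_. borel))" by (rule measurable_comp[OF dec G])
    then have "distr (canonical_model \<mu>) borel (G \<circ> (\<lambda>y. (dec1 y, dec2 y))) = distr ?N borel ((G \<circ> (\<lambda>y. (dec1 y, dec2 y))) \<circ> enc)"
      unfolding canonical_model_def by (rule distr_distr[OF _ measurable_enc])
    then show ?thesis by (simp add: comp_def dec_enc)
  qed
  also have "\<dots> = distr (marked \<mu>) borel (G \<circ> xi_marks)"
    by (subst distr_xi_marks[OF \<mu>, symmetric]) (rule distr_distr[OF G measurable_xi_marks])
  also have "\<dots> = distr (marked \<mu>) borel (rde_map z (\<lambda>x. x))"
  proof (rule distr_cong_AE)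
    show "AE \<omega> in marked \<mu>. (G \<circ> xi_marks) \<omega> = rde_map z (\<lambda>x. x) \<omega>"
      using hs by eventually_elim (simp add: G_def rde_map_def infsumI)
  qed (use measurable_comp[OF measurable_xi_marks G] id in auto)
  finally show "distr (canonical_model \<mu>) borel (\<lambda>\<omega>. - inverse (z + (\<Sum>\<^sub>\<infinity>k. complex_of_real (dec1 \<omega> k) * dec2 \<omega> k))) = distr (marked \<mu>) borel (rde_map z (\<lambda>x. x))" .
  have sm: "Measurable.pred ?N (\<lambda>n. (\<lambda>k. complex_of_real (fst n k) * snd n k) summable_on UNIV)"
    unfolding complex_summable_on_nat_iff using t by measurable
  have "AE \<omega> in marked \<mu>. (\<lambda>k. complex_of_real (fst (xi_marks \<omega>) k) * snd (xi_marks \<omega>) k) summable_on UNIV"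
    using hs by eventually_elim (auto simp: summable_on_def)
  then have "AE n in ?N. (\<lambda>k. complex_of_real (fst n k) * snd n k) summable_on UNIV"
    using sm by (subst distr_xi_marks[OF \<mu>, symmetric]) (subst AE_distr_iff[OF measurable_xi_marks], auto simp: pred_def)
  then show "AE \<omega> in canonical_model \<mu>. (\<lambda>k. complex_of_real (dec1 \<omega> k) * dec2 \<omega> k) summable_on UNIV"
  proof -
    assume *: "AE n in ?N. (\<lambda>k. complex_of_real (fst n k) * snd n k) summable_on UNIV"
    have "{y \<in> space (PiM UNIV (\<lambda>_. borel)). (\<lambda>k. complex_of_real (dec1 y k) * dec2 y k) summable_on UNIV} \<in> sets (PiM UNIV (\<lambda>_. borel))"
      using measurable_compose[OF dec sm] by (simp add: pred_def)
    then show ?thesis unfolding canonical_model_def using * by (subst AE_distr_iff[OF measurable_enc]) (auto simp: dec_enc)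
  qed
qed

end

lemma solves_RDE_imp_fixed:
  assumes "prob_space \<mu>" "sets \<mu> = sets borel" "amom \<mu> cmod \<noteq> \<top>" "solves_RDE (2 * a) z \<mu>"
  shows "distr (marked \<mu>) borel (rde_map z (\<lambda>x. x)) = \<mu>"
proof -
  have "distr (canonical_model \<mu>) borel (\<lambda>\<omega>. - inverse (z + (\<Sum>\<^sub>\<infinity>k. complex_of_real (dec1 \<omega> k) * dec2 \<omega> k))) = \<mu>"
    using assms(4) canonical_model_model[OF assms(1,2)] unfolding solves_RDE_iff nu_def by blast
  then show ?thesis unfolding canonical_model_law(1)[OF assms(1-3)] .
qed

end

section \<open>Characteristic functions on the plane\<close>

text \<open>Levy uniqueness on the line, applied to the law of X under the density w / c. The common
  mass c is read off at s = 0; if it vanishes, both sides are 0. Allowing a weight makes it possible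
  to treat one coordinate while a function of the other is carried along.\<close>

lemma char_weight_unique:
  fixes \<mu>1 \<mu>2 :: "complex measure" and w X :: "complex \<Rightarrow> real"
  assumes p: "prob_space \<mu>1" "prob_space \<mu>2" and s: "sets \<mu>1 = sets borel" "sets \<mu>2 = sets borel"
    and w[measurable]: "w \<in> borel_measurable borel" and w0: "\<And>z. 0 \<le> w z" and wB: "\<And>z. w z \<le> B"
    and X[measurable]: "X \<in> borel_measurable borel"
    and eq: "\<And>s. (CLINT z|\<mu>1. w z *\<^sub>R iexp (s * X z)) = (CLINT z|\<mu>2. w z *\<^sub>R iexp (s * X z))"
    and A[measurable]: "A \<in> sets borel"
  shows "(LINT z|\<mu>1. w z * indicator A (X z)) = (LINT z|\<mu>2. w z * indicator A (X z))"
proof -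
  interpret M1: prob_space \<mu>1 by fact
  interpret M2: prob_space \<mu>2 by fact
  note s[measurable_cong]
  have bound: "norm (w z * r) \<le> B" if "norm r \<le> 1" for z and r :: real
  proof -
    have "\<bar>w z * r\<bar> = w z * \<bar>r\<bar>" using w0[of z] by (simp add: abs_mult)
    also have "\<dots> \<le> w z * 1" using that w0[of z] by (intro mult_left_mono) auto
    finally show ?thesis using wB[of z] by simp
  qed
  have int: "integrable \<mu>1 w" "integrable \<mu>2 w"
    by (rule M1.integrable_const_bound[of _ B] M2.integrable_const_bound[of _ B]; use wB w0 in simp)+
  have intA: "integrable \<mu>1 (\<lambda>z. w z * indicator A (X z))" "integrable \<mu>2 (\<lambda>z. w z * indicator A (X z))"
    by (rule M1.integrable_const_bound[of _ B] M2.integrable_const_bound[of _ B]; use bound in \<open>simp add: indicator_def\<close>)+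
  define c where "c = (LINT z|\<mu>1. w z)"
  have c1: "c = (LINT z|\<mu>1. w z)" by (simp add: c_def)
  have c2: "c = (LINT z|\<mu>2. w z)"
  proof -
    have "complex_of_real (LINT z|\<mu>1. w z) = complex_of_real (LINT z|\<mu>2. w z)"
      using eq[of 0] by (simp add: scaleR_conv_of_real)
    then show ?thesis by (simp add: c_def)
  qed
  have c0: "0 \<le> c" unfolding c1 by (rule integral_nonneg_AE) (simp add: w0)
  show ?thesis
  proof (cases "c = 0")
    case True
    have "(LINT z|\<mu>1. w z * indicator A (X z)) = 0"
    proof (rule antisym)
      have "(LINT z|\<mu>1. w z * indicator A (X z)) \<le> (LINT z|\<mu>1. w z)"
        by (intro integral_mono intA int) (auto simp: indicator_def w0)
      then show "(LINT z|\<mu>1. w z * indicator A (X z)) \<le> 0" using True c1 by simp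
    qed (auto intro!: integral_nonneg_AE simp: w0)
    moreover have "(LINT z|\<mu>2. w z * indicator A (X z)) = 0"
    proof (rule antisym)
      have "(LINT z|\<mu>2. w z * indicator A (X z)) \<le> (LINT z|\<mu>2. w z)"
        by (intro integral_mono intA int) (auto simp: indicator_def w0)
      then show "(LINT z|\<mu>2. w z * indicator A (X z)) \<le> 0" using True c2 by simp
    qed (auto intro!: integral_nonneg_AE simp: w0)
    ultimately show ?thesis by simp
  next
    case False
    then have c: "0 < c" using c0 by simp
    define N where "N \<mu> = distr (density \<mu> (\<lambda>z. ennreal (w z / c))) borel X" for \<mu>
    have main: "real_distribution (N \<mu>) \<and> (\<forall>s. char (N \<mu>) s = (CLINT z|\<mu>. w z *\<^sub>R iexp (s * X z)) / c) \<and>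
        (LINT z|\<mu>. w z * indicator A (X z)) = c * (LINT x|N \<mu>. indicator A x)"
      if "prob_space \<mu>" and sm[measurable_cong]: "sets \<mu> = sets borel" and im: "integrable \<mu> w" and cm: "c = (LINT z|\<mu>. w z)" for \<mu>
    proof (intro conjI allI)
      interpret prob_space \<mu> by fact
      have "emeasure (N \<mu>) (space (N \<mu>)) = (\<integral>\<^sup>+z. ennreal (w z / c) \<partial>\<mu>)"
        unfolding N_def by (simp add: emeasure_distr emeasure_density)
      also have "\<dots> = ennreal (LINT z|\<mu>. w z / c)"
        by (rule nn_integral_eq_integral) (use im w0 c in auto)
      also have "(LINT z|\<mu>. w z / c) = 1" using c cm by simp
      finally have "emeasure (N \<mu>) (space (N \<mu>)) = 1" by simp
      then have "prob_space (N \<mu>)" by (rule prob_spaceI)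
      then show "real_distribution (N \<mu>)" by (simp add: real_distribution_def real_distribution_axioms_def N_def)
      fix s
      show "char (N \<mu>) s = (CLINT z|\<mu>. w z *\<^sub>R iexp (s * X z)) / c"
      proof -
        have "char (N \<mu>) s = (CLINT z|\<mu>. (w z / c) *\<^sub>R iexp (s * X z))"
          unfolding char_def N_def by (subst integral_distr, simp, simp, subst integral_density) (use w0 c in auto)
        also have "\<dots> = (CLINT z|\<mu>. (w z *\<^sub>R iexp (s * X z)) / c)"
          by (intro Bochner_Integration.integral_cong refl) (simp add: scaleR_conv_of_real)
        finally show ?thesis by simp
      qed
    next
      have "(LINT x|N \<mu>. indicator A x) = (LINT z|\<mu>. (w z / c) *\<^sub>R (indicator A (X z) :: real))"
        unfolding N_def by (subst integral_distr, simp, simp, subst integral_density) (use w0 c in auto)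
      then show "(LINT z|\<mu>. w z * indicator A (X z)) = c * (LINT x|N \<mu>. indicator A x)" using c by simp
    qed
    have "N \<mu>1 = N \<mu>2"
      using main[OF p(1) s(1) int(1) c1] main[OF p(2) s(2) int(2) c2] eq
      by (intro Levy_uniqueness ext) auto
    then show ?thesis using main[OF p(1) s(1) int(1) c1] main[OF p(2) s(2) int(2) c2] by simp
  qed
qed

text \<open>Two passes through the one-dimensional result: the first frees Re z while a
  trigonometric function of Im z serves as weight, the second frees Im z with the indicator of a set
  for Re z as weight. This gives agreement on rectangles, which generate the Borel sets of the
  plane.\<close>

lemma complex_char_unique:
  fixes \<mu>1 \<mu>2 :: "complex measure"
  assumes p: "prob_space \<mu>1" "prob_space \<mu>2" and s: "sets \<mu>1 = sets borel" "sets \<mu>2 = sets borel"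
    and eq: "\<And>t. (CLINT z|\<mu>1. iexp (inner t z)) = (CLINT z|\<mu>2. iexp (inner t z))"
  shows "\<mu>1 = \<mu>2"
proof -
  interpret M1: prob_space \<mu>1 by fact
  interpret M2: prob_space \<mu>2 by fact
  note s[measurable_cong]
  define E where "E s1 s2 z = iexp (s1 * Re z + s2 * Im z)" for s1 s2 z
  have [measurable]: "E s1 s2 \<in> borel_measurable borel" for s1 s2 unfolding E_def by measurable
  have e: "(CLINT z|\<mu>1. E s1 s2 z) = (CLINT z|\<mu>2. E s1 s2 z)" for s1 s2
    using eq[of "Complex s1 s2"] by (simp add: inner_complex_def E_def)
  have E1: "norm (E s1 s2 z) \<le> 1" for s1 s2 z by (simp add: E_def)
  have E0: "E s 0 z = iexp (s * Re z)" for s z by (simp add: E_def)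
  have ii: "integrable \<mu>1 (E s1 s2)" "integrable \<mu>2 (E s1 s2)" for s1 s2
    by (rule M1.integrable_const_bound[of _ 1] M2.integrable_const_bound[of _ 1]; use E1 in simp)+
  have bnd: "integrable \<mu>1 (\<lambda>z. f z * indicator A (g z))" "integrable \<mu>2 (\<lambda>z. f z * indicator A (g z))"
    if [measurable]: "f \<in> borel_measurable borel" "g \<in> borel_measurable borel" "A \<in> sets borel" and "\<And>z. \<bar>f z\<bar> \<le> 2" for f g :: "complex \<Rightarrow> real" and A
    by (rule M1.integrable_const_bound[of _ 2] M2.integrable_const_bound[of _ 2]; use that(4) in \<open>simp add: indicator_def\<close>)+
  have trig: "(LINT z|\<mu>1. cos (s2 * Im z) * indicator A (Re z)) = (LINT z|\<mu>2. cos (s2 * Im z) * indicator A (Re z))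
      \<and> (LINT z|\<mu>1. sin (s2 * Im z) * indicator A (Re z)) = (LINT z|\<mu>2. sin (s2 * Im z) * indicator A (Re z))"
    if [measurable]: "A \<in> sets borel" for A s2
  proof -
    define Q where "Q x z = iexp (x * (s2 * Im z))" for x z
    have EQ: "E s s2 z = iexp (s * Re z) * Q 1 z" "E s (- s2) z = iexp (s * Re z) * Q (-1) z" for s z
      by (simp_all add: E_def Q_def exp_add[symmetric] algebra_simps)
    have cQ: "complex_of_real (cos (s2 * Im z)) = (Q 1 z + Q (-1) z) / 2" for z
      by (simp add: cos_exp_eq Q_def flip: cos_of_real)
    have sQ: "complex_of_real (sin (s2 * Im z)) = (Q 1 z - Q (-1) z) / (2 * \<i>)" for z
      by (simp add: sin_exp_eq Q_def flip: sin_of_real)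
    \<comment> \<open>Weights must be nonnegative, hence the added 1; its contribution is subtracted
      again by means of \<open>one\<close>. The right-hand sides contain only characters, on which
      the two measures agree.\<close>
    have r1: "(1 + cos (s2 * Im z)) *\<^sub>R iexp (s * Re z) = E s 0 z + (E s s2 z + E s (- s2) z) / 2" for z s
      unfolding EQ E0 scaleR_conv_of_real of_real_add of_real_1 cQ by (simp only: ring_distribs add_divide_distrib mult_1_left times_divide_eq_left times_divide_eq_right mult.commute)
    have r2: "(1 + sin (s2 * Im z)) *\<^sub>R iexp (s * Re z) = E s 0 z + (E s s2 z - E s (- s2) z) / (2 * \<i>)" for z s
      unfolding EQ E0 scaleR_conv_of_real of_real_add of_real_1 sQ by (simp only: ring_distribs diff_divide_distrib mult_1_left times_divide_eq_left times_divide_eq_right mult.commute)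
    have one: "(LINT z|\<mu>1. 1 * indicator A (Re z)) = (LINT z|\<mu>2. 1 * indicator A (Re z) :: real)"
      by (rule char_weight_unique[OF p s, where B=1]) (use e[of _ 0] in \<open>auto simp: E0[abs_def]\<close>)
    have C: "(LINT z|\<mu>1. (1 + cos (s2 * Im z)) * indicator A (Re z)) = (LINT z|\<mu>2. (1 + cos (s2 * Im z)) * indicator A (Re z))"
    proof (rule char_weight_unique[OF p s, where B=2])
      fix z show "0 \<le> 1 + cos (s2 * Im z)" using cos_ge_minus_one[of "s2 * Im z"] by linarith
    next
      fix s show "(CLINT z|\<mu>1. (1 + cos (s2 * Im z)) *\<^sub>R iexp (s * Re z)) = (CLINT z|\<mu>2. (1 + cos (s2 * Im z)) *\<^sub>R iexp (s * Re z))"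
        unfolding r1 by (simp add: ii e)
    qed auto
    have S: "(LINT z|\<mu>1. (1 + sin (s2 * Im z)) * indicator A (Re z)) = (LINT z|\<mu>2. (1 + sin (s2 * Im z)) * indicator A (Re z))"
    proof (rule char_weight_unique[OF p s, where B=2])
      fix z show "0 \<le> 1 + sin (s2 * Im z)" using sin_ge_minus_one[of "s2 * Im z"] by linarith
    next
      fix s show "(CLINT z|\<mu>1. (1 + sin (s2 * Im z)) *\<^sub>R iexp (s * Re z)) = (CLINT z|\<mu>2. (1 + sin (s2 * Im z)) *\<^sub>R iexp (s * Re z))"
        unfolding r2 by (simp add: ii e)
    qed auto
    have b: "\<bar>cos x\<bar> \<le> 2" "\<bar>sin x\<bar> \<le> 2" for x :: real
      using abs_cos_le_one[of x] abs_sin_le_one[of x] by linarith+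
    have i1: "integrable \<mu>1 (\<lambda>z. 1 * indicator A (Re z) :: real)" "integrable \<mu>2 (\<lambda>z. 1 * indicator A (Re z) :: real)"
      by (rule bnd; simp)+
    have ic: "integrable \<mu>1 (\<lambda>z. cos (s2 * Im z) * indicator A (Re z))" "integrable \<mu>2 (\<lambda>z. cos (s2 * Im z) * indicator A (Re z))"
      by (rule bnd; simp add: b)+
    have isn: "integrable \<mu>1 (\<lambda>z. sin (s2 * Im z) * indicator A (Re z))" "integrable \<mu>2 (\<lambda>z. sin (s2 * Im z) * indicator A (Re z))"
      by (rule bnd; simp add: b)+
    show ?thesis using C S one i1 ic isn by (simp add: distrib_right)
  qed
  have rect: "(LINT z|\<mu>1. indicator A (Re z) * indicator B (Im z)) = (LINT z|\<mu>2. indicator A (Re z) * indicator B (Im z) :: real)"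
    if A[measurable]: "A \<in> sets borel" and B: "B \<in> sets borel" for A B
  proof (rule char_weight_unique[OF p s, where B=1])
    fix t
    have d: "(CLINT z|\<mu>. indicator A (Re z) *\<^sub>R iexp (t * Im z)) = complex_of_real (LINT z|\<mu>. cos (t * Im z) * indicator A (Re z)) + \<i> * complex_of_real (LINT z|\<mu>. sin (t * Im z) * indicator A (Re z))"
      if i: "integrable \<mu> (\<lambda>z. cos (t * Im z) * indicator A (Re z))" "integrable \<mu> (\<lambda>z. sin (t * Im z) * indicator A (Re z))" for \<mu> :: "complex measure"
    proof -
      define C where "C z = cos (t * Im z) * indicator A (Re z)" for z
      define S where "S z = sin (t * Im z) * indicator A (Re z)" for z
      have eu: "iexp y = complex_of_real (cos y) + \<i> * complex_of_real (sin y)" for y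
        by (simp add: exp_Euler cos_of_real sin_of_real)
      have "(\<lambda>z. indicator A (Re z) *\<^sub>R iexp (t * Im z)) = (\<lambda>z. complex_of_real (C z) + \<i> * complex_of_real (S z))"
        unfolding eu by (auto simp: fun_eq_iff scaleR_conv_of_real algebra_simps C_def S_def)
      then show ?thesis using i unfolding C_def[symmetric] S_def[symmetric] by simp
    qed
    have b: "\<bar>cos x\<bar> \<le> 2" "\<bar>sin x\<bar> \<le> 2" for x :: real
      using abs_cos_le_one[of x] abs_sin_le_one[of x] by linarith+
    show "(CLINT z|\<mu>1. indicator A (Re z) *\<^sub>R iexp (t * Im z)) = (CLINT z|\<mu>2. indicator A (Re z) *\<^sub>R iexp (t * Im z))"
      using trig[OF A, of t] by (subst (1 2) d) (auto intro!: bnd simp: b)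
  qed (use B in \<open>auto simp: indicator_def\<close>)
  let ?P = "borel \<Otimes>\<^sub>M borel :: (real \<times> real) measure"
  let ?f = "\<lambda>z. (Re z, Im z)"
  have "distr \<mu>1 ?P ?f = distr \<mu>2 ?P ?f"
  proof (rule measure_eqI_generator_eq[where E="{A \<times> B |A B. A \<in> sets borel \<and> B \<in> sets borel}" and \<Omega>=UNIV and A="\<lambda>_. UNIV"])
    show "Int_stable {A \<times> B |A B. A \<in> sets (borel :: real measure) \<and> B \<in> sets (borel :: real measure)}"
      using Int_stable_pair_measure_generator[of "borel :: real measure" "borel :: real measure"] .
    show "sets (distr \<mu>1 ?P ?f) = sigma_sets UNIV {A \<times> B |A B. A \<in> sets borel \<and> B \<in> sets borel}"
      "sets (distr \<mu>2 ?P ?f) = sigma_sets UNIV {A \<times> B |A B. A \<in> sets borel \<and> B \<in> sets borel}"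
      by (simp_all add: sets_pair_measure)
    fix X assume "X \<in> {A \<times> B |A B. A \<in> sets (borel :: real measure) \<and> B \<in> sets (borel :: real measure)}"
    then obtain A B where X: "X = A \<times> B" and [measurable]: "A \<in> sets borel" "B \<in> sets borel" by auto
    have "measure \<mu> (?f -` X \<inter> space \<mu>) = (LINT z|\<mu>. indicator A (Re z) * indicator B (Im z))" if [measurable_cong]: "sets \<mu> = sets borel" and "prob_space \<mu>" for \<mu>
    proof -
      have "?f -` X \<inter> space \<mu> \<in> sets \<mu>" unfolding X by measurable
      then have "measure \<mu> (?f -` X \<inter> space \<mu>) = (LINT z|\<mu>. indicator (?f -` X \<inter> space \<mu>) z)" by simp
      also have "\<dots> = (LINT z|\<mu>. indicator A (Re z) * indicator B (Im z))"
        by (intro Bochner_Integration.integral_cong refl) (auto simp: X indicator_def)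
      finally show ?thesis .
    qed
    from this[OF s(1) p(1)] this[OF s(2) p(2)] rect[of A B]
    have "measure \<mu>1 (?f -` X \<inter> space \<mu>1) = measure \<mu>2 (?f -` X \<inter> space \<mu>2)" by simp
    then show "emeasure (distr \<mu>1 ?P ?f) X = emeasure (distr \<mu>2 ?P ?f) X"
      unfolding X by (simp add: emeasure_distr M1.emeasure_eq_measure M2.emeasure_eq_measure)
  next
    show "range (\<lambda>_. UNIV) \<subseteq> {A \<times> B |A B. A \<in> sets (borel :: real measure) \<and> B \<in> sets (borel :: real measure)}"
      by (auto intro!: exI[of _ UNIV])
    show "emeasure (distr \<mu>1 ?P ?f) UNIV \<noteq> \<infinity>" for i :: nat
    proof -
      interpret D: prob_space "distr \<mu>1 ?P ?f" by (rule M1.prob_space_distr) measurable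
      show ?thesis using D.emeasure_finite[of UNIV] by simp
    qed
  qed auto
  then have "distr (distr \<mu>1 ?P ?f) borel (\<lambda>(x, y). Complex x y) = distr (distr \<mu>2 ?P ?f) borel (\<lambda>(x, y). Complex x y)" by simp
  moreover have "distr (distr \<mu> ?P ?f) borel (\<lambda>(x, y). Complex x y) = \<mu>" if [measurable_cong]: "sets \<mu> = sets borel" for \<mu>
  proof -
    have "(\<lambda>(x, y). Complex x y) \<in> borel_measurable ?P" by (subst borel_measurable_complex_iff) (auto simp: case_prod_beta')
    then have "distr (distr \<mu> ?P ?f) borel (\<lambda>(x, y). Complex x y) = distr \<mu> borel (\<lambda>z. z)"
      by (subst distr_distr) (auto simp: comp_def)
    also have "\<dots> = \<mu>" by (rule trans[OF distr_cong[OF refl that[symmetric] refl] distr_id])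
    finally show ?thesis .
  qed
  ultimately show ?thesis using s by metis
qed

section \<open>Quantised models\<close>

lemma iexp_sum: "finite I \<Longrightarrow> iexp (\<Sum>i\<in>I. f i) = (\<Prod>i\<in>I. iexp (f i))"
  by (simp add: sum_distrib_left exp_sum)

context stable_index
begin

text \<open>Half-open intervals of length 1 / (n + 1) beginning at 1 / (n + 1), away from the origin
  where \<open>nu\<close> has infinite mass. The (n + 1)^2 cells reach past n + 1, so every positive
  weight is eventually covered; \<open>quant\<close> rounds it down to the left end of its cell and
  sends uncovered values to 0.\<close>

definition cell :: "nat \<Rightarrow> nat \<Rightarrow> real set" where
  "cell n i = {x. real (i + 1) \<le> real (n + 1) * x \<and> real (n + 1) * x < real (i + 2)}"
definition cellval :: "nat \<Rightarrow> nat \<Rightarrow> real" where "cellval n i = real (i + 1) / real (n + 1)"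
definition ncell :: "nat \<Rightarrow> nat" where "ncell n = (n + 1) ^ 2"
definition quant :: "nat \<Rightarrow> real \<Rightarrow> real" where
  "quant n x = (\<Sum>i<ncell n. cellval n i * indicator (cell n i) x)"

lemma cell_measurable [measurable]: "cell n i \<in> sets borel"
  unfolding cell_def by measurable

lemma quant_measurable [measurable]: "quant n \<in> borel_measurable borel"
  unfolding quant_def by measurable

lemma cell_disjoint: "x \<in> cell n i \<Longrightarrow> x \<in> cell n j \<Longrightarrow> i = j"
  unfolding cell_def by auto

lemma cell_finite: "emeasure nu (cell n i) \<noteq> \<top>"
proof -
  let ?c = "1 / real (n + 1)"
  have "emeasure nu (cell n i) \<le> emeasure nu {?c..}"
    by (intro emeasure_mono) (auto simp: cell_def field_simps intro: order_trans[of 1 "1 + real i"])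
  also have "\<dots> = (\<integral>\<^sup>+x. indicator {?c..} x \<partial>nu)" by simp
  also have "\<dots> = (\<integral>\<^sup>+x. indicator {?c..} x * ennreal (a * x powr (- a - 1)) * indicator {0<..} x \<partial>lborel)"
    by (rule nn_integral_nu) measurable
  also have "\<dots> \<le> (\<integral>\<^sup>+x. ennreal a * (ennreal (x powr (- a - 1)) * indicator {?c..} x) \<partial>lborel)"
    using a_pos by (intro nn_integral_mono) (auto simp: indicator_def ennreal_mult)
  also have "\<dots> = ennreal a * ennreal (?c powr (- a) / a)"
    using a_pos by (subst nn_integral_cmult) (auto simp: nn_integral_powr_inf)
  also have "\<dots> < \<top>" by (simp add: ennreal_mult_less_top)
  finally show ?thesis by simp
qed

lemma quant_eq: "x \<in> cell n i \<Longrightarrow> i < ncell n \<Longrightarrow> quant n x = cellval n i"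
proof -
  assume x: "x \<in> cell n i" "i < ncell n"
  have "quant n x = (\<Sum>j\<in>{i}. cellval n j * indicator (cell n j) x)"
    unfolding quant_def using x cell_disjoint by (intro sum.mono_neutral_right) (auto simp: indicator_def)
  then show ?thesis using x by simp
qed

lemma quant_eq_0: "(\<And>i. i < ncell n \<Longrightarrow> x \<notin> cell n i) \<Longrightarrow> quant n x = 0"
  unfolding quant_def by (intro sum.neutral) auto

lemma quant_bounds: "0 \<le> x \<Longrightarrow> 0 \<le> quant n x \<and> quant n x \<le> x"
proof (cases "\<exists>i<ncell n. x \<in> cell n i")
  case True
  then obtain i where i: "i < ncell n" "x \<in> cell n i" by auto
  then have q: "quant n x = cellval n i" by (intro quant_eq) auto
  show ?thesis unfolding q using i(2) by (auto simp: cellval_def cell_def field_simps)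
next
  case False
  assume "0 \<le> x"
  then show ?thesis using False quant_eq_0[of n x] by auto
qed

lemma quant_tendsto: assumes "0 < x" shows "(\<lambda>n. quant n x) \<longlonglongrightarrow> x"
proof -
  obtain M :: nat where M: "max x (1 / x) < real M" using reals_Archimedean2 by blast
  have close: "\<bar>quant n x - x\<bar> \<le> 1 / real (n + 1)" if "M \<le> n" for n
  proof -
    have Mn: "real M \<le> real n" using that by simp
    have 1: "1 \<le> real (n + 1) * x"
    proof -
      have "1 / x \<le> real (n + 1)" using M Mn by auto
      then show ?thesis using assms by (simp add: field_simps)
    qed
    \<comment> \<open>Cell i begins at (i + 1) / (n + 1), hence the shift by one.\<close>
    define i where "i = nat \<lfloor>real (n + 1) * x\<rfloor> - 1"
    have fl: "1 \<le> \<lfloor>real (n + 1) * x\<rfloor>" using 1 by linarith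
    have ri: "real (i + 1) = of_int \<lfloor>real (n + 1) * x\<rfloor>" using fl by (simp add: i_def of_nat_diff nat_le_iff)
    have c: "x \<in> cell n i" unfolding cell_def using ri by (auto simp: add.commute) linarith+
    have "real (i + 1) \<le> real (n + 1) * x" using c by (simp add: cell_def)
    also have "\<dots> < real (n + 1) * real (n + 1)" using M Mn by (intro mult_strict_left_mono) auto
    finally have "i + 1 < (n + 1) * (n + 1)" by (metis of_nat_less_iff of_nat_mult)
    then have "i < ncell n" by (simp add: ncell_def power2_eq_square)
    then have q: "quant n x = cellval n i" by (rule quant_eq[OF c])
    define N where "N = real (n + 1)"
    have N: "0 < N" by (simp add: N_def)
    have b: "real (i + 1) \<le> N * x" "N * x \<le> real (i + 1) + 1" using c by (auto simp: cell_def N_def)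
    have "real (i + 1) / N \<le> x" using b(1) N by (simp add: divide_le_eq mult.commute)
    moreover have "x \<le> real (i + 1) / N + 1 / N" using b(2) N by (simp add: add_divide_distrib[symmetric] le_divide_eq mult.commute)
    ultimately show ?thesis unfolding q cellval_def N_def[symmetric] by linarith
  qed
  have "(\<lambda>n. \<bar>quant n x - x\<bar>) \<longlonglongrightarrow> 0"
  proof (rule tendsto_sandwich[OF _ _ tendsto_const])
    show "eventually (\<lambda>n. \<bar>quant n x - x\<bar> \<le> 1 / real (n + 1)) sequentially"
      using close by (auto simp: eventually_sequentially)
    show "(\<lambda>n. 1 / real (n + 1)) \<longlonglongrightarrow> 0" using LIMSEQ_inverse_real_of_nat by (simp add: inverse_eq_divide add.commute)
  qed auto
  then show ?thesis by (simp add: tendsto_rabs_zero_iff LIM_zero_iff)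
qed

section \<open>Consequences of the definition for an arbitrary model\<close>

context
  fixes M :: "'a measure" and \<xi> :: "'a \<Rightarrow> nat \<Rightarrow> real" and R :: "'a \<Rightarrow> nat \<Rightarrow> complex" and \<mu> :: "complex measure"
  assumes model: "rde_model nu M \<xi> R \<mu>" and \<mu>: "prob_space \<mu>" and s\<mu>: "sets \<mu> = sets borel"
begin

lemma model_ppp: "poisson_point_process M nu \<xi>"
  and model_R: "(\<lambda>\<omega>. R \<omega> k) \<in> borel_measurable M"
  and model_law: "distr M borel (\<lambda>\<omega>. R \<omega> k) = \<mu>"
  and model_prob: "prob_space M"
  and model_xi: "(\<lambda>\<omega>. \<xi> \<omega> k) \<in> borel_measurable M"
  using model unfolding rde_model_def poisson_point_process_def by auto

interpretation M: prob_space M by (rule model_prob)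
interpretation P: prob_space "PiM UNIV (\<lambda>_::nat. \<mu>)" by (intro prob_space_PiM \<mu>)
interpretation U: prob_space \<mu> by (rule \<mu>)

declare model_R [measurable] model_xi [measurable]

lemma model_xi_seq: "\<xi> \<in> M \<rightarrow>\<^sub>M PiM UNIV (\<lambda>_. borel)"
  by (rule measurable_PiM_single') auto

lemma model_R_seq: "R \<in> M \<rightarrow>\<^sub>M PiM UNIV (\<lambda>_. borel)"
  by (rule measurable_PiM_single') auto

lemma sets_PiM_mu': "sets (PiM (UNIV :: nat set) (\<lambda>_. \<mu>)) = sets (PiM UNIV (\<lambda>_. borel))"
  by (intro sets_PiM_cong s\<mu> refl)

lemma model_distr_R: "distr M (PiM UNIV (\<lambda>_. borel)) R = PiM UNIV (\<lambda>_. \<mu>)"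
proof -
  have "M.indep_vars (\<lambda>_. borel) (\<lambda>k \<omega>. R \<omega> k) UNIV" using model unfolding rde_model_def by auto
  then show ?thesis
    by (subst (asm) M.indep_vars_iff_distr_eq_PiM') (auto simp: model_law restrict_def)
qed

abbreviation "XM \<equiv> distr M (PiM UNIV (\<lambda>_. borel)) \<xi>"

lemma model_joint: "distr M (PiM UNIV (\<lambda>_. borel) \<Otimes>\<^sub>M PiM UNIV (\<lambda>_. borel)) (\<lambda>\<omega>. (\<xi> \<omega>, R \<omega>)) = XM \<Otimes>\<^sub>M PiM UNIV (\<lambda>_. \<mu>)"
proof -
  \<comment> \<open>The independence clause concerns the complex-valued copy of the weights. Taking
    real parts with \<open>rer\<close> recovers the joint law of the real weights and the
    marks.\<close>
  define ofr :: "(nat \<Rightarrow> real) \<Rightarrow> nat \<Rightarrow> complex" where "ofr x k = complex_of_real (x k)" for x k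
  define rer :: "(nat \<Rightarrow> complex) \<Rightarrow> nat \<Rightarrow> real" where "rer x k = Re (x k)" for x k
  have rer[measurable]: "rer \<in> PiM UNIV (\<lambda>_. borel) \<rightarrow>\<^sub>M PiM UNIV (\<lambda>_. borel)"
    unfolding rer_def[abs_def] by (rule measurable_PiM_single') auto
  define X where "X \<omega> k = complex_of_real (\<xi> \<omega> k)" for \<omega> k
  have X[measurable]: "X \<in> M \<rightarrow>\<^sub>M PiM UNIV (\<lambda>_. borel)"
    unfolding X_def[abs_def] by (rule measurable_PiM_single') auto
  note model_R_seq[measurable]
  have "M.indep_var (Pi\<^sub>M UNIV (\<lambda>_. borel)) X (Pi\<^sub>M UNIV (\<lambda>_. borel)) R"
    using model unfolding rde_model_def X_def[abs_def] by auto
  then have j: "distr M (PiM UNIV (\<lambda>_. borel)) X \<Otimes>\<^sub>M PiM UNIV (\<lambda>_. \<mu>) = distr M (PiM UNIV (\<lambda>_. borel) \<Otimes>\<^sub>M PiM UNIV (\<lambda>_. borel)) (\<lambda>\<omega>. (X \<omega>, R \<omega>))"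
    by (subst (asm) M.indep_var_distribution_eq) (auto simp: model_distr_R)
  have x: "\<xi> = rer \<circ> X" by (auto simp: fun_eq_iff rer_def X_def)
  have 2: "distr (PiM UNIV (\<lambda>_::nat. \<mu>)) (PiM UNIV (\<lambda>_. borel)) (\<lambda>r. r) = PiM UNIV (\<lambda>_. \<mu>)"
    by (rule trans[OF distr_cong[OF refl sets_PiM_mu'[symmetric] refl] distr_id])
  have "XM = distr (distr M (PiM UNIV (\<lambda>_. borel)) X) (PiM UNIV (\<lambda>_. borel)) rer"
    unfolding x by (rule distr_distr[OF rer X, symmetric])
  then have "XM \<Otimes>\<^sub>M PiM UNIV (\<lambda>_. \<mu>) = distr (distr M (PiM UNIV (\<lambda>_. borel)) X) (PiM UNIV (\<lambda>_. borel)) rer \<Otimes>\<^sub>M distr (PiM UNIV (\<lambda>_::nat. \<mu>)) (PiM UNIV (\<lambda>_. borel)) (\<lambda>r. r)"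
    unfolding 2 by simp
  also have "\<dots> = distr (distr M (PiM UNIV (\<lambda>_. borel)) X \<Otimes>\<^sub>M PiM UNIV (\<lambda>_. \<mu>)) (PiM UNIV (\<lambda>_. borel) \<Otimes>\<^sub>M PiM UNIV (\<lambda>_. borel)) (\<lambda>(x, r). (rer x, r))"
  proof (rule pair_measure_distr)
    show "rer \<in> distr M (PiM UNIV (\<lambda>_. borel)) X \<rightarrow>\<^sub>M PiM UNIV (\<lambda>_. borel)" by simp
    show "(\<lambda>r. r) \<in> PiM (UNIV :: nat set) (\<lambda>_. \<mu>) \<rightarrow>\<^sub>M PiM UNIV (\<lambda>_. borel)" by (rule measurable_ident_sets[OF sets_PiM_mu'])
    show "sigma_finite_measure (distr (PiM (UNIV :: nat set) (\<lambda>_. \<mu>)) (PiM UNIV (\<lambda>_. borel)) (\<lambda>r. r))"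
      unfolding 2 by unfold_locales
  qed
  also have "\<dots> = distr M (PiM UNIV (\<lambda>_. borel) \<Otimes>\<^sub>M PiM UNIV (\<lambda>_. borel)) ((\<lambda>(x, r). (rer x, r)) \<circ> (\<lambda>\<omega>. (X \<omega>, R \<omega>)))"
    unfolding j by (rule distr_distr) measurable
  also have "(\<lambda>(x, r). (rer x, r)) \<circ> (\<lambda>\<omega>. (X \<omega>, R \<omega>)) = (\<lambda>\<omega>. (\<xi> \<omega>, R \<omega>))" by (auto simp: x)
  finally show ?thesis ..
qed

lemma model_count_law:
  assumes A[measurable]: "A \<in> sets borel" and fin: "emeasure nu A \<noteq> \<top>"
  shows "measure M {\<omega>\<in>space M. seqcount A (\<xi> \<omega>) = n} = poi (enn2real (emeasure nu A)) n"
    and "AE \<omega> in M. finite {k. \<xi> \<omega> k \<in> A}"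
  using model_ppp A fin unfolding poisson_point_process_def seqcount_def poi_def by (auto simp: less_top)

lemma model_count_measurable: "A \<in> sets borel \<Longrightarrow> (\<lambda>\<omega>. seqcount A (\<xi> \<omega>)) \<in> M \<rightarrow>\<^sub>M count_space UNIV"
  using measurable_compose[OF model_xi_seq seqcount_measurable] .

lemma emeasure_xi_in:
  assumes A[measurable]: "A \<in> sets borel"
  shows "emeasure M {\<omega>\<in>space M. \<xi> \<omega> k \<in> A} = (\<integral>\<^sup>+\<omega>. indicator A (\<xi> \<omega> k) \<partial>M)"
proof -
  have "emeasure M {\<omega>\<in>space M. \<xi> \<omega> k \<in> A} = (\<integral>\<^sup>+\<omega>. indicator {\<omega>\<in>space M. \<xi> \<omega> k \<in> A} \<omega> \<partial>M)"
    by (rule nn_integral_indicator[symmetric]) measurable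
  also have "\<dots> = (\<integral>\<^sup>+\<omega>. indicator A (\<xi> \<omega> k) \<partial>M)"
    by (rule nn_integral_cong) (simp add: indicator_def)
  finally show ?thesis .
qed

text \<open>In an arbitrary model the explicit construction is not at hand; what the definition
  gives is the Poisson law of each count, and its mean is the mass of the set.\<close>

lemma Campbell_mean:
  assumes A[measurable]: "A \<in> sets borel" and fin: "emeasure nu A \<noteq> \<top>"
  shows "(\<Sum>k. emeasure M {\<omega>\<in>space M. \<xi> \<omega> k \<in> A}) = emeasure nu A"
proof -
  define r where "r = enn2real (emeasure nu A)"
  have r: "emeasure nu A = ennreal r" "0 \<le> r" using fin by (auto simp: r_def less_top)
  note model_count_measurable[OF A, measurable]
  have "(\<Sum>k. emeasure M {\<omega>\<in>space M. \<xi> \<omega> k \<in> A}) = (\<Sum>k. \<integral>\<^sup>+\<omega>. indicator A (\<xi> \<omega> k) \<partial>M)"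
    by (simp only: emeasure_xi_in[OF A])
  also have "\<dots> = (\<integral>\<^sup>+\<omega>. (\<Sum>k. indicator A (\<xi> \<omega> k)) \<partial>M)"
    by (rule nn_integral_suminf[symmetric]) measurable
  also have "\<dots> = (\<integral>\<^sup>+\<omega>. of_nat (seqcount A (\<xi> \<omega>)) \<partial>M)"
    by (rule nn_integral_cong_AE, use model_count_law(2)[OF A fin] in eventually_elim) (simp add: suminf_indicator_eq)
  also have "\<dots> = (\<integral>\<^sup>+\<omega>. (\<Sum>n. of_nat n * indicator {\<omega>\<in>space M. seqcount A (\<xi> \<omega>) = n} \<omega>) \<partial>M)"
  proof (rule nn_integral_cong)
    fix \<omega> assume "\<omega> \<in> space M"
    then have "(\<Sum>n. of_nat n * indicator {\<omega>\<in>space M. seqcount A (\<xi> \<omega>) = n} \<omega>) = (\<Sum>n\<in>{seqcount A (\<xi> \<omega>)}. of_nat n * indicator {\<omega>\<in>space M. seqcount A (\<xi> \<omega>) = n} \<omega> :: ennreal)"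
      by (intro suminf_finite) (auto simp: indicator_def)
    then show "of_nat (seqcount A (\<xi> \<omega>)) = (\<Sum>n. of_nat n * indicator {\<omega>\<in>space M. seqcount A (\<xi> \<omega>) = n} \<omega> :: ennreal)"
      using \<open>\<omega> \<in> space M\<close> by simp
  qed
  also have "\<dots> = (\<Sum>n. of_nat n * emeasure M {\<omega>\<in>space M. seqcount A (\<xi> \<omega>) = n})"
    by (subst nn_integral_suminf) (auto simp: nn_integral_cmult_indicator)
  also have "\<dots> = (\<Sum>n. ennreal (real n * poi r n))"
  proof (intro arg_cong[where f=suminf] ext)
    fix n
    have "0 \<le> poi r n" using r(2) by (simp add: poi_def)
    then show "of_nat n * emeasure M {\<omega>\<in>space M. seqcount A (\<xi> \<omega>) = n} = ennreal (real n * poi r n)"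
      by (simp add: M.emeasure_eq_measure model_count_law(1)[OF A fin, folded r_def] ennreal_of_nat_eq_real_of_nat ennreal_mult)
  qed
  also have "\<dots> = ennreal r"
  proof -
    have "(\<lambda>n. real (Suc n) * poi r (Suc n)) = (\<lambda>n. (r * exp (- r)) * (r ^ n /\<^sub>R fact n))"
      by (auto simp: fun_eq_iff poi_def fact_Suc field_simps simp del: of_nat_Suc)
    moreover have "(\<lambda>n. (r * exp (- r)) * (r ^ n /\<^sub>R fact n)) sums ((r * exp (- r)) * exp r)"
      by (intro sums_mult exp_converges)
    moreover have "(r * exp (- r)) * exp r = r" by (simp add: mult.assoc mult_exp_exp)
    ultimately have "(\<lambda>n. real (Suc n) * poi r (Suc n)) sums r" by (simp only:)
    then have "(\<lambda>n. real n * poi r n) sums r" by (subst (asm) sums_Suc_iff) simp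
    then show ?thesis using r(2) by (subst suminf_ennreal2) (auto simp: sums_iff poi_def)
  qed
  finally show ?thesis by (simp add: r)
qed

text \<open>Q is the mean measure of the process. It agrees with \<open>nu\<close> on sets of finite
  mass, and since \<open>nu\<close> is sigma-finite a countable partition extends this to all Borel
  sets.\<close>

lemma Campbell_ppp:
  assumes h[measurable]: "h \<in> borel_measurable borel"
  shows "(\<Sum>k. \<integral>\<^sup>+\<omega>. h (\<xi> \<omega> k) \<partial>M) = (\<integral>\<^sup>+x. h x \<partial>nu)"
proof -
  define Q where "Q = distr (count_space UNIV \<Otimes>\<^sub>M M) borel (\<lambda>(k, \<omega>). \<xi> \<omega> k)"
  have m: "(\<lambda>(k, \<omega>). \<xi> \<omega> k) \<in> borel_measurable (count_space UNIV \<Otimes>\<^sub>M M)"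
    by (rule measurable_pair_measure_countable1) auto
  have Q: "(\<integral>\<^sup>+x. g x \<partial>Q) = (\<Sum>k. \<integral>\<^sup>+\<omega>. g (\<xi> \<omega> k) \<partial>M)" if g: "g \<in> borel_measurable borel" for g
  proof -
    have "(\<integral>\<^sup>+x. g x \<partial>Q) = (\<integral>\<^sup>+x. g (case x of (k, \<omega>) \<Rightarrow> \<xi> \<omega> k) \<partial>(count_space UNIV \<Otimes>\<^sub>M M))"
      unfolding Q_def by (rule nn_integral_distr[OF m]) (use g in simp)
    also have "\<dots> = (\<integral>\<^sup>+k. \<integral>\<^sup>+\<omega>. g (\<xi> \<omega> k) \<partial>M \<partial>count_space UNIV)"
      using measurable_compose[OF m g] by (subst M.nn_integral_fst[symmetric]) auto
    finally show ?thesis by (simp add: nn_integral_count_space_nat)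
  qed
  have em: "emeasure Q A = (\<Sum>k. emeasure M {\<omega>\<in>space M. \<xi> \<omega> k \<in> A})" if A[measurable]: "A \<in> sets borel" for A
  proof -
    have "emeasure Q A = (\<integral>\<^sup>+x. indicator A x \<partial>Q)" by (rule nn_integral_indicator[symmetric]) (simp add: Q_def)
    also have "\<dots> = (\<Sum>k. \<integral>\<^sup>+\<omega>. indicator A (\<xi> \<omega> k) \<partial>M)" by (rule Q) measurable
    also have "\<dots> = (\<Sum>k. emeasure M {\<omega>\<in>space M. \<xi> \<omega> k \<in> A})"
      by (simp only: emeasure_xi_in[OF A])
    finally show ?thesis .
  qed
  interpret N: sigma_finite_measure nu by (rule sigma_finite_nu)
  obtain D :: "nat \<Rightarrow> real set" where D: "range D \<subseteq> sets nu" "(\<Union>i. D i) = space nu" "\<And>i. emeasure nu (D i) \<noteq> \<infinity>" "disjoint_family D"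
    using N.sigma_finite_disjoint by metis
  have Ds: "D i \<in> sets borel" for i using D(1) by auto
  have "Q = nu"
  proof (rule measure_eqI)
    fix A assume "A \<in> sets Q"
    then have A: "A \<in> sets borel" by (simp add: Q_def)
    have u: "(\<Union>i. A \<inter> D i) = A" using D(2) by auto
    have dj: "disjoint_family (\<lambda>i. A \<inter> D i)" using D(4) by (auto simp: disjoint_family_on_def)
    have "emeasure Q A = (\<Sum>i. emeasure Q (A \<inter> D i))"
      by (subst u[symmetric], rule suminf_emeasure[symmetric]) (use A Ds dj in \<open>auto simp: Q_def\<close>)
    also have "\<dots> = (\<Sum>i. emeasure nu (A \<inter> D i))"
    proof (intro arg_cong[where f=suminf] ext)
      fix i
      have "emeasure nu (A \<inter> D i) \<le> emeasure nu (D i)" by (intro emeasure_mono) (use Ds in auto)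
      then have fin: "emeasure nu (A \<inter> D i) \<noteq> \<top>" using D(3)[of i] by (auto simp: top_unique)
      have AD: "A \<inter> D i \<in> sets borel" using A Ds by auto
      show "emeasure Q (A \<inter> D i) = emeasure nu (A \<inter> D i)"
        by (simp only: em[OF AD] Campbell_mean[OF AD fin])
    qed
    also have "\<dots> = emeasure nu A"
      by (subst (2) u[symmetric], rule suminf_emeasure) (use A Ds dj in auto)
    finally show "emeasure Q A = emeasure nu A" .
  qed (simp add: Q_def)
  then show ?thesis using Q[OF h] by simp
qed

text \<open>The definition constrains the values of the enumeration through counts only. As
  \<open>nu\<close> does not charge \<open>{..0}\<close>, the expected number of entries there is
  0.\<close>

lemma AE_xi_pos: "AE \<omega> in M. \<forall>k. 0 < \<xi> \<omega> k"
proof -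
  have "(\<Sum>k. \<integral>\<^sup>+\<omega>. indicator {..0} (\<xi> \<omega> k) \<partial>M) = (\<integral>\<^sup>+x. indicator {..0} x \<partial>nu)"
    by (rule Campbell_ppp) measurable
  also have "\<dots> = 0"
    by (subst nn_integral_0_iff_AE) (use AE_nu_pos in \<open>auto elim!: eventually_mono simp: indicator_def\<close>)
  finally have "(\<integral>\<^sup>+\<omega>. indicator {..0} (\<xi> \<omega> k) \<partial>M) = 0" for k by (simp add: suminf_eq_zero_iff)
  then have "AE \<omega> in M. indicator {..0} (\<xi> \<omega> k) = (0 :: ennreal)" for k
    by (subst (asm) nn_integral_0_iff_AE) auto
  then have "AE \<omega> in M. \<forall>k. indicator {..0} (\<xi> \<omega> k) = (0 :: ennreal)" by (simp add: AE_all_countable)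
  then show ?thesis by eventually_elim (auto simp: indicator_def not_le split: if_splits)
qed

lemma expectation_single:
  assumes H: "(\<lambda>(x, r). H x r) \<in> borel_measurable (borel \<Otimes>\<^sub>M \<mu>)"
  shows "(\<integral>\<^sup>+\<omega>. H (\<xi> \<omega> k) (R \<omega> k) \<partial>M) = (\<integral>\<^sup>+\<omega>. \<integral>\<^sup>+r. H (\<xi> \<omega> k) r \<partial>\<mu> \<partial>M)"
proof -
  note s\<mu>[measurable_cong]
  note model_xi_seq[measurable] model_R_seq[measurable]
  have Hm[measurable (raw)]: "(\<lambda>x. H (f x) (g x)) \<in> borel_measurable Q"
    if "f \<in> Q \<rightarrow>\<^sub>M borel" "g \<in> Q \<rightarrow>\<^sub>M \<mu>" for f g and Q :: "'q measure"
    using measurable_compose[OF measurable_Pair[OF that] H] by simp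
  have mH: "(\<lambda>x. \<integral>\<^sup>+r. H (x k) r \<partial>\<mu>) \<in> borel_measurable (distr M (PiM UNIV (\<lambda>_. borel)) \<xi>)" by measurable
  have Hb: "(\<lambda>n. H (fst n k) (snd n k)) \<in> borel_measurable (PiM UNIV (\<lambda>_. borel) \<Otimes>\<^sub>M PiM UNIV (\<lambda>_. borel))"
  proof (rule Hm)
    show "(\<lambda>n. fst n k) \<in> borel_measurable (PiM UNIV (\<lambda>_. borel) \<Otimes>\<^sub>M PiM UNIV (\<lambda>_. borel))"
      by (rule measurable_compose[OF measurable_fst measurable_component_singleton]) simp
    show "(\<lambda>n. snd n k) \<in> PiM UNIV (\<lambda>_. borel) \<Otimes>\<^sub>M PiM UNIV (\<lambda>_. borel) \<rightarrow>\<^sub>M \<mu>"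
      by (subst measurable_cong_sets[OF refl s\<mu>])
         (rule measurable_compose[OF measurable_snd measurable_component_singleton], simp)
  qed
  have Hb': "(\<lambda>n. H (fst n k) (snd n k)) \<in> borel_measurable (XM \<Otimes>\<^sub>M PiM UNIV (\<lambda>_. \<mu>))"
    unfolding model_joint[symmetric] using Hb by simp
  have "(\<integral>\<^sup>+\<omega>. H (\<xi> \<omega> k) (R \<omega> k) \<partial>M) = (\<integral>\<^sup>+n. H (fst n k) (snd n k) \<partial>(XM \<Otimes>\<^sub>M PiM UNIV (\<lambda>_. \<mu>)))"
    unfolding model_joint[symmetric] using Hb by (subst nn_integral_distr) auto
  also have "\<dots> = (\<integral>\<^sup>+x. \<integral>\<^sup>+r. H (x k) (r k) \<partial>PiM UNIV (\<lambda>_. \<mu>) \<partial>XM)"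
    by (subst P.nn_integral_fst[OF Hb', symmetric]) simp
  also have "\<dots> = (\<integral>\<^sup>+x. \<integral>\<^sup>+r. H (x k) r \<partial>\<mu> \<partial>XM)"
  proof (rule nn_integral_cong)
    fix x
    have "(\<integral>\<^sup>+r. H (x k) (r k) \<partial>PiM UNIV (\<lambda>_. \<mu>)) = (\<integral>\<^sup>+r. H (x k) r \<partial>distr (PiM UNIV (\<lambda>_. \<mu>)) \<mu> (\<lambda>r. r k))"
      by (rule nn_integral_distr[symmetric]) measurable
    also have "distr (PiM UNIV (\<lambda>_. \<mu>)) \<mu> (\<lambda>r. r k) = \<mu>" by (rule distr_PiM_component) (auto intro: \<mu>)
    finally show "(\<integral>\<^sup>+r. H (x k) (r k) \<partial>PiM UNIV (\<lambda>_. \<mu>)) = (\<integral>\<^sup>+r. H (x k) r \<partial>\<mu>)" .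
  qed
  also have "\<dots> = (\<integral>\<^sup>+\<omega>. \<integral>\<^sup>+r. H (\<xi> \<omega> k) r \<partial>\<mu> \<partial>M)"
    by (rule nn_integral_distr[OF model_xi_seq mH])
  finally show ?thesis .
qed

text \<open>The argument of \<open>AE_real_sum_finite\<close>, run with \<open>Campbell_ppp\<close>
  in place of the Mecke formula.\<close>

lemma AE_model_summable:
  assumes A: "amom \<mu> cmod \<noteq> \<top>"
  shows "AE \<omega> in M. (\<Sum>k. ennreal (norm (complex_of_real (\<xi> \<omega> k) * R \<omega> k))) \<noteq> \<top>"
proof -
  note s\<mu>[measurable_cong]
  interpret N: sigma_finite_measure nu by (rule sigma_finite_nu)
  interpret NU: pair_sigma_finite nu \<mu> ..
  define H where "H x r = ennreal (min (x * cmod r) ((x * cmod r) powr (a/2)))" for x r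
  have Hm[measurable]: "(\<lambda>(x, r). H x r) \<in> borel_measurable (borel \<Otimes>\<^sub>M \<mu>)"
    unfolding H_def case_prod_beta' by measurable
  have Hm'[measurable (raw)]: "(\<lambda>x. H (f x) (g x)) \<in> borel_measurable Q"
    if "f \<in> Q \<rightarrow>\<^sub>M borel" "g \<in> Q \<rightarrow>\<^sub>M \<mu>" for f g and Q :: "'q measure"
    using measurable_compose[OF measurable_Pair[OF that] Hm] by simp
  have Hmn: "(\<lambda>(x, r). H x r) \<in> borel_measurable (nu \<Otimes>\<^sub>M \<mu>)"
    using Hm by (simp cong: measurable_cong_sets)
  have Rm[measurable]: "(\<lambda>\<omega>. R \<omega> k) \<in> M \<rightarrow>\<^sub>M \<mu>" for k
    using model_R by (simp add: s\<mu> cong: measurable_cong_sets)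
  have "(\<integral>\<^sup>+\<omega>. (\<Sum>k. H (\<xi> \<omega> k) (R \<omega> k)) \<partial>M) = (\<Sum>k. \<integral>\<^sup>+\<omega>. \<integral>\<^sup>+r. H (\<xi> \<omega> k) r \<partial>\<mu> \<partial>M)"
    by (subst nn_integral_suminf) (auto simp: expectation_single[OF Hm])
  also have "\<dots> = (\<integral>\<^sup>+x. \<integral>\<^sup>+r. H x r \<partial>\<mu> \<partial>nu)"
    by (rule Campbell_ppp) measurable
  also have "\<dots> = (\<integral>\<^sup>+r. \<integral>\<^sup>+x. H x r \<partial>nu \<partial>\<mu>)"
    by (rule NU.Fubini'[symmetric, OF Hmn])
  also have "\<dots> \<le> (\<integral>\<^sup>+r. ennreal ((a / (1 - a) + a / (a - a/2)) * cmod r powr a) \<partial>\<mu>)"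
    unfolding H_def using a_pos by (intro nn_integral_mono powr_nu_bound) auto
  also have "\<dots> = ennreal (a / (1 - a) + a / (a - a/2)) * amom \<mu> cmod"
    using a_pos a_less unfolding amom_def by (subst nn_integral_cmult[symmetric]) (auto simp: ennreal_mult)
  also have "\<dots> < \<top>" using A by (simp add: ennreal_mult_less_top less_top)
  finally have "AE \<omega> in M. (\<Sum>k. H (\<xi> \<omega> k) (R \<omega> k)) \<noteq> \<infinity>" by (intro nn_integral_PInf_AE) auto
  with AE_xi_pos show ?thesis
  proof eventually_elim
    case (elim \<omega>)
    have t: "norm (complex_of_real (\<xi> \<omega> k) * R \<omega> k) = \<xi> \<omega> k * cmod (R \<omega> k)" for k
      using elim(1) by (simp add: norm_mult abs_of_pos)
    show ?case unfolding t
      by (rule suminf_min_powr_finite[of _ "a/2"])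
         (use elim a_pos a_less in \<open>auto simp: H_def less_imp_le\<close>)
  qed
qed

end

section \<open>The law of the sum does not depend on the model\<close>


declare model_R [measurable del] model_xi [measurable del]

text \<open>Averaging over the mark of a point in cell i gives the factor \<open>cell_char\<close>,
  and a point outside all cells gives 1. The averaged product therefore sees the weights through the
  cell counts alone, and \<open>quant_char\<close> refers to no particular model.\<close>

definition cell_char :: "complex measure \<Rightarrow> nat \<Rightarrow> complex \<Rightarrow> nat \<Rightarrow> complex" where
  "cell_char \<mu> n t i = (CLINT r|\<mu>. iexp (inner t (cellval n i *\<^sub>R r)))"
definition cell_phase :: "nat \<Rightarrow> complex \<Rightarrow> real \<Rightarrow> complex \<Rightarrow> complex" where
  "cell_phase n t x r = iexp (inner t (quant n x *\<^sub>R r))"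
definition mean_phase :: "complex measure \<Rightarrow> nat \<Rightarrow> complex \<Rightarrow> real \<Rightarrow> complex" where
  "mean_phase \<mu> n t x = (\<Prod>i<ncell n. if x \<in> cell n i then cell_char \<mu> n t i else 1)"
definition count_law :: "real set \<Rightarrow> nat measure" where
  "count_law A = distr Xi (count_space UNIV) (seqcount A)"
definition quant_char :: "complex measure \<Rightarrow> nat \<Rightarrow> complex \<Rightarrow> complex" where
  "quant_char \<mu> n t = (\<Prod>i<ncell n. \<integral>m. cell_char \<mu> n t i ^ m \<partial>count_law (cell n i))"

lemma measurable_cell_phase [measurable (raw)]:
  assumes [measurable]: "f \<in> borel_measurable M" "g \<in> borel_measurable M"
  shows "(\<lambda>x. cell_phase n t (f x) (g x)) \<in> borel_measurable M"
  unfolding cell_phase_def by measurable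

lemma measurable_mean_phase [measurable]: "mean_phase \<mu> n t \<in> borel_measurable borel"
  unfolding mean_phase_def by measurable

lemma norm_cell_phase: "norm (cell_phase n t x r) = 1"
  by (simp add: cell_phase_def)

context
  fixes M :: "'a measure" and \<xi> :: "'a \<Rightarrow> nat \<Rightarrow> real" and R :: "'a \<Rightarrow> nat \<Rightarrow> complex" and \<mu> :: "complex measure"
  assumes model: "rde_model nu M \<xi> R \<mu>" and \<mu>: "prob_space \<mu>" and s\<mu>: "sets \<mu> = sets borel"
begin

interpretation M: prob_space M by (rule model_prob[OF model \<mu> s\<mu>])
interpretation P: prob_space "PiM UNIV (\<lambda>_::nat. \<mu>)" by (intro prob_space_PiM \<mu>)
interpretation U: prob_space \<mu> by (rule \<mu>)

lemmas model_measurable [measurable] = model_R[OF model \<mu> s\<mu>] model_xi[OF model \<mu> s\<mu>]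

lemma norm_cell_char: "norm (cell_char \<mu> n t i) \<le> 1"
proof -
  have "norm (cell_char \<mu> n t i) \<le> (LINT r|\<mu>. norm (iexp (inner t (cellval n i *\<^sub>R r))))"
    unfolding cell_char_def by (rule integral_norm_bound)
  then show ?thesis using U.prob_space by simp
qed

lemma norm_mean_phase: "norm (mean_phase \<mu> n t x) \<le> 1"
  unfolding mean_phase_def prod_norm[symmetric] by (rule prod_le_1) (auto simp: norm_cell_char)

lemma expectation_cell_phase: "(CLINT r|\<mu>. cell_phase n t x r) = mean_phase \<mu> n t x"
proof (cases "\<exists>i<ncell n. x \<in> cell n i")
  case True
  then obtain i where i: "i < ncell n" "x \<in> cell n i" by auto
  have "mean_phase \<mu> n t x = (\<Prod>j\<in>{i}. if x \<in> cell n j then cell_char \<mu> n t j else 1)"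
    unfolding mean_phase_def using i cell_disjoint by (intro prod.mono_neutral_right) auto
  then show ?thesis using i by (simp add: cell_phase_def quant_eq[OF i(2,1)] cell_char_def)
next
  case False
  then have "quant n x = 0" by (intro quant_eq_0) auto
  moreover have "mean_phase \<mu> n t x = 1" using False unfolding mean_phase_def by (intro prod.neutral) auto
  ultimately show ?thesis using U.prob_space by (simp add: cell_phase_def)
qed

lemma coordinates_indep: "P.indep_vars (\<lambda>_. borel) (\<lambda>k r. r k) UNIV"
proof -
  note s\<mu>[measurable_cong]
  have law: "distr (PiM UNIV (\<lambda>_::nat. \<mu>)) borel (\<lambda>r. r k) = \<mu>" for k
  proof -
    have "distr (PiM UNIV (\<lambda>_::nat. \<mu>)) borel (\<lambda>r. r k) = distr (PiM UNIV (\<lambda>_. \<mu>)) \<mu> (\<lambda>r. r k)"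
      by (rule distr_cong) (auto simp: s\<mu>)
    also have "\<dots> = \<mu>" by (rule distr_PiM_component) (auto intro: \<mu>)
    finally show ?thesis .
  qed
  have "distr (PiM UNIV (\<lambda>_::nat. \<mu>)) (PiM UNIV (\<lambda>_. borel)) (\<lambda>r. r) = PiM UNIV (\<lambda>_. \<mu>)"
    by (rule trans[OF distr_cong[OF refl sets_PiM_mu'[OF model \<mu> s\<mu>, symmetric] refl] distr_id])
  moreover have "(\<lambda>r. r k) \<in> borel_measurable (PiM UNIV (\<lambda>_::nat. \<mu>))" for k by measurable
  ultimately show ?thesis
    by (subst P.indep_vars_iff_distr_eq_PiM') (auto simp: law restrict_def)
qed

text \<open>By Fubini for the joint law the weights may be frozen while the independent marks are
  averaged one factor at a time. Finitely many factors are kept so that the product rule for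
  independent variables applies.\<close>

lemma expectation_prod:
  "(CLINT \<omega>|M. \<Prod>k<N. cell_phase n t (\<xi> \<omega> k) (R \<omega> k)) = (CLINT \<omega>|M. \<Prod>k<N. mean_phase \<mu> n t (\<xi> \<omega> k))"
proof -
  let ?B = "PiM UNIV (\<lambda>_. borel) \<Otimes>\<^sub>M PiM UNIV (\<lambda>_. borel) :: ((nat \<Rightarrow> real) \<times> (nat \<Rightarrow> complex)) measure"
  let ?X = "distr M (PiM UNIV (\<lambda>_. borel)) \<xi>"
  note s\<mu>[measurable_cong]
  note xs[measurable] = model_xi_seq[OF model \<mu> s\<mu>] and rs[measurable] = model_R_seq[OF model \<mu> s\<mu>]
  interpret X: prob_space ?X by (rule M.prob_space_distr) measurable
  interpret XP: pair_prob_space ?X "PiM UNIV (\<lambda>_::nat. \<mu>)" ..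
  have j: "distr M ?B (\<lambda>\<omega>. (\<xi> \<omega>, R \<omega>)) = ?X \<Otimes>\<^sub>M PiM UNIV (\<lambda>_. \<mu>)" by (rule model_joint[OF model \<mu> s\<mu>])
  define G where "G m = (\<Prod>k<N. cell_phase n t (fst m k) (snd m k))" for m :: "(nat \<Rightarrow> real) \<times> (nat \<Rightarrow> complex)"
  have f: "(\<lambda>m. fst m k) \<in> borel_measurable ?B" "(\<lambda>m. snd m k) \<in> borel_measurable ?B" for k
    using measurable_compose[OF measurable_fst measurable_component_singleton, of k UNIV "\<lambda>_. borel" "PiM UNIV (\<lambda>_. borel)"]
      measurable_compose[OF measurable_snd measurable_component_singleton, of k UNIV "PiM UNIV (\<lambda>_. borel)" "\<lambda>_. borel"] by simp_all
  have G: "G \<in> borel_measurable ?B" unfolding G_def using f by measurable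
  have nG: "norm (G m) = 1" for m by (simp add: G_def prod_norm[symmetric] norm_cell_phase)
  have G': "G \<in> borel_measurable (?X \<Otimes>\<^sub>M PiM UNIV (\<lambda>_. \<mu>))"
    unfolding j[symmetric] using G by simp
  have iG: "integrable (?X \<Otimes>\<^sub>M PiM UNIV (\<lambda>_. \<mu>)) G"
    by (rule XP.integrable_const_bound[of _ 1]) (use nG G' in auto)
  have "(CLINT \<omega>|M. \<Prod>k<N. cell_phase n t (\<xi> \<omega> k) (R \<omega> k)) = (\<integral>\<omega>. G (\<xi> \<omega>, R \<omega>) \<partial>M)" by (simp add: G_def)
  also have "\<dots> = (\<integral>m. G m \<partial>(?X \<Otimes>\<^sub>M PiM UNIV (\<lambda>_. \<mu>)))"
    unfolding j[symmetric] using G by (subst integral_distr) auto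
  also have "\<dots> = (\<integral>x. (\<integral>r. G (x, r) \<partial>PiM UNIV (\<lambda>_. \<mu>)) \<partial>?X)"
    by (rule XP.integral_fst'[OF iG, symmetric])
  also have "\<dots> = (\<integral>x. (\<Prod>k<N. mean_phase \<mu> n t (x k)) \<partial>?X)"
  proof (rule Bochner_Integration.integral_cong[OF refl])
    fix x :: "nat \<Rightarrow> real"
    have ind: "P.indep_vars (\<lambda>_. borel) (\<lambda>k r. cell_phase n t (x k) (r k)) {..<N}"
      by (rule P.indep_vars_compose2[OF P.indep_vars_subset[OF coordinates_indep]]) auto
    have mk: "(\<lambda>r. r k) \<in> borel_measurable (PiM UNIV (\<lambda>_::nat. \<mu>))" for k by measurable
    have "(\<integral>r. G (x, r) \<partial>PiM UNIV (\<lambda>_. \<mu>)) = (\<Prod>k<N. \<integral>r. cell_phase n t (x k) (r k) \<partial>PiM UNIV (\<lambda>_. \<mu>))"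
      unfolding G_def fst_conv snd_conv
      by (rule P.indep_vars_lebesgue_integral[OF _ ind]) (auto intro!: P.integrable_const_bound[of _ 1] measurable_cell_phase mk simp: norm_cell_phase)
    also have "\<dots> = (\<Prod>k<N. mean_phase \<mu> n t (x k))"
    proof (rule prod.cong[OF refl])
      fix k
      have "(\<integral>r. cell_phase n t (x k) (r k) \<partial>PiM UNIV (\<lambda>_. \<mu>)) = (\<integral>r. cell_phase n t (x k) r \<partial>distr (PiM UNIV (\<lambda>_. \<mu>)) \<mu> (\<lambda>r. r k))"
        by (rule integral_distr[symmetric]) measurable
      also have "distr (PiM UNIV (\<lambda>_. \<mu>)) \<mu> (\<lambda>r. r k) = \<mu>" by (rule distr_PiM_component) (auto intro: \<mu>)
      finally show "(\<integral>r. cell_phase n t (x k) (r k) \<partial>PiM UNIV (\<lambda>_. \<mu>)) = mean_phase \<mu> n t (x k)" by (simp add: expectation_cell_phase)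
    qed
    finally show "(\<integral>r. G (x, r) \<partial>PiM UNIV (\<lambda>_. \<mu>)) = (\<Prod>k<N. mean_phase \<mu> n t (x k))" .
  qed
  also have "\<dots> = (CLINT \<omega>|M. \<Prod>k<N. mean_phase \<mu> n t (\<xi> \<omega> k))"
    by (rule integral_distr) measurable
  finally show ?thesis .
qed

definition quant_sum :: "nat \<Rightarrow> 'a \<Rightarrow> complex" where
  "quant_sum n \<omega> = (\<Sum>k. quant n (\<xi> \<omega> k) *\<^sub>R R \<omega> k)"

lemma AE_cells_finite: "AE \<omega> in M. \<forall>i<ncell n. finite {k. \<xi> \<omega> k \<in> cell n i}"
proof -
  have "AE \<omega> in M. \<forall>i\<in>{..<ncell n}. finite {k. \<xi> \<omega> k \<in> cell n i}"
    by (intro AE_finite_allI model_count_law(2)[OF model \<mu> s\<mu>] cell_finite cell_measurable) auto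
  then show ?thesis by eventually_elim auto
qed

text \<open>Only finitely many points lie in the cells, so beyond some index all factors are 1 and
  both products are eventually constant. Sorting the averaged product by cells produces powers with
  the counts as exponents.\<close>

lemma products_stabilise:
  assumes fin: "\<forall>i<ncell n. finite {k. \<xi> \<omega> k \<in> cell n i}"
  shows "(\<lambda>N. \<Prod>k<N. cell_phase n t (\<xi> \<omega> k) (R \<omega> k)) \<longlonglongrightarrow> iexp (inner t (quant_sum n \<omega>))"
    and "(\<lambda>N. \<Prod>k<N. mean_phase \<mu> n t (\<xi> \<omega> k)) \<longlonglongrightarrow> (\<Prod>i<ncell n. cell_char \<mu> n t i ^ seqcount (cell n i) (\<xi> \<omega>))"
proof -
  have "finite (\<Union>i<ncell n. {k. \<xi> \<omega> k \<in> cell n i})" using fin by auto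
  then obtain N0 where N0: "(\<Union>i<ncell n. {k. \<xi> \<omega> k \<in> cell n i}) \<subseteq> {..<N0}"
    by (metis finite_nat_iff_bounded)
  then have out: "\<xi> \<omega> k \<notin> cell n i" if "i < ncell n" "N0 \<le> k" for i k using that by fastforce
  have q0: "quant n (\<xi> \<omega> k) = 0" if "N0 \<le> k" for k using out[OF _ that] by (intro quant_eq_0) auto
  have X: "quant_sum n \<omega> = (\<Sum>k<N. quant n (\<xi> \<omega> k) *\<^sub>R R \<omega> k)" if "N0 \<le> N" for N
    unfolding quant_sum_def using that q0 by (intro suminf_finite) auto
  have "(\<Prod>k<N. cell_phase n t (\<xi> \<omega> k) (R \<omega> k)) = iexp (inner t (quant_sum n \<omega>))" if "N0 \<le> N" for N
    unfolding X[OF that] cell_phase_def inner_sum_right by (rule iexp_sum[symmetric]) simp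
  then show "(\<lambda>N. \<Prod>k<N. cell_phase n t (\<xi> \<omega> k) (R \<omega> k)) \<longlonglongrightarrow> iexp (inner t (quant_sum n \<omega>))"
    by (intro tendsto_eventually) (auto simp: eventually_sequentially)
  have "(\<Prod>k<N. mean_phase \<mu> n t (\<xi> \<omega> k)) = (\<Prod>i<ncell n. cell_char \<mu> n t i ^ seqcount (cell n i) (\<xi> \<omega>))" if "N0 \<le> N" for N
  proof -
    have "(\<Prod>k<N. mean_phase \<mu> n t (\<xi> \<omega> k)) = (\<Prod>i<ncell n. \<Prod>k<N. if \<xi> \<omega> k \<in> cell n i then cell_char \<mu> n t i else 1)"
      unfolding mean_phase_def by (rule prod.swap)
    also have "\<dots> = (\<Prod>i<ncell n. cell_char \<mu> n t i ^ seqcount (cell n i) (\<xi> \<omega>))"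
    proof (rule prod.cong[OF refl])
      fix i assume i: "i \<in> {..<ncell n}"
      have e: "{k\<in>{..<N}. \<xi> \<omega> k \<in> cell n i} = {k. \<xi> \<omega> k \<in> cell n i}"
        using out[of i] i that by (auto simp: not_le[symmetric])
      have "(\<Prod>k<N. if \<xi> \<omega> k \<in> cell n i then cell_char \<mu> n t i else 1) = (\<Prod>k\<in>{k\<in>{..<N}. \<xi> \<omega> k \<in> cell n i}. cell_char \<mu> n t i)"
        by (rule prod.inter_filter[symmetric]) simp
      then show "(\<Prod>k<N. if \<xi> \<omega> k \<in> cell n i then cell_char \<mu> n t i else 1) = cell_char \<mu> n t i ^ seqcount (cell n i) (\<xi> \<omega>)"
        unfolding e by (simp add: seqcount_def)
    qed
    finally show ?thesis .
  qed
  then show "(\<lambda>N. \<Prod>k<N. mean_phase \<mu> n t (\<xi> \<omega> k)) \<longlonglongrightarrow> (\<Prod>i<ncell n. cell_char \<mu> n t i ^ seqcount (cell n i) (\<xi> \<omega>))"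
    by (intro tendsto_eventually) (auto simp: eventually_sequentially)
qed

lemma distr_count: 
  assumes A: "A \<in> sets borel" and fin: "emeasure nu A \<noteq> \<top>"
  shows "distr M (count_space UNIV) (\<lambda>\<omega>. seqcount A (\<xi> \<omega>)) = count_law A"
proof (rule measure_eqI_countable[of _ UNIV])
  interpret X: prob_space Xi by (rule prob_space_Xi)
  fix m :: nat
  have c: "(\<lambda>\<omega>. seqcount A (\<xi> \<omega>)) \<in> M \<rightarrow>\<^sub>M count_space UNIV" by (rule model_count_measurable[OF model \<mu> s\<mu> A])
  have c': "seqcount A \<in> Xi \<rightarrow>\<^sub>M count_space UNIV"
    using seqcount_measurable[OF A] by (simp cong: measurable_cong_sets)
  have "measure M {\<omega>\<in>space M. seqcount A (\<xi> \<omega>) = m} = poi (enn2real (emeasure nu A)) m"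
    by (rule model_count_law(1)[OF model \<mu> s\<mu> A fin])
  moreover have "measure Xi {x. seqcount A x = m} = poi (enn2real (emeasure nu A)) m"
    using Xi_joint[of "{0}" "\<lambda>_. A" "\<lambda>_. m"] A fin by (simp add: disjoint_family_on_def)
  ultimately show "emeasure (distr M (count_space UNIV) (\<lambda>\<omega>. seqcount A (\<xi> \<omega>))) {m} = emeasure (count_law A) {m}"
    unfolding count_law_def using c c'
    by (simp add: emeasure_distr M.emeasure_eq_measure X.emeasure_eq_measure vimage_def Int_def conj_commute)
qed (auto simp: count_law_def)

text \<open>Here the independence of counts in disjoint sets enters. The individual count laws
  depend on \<open>nu\<close> alone, so they can be computed under \<open>Xi\<close>.\<close>

lemma expectation_counts:
  "(CLINT \<omega>|M. \<Prod>i<ncell n. cell_char \<mu> n t i ^ seqcount (cell n i) (\<xi> \<omega>)) = quant_char \<mu> n t"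
proof -
  have c: "(\<lambda>\<omega>. seqcount (cell n i) (\<xi> \<omega>)) \<in> M \<rightarrow>\<^sub>M count_space UNIV" for i by (rule model_count_measurable[OF model \<mu> s\<mu> cell_measurable])
  have "disjoint_family_on (cell n) {..<ncell n}" using cell_disjoint by (auto simp: disjoint_family_on_def)
  then have "M.indep_vars (\<lambda>_. count_space UNIV) (\<lambda>i \<omega>. seqcount (cell n i) (\<xi> \<omega>)) {..<ncell n}"
    using model_ppp[OF model \<mu> s\<mu>] cell_finite unfolding poisson_point_process_def seqcount_def by (auto simp: less_top)
  then have ind: "M.indep_vars (\<lambda>_. borel) (\<lambda>i \<omega>. cell_char \<mu> n t i ^ seqcount (cell n i) (\<xi> \<omega>)) {..<ncell n}"
    by (rule M.indep_vars_compose2) auto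
  have b: "norm (cell_char \<mu> n t i ^ m) \<le> 1" for i m by (simp add: norm_power power_le_one norm_cell_char)
  have "(CLINT \<omega>|M. \<Prod>i<ncell n. cell_char \<mu> n t i ^ seqcount (cell n i) (\<xi> \<omega>)) = (\<Prod>i<ncell n. CLINT \<omega>|M. cell_char \<mu> n t i ^ seqcount (cell n i) (\<xi> \<omega>))"
  proof (rule M.indep_vars_lebesgue_integral[OF _ ind])
    fix i
    have "(\<lambda>\<omega>. cell_char \<mu> n t i ^ seqcount (cell n i) (\<xi> \<omega>)) \<in> borel_measurable M"
      by (rule measurable_compose[OF c]) simp
    then show "integrable M (\<lambda>\<omega>. cell_char \<mu> n t i ^ seqcount (cell n i) (\<xi> \<omega>))"
      by (rule M.integrable_const_bound[of _ 1, rotated]) (use b in auto)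
  qed simp
  also have "\<dots> = quant_char \<mu> n t"
    unfolding quant_char_def
  proof (rule prod.cong[OF refl])
    fix i
    have "(CLINT \<omega>|M. cell_char \<mu> n t i ^ seqcount (cell n i) (\<xi> \<omega>)) = (\<integral>m. cell_char \<mu> n t i ^ m \<partial>distr M (count_space UNIV) (\<lambda>\<omega>. seqcount (cell n i) (\<xi> \<omega>)))"
      by (rule integral_distr[symmetric, OF c]) simp
    then show "(CLINT \<omega>|M. cell_char \<mu> n t i ^ seqcount (cell n i) (\<xi> \<omega>)) = (\<integral>m. cell_char \<mu> n t i ^ m \<partial>count_law (cell n i))"
      by (simp add: distr_count[OF cell_measurable cell_finite])
  qed
  finally show ?thesis .
qed

lemma measurable_quant_sum [measurable]: "quant_sum n \<in> borel_measurable M"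
  unfolding quant_sum_def[abs_def] by measurable

text \<open>The identity for finite products passes to the limit because all products are bounded by
  1 in modulus.\<close>

lemma char_quant_sum: "(CLINT \<omega>|M. iexp (inner t (quant_sum n \<omega>))) = quant_char \<mu> n t"
proof -
  have c: "(\<lambda>\<omega>. cell_char \<mu> n t i ^ seqcount (cell n i) (\<xi> \<omega>)) \<in> borel_measurable M" for i
    by (rule measurable_compose[OF model_count_measurable[OF model \<mu> s\<mu> cell_measurable]]) simp
  have "(\<lambda>N. CLINT \<omega>|M. \<Prod>k<N. cell_phase n t (\<xi> \<omega> k) (R \<omega> k)) \<longlonglongrightarrow> (CLINT \<omega>|M. iexp (inner t (quant_sum n \<omega>)))"
  proof (rule integral_dominated_convergence[where w="\<lambda>_. 1"])
    show "AE \<omega> in M. (\<lambda>N. \<Prod>k<N. cell_phase n t (\<xi> \<omega> k) (R \<omega> k)) \<longlonglongrightarrow> iexp (inner t (quant_sum n \<omega>))"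
      using AE_cells_finite by eventually_elim (rule products_stabilise(1))
  qed (auto simp: prod_norm[symmetric] norm_cell_phase)
  moreover have "(\<lambda>N. CLINT \<omega>|M. \<Prod>k<N. mean_phase \<mu> n t (\<xi> \<omega> k)) \<longlonglongrightarrow> (CLINT \<omega>|M. \<Prod>i<ncell n. cell_char \<mu> n t i ^ seqcount (cell n i) (\<xi> \<omega>))"
  proof (rule integral_dominated_convergence[where w="\<lambda>_. 1"])
    show "AE \<omega> in M. (\<lambda>N. \<Prod>k<N. mean_phase \<mu> n t (\<xi> \<omega> k)) \<longlonglongrightarrow> (\<Prod>i<ncell n. cell_char \<mu> n t i ^ seqcount (cell n i) (\<xi> \<omega>))"
      using AE_cells_finite by eventually_elim (rule products_stabilise(2))
    show "AE \<omega> in M. norm (\<Prod>k<N. mean_phase \<mu> n t (\<xi> \<omega> k)) \<le> 1" for N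
      by (auto simp: prod_norm[symmetric] intro!: prod_le_1 norm_mean_phase)
  qed (use c in auto)
  ultimately show ?thesis
    unfolding expectation_prod expectation_counts by (rule LIMSEQ_unique)
qed

text \<open>Rounding down keeps each weight below its original value, so the absolutely convergent
  series itself dominates the quantised ones.\<close>

lemma char_sum_limit:
  assumes A: "amom \<mu> cmod \<noteq> \<top>"
  shows "(\<lambda>n. quant_char \<mu> n t) \<longlonglongrightarrow> (CLINT \<omega>|M. iexp (inner t (\<Sum>k. complex_of_real (\<xi> \<omega> k) * R \<omega> k)))"
  unfolding char_quant_sum[symmetric]
proof (rule integral_dominated_convergence[where w="\<lambda>_. 1"])
  show "AE \<omega> in M. (\<lambda>n. iexp (inner t (quant_sum n \<omega>))) \<longlonglongrightarrow> iexp (inner t (\<Sum>k. complex_of_real (\<xi> \<omega> k) * R \<omega> k))"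
    using AE_model_summable[OF model \<mu> s\<mu> A] AE_xi_pos[OF model \<mu> s\<mu>]
  proof eventually_elim
    case (elim \<omega>)
    have s: "summable (\<lambda>k. norm (complex_of_real (\<xi> \<omega> k) * R \<omega> k))" using elim(1) by (intro summable_suminf_not_top) auto
    have "(\<lambda>n. \<Sum>k. quant n (\<xi> \<omega> k) *\<^sub>R R \<omega> k) \<longlonglongrightarrow> (\<Sum>k. complex_of_real (\<xi> \<omega> k) * R \<omega> k)"
    proof (rule tannerys_theorem[THEN conjunct2, THEN conjunct2])
      show "(\<lambda>n. quant n (\<xi> \<omega> k) *\<^sub>R R \<omega> k) \<longlonglongrightarrow> complex_of_real (\<xi> \<omega> k) * R \<omega> k" for k
        unfolding scaleR_conv_of_real[symmetric] using elim(2) by (intro tendsto_scaleR quant_tendsto tendsto_const) auto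
      have "norm (quant n (\<xi> \<omega> k) *\<^sub>R R \<omega> k) \<le> norm (complex_of_real (\<xi> \<omega> k) * R \<omega> k)" for n k
        using quant_bounds[of "\<xi> \<omega> k" n] elim(2) by (auto simp: norm_mult less_imp_le intro!: mult_right_mono)
      then show "\<forall>\<^sub>F (k, n) in sequentially \<times>\<^sub>F sequentially. norm (quant n (\<xi> \<omega> k) *\<^sub>R R \<omega> k) \<le> norm (complex_of_real (\<xi> \<omega> k) * R \<omega> k)"
        by (intro always_eventually) auto
    qed (use s in auto)
    then have "(\<lambda>n. quant_sum n \<omega>) \<longlonglongrightarrow> (\<Sum>k. complex_of_real (\<xi> \<omega> k) * R \<omega> k)" by (simp add: quant_sum_def)
    then show ?case by (intro tendsto_intros)
  qed
qed auto

end

declare model_measurable [measurable del] measurable_quant_sum [measurable del]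

text \<open>Both characteristic functions are limits of the same sequence
  \<open>quant_char\<close>.\<close>

theorem model_sum_law_unique:
  fixes M :: "'a measure" and M' :: "'b measure"
  assumes m: "rde_model nu M \<xi> R \<mu>" and m': "rde_model nu M' \<xi>' R' \<mu>"
    and \<mu>: "prob_space \<mu>" "sets \<mu> = sets borel" and A: "amom \<mu> cmod \<noteq> \<top>"
  shows "distr M borel (\<lambda>\<omega>. \<Sum>k. complex_of_real (\<xi> \<omega> k) * R \<omega> k) = distr M' borel (\<lambda>\<omega>. \<Sum>k. complex_of_real (\<xi>' \<omega> k) * R' \<omega> k)"
proof -
  interpret M: prob_space M by (rule model_prob[OF m \<mu>])
  interpret M': prob_space M' by (rule model_prob[OF m' \<mu>])
  note [measurable] = model_R[OF m \<mu>] model_xi[OF m \<mu>] model_R[OF m' \<mu>] model_xi[OF m' \<mu>]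
  show ?thesis
  proof (rule complex_char_unique)
    fix t
    have 1: "(CLINT z|distr M borel (\<lambda>\<omega>. \<Sum>k. complex_of_real (\<xi> \<omega> k) * R \<omega> k). iexp (inner t z)) = (CLINT \<omega>|M. iexp (inner t (\<Sum>k. complex_of_real (\<xi> \<omega> k) * R \<omega> k)))"
      by (rule integral_distr) measurable
    have 2: "(CLINT z|distr M' borel (\<lambda>\<omega>. \<Sum>k. complex_of_real (\<xi>' \<omega> k) * R' \<omega> k). iexp (inner t z)) = (CLINT \<omega>|M'. iexp (inner t (\<Sum>k. complex_of_real (\<xi>' \<omega> k) * R' \<omega> k)))"
      by (rule integral_distr) measurable
    show "(CLINT z|distr M borel (\<lambda>\<omega>. \<Sum>k. complex_of_real (\<xi> \<omega> k) * R \<omega> k). iexp (inner t z)) = (CLINT z|distr M' borel (\<lambda>\<omega>. \<Sum>k. complex_of_real (\<xi>' \<omega> k) * R' \<omega> k). iexp (inner t z))"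
      unfolding 1 2 by (rule LIMSEQ_unique[OF char_sum_limit[OF m \<mu> A] char_sum_limit[OF m' \<mu> A]])
  qed (auto intro!: M.prob_space_distr M'.prob_space_distr)
qed

text \<open>The canonical model is the bridge: the sum in any model has the same law as there, and
  there the output law is that of \<open>rde_map\<close>, which is \<mu> by assumption.\<close>

lemma fixed_imp_solves_RDE:
  assumes \<mu>: "prob_space \<mu>" "sets \<mu> = sets borel" and A: "amom \<mu> cmod \<noteq> \<top>"
    and fp: "distr (marked \<mu>) borel (rde_map z (\<lambda>x. x)) = \<mu>"
  shows "solves_RDE (2 * a) z \<mu>"
  unfolding solves_RDE_iff
proof (intro allI impI conjI)
  fix M :: "(nat \<Rightarrow> real) measure" and \<xi> R
  assume "rde_model (ppp_intensity (2 * a)) M \<xi> R \<mu>"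
  then have m: "rde_model nu M \<xi> R \<mu>" by (simp add: nu_def)
  have eq: "distr N borel (\<lambda>\<omega>. - inverse (z + (\<Sum>\<^sub>\<infinity>k. complex_of_real (x \<omega> k) * r \<omega> k))) = distr (distr N borel (\<lambda>\<omega>. \<Sum>k. complex_of_real (x \<omega> k) * r \<omega> k)) borel (\<lambda>s. - inverse (z + s))"
    if n: "rde_model nu N x r \<mu>" for N :: "(nat \<Rightarrow> real) measure" and x r
  proof -
    note [measurable] = model_R[OF n \<mu>] model_xi[OF n \<mu>]
    have i: "(\<lambda>\<omega>. \<Sum>\<^sub>\<infinity>k. complex_of_real (x \<omega> k) * r \<omega> k) \<in> borel_measurable N"
      by (rule measurable_complex_infsum) measurable
    have "distr N borel (\<lambda>\<omega>. - inverse (z + (\<Sum>\<^sub>\<infinity>k. complex_of_real (x \<omega> k) * r \<omega> k))) = distr N borel ((\<lambda>s. - inverse (z + s)) \<circ> (\<lambda>\<omega>. \<Sum>k. complex_of_real (x \<omega> k) * r \<omega> k))"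
    proof (rule distr_cong_AE)
      show "AE \<omega> in N. - inverse (z + (\<Sum>\<^sub>\<infinity>k. complex_of_real (x \<omega> k) * r \<omega> k)) = ((\<lambda>s. - inverse (z + s)) \<circ> (\<lambda>\<omega>. \<Sum>k. complex_of_real (x \<omega> k) * r \<omega> k)) \<omega>"
        using AE_model_summable[OF n \<mu> A] by eventually_elim (simp add: complex_infsum_nat_eq)
    qed (use i in auto)
    also have "\<dots> = distr (distr N borel (\<lambda>\<omega>. \<Sum>k. complex_of_real (x \<omega> k) * r \<omega> k)) borel (\<lambda>s. - inverse (z + s))"
      by (rule distr_distr[symmetric]) measurable
    finally show ?thesis .
  qed
  show "AE \<omega> in M. (\<lambda>k. complex_of_real (\<xi> \<omega> k) * R \<omega> k) summable_on UNIV"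
    unfolding complex_summable_on_nat_iff by (rule AE_model_summable[OF m \<mu> A])
  have "distr M borel (\<lambda>\<omega>. - inverse (z + (\<Sum>\<^sub>\<infinity>k. complex_of_real (\<xi> \<omega> k) * R \<omega> k)))
    = distr (canonical_model \<mu>) borel (\<lambda>\<omega>. - inverse (z + (\<Sum>\<^sub>\<infinity>k. complex_of_real (dec1 \<omega> k) * dec2 \<omega> k)))"
    unfolding eq[OF m] eq[OF canonical_model_model[OF \<mu>]] model_sum_law_unique[OF m canonical_model_model[OF \<mu>] \<mu> A] ..
  also have "\<dots> = \<mu>" unfolding canonical_model_law(1)[OF \<mu> A] by (rule fp)
  finally show "distr M borel (\<lambda>\<omega>. - inverse (z + (\<Sum>\<^sub>\<infinity>k. complex_of_real (\<xi> \<omega> k) * R \<omega> k))) = \<mu>" .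
qed

end

section \<open>Uniqueness and imaginary parts\<close>

text \<open>The a priori finiteness of x is what permits the subtraction; each application has to
  establish it first.\<close>

lemma absorb_half:
  fixes x y :: ennreal
  assumes "x \<le> y + ennreal (1/2) * x" "x \<noteq> \<top>"
  shows "x \<le> 2 * y"
proof (cases y)
  case (real s)
  obtain r where r: "0 \<le> r" "x = ennreal r" using assms(2) by (cases x) auto
  have "ennreal s + ennreal (1/2) * ennreal r = ennreal (s + 1/2 * r)"
    using real r by (subst ennreal_mult[symmetric]) (auto intro: ennreal_plus[symmetric] simp del: ennreal_plus)
  then have "ennreal r \<le> ennreal (s + 1/2 * r)"
    using assms(1) unfolding real(2) r(2) by simp
  then have "r \<le> s + 1/2 * r" using real r by (subst (asm) ennreal_le_iff) auto
  then have "r \<le> 2 * s" by simp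
  then have "ennreal r \<le> ennreal (2 * s)" by (rule ennreal_leI)
  then show ?thesis using real r by (simp add: ennreal_mult)
qed (simp add: ennreal_mult_top)

lemma two_ennreal_half: "2 * ennreal (1/2) = 1"
proof -
  have "2 * ennreal (1/2) = ennreal (1/2) + ennreal (1/2)" by (rule mult_2)
  also have "\<dots> = ennreal (1/2 + 1/2)" by (rule ennreal_plus[symmetric]) auto
  finally show ?thesis by simp
qed

lemma powr_quotient_square:
  fixes c x s :: real
  assumes "0 < c" "0 \<le> x" shows "(x / c\<^sup>2) powr s = x powr s * c powr (- (2 * s))"
proof -
  have "(c\<^sup>2) powr s = (c powr 2) powr s" using assms by simp
  also have "\<dots> = c powr (2 * s)" by (rule powr_powr)
  finally have e: "(c\<^sup>2) powr s = c powr (2 * s)" .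
  have "(x / c\<^sup>2) powr s = x powr s / (c\<^sup>2) powr s" by (rule powr_divide)
  then show ?thesis unfolding e by (simp only: powr_minus divide_inverse)
qed

lemma powr_neg_le_1: "1 \<le> x \<Longrightarrow> 0 \<le> q \<Longrightarrow> x powr (- q) \<le> (1 :: real)"
  by (simp add: powr_minus inverse_le_1_iff ge_one_powr_ge_zero)

lemma nn_integral_pair_mult:
  assumes "prob_space \<mu>" "prob_space \<nu>"
    and [measurable]: "f \<in> borel_measurable \<mu>" "g \<in> borel_measurable \<nu>"
  shows "(\<integral>\<^sup>+n. f (fst n) * g (snd n) \<partial>(\<mu> \<Otimes>\<^sub>M \<nu>)) = (\<integral>\<^sup>+x. f x \<partial>\<mu>) * (\<integral>\<^sup>+y. g y \<partial>\<nu>)"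
proof -
  interpret U: prob_space \<mu> by fact
  interpret V: prob_space \<nu> by fact
  have "(\<integral>\<^sup>+n. f (fst n) * g (snd n) \<partial>(\<mu> \<Otimes>\<^sub>M \<nu>)) = (\<integral>\<^sup>+x. \<integral>\<^sup>+y. f x * g y \<partial>\<nu> \<partial>\<mu>)"
    by (subst V.nn_integral_fst[symmetric]) auto
  also have "\<dots> = (\<integral>\<^sup>+x. f x * (\<integral>\<^sup>+y. g y \<partial>\<nu>) \<partial>\<mu>)" by (intro nn_integral_cong nn_integral_cmult) auto
  also have "\<dots> = (\<integral>\<^sup>+x. f x \<partial>\<mu>) * (\<integral>\<^sup>+y. g y \<partial>\<nu>)" by (rule nn_integral_multc) auto
  finally show ?thesis .
qed

text \<open>Interpolation between the Lipschitz bound and the trivial bound 2, so that moments of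
  order below 1 control characteristic functions.\<close>

lemma norm_iexp_diff_le:
  assumes "0 < b" "b \<le> 1"
  shows "norm (iexp x - iexp y) \<le> 2 * \<bar>x - y\<bar> powr b"
proof (cases "\<bar>x - y\<bar> \<le> 1")
  case True
  have e: "iexp x = iexp y * iexp (x - y)" by (simp add: exp_add[symmetric] algebra_simps)
  have "norm (iexp x - iexp y) = norm (iexp y * (iexp (x - y) - 1))"
    by (simp only: right_diff_distrib mult_1_right e[symmetric])
  also have "\<dots> = norm (iexp (x - y) - 1)" by (simp add: norm_mult)
  also have "\<dots> \<le> \<bar>x - y\<bar>" using iexp_approx1[of "x - y" 0] by simp
  also have "\<dots> \<le> \<bar>x - y\<bar> powr b"
  proof (cases "x = y")
    case False
    then have "\<bar>x - y\<bar> powr 1 \<le> \<bar>x - y\<bar> powr b" using True assms by (intro powr_mono') auto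
    then show ?thesis using False by simp
  qed simp
  finally show ?thesis using powr_ge_zero[of "\<bar>x - y\<bar>" b] by linarith
next
  case False
  have "norm (iexp x - iexp y) \<le> norm (iexp x) + norm (iexp y)" by (rule norm_triangle_ineq4)
  also have "\<dots> = 2 * 1" by simp
  also have "\<dots> \<le> 2 * \<bar>x - y\<bar> powr b" using False assms by (intro mult_left_mono ge_one_powr_ge_zero) auto
  finally show ?thesis .
qed

section \<open>Choice of \<eta> and of the threshold for z\<close>

context stable_index
begin

text \<open>Below a, so that negative moments of order \<eta> of the output are finite; below 1 - 3
  * a, so that inverse moments of order 2 * a + \<eta> exist. The half makes both inequalities
  strict.\<close>

definition eta :: real where "eta = min a (1 - 3 * a) / 2"

lemma eta: "0 < eta" "eta < a" "3 * a + eta < 1" "2 * a + eta < 1" "a + eta < 1"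
  using a_pos a_less unfolding eta_def by (auto simp: min_def field_simps)

definition inverse_const :: "real \<Rightarrow> real" where "inverse_const p = 2 powr p + 6 * a / (1 - a - p)"

lemma inverse_const_pos: "p + a < 1 \<Longrightarrow> 0 < inverse_const p"
  using a_pos unfolding inverse_const_def by (intro add_pos_nonneg divide_nonneg_pos) auto

text \<open>The second condition makes the map preserve the bound 1 on the moment of order a. The
  third is the contraction factor: 2 * \<open>weight_const\<close> from \<open>contraction\<close>,
  times 2 * \<open>inverse_const\<close> from \<open>inverse_moment_le\<close>.\<close>

definition large :: "complex \<Rightarrow> bool" where
  "large z \<longleftrightarrow> 1 \<le> cmod z \<and> inverse_const a * cmod z powr (- a) \<le> 1/2 \<and> 4 * weight_const eta * inverse_const (2 * a) * cmod z powr (- (2 * a)) \<le> 1/2"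

lemma eventually_large: "\<exists>E>0. \<forall>z. E \<le> cmod z \<longrightarrow> large z"
proof -
  have l: "((\<lambda>x. c * x powr (- p)) \<longlongrightarrow> 0) at_top" if "0 < p" for c p :: real
    using tendsto_mult_right_zero[OF tendsto_neg_powr[OF _ filterlim_ident, of "- p"]] that by simp
  have "\<forall>\<^sub>F x in at_top. inverse_const a * x powr (- a) < 1/2" by (rule order_tendstoD(2)[OF l]) (use a_pos in auto)
  moreover have "\<forall>\<^sub>F x in at_top. (4 * weight_const eta * inverse_const (2 * a)) * x powr (- (2 * a)) < 1/2" by (rule order_tendstoD(2)[OF l]) (use a_pos in auto)
  ultimately have "\<forall>\<^sub>F x in at_top. inverse_const a * x powr (- a) < 1/2 \<and> (4 * weight_const eta * inverse_const (2 * a)) * x powr (- (2 * a)) < 1/2" by (rule eventually_conj)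
  then obtain E where "\<And>x. E \<le> x \<Longrightarrow> inverse_const a * x powr (- a) < 1/2 \<and> (4 * weight_const eta * inverse_const (2 * a)) * x powr (- (2 * a)) < 1/2"
    unfolding eventually_at_top_linorder by blast
  then show ?thesis by (intro exI[of _ "max 1 E"]) (auto simp: large_def less_imp_le)
qed

lemma weighted_moment_distr:
  assumes [measurable]: "T \<in> \<rho> \<rightarrow>\<^sub>M \<rho>'" "h \<in> borel_measurable \<rho>'" "f \<in> borel_measurable \<rho>'"
  shows "weighted_moment \<eta> (distr \<rho> \<rho>' T) h f = weighted_moment \<eta> \<rho> (\<lambda>x. h (T x)) (\<lambda>x. f (T x))"
  unfolding weighted_moment_def by (rule nn_integral_distr) measurable

lemma weighted_dist_distr:
  assumes [measurable]: "T \<in> \<rho> \<rightarrow>\<^sub>M \<rho>'" "g \<in> borel_measurable \<rho>'" "f \<in> borel_measurable \<rho>'"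
  shows "weighted_dist \<eta> (distr \<rho> \<rho>' T) f g = weighted_dist \<eta> \<rho> (\<lambda>x. f (T x)) (\<lambda>x. g (T x))"
  unfolding weighted_dist_def by (simp add: weighted_moment_distr)

lemma amom_distr:
  assumes [measurable]: "T \<in> \<rho> \<rightarrow>\<^sub>M \<rho>'" "h \<in> borel_measurable \<rho>'"
  shows "amom (distr \<rho> \<rho>' T) h = amom \<rho> (\<lambda>x. h (T x))"
  unfolding amom_def by (rule nn_integral_distr) measurable

lemma powr_rde_map_le: "0 \<le> p \<Longrightarrow> ennreal (cmod (rde_map z f \<omega>) powr p) \<le> inv_powr p (z + complex_sum f \<omega>)"
  by (cases "z + complex_sum f \<omega> = 0") (auto simp: rde_map_def inv_powr_nz norm_inverse powr_minus inverse_powr)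

text \<open>A quantity dominated by the modulus of w absorbs the singular weight itself. At w = 0 it
  vanishes, and 0 times infinity is 0.\<close>

lemma powr_inv_powr_le:
  assumes "0 \<le> h" "h \<le> cmod w" "0 < \<eta>"
  shows "ennreal (h powr (a + \<eta>)) * inv_powr \<eta> w \<le> ennreal (cmod w powr a)"
proof (cases "w = 0")
  case True then show ?thesis using assms by simp
next
  case False
  have "h powr (a + \<eta>) * cmod w powr (- \<eta>) \<le> cmod w powr (a + \<eta>) * cmod w powr (- \<eta>)"
    using assms a_pos by (intro mult_right_mono powr_mono2) auto
  also have "\<dots> = cmod w powr a" by (simp add: powr_add[symmetric])
  finally show ?thesis using False by (simp add: inv_powr_nz ennreal_mult[symmetric] ennreal_leI)
qed

lemma Im_complex_sum_nonneg: "(\<And>y. 0 \<le> Im (f y)) \<Longrightarrow> 0 \<le> Im (complex_sum f \<omega>)"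
proof -
  assume "\<And>y. 0 \<le> Im (f y)"
  then have "real_sum (\<lambda>y. - Im (f y)) \<omega> = 0" by (auto simp: real_sum_def ennreal_neg mult_nonneg_nonneg suminf_eq_zero_iff cong: if_cong)
  then show ?thesis by (simp add: complex_sum_def)
qed

lemma Im_rde_map: "Im (rde_map z f \<omega>) = Im (z + complex_sum f \<omega>) / (cmod (z + complex_sum f \<omega>))\<^sup>2"
  by (simp add: rde_map_def cmod_power2) (simp add: minus_divide_left add.commute)

context
  fixes z :: complex
  assumes large: "large z"
begin

lemma z_ge: "1 \<le> cmod z" "z \<noteq> 0"
  using large by (auto simp: large_def)

lemma inverse_moment_le:
  assumes \<rho>: "prob_space \<rho>" and f: "f \<in> borel_measurable \<rho>" and A: "amom \<rho> (\<lambda>y. cmod (f y)) \<le> 1"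
    and p: "0 < p" "p + a < 1"
  shows "(\<integral>\<^sup>+\<omega>. inv_powr p (z + complex_sum f \<omega>) \<partial>marked \<rho>) \<le> ennreal (2 * (inverse_const p * cmod z powr (- p)))"
proof -
  have "ennreal (cmod z powr (- a)) * amom \<rho> (\<lambda>y. cmod (f y)) \<le> ennreal 1 * 1"
    using z_ge a_pos A by (intro mult_mono ennreal_leI) (auto intro!: powr_neg_le_1)
  then have "1 + ennreal (cmod z powr (- a)) * amom \<rho> (\<lambda>y. cmod (f y)) \<le> 1 + 1" by (intro add_mono) auto
  then have l: "1 + ennreal (cmod z powr (- a)) * amom \<rho> (\<lambda>y. cmod (f y)) \<le> 2" by simp
  have "(\<integral>\<^sup>+\<omega>. inv_powr p (z + complex_sum f \<omega>) \<partial>marked \<rho>) \<le> ennreal (inverse_const p * cmod z powr (- p)) * (1 + ennreal (cmod z powr (- a)) * amom \<rho> (\<lambda>y. cmod (f y)))"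
    unfolding inverse_const_def using A by (intro inverse_moment[OF \<rho> f _ p z_ge(2)]) (auto simp: top_unique)
  also have "\<dots> \<le> ennreal (inverse_const p * cmod z powr (- p)) * 2" by (intro mult_left_mono l) auto
  also have "\<dots> = ennreal (2 * (inverse_const p * cmod z powr (- p)))" by (simp add: ennreal_mult' mult.commute)
  finally show ?thesis .
qed

lemma amom_rde_map_le_1:
  assumes \<rho>: "prob_space \<rho>" and f: "f \<in> borel_measurable \<rho>" and A: "amom \<rho> (\<lambda>y. cmod (f y)) \<le> 1"
  shows "amom (marked \<rho>) (\<lambda>\<omega>. cmod (rde_map z f \<omega>)) \<le> 1"
proof -
  have "amom (marked \<rho>) (\<lambda>\<omega>. cmod (rde_map z f \<omega>)) \<le> ennreal (2 * (inverse_const a * cmod z powr (- a)))"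
    by (rule order_trans[OF amom_rde_map_le inverse_moment_le[OF assms]]) (use a_pos a_less in auto)
  also have "\<dots> \<le> 1" using large by (simp add: large_def)
  finally show ?thesis .
qed

lemma contraction_half:
  assumes \<rho>: "prob_space \<rho>" and f: "f \<in> borel_measurable \<rho>" "amom \<rho> (\<lambda>y. cmod (f y)) \<le> 1"
    and g: "g \<in> borel_measurable \<rho>" "amom \<rho> (\<lambda>y. cmod (g y)) \<le> 1"
  shows "weighted_dist eta (marked \<rho>) (rde_map z f) (rde_map z g) \<le> ennreal (1/2) * weighted_dist eta \<rho> f g"
proof -
  have p: "0 < 2 * a" "2 * a + a < 1" using a_pos a_less by auto
  let ?B = "ennreal (2 * (inverse_const (2 * a) * cmod z powr (- (2 * a))))"
  have "weighted_dist eta (marked \<rho>) (rde_map z f) (rde_map z g) \<le> 2 * ennreal (weight_const eta) * ?B * weighted_dist eta \<rho> f g"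
    using f g by (intro contraction[OF \<rho> _ _ _ _ eta(1,4) z_ge(2) inverse_moment_le[OF \<rho> f p] inverse_moment_le[OF \<rho> g p]]) (auto simp: top_unique)
  also have "2 * ennreal (weight_const eta) * ?B = ennreal (4 * weight_const eta * inverse_const (2 * a) * cmod z powr (- (2 * a)))"
    using weight_const(1)[OF eta(1,4)] inverse_const_pos[OF p(2)] by (simp add: ennreal_mult[symmetric] ennreal_numeral[symmetric] mult_ac del: ennreal_numeral)
  also have "\<dots> * weighted_dist eta \<rho> f g \<le> ennreal (1/2) * weighted_dist eta \<rho> f g"
    using large by (intro mult_right_mono ennreal_leI) (auto simp: large_def)
  finally show ?thesis .
qed

section \<open>Properties of a single fixed law\<close>

context
  fixes \<mu> :: "complex measure"
  assumes \<mu>: "prob_space \<mu>" and s\<mu>: "sets \<mu> = sets borel" and A: "amom \<mu> cmod \<noteq> \<top>"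
    and fixed: "distr (marked \<mu>) borel (rde_map z (\<lambda>x. x)) = \<mu>"
begin

interpretation U: prob_space \<mu> by (rule \<mu>)

lemma measurable_id_mu [measurable]: "(\<lambda>x. x) \<in> borel_measurable \<mu>"
  by (simp add: s\<mu> cong: measurable_cong_sets)

lemma nn_integral_fixed:
  assumes [measurable]: "G \<in> borel_measurable borel"
  shows "(\<integral>\<^sup>+x. G x \<partial>\<mu>) = (\<integral>\<^sup>+\<omega>. G (rde_map z (\<lambda>x. x) \<omega>) \<partial>marked \<mu>)"
proof -
  have "(\<integral>\<^sup>+x. G x \<partial>\<mu>) = (\<integral>\<^sup>+x. G x \<partial>distr (marked \<mu>) borel (rde_map z (\<lambda>x. x)))" by (simp only: fixed)
  also have "\<dots> = (\<integral>\<^sup>+\<omega>. G (rde_map z (\<lambda>x. x) \<omega>) \<partial>marked \<mu>)"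
    by (rule nn_integral_distr[OF rde_map_measurable[OF measurable_id_mu]]) simp
  finally show ?thesis .
qed

text \<open>The moment m, finite by assumption, satisfies m \<le> (1 + m) / 2 by the inverse moment
  bound. Every fixed law thus lies in the region where \<open>contraction_half\<close>
  applies.\<close>

lemma fixed_amom_le: "amom \<mu> cmod \<le> 1"
proof -
  let ?m = "amom \<mu> cmod"
  have "?m = amom (marked \<mu>) (\<lambda>\<omega>. cmod (rde_map z (\<lambda>x. x) \<omega>))" unfolding amom_def by (rule nn_integral_fixed) measurable
  also have "\<dots> \<le> ennreal (inverse_const a * cmod z powr (- a)) * (1 + ennreal (cmod z powr (- a)) * ?m)"
    unfolding inverse_const_def by (rule order_trans[OF amom_rde_map_le inverse_moment[OF \<mu> _ A]]) (use a_pos a_less z_ge in auto)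
  also have "\<dots> \<le> ennreal (1/2) * (1 + ennreal 1 * ?m)"
    using large z_ge a_pos by (intro mult_mono add_mono ennreal_leI) (auto simp: large_def intro!: powr_neg_le_1)
  also have "\<dots> = ennreal (1/2) + ennreal (1/2) * ?m" by (simp add: distrib_left)
  finally have "?m \<le> 2 * ennreal (1/2)" by (rule absorb_half) (rule A)
  also have "\<dots> = 1" by (rule two_ennreal_half)
  finally show ?thesis .
qed

text \<open>This and the next lemma bound the factors of the mixed terms in the distance of the
  product coupling.\<close>

lemma fixed_positive_moment: "(\<integral>\<^sup>+x. ennreal (cmod x powr (a + eta)) \<partial>\<mu>) \<noteq> \<top>"
proof -
  have "(\<integral>\<^sup>+x. ennreal (cmod x powr (a + eta)) \<partial>\<mu>) = (\<integral>\<^sup>+\<omega>. ennreal (cmod (rde_map z (\<lambda>x. x) \<omega>) powr (a + eta)) \<partial>marked \<mu>)"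
    by (rule nn_integral_fixed) measurable
  also have "\<dots> \<le> (\<integral>\<^sup>+\<omega>. inv_powr (a + eta) (z + complex_sum (\<lambda>x. x) \<omega>) \<partial>marked \<mu>)"
    by (intro nn_integral_mono powr_rde_map_le) (use a_pos eta in auto)
  also have "\<dots> \<le> ennreal (2 * (inverse_const (a + eta) * cmod z powr (- (a + eta))))"
    by (rule inverse_moment_le[OF \<mu>]) (use fixed_amom_le a_pos eta in auto)
  finally show ?thesis by (auto simp: top_unique)
qed

lemma fixed_negative_moment: "(\<integral>\<^sup>+x. inv_powr eta x \<partial>\<mu>) \<noteq> \<top>"
  by (subst nn_integral_fixed) (use negative_moment_rde_map[OF \<mu> measurable_id_mu A z_ge(2) eta(1,2)] in auto)

text \<open>The imaginary part of - 1 / w is Im w divided by the squared modulus of w, and the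
  weight contributes the power \<eta> of that modulus, so the inverse order 2 * (a + \<eta>) drops
  to 2 * a + \<eta>. The part coming from Im z is an inverse moment; the part coming from S is again
  the weighted moment, with a factor at most 1/2, and is absorbed. The maximum with 0 provides a
  nonnegative h on the whole plane.\<close>

lemma Im_weighted_moment:
  assumes "0 \<le> Im z"
  shows "weighted_moment eta \<mu> (\<lambda>x. max 0 (Im x)) (\<lambda>x. x) \<le> ennreal (4 * inverse_const (2 * a + eta) * Im z powr (a + eta))"
proof -
  let ?h = "\<lambda>x. max 0 (Im x)" and ?f = "\<lambda>x::complex. x" and ?s = "a + eta"
  let ?J = "weighted_moment eta \<mu> ?h ?f"
  have p: "0 < 2 * a" "2 * a + a < 1" "0 < 2 * a + eta" "2 * a + eta + a < 1" using a_pos a_less eta by auto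
  have A1: "amom \<mu> (\<lambda>x. cmod (?f x)) \<le> 1" using fixed_amom_le by simp
  \<comment> \<open>Finiteness of \<open>?J\<close>, without which the half could not be
    absorbed.\<close>
  have "?J \<le> amom \<mu> cmod"
    unfolding weighted_moment_def amom_def using eta abs_Im_le_cmod by (intro nn_integral_mono powr_inv_powr_le) (auto simp: max_def intro: order_trans[OF abs_ge_self])
  then have J: "?J \<noteq> \<top>" using A by (auto simp: top_unique)
  have hm[measurable]: "?h \<in> borel_measurable \<mu>" by measurable
  have "?J = (\<integral>\<^sup>+\<omega>. ennreal (?h (rde_map z ?f \<omega>) powr ?s) * inv_powr eta (rde_map z ?f \<omega>) \<partial>marked \<mu>)"
    unfolding weighted_moment_def by (rule nn_integral_fixed) measurable
  also have "\<dots> \<le> (\<integral>\<^sup>+\<omega>. ennreal (Im z powr ?s) * inv_powr (2 * a + eta) (z + complex_sum ?f \<omega>)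
      + ennreal (enn2real (real_sum ?h \<omega>) powr ?s) * inv_powr (2 * a + eta) (z + complex_sum ?f \<omega>) \<partial>marked \<mu>)"
  proof (rule nn_integral_mono_AE)
    have "AE \<omega> in marked \<mu>. real_sum (\<lambda>x. cmod (?f x)) \<omega> \<noteq> \<top>" by (rule AE_real_sum_finite[OF \<mu>]) (use A in auto)
    with AE_denominator_nonzero[OF \<mu> measurable_id_mu A z_ge(2)]
    show "AE \<omega> in marked \<mu>. ennreal (?h (rde_map z ?f \<omega>) powr ?s) * inv_powr eta (rde_map z ?f \<omega>)
      \<le> ennreal (Im z powr ?s) * inv_powr (2 * a + eta) (z + complex_sum ?f \<omega>) + ennreal (enn2real (real_sum ?h \<omega>) powr ?s) * inv_powr (2 * a + eta) (z + complex_sum ?f \<omega>)"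
    proof eventually_elim
      case (elim \<omega>)
      let ?w = "z + complex_sum ?f \<omega>" and ?H = "enn2real (real_sum ?h \<omega>)"
      have w: "0 < cmod ?w" using elim by simp
      have hf: "real_sum ?h \<omega> \<noteq> \<top>" by (rule real_sum_finite_le[OF elim(2)]) (auto simp: max_def intro: order_trans[OF abs_ge_self abs_Im_le_cmod])
      have "Im (complex_sum ?f \<omega>) \<le> enn2real (real_sum Im \<omega>)" by (simp add: complex_sum_def)
      also have "\<dots> \<le> ?H" by (intro enn2real_mono real_sum_mono) (use hf in \<open>auto simp: less_top\<close>)
      finally have le: "Im ?w \<le> Im z + ?H" by simp
      have "?h (rde_map z ?f \<omega>) \<le> (Im z + ?H) / (cmod ?w)\<^sup>2"
        unfolding Im_rde_map using le assms by (auto intro!: divide_right_mono)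
      then have "?h (rde_map z ?f \<omega>) powr ?s \<le> ((Im z + ?H) / (cmod ?w)\<^sup>2) powr ?s" using a_pos eta by (intro powr_mono2) auto
      also have "\<dots> = (Im z + ?H) powr ?s * cmod ?w powr (- (2 * ?s))"
        using w assms by (intro powr_quotient_square) auto
      also have "\<dots> \<le> (Im z powr ?s + ?H powr ?s) * cmod ?w powr (- (2 * ?s))"
        using assms eta a_pos by (intro mult_right_mono powr_add_le) auto
      finally have "?h (rde_map z ?f \<omega>) powr ?s * cmod ?w powr eta \<le> (Im z powr ?s + ?H powr ?s) * cmod ?w powr (- (2 * ?s)) * cmod ?w powr eta"
        by (intro mult_right_mono) auto
      also have "\<dots> = (Im z powr ?s + ?H powr ?s) * cmod ?w powr (- (2 * a + eta))"
        unfolding mult.assoc powr_add[symmetric] by (simp add: algebra_simps)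
      finally have "ennreal (?h (rde_map z ?f \<omega>) powr ?s) * ennreal (cmod ?w powr eta) \<le> ennreal (Im z powr ?s + ?H powr ?s) * ennreal (cmod ?w powr (- (2 * a + eta)))"
        by (simp add: ennreal_mult[symmetric] ennreal_leI del: ennreal_plus)
      moreover have "inv_powr eta (rde_map z ?f \<omega>) = ennreal (cmod ?w powr eta)"
        unfolding rde_map_def using elim(1) by (subst inv_powr_nz) (auto simp: norm_inverse inverse_powr powr_minus)
      ultimately show ?case using elim(1) by (simp add: inv_powr_nz distrib_right)
    qed
  qed
  also have "\<dots> = ennreal (Im z powr ?s) * (\<integral>\<^sup>+\<omega>. inv_powr (2 * a + eta) (z + complex_sum ?f \<omega>) \<partial>marked \<mu>)
      + (\<integral>\<^sup>+\<omega>. ennreal (enn2real (real_sum ?h \<omega>) powr ?s) * inv_powr (2 * a + eta) (z + complex_sum ?f \<omega>) \<partial>marked \<mu>)"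
    by (subst nn_integral_add) (auto simp: nn_integral_cmult)
  also have "\<dots> \<le> ennreal (Im z powr ?s) * ennreal (2 * (inverse_const (2 * a + eta) * cmod z powr (- (2 * a + eta)))) + ennreal (1/2) * ?J"
  proof (intro add_mono mult_left_mono inverse_moment_le[OF \<mu> measurable_id_mu A1 p(3,4)])
    have "(\<integral>\<^sup>+\<omega>. ennreal (enn2real (real_sum ?h \<omega>) powr ?s) * inv_powr (2 * a + eta) (z + complex_sum ?f \<omega>) \<partial>marked \<mu>)
      \<le> ennreal (weight_const eta) * (\<integral>\<^sup>+\<omega>. inv_powr (2 * a) (z + complex_sum ?f \<omega>) \<partial>marked \<mu>) * ?J"
      by (rule weighted_bound[OF \<mu> measurable_id_mu A hm _ eta(1,4)]) auto
    also have "\<dots> \<le> ennreal (weight_const eta) * ennreal (2 * (inverse_const (2 * a) * cmod z powr (- (2 * a)))) * ?J"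
      by (intro mult_right_mono mult_left_mono inverse_moment_le[OF \<mu> measurable_id_mu A1 p(1,2)]) auto
    also have "ennreal (weight_const eta) * ennreal (2 * (inverse_const (2 * a) * cmod z powr (- (2 * a)))) = ennreal (weight_const eta * (2 * (inverse_const (2 * a) * cmod z powr (- (2 * a)))))"
      using weight_const(1)[OF eta(1,4)] inverse_const_pos[OF p(2)] by (simp add: ennreal_mult)
    also have "\<dots> * ?J \<le> ennreal (1/2) * ?J"
    proof (intro mult_right_mono ennreal_leI)
      have "0 \<le> weight_const eta * (inverse_const (2 * a) * cmod z powr (- (2 * a)))" using weight_const(1)[OF eta(1,4)] inverse_const_pos[OF p(2)] by simp
      then show "weight_const eta * (2 * (inverse_const (2 * a) * cmod z powr (- (2 * a)))) \<le> 1/2" using large by (simp add: large_def mult_ac)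
    qed simp
    finally show "(\<integral>\<^sup>+\<omega>. ennreal (enn2real (real_sum ?h \<omega>) powr ?s) * inv_powr (2 * a + eta) (z + complex_sum ?f \<omega>) \<partial>marked \<mu>) \<le> ennreal (1/2) * ?J" .
  qed auto
  finally have "?J \<le> 2 * (ennreal (Im z powr ?s) * ennreal (2 * (inverse_const (2 * a + eta) * cmod z powr (- (2 * a + eta)))))"
    by (rule absorb_half[OF _ J])
  also have "\<dots> = ennreal (4 * inverse_const (2 * a + eta) * Im z powr ?s * cmod z powr (- (2 * a + eta)))"
    using inverse_const_pos[OF p(4)] by (simp add: ennreal_mult[symmetric] ennreal_numeral[symmetric] mult_ac del: ennreal_numeral)
  also have "\<dots> \<le> ennreal (4 * inverse_const (2 * a + eta) * Im z powr ?s * 1)"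
    using inverse_const_pos[OF p(4)] z_ge p by (intro ennreal_leI mult_left_mono powr_neg_le_1) auto
  finally show ?thesis by simp
qed

text \<open>For Im z \<le> 1 the estimate even has order a, which is stronger than order \<kappa> <
  a; for Im z > 1 the bound 1 on the moment suffices.\<close>

lemma fixed_Im_moment:
  assumes pos: "AE x in \<mu>. 0 \<le> Im x" and z: "0 < Im z" and \<kappa>: "0 < \<kappa>" "\<kappa> < a"
  shows "(\<integral>\<^sup>+x. ennreal (Im x powr a) \<partial>\<mu>) \<le> ennreal ((1 + 4 * inverse_const (2 * a + eta)) * Im z powr \<kappa>)"
proof -
  let ?h = "\<lambda>x. max 0 (Im x)" and ?K = "4 * inverse_const (2 * a + eta)"
  have K: "0 < ?K" using inverse_const_pos[of "2 * a + eta"] eta by simp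
  have [measurable]: "?h \<in> borel_measurable \<mu>" by measurable
  have "(\<integral>\<^sup>+x. ennreal (Im x powr a) \<partial>\<mu>) = amom \<mu> ?h"
    unfolding amom_def using pos by (intro nn_integral_cong_AE) (auto elim!: eventually_mono)
  also have "\<dots> \<le> ennreal ((1 + ?K) * Im z powr \<kappa>)"
  proof (cases "Im z \<le> 1")
    case True
    \<comment> \<open>The choice t = Im z balances the two terms: both become multiples of (Im z)
      powr a.\<close>
    have "amom \<mu> ?h \<le> ennreal (Im z powr a) * amom \<mu> cmod + ennreal (Im z powr (- eta)) * weighted_moment eta \<mu> ?h (\<lambda>x. x)"
      by (rule amom_le_weighted_moment) (use z eta in auto)
    also have "\<dots> \<le> ennreal (Im z powr a) * 1 + ennreal (Im z powr (- eta)) * ennreal (?K * Im z powr (a + eta))"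
      by (intro add_mono mult_left_mono fixed_amom_le Im_weighted_moment) (use z in auto)
    also have "\<dots> = ennreal (Im z powr a + Im z powr (- eta) * (?K * Im z powr (a + eta)))"
      using K by (simp add: ennreal_mult)
    also have "Im z powr (- eta) * (?K * Im z powr (a + eta)) = ?K * Im z powr a"
      using powr_add[of "Im z" "- eta" "a + eta"] by simp
    also have "ennreal (Im z powr a + ?K * Im z powr a) \<le> ennreal ((1 + ?K) * Im z powr \<kappa>)"
    proof (intro ennreal_leI)
      have "Im z powr a \<le> Im z powr \<kappa>" using True z \<kappa> by (intro powr_mono') auto
      then have "(1 + ?K) * Im z powr a \<le> (1 + ?K) * Im z powr \<kappa>" using K by (intro mult_left_mono) auto
      then show "Im z powr a + ?K * Im z powr a \<le> (1 + ?K) * Im z powr \<kappa>" by (simp add: distrib_right)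
    qed
    finally show ?thesis .
  next
    case False
    have "amom \<mu> ?h \<le> amom \<mu> cmod"
      unfolding amom_def using a_pos by (intro nn_integral_mono ennreal_leI powr_mono2) (auto simp: max_def intro: order_trans[OF abs_ge_self abs_Im_le_cmod])
    also have "\<dots> \<le> ennreal 1" using fixed_amom_le by simp
    also have "\<dots> \<le> ennreal ((1 + ?K) * Im z powr \<kappa>)"
    proof (intro ennreal_leI)
      have "1 * 1 \<le> (1 + ?K) * Im z powr \<kappa>" using False K \<kappa> by (intro mult_mono ge_one_powr_ge_zero) auto
      then show "1 \<le> (1 + ?K) * Im z powr \<kappa>" by simp
    qed
    finally show ?thesis .
  qed
  finally show ?thesis .
qed

text \<open>At Im z = 0 the weighted moment is 0. The weight \<open>inv_powr\<close> never vanishes,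
  so the positive part of Im x must.\<close>

lemma fixed_real:
  assumes pos: "AE x in \<mu>. 0 \<le> Im x" and z: "Im z = 0"
  shows "AE x in \<mu>. Im x = 0"
proof -
  have "weighted_moment eta \<mu> (\<lambda>x. max 0 (Im x)) (\<lambda>x. x) = 0" using Im_weighted_moment z by simp
  then have "AE x in \<mu>. ennreal (max 0 (Im x) powr (a + eta)) * inv_powr eta x = 0"
    unfolding weighted_moment_def by (subst (asm) nn_integral_0_iff_AE) (auto intro!: borel_measurable_times)
  with pos show ?thesis by eventually_elim (auto simp: max_def split: if_splits)
qed

end

declare measurable_id_mu [measurable del]

section \<open>Couplings of two fixed laws\<close>

definition couplings :: "complex measure \<Rightarrow> complex measure \<Rightarrow> (complex \<times> complex) measure set" where
  "couplings \<mu> \<mu>' = {\<pi>. prob_space \<pi> \<and> sets \<pi> = sets (borel \<Otimes>\<^sub>M borel) \<and> distr \<pi> borel fst = \<mu> \<and> distr \<pi> borel snd = \<mu>'}"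

text \<open>Small couplings are turned into equality of laws through characteristic functions; the
  left-hand side does not involve \<pi>, so the right-hand side may be made small over all
  couplings.\<close>

lemma couplings_char:
  assumes \<pi>: "\<pi> \<in> couplings \<mu> \<mu>'"
  shows "ennreal (norm ((CLINT x|\<mu>. iexp (inner u x)) - (CLINT x|\<mu>'. iexp (inner u x)))) \<le> ennreal (2 * norm u powr a) * amom \<pi> (\<lambda>n. cmod (fst n - snd n))"
proof -
  interpret P: prob_space \<pi> using \<pi> by (simp add: couplings_def)
  have sp[measurable_cong]: "sets \<pi> = sets (borel \<Otimes>\<^sub>M borel)" using \<pi> by (simp add: couplings_def)
  have m: "distr \<pi> borel fst = \<mu>" "distr \<pi> borel snd = \<mu>'" using \<pi> by (auto simp: couplings_def)
  have e1: "(CLINT x|\<mu>. iexp (inner u x)) = (CLINT n|\<pi>. iexp (inner u (fst n)))"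
    unfolding m(1)[symmetric] by (rule integral_distr) measurable
  have e2: "(CLINT x|\<mu>'. iexp (inner u x)) = (CLINT n|\<pi>. iexp (inner u (snd n)))"
    unfolding m(2)[symmetric] by (rule integral_distr) measurable
  have i: "integrable \<pi> (\<lambda>n. iexp (inner u (fst n)))" "integrable \<pi> (\<lambda>n. iexp (inner u (snd n)))"
    by (rule P.integrable_const_bound[of _ 1]; auto)+
  have "norm ((CLINT x|\<mu>. iexp (inner u x)) - (CLINT x|\<mu>'. iexp (inner u x))) = norm (CLINT n|\<pi>. iexp (inner u (fst n)) - iexp (inner u (snd n)))"
    unfolding e1 e2 by (subst Bochner_Integration.integral_diff[OF i]) simp
  then have "ennreal (norm ((CLINT x|\<mu>. iexp (inner u x)) - (CLINT x|\<mu>'. iexp (inner u x)))) \<le> (\<integral>\<^sup>+n. ennreal (norm (iexp (inner u (fst n)) - iexp (inner u (snd n)))) \<partial>\<pi>)"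
    using integral_norm_bound_ennreal[OF Bochner_Integration.integrable_diff[OF i]] by simp
  also have "\<dots> \<le> (\<integral>\<^sup>+n. ennreal (2 * norm u powr a) * ennreal (cmod (fst n - snd n) powr a) \<partial>\<pi>)"
  proof (intro nn_integral_mono)
    fix n :: "complex \<times> complex"
    have "norm (iexp (inner u (fst n)) - iexp (inner u (snd n))) \<le> 2 * \<bar>inner u (fst n) - inner u (snd n)\<bar> powr a"
      by (rule norm_iexp_diff_le) (use a_pos a_less in auto)
    also have "\<dots> = 2 * \<bar>inner u (fst n - snd n)\<bar> powr a" by (simp add: inner_diff_right)
    also have "\<dots> \<le> 2 * (norm u * norm (fst n - snd n)) powr a"
      using a_pos by (intro mult_left_mono powr_mono2 Cauchy_Schwarz_ineq2) auto
    also have "\<dots> = 2 * norm u powr a * norm (fst n - snd n) powr a" by (simp add: powr_mult)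
    finally show "ennreal (norm (iexp (inner u (fst n)) - iexp (inner u (snd n)))) \<le> ennreal (2 * norm u powr a) * ennreal (cmod (fst n - snd n) powr a)"
      by (simp add: ennreal_mult[symmetric] ennreal_leI)
  qed
  also have "\<dots> = ennreal (2 * norm u powr a) * amom \<pi> (\<lambda>n. cmod (fst n - snd n))"
    unfolding amom_def by (rule nn_integral_cmult) measurable
  finally show ?thesis .
qed

context
  fixes \<mu> \<mu>' :: "complex measure"
  assumes \<mu>: "prob_space \<mu>" "sets \<mu> = sets borel" "amom \<mu> cmod \<noteq> \<top>" "distr (marked \<mu>) borel (rde_map z (\<lambda>x. x)) = \<mu>"
    and \<mu>': "prob_space \<mu>'" "sets \<mu>' = sets borel" "amom \<mu>' cmod \<noteq> \<top>" "distr (marked \<mu>') borel (rde_map z (\<lambda>x. x)) = \<mu>'"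
begin

lemma couplings_moments:
  assumes \<pi>: "\<pi> \<in> couplings \<mu> \<mu>'"
  shows "fst \<in> borel_measurable \<pi>" "snd \<in> borel_measurable \<pi>" "amom \<pi> (\<lambda>n. cmod (fst n)) \<le> 1" "amom \<pi> (\<lambda>n. cmod (snd n)) \<le> 1"
proof -
  have sp[measurable_cong]: "sets \<pi> = sets (borel \<Otimes>\<^sub>M borel)" using \<pi> by (simp add: couplings_def)
  show m: "fst \<in> borel_measurable \<pi>" "snd \<in> borel_measurable \<pi>" by measurable
  have d: "distr \<pi> borel fst = \<mu>" "distr \<pi> borel snd = \<mu>'" using \<pi> by (auto simp: couplings_def)
  show "amom \<pi> (\<lambda>n. cmod (fst n)) \<le> 1" using fixed_amom_le[OF \<mu>] amom_distr[OF m(1), of cmod] d by simp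
  show "amom \<pi> (\<lambda>n. cmod (snd n)) \<le> 1" using fixed_amom_le[OF \<mu>'] amom_distr[OF m(2), of cmod] d by simp
qed

text \<open>Both coordinates are fed with the same weights and with one i.i.d. sequence of coupled
  pairs. The marginals are reproduced because \<mu> and \<mu>' are fixed laws, while the distance is
  halved.\<close>

lemma couplings_step:
  assumes \<pi>: "\<pi> \<in> couplings \<mu> \<mu>'"
  shows "\<exists>\<pi>'\<in>couplings \<mu> \<mu>'. weighted_dist eta \<pi>' fst snd \<le> ennreal (1/2) * weighted_dist eta \<pi> fst snd"
proof -
  note mm[measurable] = couplings_moments[OF \<pi>]
  have p: "prob_space \<pi>" and d: "distr \<pi> borel fst = \<mu>" "distr \<pi> borel snd = \<mu>'" using \<pi> by (auto simp: couplings_def)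
  interpret K: prob_space "marked \<pi>" by (rule prob_space_marked[OF p])
  let ?T = "\<lambda>\<omega>. (rde_map z fst \<omega>, rde_map z snd \<omega>)"
  have T[measurable]: "?T \<in> marked \<pi> \<rightarrow>\<^sub>M borel \<Otimes>\<^sub>M borel" by measurable
  let ?\<pi> = "distr (marked \<pi>) (borel \<Otimes>\<^sub>M borel) ?T"
  have "distr ?\<pi> borel fst = distr (marked \<pi>) borel (rde_map z fst)" by (subst distr_distr) (auto simp: comp_def)
  also have "\<dots> = \<mu>" unfolding distr_rde_map_map[OF p mm(1)] d by (rule \<mu>)
  finally have 1: "distr ?\<pi> borel fst = \<mu>" .
  have "distr ?\<pi> borel snd = distr (marked \<pi>) borel (rde_map z snd)" by (subst distr_distr) (auto simp: comp_def)
  also have "\<dots> = \<mu>'" unfolding distr_rde_map_map[OF p mm(2)] d by (rule \<mu>')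
  finally have 2: "distr ?\<pi> borel snd = \<mu>'" .
  have "prob_space ?\<pi>" by (rule K.prob_space_distr[OF T])
  then have "?\<pi> \<in> couplings \<mu> \<mu>'" using 1 2 by (simp add: couplings_def)
  moreover have "weighted_dist eta ?\<pi> fst snd = weighted_dist eta (marked \<pi>) (rde_map z fst) (rde_map z snd)" by (subst weighted_dist_distr[OF T]) auto
  moreover have "\<dots> \<le> ennreal (1/2) * weighted_dist eta \<pi> fst snd" by (rule contraction_half[OF p mm(1,3,2,4)])
  ultimately show ?thesis by (intro bexI[of _ ?\<pi>]) auto
qed

text \<open>The start of the iteration. Expanding the power of the difference gives terms with one
  variable, bounded by the moment of order a, and mixed terms which factor by independence into a
  positive and a negative moment.\<close>

lemma product_coupling:
  "\<mu> \<Otimes>\<^sub>M \<mu>' \<in> couplings \<mu> \<mu>'" "weighted_dist eta (\<mu> \<Otimes>\<^sub>M \<mu>') fst snd \<noteq> \<top>"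
proof -
  interpret U: prob_space \<mu> by (rule \<mu>)
  interpret U': prob_space \<mu>' by (rule \<mu>')
  interpret UU: pair_prob_space \<mu> \<mu>' ..
  note \<mu>(2)[measurable_cong] \<mu>'(2)[measurable_cong]
  have s: "sets (\<mu> \<Otimes>\<^sub>M \<mu>') = sets (borel \<Otimes>\<^sub>M borel)" by (intro sets_pair_measure_cong \<mu> \<mu>')
  have "distr (\<mu> \<Otimes>\<^sub>M \<mu>') borel fst = distr (\<mu> \<Otimes>\<^sub>M \<mu>') \<mu> fst" by (rule distr_cong) (auto simp: \<mu>)
  also have "\<dots> = \<mu>" by (subst U'.distr_pair_fst) simp
  finally have 1: "distr (\<mu> \<Otimes>\<^sub>M \<mu>') borel fst = \<mu>" .
  have "distr (\<mu> \<Otimes>\<^sub>M \<mu>') borel snd = \<mu>'"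
  proof (rule measure_eqI)
    fix B assume "B \<in> sets (distr (\<mu> \<Otimes>\<^sub>M \<mu>') borel snd)"
    then have B: "B \<in> sets \<mu>'" by (simp add: \<mu>')
    have "snd -` B \<inter> space (\<mu> \<Otimes>\<^sub>M \<mu>') = space \<mu> \<times> B" using sets.sets_into_space[OF B] by (auto simp: space_pair_measure)
    then show "emeasure (distr (\<mu> \<Otimes>\<^sub>M \<mu>') borel snd) B = emeasure \<mu>' B"
      using B by (simp add: emeasure_distr \<mu>' U'.emeasure_pair_measure_Times U.emeasure_space_1)
  qed (simp add: \<mu>')
  with 1 show "\<mu> \<Otimes>\<^sub>M \<mu>' \<in> couplings \<mu> \<mu>'" using UU.prob_space_axioms s by (simp add: couplings_def)
  have mom: "(\<integral>\<^sup>+x. ennreal (cmod x powr (a + eta)) * inv_powr eta x \<partial>\<nu>) \<le> amom \<nu> cmod" for \<nu>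
    unfolding amom_def by (intro nn_integral_mono powr_inv_powr_le) (use eta in auto)
  have split: "ennreal (cmod (x - y) powr (a + eta)) \<le> ennreal (cmod x powr (a + eta)) + ennreal (cmod y powr (a + eta))" for x y
  proof -
    have "cmod (x - y) powr (a + eta) \<le> (cmod x + cmod y) powr (a + eta)"
      using a_pos eta by (intro powr_mono2 norm_triangle_ineq4) auto
    also have "\<dots> \<le> cmod x powr (a + eta) + cmod y powr (a + eta)" using a_pos eta by (intro powr_add_le) auto
    finally show ?thesis by (simp add: ennreal_leI flip: ennreal_plus)
  qed
  let ?P = "\<mu> \<Otimes>\<^sub>M \<mu>'" and ?s = "\<lambda>x. ennreal (cmod x powr (a + eta))"
  have m1: "(\<integral>\<^sup>+n. ?s (fst n) * inv_powr eta (fst n) \<partial>?P) = (\<integral>\<^sup>+x. ?s x * inv_powr eta x \<partial>\<mu>)"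
    using nn_integral_pair_mult[OF \<mu>(1) \<mu>'(1), of "\<lambda>x. ?s x * inv_powr eta x" "\<lambda>_. 1"] by (simp add: U'.emeasure_space_1)
  have m2: "(\<integral>\<^sup>+n. ?s (snd n) * inv_powr eta (snd n) \<partial>?P) = (\<integral>\<^sup>+x. ?s x * inv_powr eta x \<partial>\<mu>')"
    using nn_integral_pair_mult[OF \<mu>(1) \<mu>'(1), of "\<lambda>_. 1" "\<lambda>x. ?s x * inv_powr eta x"] by (simp add: U.emeasure_space_1)
  have m3: "(\<integral>\<^sup>+n. inv_powr eta (fst n) * ?s (snd n) \<partial>?P) = (\<integral>\<^sup>+x. inv_powr eta x \<partial>\<mu>) * (\<integral>\<^sup>+x. ?s x \<partial>\<mu>')"
    by (rule nn_integral_pair_mult[OF \<mu>(1) \<mu>'(1)]) measurable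
  have m4: "(\<integral>\<^sup>+n. ?s (fst n) * inv_powr eta (snd n) \<partial>?P) = (\<integral>\<^sup>+x. ?s x \<partial>\<mu>) * (\<integral>\<^sup>+x. inv_powr eta x \<partial>\<mu>')"
    by (rule nn_integral_pair_mult[OF \<mu>(1) \<mu>'(1)]) measurable
  note fin = mom[of \<mu>] \<mu>(3) mom[of \<mu>'] \<mu>'(3) fixed_positive_moment[OF \<mu>] fixed_negative_moment[OF \<mu>] fixed_positive_moment[OF \<mu>'] fixed_negative_moment[OF \<mu>']
  have "weighted_moment eta ?P (\<lambda>n. cmod (fst n - snd n)) fst \<le> (\<integral>\<^sup>+n. ?s (fst n) * inv_powr eta (fst n) + inv_powr eta (fst n) * ?s (snd n) \<partial>?P)"
    unfolding weighted_moment_def mult.commute[of "inv_powr eta (fst _)"] distrib_right[symmetric] by (intro nn_integral_mono mult_right_mono split) auto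
  also have "\<dots> = (\<integral>\<^sup>+n. ?s (fst n) * inv_powr eta (fst n) \<partial>?P) + (\<integral>\<^sup>+n. inv_powr eta (fst n) * ?s (snd n) \<partial>?P)"
    by (rule nn_integral_add) measurable
  also have "\<dots> < \<top>" unfolding m1 m3 using fin by (auto simp: less_top[symmetric] top_unique ennreal_mult_eq_top_iff)
  finally have J1: "weighted_moment eta ?P (\<lambda>n. cmod (fst n - snd n)) fst < \<top>" .
  have "weighted_moment eta ?P (\<lambda>n. cmod (fst n - snd n)) snd \<le> (\<integral>\<^sup>+n. ?s (fst n) * inv_powr eta (snd n) + ?s (snd n) * inv_powr eta (snd n) \<partial>?P)"
    unfolding weighted_moment_def distrib_right[symmetric] by (intro nn_integral_mono mult_right_mono split) auto
  also have "\<dots> = (\<integral>\<^sup>+n. ?s (fst n) * inv_powr eta (snd n) \<partial>?P) + (\<integral>\<^sup>+n. ?s (snd n) * inv_powr eta (snd n) \<partial>?P)"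
    by (rule nn_integral_add) measurable
  also have "\<dots> < \<top>" unfolding m2 m4 using fin by (auto simp: less_top[symmetric] top_unique ennreal_mult_eq_top_iff)
  finally have "weighted_moment eta ?P (\<lambda>n. cmod (fst n - snd n)) snd < \<top>" .
  with J1 show "weighted_dist eta (\<mu> \<Otimes>\<^sub>M \<mu>') fst snd \<noteq> \<top>" by (auto simp: weighted_dist_def)
qed

lemma couplings_geometric:
  "\<exists>\<pi>\<in>couplings \<mu> \<mu>'. weighted_dist eta \<pi> fst snd \<le> ennreal ((1/2)^n) * weighted_dist eta (\<mu> \<Otimes>\<^sub>M \<mu>') fst snd"
proof (induction n)
  case 0 then show ?case using product_coupling(1) by (intro bexI[of _ "\<mu> \<Otimes>\<^sub>M \<mu>'"]) auto
next
  case (Suc n)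
  then obtain \<pi> where \<pi>: "\<pi> \<in> couplings \<mu> \<mu>'" "weighted_dist eta \<pi> fst snd \<le> ennreal ((1/2)^n) * weighted_dist eta (\<mu> \<Otimes>\<^sub>M \<mu>') fst snd" by blast
  obtain \<pi>' where \<pi>': "\<pi>' \<in> couplings \<mu> \<mu>'" "weighted_dist eta \<pi>' fst snd \<le> ennreal (1/2) * weighted_dist eta \<pi> fst snd" using couplings_step[OF \<pi>(1)] by blast
  have "weighted_dist eta \<pi>' fst snd \<le> ennreal (1/2) * (ennreal ((1/2)^n) * weighted_dist eta (\<mu> \<Otimes>\<^sub>M \<mu>') fst snd)"
    by (rule order_trans[OF \<pi>'(2)]) (intro mult_left_mono \<pi>(2), simp)
  also have "\<dots> = ennreal (1/2 * (1/2)^n) * weighted_dist eta (\<mu> \<Otimes>\<^sub>M \<mu>') fst snd"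
    by (subst mult.assoc[symmetric], subst ennreal_mult[symmetric]) auto
  also have "1/2 * (1/2)^n = (1/2 :: real)^Suc n" by (rule power_Suc[symmetric])
  finally show ?case using \<pi>'(1) by blast
qed

theorem fixed_unique: "\<mu> = \<mu>'"
proof (rule complex_char_unique[OF \<mu>(1) \<mu>'(1) \<mu>(2) \<mu>'(2)])
  fix u :: complex
  define d where "d = norm ((CLINT x|\<mu>. iexp (inner u x)) - (CLINT x|\<mu>'. iexp (inner u x)))"
  define c where "c = 2 * norm u powr a"
  obtain D where D: "0 \<le> D" "weighted_dist eta (\<mu> \<Otimes>\<^sub>M \<mu>') fst snd = ennreal D" using product_coupling(2) by (cases "weighted_dist eta (\<mu> \<Otimes>\<^sub>M \<mu>') fst snd") auto
  have c: "0 \<le> c" by (simp add: c_def)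
  \<comment> \<open>The order of the limits matters: n tends to infinity for fixed t, and only then
    is t made small, because t powr (- eta) blows up.\<close>
  have bound: "d \<le> c * (t powr a + t powr (- eta) * ((1/2)^n * D))" if t: "0 < t" for t n
  proof -
    obtain \<pi> where \<pi>: "\<pi> \<in> couplings \<mu> \<mu>'" "weighted_dist eta \<pi> fst snd \<le> ennreal ((1/2)^n) * ennreal D" using couplings_geometric[of n] D by auto
    note mm[measurable] = couplings_moments[OF \<pi>(1)]
    have "amom \<pi> (\<lambda>n. cmod (fst n - snd n)) \<le> ennreal (t powr a) * amom \<pi> (\<lambda>n. cmod (fst n)) + ennreal (t powr (- eta)) * weighted_moment eta \<pi> (\<lambda>n. cmod (fst n - snd n)) fst"
      by (rule amom_le_weighted_moment) (use t eta in auto)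
    also have "\<dots> \<le> ennreal (t powr a) * 1 + ennreal (t powr (- eta)) * (ennreal ((1/2)^n) * ennreal D)"
      by (intro add_mono mult_left_mono mm order_trans[OF _ \<pi>(2)]) (auto simp: weighted_dist_def)
    also have "\<dots> = ennreal (t powr a + t powr (- eta) * ((1/2)^n * D))" using D by (simp add: ennreal_mult)
    finally have am: "amom \<pi> (\<lambda>n. cmod (fst n - snd n)) \<le> ennreal (t powr a + t powr (- eta) * ((1/2)^n * D))" .
    have "ennreal d \<le> ennreal c * amom \<pi> (\<lambda>n. cmod (fst n - snd n))" unfolding d_def c_def by (rule couplings_char[OF \<pi>(1)])
    also have "\<dots> \<le> ennreal c * ennreal (t powr a + t powr (- eta) * ((1/2)^n * D))" by (intro mult_left_mono am) auto
    also have "\<dots> = ennreal (c * (t powr a + t powr (- eta) * ((1/2)^n * D)))" using c D by (simp add: ennreal_mult del: ennreal_plus)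
    finally show ?thesis using c D by (subst (asm) ennreal_le_iff) auto
  qed
  have lim: "d \<le> c * t powr a" if t: "0 < t" for t
  proof (rule LIMSEQ_le_const)
    have "(\<lambda>n. c * (t powr a + t powr (- eta) * ((1/2)^n * D))) \<longlonglongrightarrow> c * (t powr a + t powr (- eta) * (0 * D))"
      by (intro tendsto_intros LIMSEQ_power_zero) auto
    then show "(\<lambda>n. c * (t powr a + t powr (- eta) * ((1/2)^n * D))) \<longlonglongrightarrow> c * t powr a" by simp
  qed (use bound[OF t] in auto)
  have "d = 0"
  proof (rule ccontr)
    assume "d \<noteq> 0"
    then have d: "0 < d" by (simp add: d_def)
    then have c': "0 < c" using lim[of 1] by simp
    \<comment> \<open>This t makes c * t powr a equal to d / 2, which contradicts d > 0.\<close>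
    have "((d / (2 * c)) powr (1 / a)) powr a = d / (2 * c)" using d c' a_pos by (simp add: powr_powr)
    then have "d \<le> c * (d / (2 * c))" using lim[of "(d / (2 * c)) powr (1 / a)"] d c' by simp
    then show False using d c' by simp
  qed
  then show "(CLINT x|\<mu>. iexp (inner u x)) = (CLINT x|\<mu>'. iexp (inner u x))" by (simp add: d_def)
qed

end

end

section \<open>Existence on a tree of weights\<close>


text \<open>A vertex is the word of child indices along the path from the root, and t v p is the
  weight on the edge from v to its p-th child. All iterates live on this one sample space, so almost
  sure convergence makes sense.\<close>

definition tree :: "(nat list \<Rightarrow> nat \<Rightarrow> real) measure" where
  "tree = PiM UNIV (\<lambda>_. weights)"

definition split_tree :: "(nat list \<Rightarrow> nat \<Rightarrow> real) \<Rightarrow> (nat \<Rightarrow> real) \<times> (nat \<Rightarrow> nat list \<Rightarrow> nat \<Rightarrow> real)" where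
  "split_tree t = (t [], \<lambda>p v. t (p # v))"

definition join_tree :: "(nat \<Rightarrow> real) \<times> (nat \<Rightarrow> nat list \<Rightarrow> nat \<Rightarrow> real) \<Rightarrow> nat list \<Rightarrow> nat \<Rightarrow> real" where
  "join_tree \<omega> v = (case v of [] \<Rightarrow> fst \<omega> | p # u \<Rightarrow> snd \<omega> p u)"

lemma split_join [simp]: "split_tree (join_tree \<omega>) = \<omega>"
  by (simp add: split_tree_def join_tree_def)

lemma prob_space_tree: "prob_space tree"
  unfolding tree_def by (intro prob_space_PiM prob_space_weights)

lemma emeasure_tree_UNIV [simp]: "emeasure tree UNIV = 1"
  using prob_space.emeasure_space_1[OF prob_space_tree] by (simp add: tree_def space_PiM)

lemma measurable_tree_component: "(\<lambda>t. t v) \<in> tree \<rightarrow>\<^sub>M weights"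
  unfolding tree_def by (rule measurable_component_singleton) simp

lemma space_tree [simp]: "space tree = UNIV"
  by (simp add: tree_def space_PiM)

lemma measurable_into_marked:
  assumes "(\<lambda>x. fst (f x)) \<in> M \<rightarrow>\<^sub>M weights" "\<And>p. (\<lambda>x. snd (f x) p) \<in> M \<rightarrow>\<^sub>M \<rho>"
  shows "f \<in> M \<rightarrow>\<^sub>M marked \<rho>"
proof -
  have "(\<lambda>x. snd (f x)) \<in> M \<rightarrow>\<^sub>M PiM UNIV (\<lambda>_. \<rho>)"
    by (rule measurable_PiM_single') (use assms(2) measurable_space[OF assms(2)] in auto)
  from measurable_Pair[OF assms(1) this] show ?thesis by (simp add: marked_def)
qed

lemma measurable_into_tree:
  assumes "\<And>v. (\<lambda>x. f x v) \<in> M \<rightarrow>\<^sub>M weights"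
  shows "f \<in> M \<rightarrow>\<^sub>M tree"
  unfolding tree_def by (rule measurable_PiM_single') (use assms measurable_space[OF assms] in auto)

lemma measurable_split_tree [measurable]: "split_tree \<in> tree \<rightarrow>\<^sub>M marked tree"
  by (rule measurable_into_marked)
     (auto simp: split_tree_def intro!: measurable_tree_component measurable_into_tree)

lemma measurable_join_tree [measurable]: "join_tree \<in> marked tree \<rightarrow>\<^sub>M tree"
proof (rule measurable_into_tree)
  fix v :: "nat list"
  show "(\<lambda>\<omega>. join_tree \<omega> v) \<in> marked tree \<rightarrow>\<^sub>M weights"
  proof (cases v)
    case Nil
    have "fst \<in> marked tree \<rightarrow>\<^sub>M weights" by (simp add: marked_def)
    then show ?thesis using Nil by (simp add: join_tree_def)
  next
    case (Cons p u)
    then show ?thesis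
      using measurable_compose[OF measurable_marked_snd measurable_tree_component] by (simp add: join_tree_def)
  qed
qed

text \<open>A tree is a root weight family together with independent subtrees.  On cylinders both
  laws are the same finite product.\<close>
lemma distr_join_tree: "distr (marked tree) tree join_tree = tree"
proof -
  interpret W: product_prob_space "\<lambda>_. weights" "UNIV :: nat list set" by (intro product_prob_spaceI prob_space_weights)
  interpret T: prob_space tree by (rule prob_space_tree)
  interpret K: prob_space "marked tree" by (rule prob_space_marked[OF prob_space_tree])
  have prod: "(\<integral>\<^sup>+t. (\<Prod>j\<in>J. F j (t j)) \<partial>tree) = (\<Prod>j\<in>J. \<integral>\<^sup>+w. F j w \<partial>weights)"
    if "finite J" "\<And>j. F j \<in> borel_measurable weights" for F :: "nat list \<Rightarrow> (nat \<Rightarrow> real) \<Rightarrow> ennreal" and J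
    unfolding tree_def by (rule nn_integral_PiM_prod[OF prob_space_weights that])
  have "distr (marked tree) tree join_tree = PiM UNIV (\<lambda>_. weights)"
  proof (rule measure_eqI_PiM_infinite)
    show "sets (distr (marked tree) tree join_tree) = sets (PiM UNIV (\<lambda>_. weights))" by (simp add: tree_def)
    show "finite_measure (distr (marked tree) tree join_tree)"
      using K.prob_space_distr[OF measurable_join_tree] by (simp add: prob_space_def)
    fix E and J :: "nat list set" assume J: "finite J" "J \<subseteq> UNIV" and E: "\<And>i. i \<in> J \<Longrightarrow> E i \<in> sets weights"
    define F :: "nat list \<Rightarrow> (nat \<Rightarrow> real) \<Rightarrow> ennreal" where "F j = (if j \<in> J then indicator (E j) else (\<lambda>_. 1))" for j
    have F: "F j \<in> borel_measurable weights" for j using E by (auto simp: F_def)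
    \<comment> \<open>The finite index set J is enlarged to the root together with a box of words p
      # v, p < N and v in V, so that the product factors over root, child and word below. The
      factors outside J are 1, and whatever \<open>hd\<close> and \<open>tl\<close> return on the
      empty word only enlarges the box.\<close>
    define V where "V = (\<Union>j\<in>J. {tl j})"
    define N where "N = Suc (Max (insert 0 (hd ` J)))"
    define J' where "J' = insert [] ((\<lambda>(p, v). p # v) ` ({..<N} \<times> V))"
    have V: "finite V" and J': "finite J'" using J by (auto simp: V_def J'_def)
    have sub: "J \<subseteq> J'"
    proof
      fix j assume j: "j \<in> J"
      show "j \<in> J'"
      proof (cases j)
        case (Cons p v)
        have "p \<in> insert 0 (hd ` J)" using j Cons by force
        then have "p < N" using J by (auto simp: N_def less_Suc_eq_le intro: Max_ge)
        moreover have "v \<in> V" using j Cons by (force simp: V_def)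
        ultimately show ?thesis using Cons by (auto simp: J'_def)
      qed (simp add: J'_def)
    qed
    let ?C = "prod_emb UNIV (\<lambda>_. weights) J (Pi\<^sub>E J E)"
    have emb: "?C \<in> sets tree" unfolding tree_def using J E by (intro sets_PiM_I) auto
    have ind: "indicator ?C t = (\<Prod>j\<in>J'. F j (t j))" for t :: "nat list \<Rightarrow> nat \<Rightarrow> real"
    proof -
      have "(\<Prod>j\<in>J'. F j (t j)) = (\<Prod>j\<in>J. F j (t j))" using sub J' by (intro prod.mono_neutral_right) (auto simp: F_def)
      also have "\<dots> = (\<Prod>j\<in>J. indicator (E j) (t j))" by (intro prod.cong) (auto simp: F_def)
      also have "\<dots> = indicator ?C t"
        using J(1) by (auto simp: prod_emb_def PiE_iff space_PiM split: split_indicator)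
      finally show ?thesis by simp
    qed
    have Jp: "(\<Prod>j\<in>J'. G j) = G [] * (\<Prod>p<N. \<Prod>v\<in>V. G (p # v))" for G :: "nat list \<Rightarrow> ennreal"
    proof -
      have "(\<Prod>j\<in>J'. G j) = G [] * (\<Prod>j\<in>(\<lambda>(p, v). p # v) ` ({..<N} \<times> V). G j)"
        unfolding J'_def using V by (subst prod.insert) auto
      also have "(\<Prod>j\<in>(\<lambda>(p, v). p # v) ` ({..<N} \<times> V). G j) = (\<Prod>(p, v)\<in>{..<N} \<times> V. G (p # v))"
        by (subst prod.reindex) (auto simp: inj_on_def case_prod_beta' intro!: prod.cong)
      finally show ?thesis by (simp add: prod.cartesian_product)
    qed
    have Ft: "(\<lambda>t. F j (t v)) \<in> borel_measurable tree" for j v by (rule measurable_compose[OF measurable_tree_component F])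
    have FY: "(\<lambda>Y. F j (Y p v)) \<in> borel_measurable (PiM UNIV (\<lambda>_. tree))" for j v and p :: nat
    proof -
      have "(\<lambda>Y. Y p) \<in> PiM UNIV (\<lambda>_. tree) \<rightarrow>\<^sub>M tree" by (rule measurable_component_singleton) simp
      from measurable_compose[OF this Ft[of j v]] show ?thesis .
    qed
    have "emeasure (distr (marked tree) tree join_tree) ?C = (\<integral>\<^sup>+t. indicator ?C t \<partial>distr (marked tree) tree join_tree)"
      using emb by (intro nn_integral_indicator[symmetric]) simp
    also have "\<dots> = (\<integral>\<^sup>+\<omega>. indicator ?C (join_tree \<omega>) \<partial>marked tree)" by (rule nn_integral_distr) (use emb in auto)
    also have "\<dots> = (\<integral>\<^sup>+\<omega>. F [] (fst \<omega>) * (\<Prod>p<N. \<Prod>v\<in>V. F (p # v) (snd \<omega> p v)) \<partial>(weights \<Otimes>\<^sub>M PiM UNIV (\<lambda>_. tree)))"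
      unfolding ind Jp marked_def by (simp add: join_tree_def)
    also have "\<dots> = (\<integral>\<^sup>+w. F [] w \<partial>weights) * (\<integral>\<^sup>+Y. (\<Prod>p<N. \<Prod>v\<in>V. F (p # v) (Y p v)) \<partial>PiM UNIV (\<lambda>_. tree))"
    proof (rule nn_integral_pair_mult[OF prob_space_weights _ F, of _ "\<lambda>Y. \<Prod>p<N. \<Prod>v\<in>V. F (p # v) (Y p v)"])
      show "prob_space (PiM UNIV (\<lambda>_. tree))" by (intro prob_space_PiM prob_space_tree)
      show "(\<lambda>Y. \<Prod>p<N. \<Prod>v\<in>V. F (p # v) (Y p v)) \<in> borel_measurable (PiM UNIV (\<lambda>_. tree))"
        by (intro borel_measurable_prod_ennreal FY)
    qed
    also have "(\<integral>\<^sup>+Y. (\<Prod>p<N. \<Prod>v\<in>V. F (p # v) (Y p v)) \<partial>PiM UNIV (\<lambda>_. tree)) = (\<Prod>p<N. \<integral>\<^sup>+t. (\<Prod>v\<in>V. F (p # v) (t v)) \<partial>tree)"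
      by (rule nn_integral_PiM_prod[OF prob_space_tree, of "{..<N}" "\<lambda>p t. \<Prod>v\<in>V. F (p # v) (t v)"]) (simp, intro borel_measurable_prod_ennreal Ft)
    also have "\<dots> = (\<Prod>p<N. \<Prod>v\<in>V. \<integral>\<^sup>+w. F (p # v) w \<partial>weights)"
      by (intro prod.cong refl prod V F)
    also have "(\<integral>\<^sup>+w. F [] w \<partial>weights) * \<dots> = (\<Prod>j\<in>J'. \<integral>\<^sup>+w. F j w \<partial>weights)" by (rule Jp[symmetric])
    also have "\<dots> = (\<integral>\<^sup>+t. (\<Prod>j\<in>J'. F j (t j)) \<partial>tree)" by (rule prod[OF J' F, symmetric])
    also have "\<dots> = emeasure tree ?C" unfolding ind[symmetric] using emb by (intro nn_integral_indicator)
    finally show "emeasure (distr (marked tree) tree join_tree) ?C = emeasure (PiM UNIV (\<lambda>_. weights)) ?C" by (simp add: tree_def)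
  qed simp
  then show ?thesis by (simp add: tree_def)
qed

lemma distr_split_tree: "distr tree (marked tree) split_tree = marked tree"
proof -
  have "distr tree (marked tree) split_tree = distr (distr (marked tree) tree join_tree) (marked tree) split_tree" by (simp add: distr_join_tree)
  also have "\<dots> = distr (marked tree) (marked tree) (\<lambda>x. x)" by (subst distr_distr) (auto simp: comp_def)
  finally show ?thesis by (simp add: distr_id2)
qed

lemma nn_integral_split_tree:
  "G \<in> borel_measurable (marked tree) \<Longrightarrow> (\<integral>\<^sup>+t. G (split_tree t) \<partial>tree) = (\<integral>\<^sup>+\<omega>. G \<omega> \<partial>marked tree)"
  using nn_integral_distr[OF measurable_split_tree, of G] by (simp only: distr_split_tree)

lemma AE_split_tree: "AE \<omega> in marked tree. P \<omega> \<Longrightarrow> AE t in tree. P (split_tree t)"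
  by (subst (asm) distr_split_tree[symmetric]) (rule AE_distrD[OF measurable_split_tree])

lemma AE_marks:
  assumes \<rho>: "prob_space \<rho>" and P: "AE y in \<rho>. P y"
  shows "AE \<omega> in marked \<rho>. \<forall>p. P (snd \<omega> p)"
proof -
  interpret R: prob_space \<rho> by fact
  interpret W: prob_space weights by (rule prob_space_weights)
  obtain N where N: "{y\<in>space \<rho>. \<not> P y} \<subseteq> N" "N \<in> sets \<rho>" "emeasure \<rho> N = 0" using AE_E[OF P] by blast
  have "AE \<omega> in marked \<rho>. P (snd \<omega> p)" for p
  proof -
    have m: "(\<lambda>Y. indicator N (Y p) :: ennreal) \<in> borel_measurable (PiM UNIV (\<lambda>_. \<rho>))"
      by (rule measurable_compose[OF measurable_component_singleton]) (use N(2) in auto)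
    have m': "(\<lambda>\<omega>. indicator N (snd \<omega> p) :: ennreal) \<in> borel_measurable (marked \<rho>)"
      by (rule measurable_compose[OF measurable_marked_snd]) (use N(2) in auto)
    have "(\<integral>\<^sup>+\<omega>. indicator N (snd \<omega> p) \<partial>marked \<rho>) = (\<integral>\<^sup>+w. 1 \<partial>weights) * (\<integral>\<^sup>+Y. indicator N (Y p) \<partial>PiM UNIV (\<lambda>_. \<rho>))"
      using nn_integral_pair_mult[OF prob_space_weights prob_space_PiM[OF \<rho>] _ m, of "\<lambda>_. 1"] by (simp add: marked_def)
    also have "(\<integral>\<^sup>+Y. indicator N (Y p) \<partial>PiM UNIV (\<lambda>_. \<rho>)) = (\<integral>\<^sup>+y. indicator N y \<partial>\<rho>)"
      using nn_integral_PiM_prod[OF \<rho>, of "{p}" "\<lambda>_. indicator N"] N(2) by simp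
    also have "\<dots> = 0" using N by simp
    finally have "(\<integral>\<^sup>+\<omega>. indicator N (snd \<omega> p) \<partial>marked \<rho>) = 0" by simp
    then have "AE \<omega> in marked \<rho>. indicator N (snd \<omega> p) = (0 :: ennreal)"
      using nn_integral_0_iff_AE[OF m'] by simp
    then show ?thesis
    proof (rule AE_mp, intro AE_I2 impI)
      fix \<omega> assume \<omega>: "\<omega> \<in> space (marked \<rho>)" "indicator N (snd \<omega> p) = (0 :: ennreal)"
      show "P (snd \<omega> p)"
        using measurable_space[OF measurable_marked_snd \<omega>(1), of p] \<omega>(2) N(1) by (auto split: split_indicator_asm)
    qed
  qed
  then show ?thesis by (simp add: AE_all_countable)
qed

lemma complex_sum_cong_marks:
  assumes "\<And>p. f (snd \<omega> p) = g (snd \<omega> p)" shows "complex_sum f \<omega> = complex_sum g \<omega>"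
  unfolding complex_sum_def real_sum_def by (simp only: assms)

text \<open>Dominated convergence for the weighted series. Domination and convergence are required
  for every mark, which is why the iterates are truncated before this is used.\<close>

lemma complex_sum_tendsto:
  assumes h: "real_sum h \<omega> \<noteq> \<top>" and le: "\<And>n y. cmod (f n y) \<le> h y" and lim: "\<And>y. (\<lambda>n. f n y) \<longlonglongrightarrow> g y"
  shows "(\<lambda>n. complex_sum (f n) \<omega>) \<longlonglongrightarrow> complex_sum g \<omega>"
proof -
  have le': "cmod (g y) \<le> h y" for y
    by (rule LIMSEQ_le_const2[OF tendsto_norm[OF lim]]) (use le in auto)
  have h0: "0 \<le> h y" for y using le[of 0 y] norm_ge_zero[of "f 0 y"] by linarith
  have S: "complex_sum k \<omega> = (\<Sum>p. wterm k \<omega> p)" if "\<And>y. cmod (k y) \<le> h y" for k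
    by (rule sums_unique[OF complex_sum_sums[OF real_sum_finite_le[OF h that]]])
  have sm: "summable (\<lambda>p. if 0 < fst \<omega> p then fst \<omega> p * h (snd \<omega> p) else 0)"
    using h unfolding real_sum_eq by (intro summable_suminf_not_top) (auto simp: h0)
  show ?thesis
    unfolding S[OF le] S[OF le']
  proof (rule tannerys_theorem[THEN conjunct2, THEN conjunct2])
    show "(\<lambda>n. wterm (f n) \<omega> p) \<longlonglongrightarrow> wterm g \<omega> p" for p using lim by (auto intro!: tendsto_intros)
    show "\<forall>\<^sub>F (p, n) in sequentially \<times>\<^sub>F sequentially. norm (wterm (f n) \<omega> p) \<le> (if 0 < fst \<omega> p then fst \<omega> p * h (snd \<omega> p) else 0)"
      by (intro always_eventually) (auto simp: norm_mult intro!: mult_left_mono le)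
  qed (use sm in auto)
qed

section \<open>Convergence of the iterates for fixed z\<close>

context
  fixes z :: complex
  assumes large: "large z"
begin

text \<open>The start is the output for zero input and has nonnegative imaginary part when z does.
  Iterate n reads only the first n generations of weights.\<close>

primrec tree_iterate :: "nat \<Rightarrow> (nat list \<Rightarrow> nat \<Rightarrow> real) \<Rightarrow> complex" where
  "tree_iterate 0 = (\<lambda>_. - inverse z)"
| "tree_iterate (Suc n) = (\<lambda>t. rde_map z (tree_iterate n) (split_tree t))"

declare tree_iterate.simps(2) [simp del]

lemma tree_iterate_measurable [measurable]: "tree_iterate n \<in> borel_measurable tree"
proof (induction n)
  case (Suc n) then show ?case using measurable_compose[OF measurable_split_tree rde_map_measurable] by (simp add: tree_iterate.simps(2))
qed simp

lemma tree_iterate_amom: "amom tree (\<lambda>t. cmod (tree_iterate n t)) \<le> 1"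
proof (induction n)
  case 0
  have "cmod (inverse z) powr a \<le> 1" using z_ge[OF large] a_pos by (auto simp: norm_inverse inverse_powr inverse_le_1_iff ge_one_powr_ge_zero)
  then show ?case by (simp add: amom_def)
next
  case (Suc n)
  have "amom tree (\<lambda>t. cmod (tree_iterate (Suc n) t)) = amom (marked tree) (\<lambda>\<omega>. cmod (rde_map z (tree_iterate n) \<omega>))"
    unfolding amom_def tree_iterate.simps by (rule nn_integral_split_tree) measurable
  then show ?case using amom_rde_map_le_1[OF large prob_space_tree tree_iterate_measurable Suc] by simp
qed

lemma tree_iterate_Im: "0 \<le> Im z \<Longrightarrow> 0 \<le> Im (tree_iterate n t)"
proof (induction n arbitrary: t)
  case (Suc n) then show ?case by (simp add: tree_iterate.simps(2) Im_rde_map Im_complex_sum_nonneg)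
qed simp

text \<open>Seen from the root, two consecutive iterates use the same weights and the same subtrees
  and differ only in the function evaluated on the subtrees.\<close>

lemma tree_iterate_contraction: "weighted_dist eta tree (tree_iterate (Suc n)) (tree_iterate (Suc (Suc n))) \<le> ennreal (1/2) * weighted_dist eta tree (tree_iterate n) (tree_iterate (Suc n))"
proof -
  have "weighted_dist eta tree (tree_iterate (Suc n)) (tree_iterate (Suc (Suc n))) = weighted_dist eta (marked tree) (rde_map z (tree_iterate n)) (rde_map z (tree_iterate (Suc n)))"
    unfolding weighted_dist_def weighted_moment_def tree_iterate.simps(2)[of "Suc n"] tree_iterate.simps(2)[of n]
    by (intro arg_cong2[where f="(+)"] nn_integral_split_tree; (unfold tree_iterate.simps(2)[of n, symmetric])?, measurable)
  then show ?thesis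
    using contraction_half[OF large prob_space_tree tree_iterate_measurable tree_iterate_amom tree_iterate_measurable tree_iterate_amom, of n "Suc n"] by simp
qed

lemma tree_iterate_start: "weighted_dist eta tree (tree_iterate 0) (tree_iterate (Suc 0)) \<noteq> \<top>"
proof -
  \<comment> \<open>The abbreviation \<open>?trunc_iterate\<close> denotes the first iterate here
    and is unrelated to the truncation defined further on.\<close>
  let ?c = "- inverse z" and ?s = "\<lambda>x. ennreal (cmod x powr (a + eta))" and ?trunc_iterate = "tree_iterate (Suc 0)"
  have m[measurable]: "?trunc_iterate \<in> borel_measurable tree" by (rule tree_iterate_measurable)
  have c: "?c \<noteq> 0" using z_ge[OF large] by simp
  have split: "?s (x - y) \<le> ?s x + ?s y" for x y
  proof -
    have "cmod (x - y) powr (a + eta) \<le> (cmod x + cmod y) powr (a + eta)"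
      using a_pos eta by (intro powr_mono2 norm_triangle_ineq4) auto
    also have "\<dots> \<le> cmod x powr (a + eta) + cmod y powr (a + eta)" using a_pos eta by (intro powr_add_le) auto
    finally show ?thesis by (simp add: ennreal_leI flip: ennreal_plus)
  qed
  have Ys: "(\<integral>\<^sup>+t. ?s (?trunc_iterate t) \<partial>tree) \<noteq> \<top>"
  proof -
    have "(\<integral>\<^sup>+t. ?s (?trunc_iterate t) \<partial>tree) = (\<integral>\<^sup>+\<omega>. ?s (rde_map z (tree_iterate 0) \<omega>) \<partial>marked tree)"
      unfolding tree_iterate.simps(2) by (rule nn_integral_split_tree) (use tree_iterate_measurable[of 0] in measurable)
    also have "\<dots> \<le> (\<integral>\<^sup>+\<omega>. inv_powr (a + eta) (z + complex_sum (tree_iterate 0) \<omega>) \<partial>marked tree)"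
      by (intro nn_integral_mono powr_rde_map_le) (use a_pos eta in auto)
    also have "\<dots> \<le> ennreal (2 * (inverse_const (a + eta) * cmod z powr (- (a + eta))))"
      by (rule inverse_moment_le[OF large prob_space_tree tree_iterate_measurable tree_iterate_amom]) (use a_pos eta in auto)
    finally show ?thesis by (auto simp: top_unique)
  qed
  have Yi: "(\<integral>\<^sup>+t. inv_powr eta (?trunc_iterate t) \<partial>tree) \<noteq> \<top>"
  proof -
    have "(\<integral>\<^sup>+t. inv_powr eta (?trunc_iterate t) \<partial>tree) = (\<integral>\<^sup>+\<omega>. inv_powr eta (rde_map z (tree_iterate 0) \<omega>) \<partial>marked tree)"
      unfolding tree_iterate.simps(2) by (rule nn_integral_split_tree) (use tree_iterate_measurable[of 0] in measurable)
    moreover have "\<dots> \<noteq> \<top>"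
      by (rule negative_moment_rde_map[OF prob_space_tree tree_iterate_measurable _ z_ge(2)[OF large] eta(1,2)]) (use tree_iterate_amom[of 0] in \<open>auto simp: top_unique\<close>)
    ultimately show ?thesis by simp
  qed
  have "weighted_moment eta tree (\<lambda>t. cmod (?c - ?trunc_iterate t)) (\<lambda>_. ?c) \<le> (\<integral>\<^sup>+t. (?s ?c + ?s (?trunc_iterate t)) * inv_powr eta ?c \<partial>tree)"
    unfolding weighted_moment_def by (intro nn_integral_mono mult_right_mono split) auto
  also have "\<dots> = (\<integral>\<^sup>+t. ?s ?c + ?s (?trunc_iterate t) \<partial>tree) * inv_powr eta ?c"
    by (rule nn_integral_multc) measurable
  also have "(\<integral>\<^sup>+t. ?s ?c + ?s (?trunc_iterate t) \<partial>tree) = ?s ?c + (\<integral>\<^sup>+t. ?s (?trunc_iterate t) \<partial>tree)"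
    by (subst nn_integral_add) auto
  also have "(?s ?c + (\<integral>\<^sup>+t. ?s (?trunc_iterate t) \<partial>tree)) * inv_powr eta ?c < \<top>" using Ys c by (auto simp: inv_powr_nz less_top[symmetric] ennreal_mult_eq_top_iff)
  finally have 1: "weighted_moment eta tree (\<lambda>t. cmod (?c - ?trunc_iterate t)) (\<lambda>_. ?c) < \<top>" .
  have "weighted_moment eta tree (\<lambda>t. cmod (?c - ?trunc_iterate t)) ?trunc_iterate \<le> (\<integral>\<^sup>+t. ?s ?c * inv_powr eta (?trunc_iterate t) + ennreal (cmod (?trunc_iterate t) powr a) \<partial>tree)"
    unfolding weighted_moment_def
  proof (intro nn_integral_mono)
    fix t
    have "?s (?c - ?trunc_iterate t) * inv_powr eta (?trunc_iterate t) \<le> (?s ?c + ?s (?trunc_iterate t)) * inv_powr eta (?trunc_iterate t)" by (intro mult_right_mono split) auto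
    also have "\<dots> = ?s ?c * inv_powr eta (?trunc_iterate t) + ?s (?trunc_iterate t) * inv_powr eta (?trunc_iterate t)" by (rule distrib_right)
    also have "\<dots> \<le> ?s ?c * inv_powr eta (?trunc_iterate t) + ennreal (cmod (?trunc_iterate t) powr a)"
      by (intro add_left_mono powr_inv_powr_le) (use eta in auto)
    finally show "?s (?c - ?trunc_iterate t) * inv_powr eta (?trunc_iterate t) \<le> ?s ?c * inv_powr eta (?trunc_iterate t) + ennreal (cmod (?trunc_iterate t) powr a)" .
  qed
  also have "\<dots> = ?s ?c * (\<integral>\<^sup>+t. inv_powr eta (?trunc_iterate t) \<partial>tree) + amom tree (\<lambda>t. cmod (?trunc_iterate t))"
    unfolding amom_def by (subst nn_integral_add) (auto simp: nn_integral_cmult)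
  also have "\<dots> < \<top>" using Yi tree_iterate_amom[of "Suc 0"] by (auto simp: less_top[symmetric] ennreal_mult_eq_top_iff top_unique)
  finally show ?thesis using 1 by (auto simp: weighted_dist_def)
qed

definition increment :: "nat \<Rightarrow> (nat list \<Rightarrow> nat \<Rightarrow> real) \<Rightarrow> real" where
  "increment n t = cmod (tree_iterate n t - tree_iterate (Suc n) t)"

lemma increment_measurable [measurable]: "increment n \<in> borel_measurable tree"
  using tree_iterate_measurable[of n] tree_iterate_measurable[of "Suc n"] unfolding increment_def[abs_def] by measurable

text \<open>The weighted distances decay like (1/2)^n. Taking t = q^n in
  \<open>amom_le_weighted_moment\<close> distributes this decay over both terms, each of which
  becomes geometric.\<close>

lemma increment_amom_summable: "(\<Sum>n. amom tree (increment n)) \<noteq> \<top>"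
proof -
  obtain C where C: "0 \<le> C" "weighted_dist eta tree (tree_iterate 0) (tree_iterate (Suc 0)) = ennreal C" using tree_iterate_start by (cases "weighted_dist eta tree (tree_iterate 0) (tree_iterate (Suc 0))") auto
  have geo: "weighted_dist eta tree (tree_iterate n) (tree_iterate (Suc n)) \<le> ennreal ((1/2)^n * C)" for n
  proof (induction n)
    case (Suc n)
    have "weighted_dist eta tree (tree_iterate (Suc n)) (tree_iterate (Suc (Suc n))) \<le> ennreal (1/2) * ennreal ((1/2)^n * C)"
      by (rule order_trans[OF tree_iterate_contraction]) (intro mult_left_mono Suc, simp)
    also have "\<dots> = ennreal (1/2 * ((1/2)^n * C))" using C by (intro ennreal_mult[symmetric]) auto
    finally show ?case by (simp only: power_Suc mult.assoc)
  qed (use C in simp)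
  \<comment> \<open>Chosen so that q powr (- eta) is the square root of 2: the loss from the weight
    uses up half of the exponent in the decay (1/2)^n, and v = 2 powr (- 1 / 2) remains.\<close>
  define q where "q = (2 :: real) powr (- 1 / (2 * eta))"
  define u where "u = q powr a" define v where "v = (2 :: real) powr (- 1 / 2)"
  have q: "0 < q" "q < 1" using eta unfolding q_def by (auto simp: powr_less_one)
  have u: "0 < u" "u < 1" using q a_pos powr_less_mono2[of a q 1] unfolding u_def by simp_all
  have v: "0 < v" "v < 1" unfolding v_def by (auto simp: powr_less_one)
  have qv: "q powr (- eta) * (1/2) = v"
  proof -
    have "q powr (- eta) = 2 powr (1/2)" unfolding q_def powr_powr using eta by simp
    then have "q powr (- eta) * (1/2) = 2 powr (1/2) * 2 powr (- 1)" by (simp add: powr_minus)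
    also have "\<dots> = v" unfolding v_def powr_add[symmetric] by simp
    finally show ?thesis .
  qed
  have bound: "amom tree (increment n) \<le> ennreal (u ^ n + v ^ n * C)" for n
  proof -
    have t: "0 < q ^ n" using q by simp
    have "amom tree (increment n) \<le> ennreal ((q^n) powr a) * amom tree (\<lambda>t. cmod (tree_iterate n t)) + ennreal ((q^n) powr (- eta)) * weighted_moment eta tree (increment n) (tree_iterate n)"
      by (rule amom_le_weighted_moment[OF tree_iterate_measurable increment_measurable _ eta(1) t]) (simp add: increment_def)
    also have "\<dots> \<le> ennreal ((q^n) powr a) * 1 + ennreal ((q^n) powr (- eta)) * ennreal ((1/2)^n * C)"
      by (intro add_mono mult_left_mono tree_iterate_amom order_trans[OF _ geo]) (auto simp: weighted_dist_def increment_def[abs_def])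
    also have "\<dots> = ennreal ((q^n) powr a + (q^n) powr (- eta) * ((1/2)^n * C))" using C by (simp add: ennreal_mult)
    also have "(q^n) powr a = u ^ n" using q by (simp add: u_def powr_realpow[symmetric] powr_powr mult.commute)
    also have "(q^n) powr (- eta) * ((1/2)^n * C) = v ^ n * C"
    proof -
      have "(q^n) powr (- eta) = (q powr (- eta)) ^ n" using q by (simp add: powr_realpow[symmetric] powr_powr mult.commute)
      then have "(q^n) powr (- eta) * ((1/2)^n * C) = (q powr (- eta)) ^ n * (1/2)^n * C" by simp
      also have "\<dots> = v ^ n * C" by (simp only: qv[symmetric] power_mult_distrib)
      finally show ?thesis .
    qed
    finally show ?thesis .
  qed
  have sm: "summable (\<lambda>n. u ^ n + v ^ n * C)" using u v by (intro summable_add summable_mult2 summable_geometric) auto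
  have "(\<Sum>n. amom tree (increment n)) \<le> (\<Sum>n. ennreal (u ^ n + v ^ n * C))" by (intro suminf_le bound) auto
  also have "\<dots> = ennreal (\<Sum>n. u ^ n + v ^ n * C)" using u v C sm by (intro suminf_ennreal2) auto
  finally show ?thesis by (auto simp: top_unique)
qed

definition increment_sum :: "(nat list \<Rightarrow> nat \<Rightarrow> real) \<Rightarrow> ennreal" where
  "increment_sum t = (\<Sum>n. ennreal (increment n t))"

text \<open>A common bound for all iterates, namely the modulus of the start plus the total
  variation. Its moment of order a is finite, so its weighted sums converge almost surely and can
  serve as majorants.\<close>

definition envelope :: "(nat list \<Rightarrow> nat \<Rightarrow> real) \<Rightarrow> real" where
  "envelope t = cmod (inverse z) + enn2real (increment_sum t)"

lemma increment_sum_measurable [measurable]: "increment_sum \<in> borel_measurable tree" "envelope \<in> borel_measurable tree"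
  unfolding increment_sum_def[abs_def] envelope_def[abs_def] by measurable

lemma increment_powr_sum: "(\<integral>\<^sup>+t. (\<Sum>n. ennreal (increment n t powr a)) \<partial>tree) \<noteq> \<top>"
  using increment_amom_summable by (subst nn_integral_suminf) (auto simp: amom_def)

lemma AE_increment_sum_finite: "AE t in tree. increment_sum t \<noteq> \<top>"
proof -
  have "AE t in tree. (\<Sum>n. ennreal (increment n t powr a)) \<noteq> \<infinity>" using increment_powr_sum by (intro nn_integral_PInf_AE) auto
  then show ?thesis
  proof eventually_elim
    case (elim t)
    have fin: "(\<Sum>n. ennreal (min (increment n t) (increment n t powr a))) \<noteq> \<top>"
    proof (rule ennreal_neq_top_mono)
      show "(\<Sum>n. ennreal (min (increment n t) (increment n t powr a))) \<le> (\<Sum>n. ennreal (increment n t powr a))"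
        by (intro suminf_le ennreal_leI) auto
    qed (use elim in simp)
    have "0 \<le> increment n t" for n by (simp add: increment_def)
    then show ?case unfolding increment_sum_def by (rule suminf_min_powr_finite[OF _ a_pos _ fin]) (use a_pos a_less in simp)
  qed
qed

lemma envelope_amom: "amom tree envelope \<noteq> \<top>"
proof -
  have "amom tree envelope \<le> (\<integral>\<^sup>+t. ennreal (cmod (inverse z) powr a) + (\<Sum>n. ennreal (increment n t powr a)) \<partial>tree)"
    unfolding amom_def
  proof (rule nn_integral_mono_AE)
    show "AE t in tree. ennreal (envelope t powr a) \<le> ennreal (cmod (inverse z) powr a) + (\<Sum>n. ennreal (increment n t powr a))"
      using AE_increment_sum_finite
    proof eventually_elim
      case (elim t)
      have "envelope t powr a \<le> cmod (inverse z) powr a + enn2real (increment_sum t) powr a"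
        unfolding envelope_def using a_pos a_less by (intro powr_add_le) auto
      then have 1: "ennreal (envelope t powr a) \<le> ennreal (cmod (inverse z) powr a) + ennreal (enn2real (increment_sum t) powr a)"
        by (simp add: ennreal_leI flip: ennreal_plus)
      have "ennreal (enn2real (increment_sum t) powr a) \<le> ennreal 0 + (\<Sum>n. ennreal (increment n t powr a))"
        unfolding increment_sum_def
      proof (rule ennreal_powr_suminf_le)
        show "(\<Sum>p<n. increment p t) powr a \<le> 0 + (\<Sum>p<n. increment p t powr a)" for n
          using sum_powr_le[of "\<lambda>p. increment p t" a n] a_pos a_less by (auto simp: increment_def)
      qed (use a_pos in \<open>auto simp: increment_def\<close>)
      then have "ennreal (enn2real (increment_sum t) powr a) \<le> (\<Sum>n. ennreal (increment n t powr a))" by (simp only: ennreal_0 add_0)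
      from order_trans[OF 1 add_left_mono[OF this]] show ?case .
    qed
  qed
  also have "\<dots> = ennreal (cmod (inverse z) powr a) + (\<integral>\<^sup>+t. (\<Sum>n. ennreal (increment n t powr a)) \<partial>tree)"
    by (subst nn_integral_add) auto
  finally show ?thesis using increment_powr_sum by (auto simp: top_unique)
qed

text \<open>Replacing the iterates by 0 on the null set of divergence makes convergence and the
  bound by \<open>envelope\<close> hold at every tree, as \<open>complex_sum_tendsto\<close>
  demands.\<close>

definition trunc_iterate :: "nat \<Rightarrow> (nat list \<Rightarrow> nat \<Rightarrow> real) \<Rightarrow> complex" where
  "trunc_iterate n t = (if increment_sum t = \<top> then 0 else tree_iterate n t)"

definition limit_map :: "(nat list \<Rightarrow> nat \<Rightarrow> real) \<Rightarrow> complex" where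
  "limit_map t = lim (\<lambda>n. trunc_iterate n t)"

lemma trunc_iterate_measurable [measurable]: "trunc_iterate n \<in> borel_measurable tree"
  using tree_iterate_measurable[of n] unfolding trunc_iterate_def[abs_def] by measurable

lemma tree_iterate_telescope: "(\<Sum>k<n. tree_iterate (Suc k) t - tree_iterate k t) = tree_iterate n t - tree_iterate 0 t"
  by (rule sum_lessThan_telescope[where f = "\<lambda>k. tree_iterate k t"])

lemma trunc_iterate_tendsto: "(\<lambda>n. trunc_iterate n t) \<longlonglongrightarrow> limit_map t"
proof -
  have "convergent (\<lambda>n. trunc_iterate n t)"
  proof (cases "increment_sum t = \<top>")
    case False
    then have "summable (\<lambda>n. increment n t)" unfolding increment_sum_def by (intro summable_suminf_not_top) (auto simp: increment_def)
    then have "summable (\<lambda>n. norm (tree_iterate (Suc n) t - tree_iterate n t))" by (simp add: increment_def norm_minus_commute)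
    then have "summable (\<lambda>n. tree_iterate (Suc n) t - tree_iterate n t)" by (rule summable_norm_cancel)
    then have "(\<lambda>n. \<Sum>k<n. tree_iterate (Suc k) t - tree_iterate k t) \<longlonglongrightarrow> (\<Sum>k. tree_iterate (Suc k) t - tree_iterate k t)" by (rule summable_LIMSEQ)
    then have "(\<lambda>n. tree_iterate n t - tree_iterate 0 t) \<longlonglongrightarrow> (\<Sum>k. tree_iterate (Suc k) t - tree_iterate k t)" unfolding tree_iterate_telescope .
    from tendsto_add[OF this tendsto_const[of "tree_iterate 0 t"]] show ?thesis using False by (auto simp: trunc_iterate_def convergent_def)
  qed (simp add: trunc_iterate_def convergent_const)
  then show ?thesis unfolding limit_map_def by (simp add: convergent_LIMSEQ_iff)
qed

lemma limit_map_measurable [measurable]: "limit_map \<in> borel_measurable tree"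
  by (rule borel_measurable_LIMSEQ_metric[OF trunc_iterate_measurable trunc_iterate_tendsto])

lemma trunc_iterate_le: "cmod (trunc_iterate n t) \<le> envelope t"
proof (cases "increment_sum t = \<top>")
  case False
  have s: "summable (\<lambda>n. increment n t)" using False unfolding increment_sum_def by (intro summable_suminf_not_top) (auto simp: increment_def)
  have Bt: "enn2real (increment_sum t) = (\<Sum>n. increment n t)"
    unfolding increment_sum_def using s by (subst suminf_ennreal2) (auto simp: increment_def suminf_nonneg)
  have "tree_iterate n t = tree_iterate 0 t + (\<Sum>k<n. tree_iterate (Suc k) t - tree_iterate k t)" by (simp only: tree_iterate_telescope) simp
  then have "cmod (tree_iterate n t) \<le> cmod (tree_iterate 0 t) + cmod (\<Sum>k<n. tree_iterate (Suc k) t - tree_iterate k t)" by (metis norm_triangle_ineq)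
  also have "cmod (\<Sum>k<n. tree_iterate (Suc k) t - tree_iterate k t) \<le> (\<Sum>k<n. increment k t)"
    unfolding increment_def by (rule order_trans[OF norm_sum]) (simp add: norm_minus_commute)
  also have "\<dots> \<le> (\<Sum>k. increment k t)" using s by (intro sum_le_suminf) (auto simp: increment_def)
  finally show ?thesis using False by (simp add: trunc_iterate_def envelope_def Bt)
qed (simp add: trunc_iterate_def envelope_def)

lemma limit_map_le: "cmod (limit_map t) \<le> envelope t"
  by (rule LIMSEQ_le_const2[OF tendsto_norm[OF trunc_iterate_tendsto]]) (use trunc_iterate_le in auto)

lemma envelope_nonneg: "0 \<le> envelope t"
  by (simp add: envelope_def)

lemma limit_map_amom: "amom tree (\<lambda>t. cmod (limit_map t)) \<noteq> \<top>"
proof (rule ennreal_neq_top_mono[OF _ envelope_amom])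
  show "amom tree (\<lambda>t. cmod (limit_map t)) \<le> amom tree envelope"
    unfolding amom_def using a_pos limit_map_le by (intro nn_integral_mono ennreal_leI powr_mono2) auto
qed

text \<open>The recursion of the iterates survives in the limit. It holds for truncated iterates
  only where the root and all its subtrees avoid the exceptional null set, which is almost sure
  because there are countably many subtrees.\<close>

lemma limit_map_fixed: "AE t in tree. limit_map t = rde_map z limit_map (split_tree t)"
proof -
  have "AE t in tree. \<forall>p. increment_sum (snd (split_tree t) p) \<noteq> \<top>"
    by (rule AE_split_tree[OF AE_marks[OF prob_space_tree AE_increment_sum_finite]])
  moreover have "AE t in tree. real_sum envelope (split_tree t) \<noteq> \<top>"
    by (rule AE_split_tree[OF AE_real_sum_finite[OF prob_space_tree _ envelope_nonneg envelope_amom]]) measurable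
  moreover have "AE t in tree. z + complex_sum limit_map (split_tree t) \<noteq> 0"
    by (rule AE_split_tree[OF AE_denominator_nonzero[OF prob_space_tree limit_map_measurable limit_map_amom z_ge(2)[OF large]]])
  ultimately show ?thesis using AE_increment_sum_finite
  proof eventually_elim
    case (elim t)
    have "(\<lambda>n. complex_sum (trunc_iterate n) (split_tree t)) \<longlonglongrightarrow> complex_sum limit_map (split_tree t)"
      by (rule complex_sum_tendsto[OF elim(2) trunc_iterate_le trunc_iterate_tendsto])
    then have "(\<lambda>n. rde_map z (trunc_iterate n) (split_tree t)) \<longlonglongrightarrow> rde_map z limit_map (split_tree t)"
      unfolding rde_map_def using elim(3) by (intro tendsto_intros)
    moreover have "rde_map z (trunc_iterate n) (split_tree t) = trunc_iterate (Suc n) t" for n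
    proof -
      have "complex_sum (trunc_iterate n) (split_tree t) = complex_sum (tree_iterate n) (split_tree t)" by (rule complex_sum_cong_marks) (use elim(1) in \<open>simp add: trunc_iterate_def\<close>)
      then show ?thesis using elim(4) by (simp add: trunc_iterate_def rde_map_def tree_iterate.simps(2))
    qed
    ultimately have "(\<lambda>n. trunc_iterate (Suc n) t) \<longlonglongrightarrow> rde_map z limit_map (split_tree t)" by simp
    moreover have "(\<lambda>n. trunc_iterate (Suc n) t) \<longlonglongrightarrow> limit_map t" by (rule LIMSEQ_Suc[OF trunc_iterate_tendsto])
    ultimately show ?case by (rule LIMSEQ_unique[rotated])
  qed
qed

theorem fixed_exists:
  assumes "0 \<le> Im z"
  shows "\<exists>\<mu>. prob_space \<mu> \<and> sets \<mu> = sets borel \<and> (AE x in \<mu>. 0 \<le> Im x) \<and> amom \<mu> cmod \<noteq> \<top> \<and> distr (marked \<mu>) borel (rde_map z (\<lambda>x. x)) = \<mu>"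
proof (intro exI[of _ "distr tree borel limit_map"] conjI)
  interpret T: prob_space tree by (rule prob_space_tree)
  show "prob_space (distr tree borel limit_map)" by (rule T.prob_space_distr) measurable
  have "0 \<le> Im (limit_map t)" for t
    by (rule LIMSEQ_le_const[OF tendsto_Im[OF trunc_iterate_tendsto]]) (use tree_iterate_Im[OF assms] in \<open>auto simp: trunc_iterate_def\<close>)
  then show "AE x in distr tree borel limit_map. 0 \<le> Im x" by (subst AE_distr_iff) auto
  show "amom (distr tree borel limit_map) cmod \<noteq> \<top>" using limit_map_amom by (subst amom_distr) auto
  have "distr (marked (distr tree borel limit_map)) borel (rde_map z (\<lambda>x. x)) = distr (marked tree) borel (rde_map z limit_map)"
    by (rule distr_rde_map_map[OF prob_space_tree limit_map_measurable, symmetric])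
  also have "\<dots> = distr (distr tree (marked tree) split_tree) borel (rde_map z limit_map)" by (simp only: distr_split_tree)
  also have "\<dots> = distr tree borel (\<lambda>t. rde_map z limit_map (split_tree t))"
    by (subst distr_distr[OF rde_map_measurable[OF limit_map_measurable] measurable_split_tree]) (simp add: comp_def)
  also have "\<dots> = distr tree borel limit_map"
    by (rule distr_cong_AE) (use limit_map_fixed measurable_compose[OF measurable_split_tree rde_map_measurable[OF limit_map_measurable]] in \<open>auto elim: eventually_mono\<close>)
  finally show "distr (marked (distr tree borel limit_map)) borel (rde_map z (\<lambda>x. x)) = distr tree borel limit_map" .
qed simp

end

section \<open>Conclusion\<close>


text \<open>Replaces the quantification over all models by a single fixed point equation, to which
  both existence and uniqueness refer.\<close>

lemma fixed_law_iff:
  assumes z: "large z"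
  shows "fixed_law (2 * a) z \<mu> \<longleftrightarrow> prob_space \<mu> \<and> sets \<mu> = sets borel \<and> (AE x in \<mu>. 0 \<le> Im x) \<and> amom \<mu> cmod \<noteq> \<top>
    \<and> distr (marked \<mu>) borel (rde_map z (\<lambda>x. x)) = \<mu>"
  using solves_RDE_imp_fixed[of \<mu> z] fixed_imp_solves_RDE[of \<mu> z]
  unfolding fixed_law_def amom_def[symmetric] by (auto simp: amom_def less_top)

lemma fixed_law_unique_exists:
  assumes z: "large z" "0 \<le> Im z"
  shows "\<exists>!\<mu>. fixed_law (2 * a) z \<mu>"
proof -
  have "\<mu> = \<mu>'" if "fixed_law (2 * a) z \<mu>" "fixed_law (2 * a) z \<mu>'" for \<mu> \<mu>'
    using that fixed_unique[OF z(1), of \<mu> \<mu>'] unfolding fixed_law_iff[OF z(1)] by blast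
  moreover have "\<exists>\<mu>. fixed_law (2 * a) z \<mu>"
    unfolding fixed_law_iff[OF z(1)] by (rule fixed_exists[OF z])
  ultimately show ?thesis by blast
qed

end

theorem theorem5p1:
  fixes \<alpha> :: real
  assumes "0 < \<alpha>" and "\<alpha> < 2 / 3"
  shows "\<exists>E > 0.
           (\<forall>z::complex. 0 \<le> Im z \<and> E \<le> cmod z \<longrightarrow> (\<exists>!\<mu>. fixed_law \<alpha> z \<mu>)) \<and>
           (\<forall>\<kappa>. 0 < \<kappa> \<and> \<kappa> < \<alpha> / 2 \<longrightarrow>
              (\<exists>E' \<ge> E. \<exists>c > 0. \<forall>z \<mu>. 0 < Im z \<and> E' \<le> cmod z \<and> fixed_law \<alpha> z \<mu> \<longrightarrow>
                 (\<integral>\<^sup>+ x. ennreal (Im x powr (\<alpha> / 2)) \<partial>\<mu>) \<le> ennreal (c * Im z powr \<kappa>))) \<and>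
           (\<forall>z \<mu>. Im z = 0 \<and> E \<le> cmod z \<and> fixed_law \<alpha> z \<mu> \<longrightarrow> (AE x in \<mu>. Im x = 0))"
proof -
  define a where "a = \<alpha> / 2"
  have \<alpha>: "\<alpha> = 2 * a" "\<alpha> / 2 = a" by (simp_all add: a_def)
  interpret stable_index a by unfold_locales (use assms in \<open>auto simp: a_def\<close>)
  obtain E where E: "0 < E" "\<And>z. E \<le> cmod z \<Longrightarrow> large z" using eventually_large by blast
  \<comment> \<open>This constant does not involve \<kappa>, and the threshold E of the existence
    part serves as E' as well.\<close>
  define c where "c = 1 + 4 * inverse_const (2 * a + eta)"
  have c: "0 < c" unfolding c_def using inverse_const_pos[of "2 * a + eta"] eta by simp
  show ?thesis
    unfolding \<alpha>(2) unfolding \<alpha>(1)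
  proof (rule exI[of _ E], intro conjI allI impI; (elim conjE)?)
    show "0 < E" by (rule E)
  next
    fix z assume "0 \<le> Im z" "E \<le> cmod z"
    then show "\<exists>!\<mu>. fixed_law (2 * a) z \<mu>" by (intro fixed_law_unique_exists E)
  next
    fix \<kappa> assume \<kappa>: "0 < \<kappa>" "\<kappa> < a"
    show "\<exists>E'\<ge>E. \<exists>c>0. \<forall>z \<mu>. 0 < Im z \<and> E' \<le> cmod z \<and> fixed_law (2 * a) z \<mu> \<longrightarrow>
       (\<integral>\<^sup>+ x. ennreal (Im x powr a) \<partial>\<mu>) \<le> ennreal (c * Im z powr \<kappa>)"
    proof (rule exI[of _ E], rule conjI[OF order_refl], rule exI[of _ c], rule conjI[OF c], intro allI impI, elim conjE)
      fix z \<mu> assume z: "0 < Im z" "E \<le> cmod z" "fixed_law (2 * a) z \<mu>"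
      note l = E(2)[OF z(2)]
      show "(\<integral>\<^sup>+ x. ennreal (Im x powr a) \<partial>\<mu>) \<le> ennreal (c * Im z powr \<kappa>)"
        using z(3) fixed_Im_moment[OF l _ _ _ _ _ z(1) \<kappa>] unfolding fixed_law_iff[OF l] c_def by blast
    qed
  next
    fix z \<mu> assume z: "Im z = 0" "E \<le> cmod z" "fixed_law (2 * a) z \<mu>"
    note l = E(2)[OF z(2)]
    show "AE x in \<mu>. Im x = 0"
      using z(3) fixed_real[OF l _ _ _ _ _ z(1)] unfolding fixed_law_iff[OF l] by blast
  qed
qed

end
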